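(* Let $X$ be a locally compact CAT(0) space and suppose that $X$ contains a periodic Morse flat $F$; write $\hat\sigma=\partial_T F$. Then the set of singular points of $\hat\sigma$ (the complement in $\hat\sigma$ of the set of regular points) is covered by finitely many singular spheres in $\hat\sigma$, each of positive codimension in $\hat\sigma$.
   Context: $\partial_T$ denotes the ideal boundary with the Tits metric; for a flat $F$, $\partial_T F\subset\partial_T X$ is a round sphere. A flat $F$ is periodic if its stabilizer in $\mathrm{Isom}(X)$ contains a subgroup acting geometrically on $F$. A flat half-space is a closed convex subset isometric to a Euclidean half-space; a flat $F$ is Morse if it does not bound a flat half-space (i.e. there is no flat half-space $H$ with $\partial H=F$). A point of $\hat\sigma$ is regular if it has a Tits-metric neighborhood in $\partial_T X$ entirely contained in $\hat\sigma$, and singular otherwise. A round sphere $\sigma\subset\hat\sigma$ is singular if there exists a round hemisphere $\tau^+\subset\partial_T X$ with $\partial\tau^+=\sigma$ and $\tau^+\cap\hat\sigma=\sigma$ such that $\tau^+\cup\tau^-$ is a round sphere for every round hemisphere $\tau^-\subset\hat\sigma$ with $\partial\tau^-=\sigma$. *)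

theory Defs
  imports "HOL-Analysis.Analysis"
begin

definition geodesic_seg :: "(real \<Rightarrow> 'a::metric_space) \<Rightarrow> 'a \<Rightarrow> 'a \<Rightarrow> bool" where
  "geodesic_seg g x y \<longleftrightarrow> g 0 = x \<and> g (dist x y) = y \<and>
     (\<forall>s\<in>{0..dist x y}. \<forall>t\<in>{0..dist x y}. dist (g s) (g t) = \<bar>s - t\<bar>)"

definition geodesic_space :: "'a::metric_space itself \<Rightarrow> bool" where
  "geodesic_space _ \<longleftrightarrow> (\<forall>x y::'a. \<exists>g. geodesic_seg g x y)"

text \<open>Point of the comparison segment from a to b in the Euclidean plane at arclength s,
  where d is the length of the side.\<close>
definition cmp_pt :: "complex \<Rightarrow> complex \<Rightarrow> real \<Rightarrow> real \<Rightarrow> complex" where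
  "cmp_pt a b d s = a + of_real (s / d) * (b - a)"

text \<open>CAT(0) inequality for a geodesic triangle: sides are given as a list of three
  triples (geodesic, start vertex, end vertex) together with comparison vertices in R^2.\<close>
definition CAT0_ineq :: "((real \<Rightarrow> 'a::metric_space) \<times> 'a \<times> 'a) list \<Rightarrow> (complex \<times> complex) list \<Rightarrow> bool" where
  "CAT0_ineq sides cmp \<longleftrightarrow>
     (\<forall>i<3. \<forall>j<3.
        \<forall>s\<in>{0..dist (fst (snd (sides!i))) (snd (snd (sides!i)))}.
        \<forall>t\<in>{0..dist (fst (snd (sides!j))) (snd (snd (sides!j)))}.
          dist (fst (sides!i) s) (fst (sides!j) t)
          \<le> dist (cmp_pt (fst (cmp!i)) (snd (cmp!i)) (dist (fst (snd (sides!i))) (snd (snd (sides!i)))) s)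
                 (cmp_pt (fst (cmp!j)) (snd (cmp!j)) (dist (fst (snd (sides!j))) (snd (snd (sides!j)))) t))"

definition CAT0 :: "'a::metric_space itself \<Rightarrow> bool" where
  "CAT0 T \<longleftrightarrow> complete (UNIV::'a set) \<and> geodesic_space T \<and>
     (\<forall>(x::'a) y z g1 g2 g3 (a::complex) b c.
        geodesic_seg g1 x y \<and> geodesic_seg g2 y z \<and> geodesic_seg g3 z x \<and>
        dist a b = dist x y \<and> dist b c = dist y z \<and> dist c a = dist z x \<longrightarrow>
        CAT0_ineq [(g1, x, y), (g2, y, z), (g3, z, x)] [(a, b), (b, c), (c, a)])"

definition convex_set :: "'a::metric_space set \<Rightarrow> bool" where
  "convex_set C \<longleftrightarrow> (\<forall>x\<in>C. \<forall>y\<in>C. \<forall>g. geodesic_seg g x y \<longrightarrow> g ` {0..dist x y} \<subseteq> C)"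

definition geod_ray :: "(real \<Rightarrow> 'a::metric_space) \<Rightarrow> bool" where
  "geod_ray c \<longleftrightarrow> (\<forall>s\<ge>0. \<forall>t\<ge>0. dist (c s) (c t) = \<bar>s - t\<bar>)"

definition asymptotic :: "(real \<Rightarrow> 'a::metric_space) \<Rightarrow> (real \<Rightarrow> 'a) \<Rightarrow> bool" where
  "asymptotic c c' \<longleftrightarrow> (\<exists>B. \<forall>t\<ge>0. dist (c t) (c' t) \<le> B)"

definition ideal_boundary :: "'a::metric_space itself \<Rightarrow> (real \<Rightarrow> 'a) set set" where
  "ideal_boundary _ = {{c'. geod_ray c' \<and> asymptotic c c'} | c. geod_ray c}"

definition comparison_angle :: "'a::metric_space \<Rightarrow> 'a \<Rightarrow> 'a \<Rightarrow> real" where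
  "comparison_angle x p q =
     arccos ((dist x p ^ 2 + dist x q ^ 2 - dist p q ^ 2) / (2 * dist x p * dist x q))"

definition alex_angle :: "(real \<Rightarrow> 'a::metric_space) \<Rightarrow> (real \<Rightarrow> 'a) \<Rightarrow> real" where
  "alex_angle c c' =
     Inf {Sup {comparison_angle (c 0) (c t) (c' t') | t t'. 0 < t \<and> t < e \<and> 0 < t' \<and> t' < e} | e. e > 0}"

definition bd_angle :: "(real \<Rightarrow> 'a::metric_space) set \<Rightarrow> (real \<Rightarrow> 'a) set \<Rightarrow> real" where
  "bd_angle \<xi> \<eta> = Sup {alex_angle c c' | c c'. c \<in> \<xi> \<and> c' \<in> \<eta> \<and> c 0 = c' 0}"

definition angle_continuous :: "(real \<Rightarrow> (real \<Rightarrow> 'a::metric_space) set) \<Rightarrow> bool" where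
  "angle_continuous p \<longleftrightarrow> (\<forall>t\<in>{0..1}. \<forall>e>0. \<exists>d>0. \<forall>s\<in>{0..1}.
       \<bar>s - t\<bar> < d \<longrightarrow> bd_angle (p s) (p t) < e)"

definition partition01 :: "real list \<Rightarrow> bool" where
  "partition01 ts \<longleftrightarrow> ts \<noteq> [] \<and> sorted ts \<and> hd ts = 0 \<and> last ts = 1"

definition angle_length :: "(real \<Rightarrow> (real \<Rightarrow> 'a::metric_space) set) \<Rightarrow> ereal" where
  "angle_length p = Sup {ereal (\<Sum>i<length ts - 1. bd_angle (p (ts!i)) (p (ts!(Suc i)))) | ts. partition01 ts}"

definition tits_dist :: "(real \<Rightarrow> 'a::metric_space) set \<Rightarrow> (real \<Rightarrow> 'a) set \<Rightarrow> ereal" where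
  "tits_dist \<xi> \<eta> = Inf {angle_length p | p.
      p 0 = \<xi> \<and> p 1 = \<eta> \<and> p ` {0..1} \<subseteq> ideal_boundary TYPE('a) \<and> angle_continuous p}"

definition std_sphere :: "nat \<Rightarrow> (nat \<Rightarrow> real) set" where
  "std_sphere k = {x. (\<forall>i>k. x i = 0) \<and> (\<Sum>i\<le>k. x i ^ 2) = 1}"

definition std_hemisphere :: "nat \<Rightarrow> (nat \<Rightarrow> real) set" where
  "std_hemisphere k = {x \<in> std_sphere k. x 0 \<ge> 0}"

definition std_equator :: "nat \<Rightarrow> (nat \<Rightarrow> real) set" where
  "std_equator k = {x \<in> std_sphere k. x 0 = 0}"

definition sph_dist :: "nat \<Rightarrow> (nat \<Rightarrow> real) \<Rightarrow> (nat \<Rightarrow> real) \<Rightarrow> real" where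
  "sph_dist k x y = arccos (\<Sum>i\<le>k. x i * y i)"

definition tits_isometry :: "nat \<Rightarrow> (nat \<Rightarrow> real) set \<Rightarrow> ((nat \<Rightarrow> real) \<Rightarrow> (real \<Rightarrow> 'a::metric_space) set) \<Rightarrow> (real \<Rightarrow> 'a) set set \<Rightarrow> bool" where
  "tits_isometry k A f S \<longleftrightarrow> bij_betw f A S \<and>
     (\<forall>x\<in>A. \<forall>y\<in>A. tits_dist (f x) (f y) = ereal (sph_dist k x y))"

definition round_sphere_dim :: "(real \<Rightarrow> 'a::metric_space) set set \<Rightarrow> nat \<Rightarrow> bool" where
  "round_sphere_dim S k \<longleftrightarrow> S \<subseteq> ideal_boundary TYPE('a) \<and> (\<exists>f. tits_isometry k (std_sphere k) f S)"

definition round_sphere :: "(real \<Rightarrow> 'a::metric_space) set set \<Rightarrow> bool" where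
  "round_sphere S \<longleftrightarrow> (\<exists>k. round_sphere_dim S k)"

definition round_hemisphere :: "(real \<Rightarrow> 'a::metric_space) set set \<Rightarrow> (real \<Rightarrow> 'a) set set \<Rightarrow> bool" where
  "round_hemisphere T B \<longleftrightarrow> T \<subseteq> ideal_boundary TYPE('a) \<and>
     (\<exists>k f. tits_isometry k (std_hemisphere k) f T \<and> f ` std_equator k = B)"

definition eucl_space :: "nat \<Rightarrow> (nat \<Rightarrow> real) set" where
  "eucl_space n = {x. \<forall>i\<ge>n. x i = 0}"

definition eucl_dist :: "nat \<Rightarrow> (nat \<Rightarrow> real) \<Rightarrow> (nat \<Rightarrow> real) \<Rightarrow> real" where
  "eucl_dist n x y = sqrt (\<Sum>i<n. (x i - y i) ^ 2)"

definition isom_embedding :: "nat \<Rightarrow> (nat \<Rightarrow> real) set \<Rightarrow> ((nat \<Rightarrow> real) \<Rightarrow> 'a::metric_space) \<Rightarrow> bool" where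
  "isom_embedding n A f \<longleftrightarrow> (\<forall>x\<in>A. \<forall>y\<in>A. dist (f x) (f y) = eucl_dist n x y)"

definition is_flat :: "'a::metric_space set \<Rightarrow> bool" where
  "is_flat F \<longleftrightarrow> (\<exists>n f. isom_embedding n (eucl_space n) f \<and> F = f ` eucl_space n)"

definition flat_half_space :: "'a::metric_space set \<Rightarrow> 'a set \<Rightarrow> bool" where
  "flat_half_space H B \<longleftrightarrow> closed H \<and> convex_set H \<and>
     (\<exists>n f. n \<ge> 1 \<and> isom_embedding n {x \<in> eucl_space n. x 0 \<ge> 0} f \<and>
        H = f ` {x \<in> eucl_space n. x 0 \<ge> 0} \<and> B = f ` {x \<in> eucl_space n. x 0 = 0})"

definition morse_flat :: "'a::metric_space set \<Rightarrow> bool" where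
  "morse_flat F \<longleftrightarrow> is_flat F \<and> \<not> (\<exists>H. flat_half_space H F)"

definition isometries :: "'a::metric_space itself \<Rightarrow> ('a \<Rightarrow> 'a) set" where
  "isometries _ = {g. bij g \<and> (\<forall>x y. dist (g x) (g y) = dist x y)}"

definition acts_geometrically :: "('a::metric_space \<Rightarrow> 'a) set \<Rightarrow> 'a set \<Rightarrow> bool" where
  "acts_geometrically G F \<longleftrightarrow>
     (\<forall>K. compact K \<and> K \<subseteq> F \<longrightarrow> finite {g \<in> G. g ` K \<inter> K \<noteq> {}}) \<and>
     (\<exists>K. compact K \<and> K \<subseteq> F \<and> F = (\<Union>g\<in>G. g ` K))"

definition periodic_flat :: "'a::metric_space set \<Rightarrow> bool" where
  "periodic_flat F \<longleftrightarrow> is_flat F \<and>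
     (\<exists>G. G \<subseteq> {g \<in> isometries TYPE('a). g ` F = F} \<and> id \<in> G \<and>
          (\<forall>g\<in>G. \<forall>h\<in>G. g \<circ> h \<in> G) \<and> (\<forall>g\<in>G. inv g \<in> G) \<and>
          acts_geometrically G F)"

definition bd_of :: "'a::metric_space set \<Rightarrow> (real \<Rightarrow> 'a) set set" where
  "bd_of F = {\<xi> \<in> ideal_boundary TYPE('a). \<exists>c\<in>\<xi>. c ` {0..} \<subseteq> F}"

definition regular_point :: "(real \<Rightarrow> 'a::metric_space) set set \<Rightarrow> (real \<Rightarrow> 'a) set \<Rightarrow> bool" where
  "regular_point \<Sigma> \<xi> \<longleftrightarrow> \<xi> \<in> \<Sigma> \<and>
     (\<exists>e>0. {\<eta> \<in> ideal_boundary TYPE('a). tits_dist \<xi> \<eta> < ereal e} \<subseteq> \<Sigma>)"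

definition singular_points :: "(real \<Rightarrow> 'a::metric_space) set set \<Rightarrow> (real \<Rightarrow> 'a) set set" where
  "singular_points \<Sigma> = {\<xi> \<in> \<Sigma>. \<not> regular_point \<Sigma> \<xi>}"

definition singular_sphere :: "(real \<Rightarrow> 'a::metric_space) set set \<Rightarrow> (real \<Rightarrow> 'a) set set \<Rightarrow> bool" where
  "singular_sphere \<Sigma> \<sigma> \<longleftrightarrow> round_sphere \<sigma> \<and> \<sigma> \<subseteq> \<Sigma> \<and>
     (\<exists>T. round_hemisphere T \<sigma> \<and> T \<inter> \<Sigma> = \<sigma> \<and>
        (\<forall>T'. round_hemisphere T' \<sigma> \<and> T' \<subseteq> \<Sigma> \<longrightarrow> round_sphere (T \<union> T')))"

end

theory Submission
  imports Defs
begin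

text \<open>
  For a boundary point \<open>\<eta>\<close> the rays to \<open>\<eta>\<close> starting in the flat form a contracting field, and its Busemann
  function restricts to a convex function \<open>b\<close> on the flat. If \<open>b\<close> is affine, then it has slope \<open>1\<close> and \<open>\<eta>\<close> lies in
  the boundary of the flat, because otherwise the field spans a flat half-space. If not, then some limit of
  lattice translates of the field has a lineality space \<open>W\<close> of maximal dimension, and maximality forces \<open>b\<close> to
  grow as fast as possible transversally to \<open>W\<close>. The rays over \<open>W\<close> then form a hemisphere that completes every
  flat hemisphere over \<open>W\<close> to a round sphere. A rigid field determines \<open>W\<close> in a neighbourhood, so by
  compactness only finitely many maximal \<open>W\<close> occur. A boundary point off the flat at small angle to a direction
  \<open>u\<close> has a \<open>W\<close> close to \<open>u\<close>, and therefore singular directions lie in some maximal \<open>W\<close>.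
\<close>

section \<open>Finite-dimensional subspaces of inner product spaces\<close>

text \<open>The Morse hypothesis acts through one fact: an affine \<open>b\<close> has a gradient of
  norm exactly one. This explains the growth across \<open>W\<close>. Suppose a vector
  \<open>u\<close> of norm less than one, compatible with \<open>b\<close> on \<open>W\<close>, lies
  outside the closed hull of the subgradients. Moving \<open>u\<close> close to the hull, minimisers
  of \<open>b - u\<close> plus a small quadratic escape to infinity. Translates along them converge
  to a field that is affine in one more direction, hence by maximality affine altogether, yet its
  gradient has norm less than one. So the subgradients fill the slice of the unit ball that
  \<open>W\<close> allows, and the support function of this slice across \<open>W\<close> is
  \<open>sqrt (1 - (norm c)\<^sup>2)\<close>. Limits recentre a field by isometries that preserve
  the flat. Isometries with a rotational part would turn the lineality spaces, and these could then
  not be compared before and after a limit. Periodicity is therefore sharpened to a lattice of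
  translations, which is Bieberbach's first theorem. A field has uncountably many parameters, so
  limits are taken along filters finer than \<open>sequentially\<close> rather than along
  subsequences.\<close>

definition onb :: "'v::real_inner set \<Rightarrow> 'v set \<Rightarrow> bool" where
  "onb B W \<longleftrightarrow> finite B \<and> pairwise orthogonal B \<and> (\<forall>b\<in>B. norm b = 1) \<and> span B = W"

text \<open>The ambient inner product space may have infinite dimension, so finiteness is a property
  of the subspace, witnessed by a finite orthonormal basis.\<close>

definition fin_dim :: "'v::real_inner set \<Rightarrow> bool" where
  "fin_dim W \<longleftrightarrow> (\<exists>B. onb B W)"

definition orth_proj :: "'v::real_inner set \<Rightarrow> 'v \<Rightarrow> 'v" where
  "orth_proj W x = (SOME w. w \<in> W \<and> (\<forall>v\<in>W. (x - w) \<bullet> v = 0))"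

lemma onb_inner:
  assumes "onb B W" "a \<in> B" "b \<in> B"
  shows "a \<bullet> b = (if a = b then 1 else 0)"
  using assms unfolding onb_def pairwise_def orthogonal_def
  by (auto simp: norm_eq_1)

lemma onb_span_inner_sum:
  assumes "onb B W" "b \<in> B"
  shows "(\<Sum>a\<in>B. u a *\<^sub>R a) \<bullet> b = u b"
proof -
  have "(\<Sum>a\<in>B. u a *\<^sub>R a) \<bullet> b = (\<Sum>a\<in>B. if a = b then u a else 0)"
    unfolding inner_sum_left using onb_inner[OF assms(1) _ assms(2)] by (intro sum.cong) auto
  also have "\<dots> = u b"
    using assms by (simp add: onb_def)
  finally show ?thesis .
qed

lemma onb_residual:
  assumes "onb B W" "v \<in> W"
  shows "(x - (\<Sum>b\<in>B. (x \<bullet> b) *\<^sub>R b)) \<bullet> v = 0"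
proof -
  have "v \<in> span B" using assms by (simp add: onb_def)
  then show ?thesis
  proof (induction rule: span_induct_alt)
    case base show ?case by simp
  next
    case (step c b y)
    then show ?case
      using onb_span_inner_sum[OF assms(1), of b "\<lambda>b. x \<bullet> b"]
      by (simp add: inner_add_right inner_diff_left)
  qed
qed

lemma onb_expand_in: "onb B W \<Longrightarrow> (\<Sum>b\<in>B. u b *\<^sub>R b) \<in> W"
  by (auto simp: onb_def intro!: span_sum span_scale intro: span_base)

lemma onb_expand:
  assumes "onb B W" "v \<in> W"
  shows "v = (\<Sum>b\<in>B. (v \<bullet> b) *\<^sub>R b)"
proof -
  let ?r = "v - (\<Sum>b\<in>B. (v \<bullet> b) *\<^sub>R b)"
  have "subspace W" using assms by (auto simp: onb_def)
  then have "?r \<in> W"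
    using assms(2) onb_expand_in[OF assms(1)] by (simp add: subspace_diff)
  then have "?r \<bullet> ?r = 0" using onb_residual[OF assms(1)] by blast
  then show ?thesis by simp
qed

lemma onb_norm_sum:
  assumes "onb B W"
  shows "(\<Sum>a\<in>B. u a *\<^sub>R a) \<bullet> (\<Sum>a\<in>B. w a *\<^sub>R a) = (\<Sum>a\<in>B. u a * w a)"
  by (simp add: inner_sum_right onb_span_inner_sum[OF assms] mult.commute)

lemma fin_dim_imp_subspace: "fin_dim W \<Longrightarrow> subspace W"
  by (auto simp: fin_dim_def onb_def)

lemma orth_proj_exists:
  assumes "fin_dim W"
  shows "\<exists>w. w \<in> W \<and> (\<forall>v\<in>W. (x - w) \<bullet> v = 0)"
proof -
  obtain B where "onb B W" using assms by (auto simp: fin_dim_def)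
  then show ?thesis
    by (intro exI[of _ "\<Sum>b\<in>B. (x \<bullet> b) *\<^sub>R b"] conjI ballI onb_expand_in onb_residual)
qed

lemma orth_proj_in: "fin_dim W \<Longrightarrow> orth_proj W x \<in> W"
  and orth_proj_orth: "fin_dim W \<Longrightarrow> v \<in> W \<Longrightarrow> (x - orth_proj W x) \<bullet> v = 0"
  using someI_ex[OF orth_proj_exists, of W x] unfolding orth_proj_def by auto

lemma orth_proj_unique:
  assumes "fin_dim W" "w \<in> W" "\<And>v. v \<in> W \<Longrightarrow> (x - w) \<bullet> v = 0"
  shows "orth_proj W x = w"
proof -
  let ?d = "orth_proj W x - w"
  have "?d \<in> W"
    using assms orth_proj_in fin_dim_imp_subspace subspace_diff by metis
  then have "(x - w) \<bullet> ?d = 0" "(x - orth_proj W x) \<bullet> ?d = 0"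
    using assms orth_proj_orth by auto
  then have "?d \<bullet> ?d = 0" by (simp add: inner_diff_left)
  then show ?thesis by simp
qed

lemma orth_proj_id: "fin_dim W \<Longrightarrow> w \<in> W \<Longrightarrow> orth_proj W w = w"
  by (rule orth_proj_unique) auto

lemma norm_orth_residual_le:
  assumes "fin_dim W" "w \<in> W"
  shows "norm (x - orth_proj W x) \<le> norm (x - w)"
proof -
  let ?p = "orth_proj W x"
  have "(x - ?p) \<bullet> (?p - w) = 0"
    using assms orth_proj_orth orth_proj_in fin_dim_imp_subspace subspace_diff by metis
  then have "(norm (x - w))\<^sup>2 = (norm (x - ?p))\<^sup>2 + (norm (?p - w))\<^sup>2"
    using norm_add_Pythagorean[of "x - ?p" "?p - w"] by (simp add: orthogonal_def)
  then show ?thesis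
    by (metis norm_ge_zero le_add_same_cancel1 power2_le_imp_le zero_le_power2)
qed

lemma orthonormal_independent:
  assumes "pairwise orthogonal B" "\<forall>b\<in>B. norm b = 1"
  shows "independent B"
  using assms by (intro pairwise_orthogonal_independent) auto

text \<open>An orthonormal subset of \<open>W\<close> of the largest possible size spans
  \<open>W\<close>: otherwise the normalised residual of a missed vector would enlarge it. Sizes are
  bounded because orthonormal sets are independent.\<close>

lemma fin_dim_subspace:
  assumes S: "fin_dim S" and W: "subspace W" "W \<subseteq> S"
  shows "fin_dim W"
proof -
  obtain B where B: "onb B S" using S by (auto simp: fin_dim_def)
  define P where "P = (\<lambda>k. \<exists>C. C \<subseteq> W \<and> finite C \<and> card C = k \<and> pairwise orthogonal C \<and> (\<forall>b\<in>C. norm b = 1))"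
  have bound: "k \<le> card B" if Pk: "P k" for k
  proof -
    obtain C where C: "C \<subseteq> W" "finite C" "card C = k" "pairwise orthogonal C" "\<forall>b\<in>C. norm b = 1"
      using Pk unfolding P_def by blast
    then have "C \<subseteq> span B" using W B by (auto simp: onb_def)
    then show ?thesis
      using independent_span_bound[of B C] orthonormal_independent[of C] C B by (auto simp: onb_def)
  qed
  have "P 0" unfolding P_def by (intro exI[of _ "{}"]) auto
  then have "P (Greatest P)" by (rule GreatestI_nat) (use bound in auto)
  then obtain C where C: "C \<subseteq> W" "finite C" "card C = Greatest P" "pairwise orthogonal C" "\<forall>b\<in>C. norm b = 1"
    unfolding P_def by blast
  have onbC: "onb C (span C)" using C by (auto simp: onb_def)
  have "W \<subseteq> span C"
  proof
    fix x assume x: "x \<in> W"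
    define r where "r = x - (\<Sum>b\<in>C. (x \<bullet> b) *\<^sub>R b)"
    have "r = 0"
    proof (rule ccontr)
      assume r0: "r \<noteq> 0"
      define e where "e = r /\<^sub>R norm r"
      have eC: "e \<bullet> b = 0" if "b \<in> C" for b
        using onb_residual[OF onbC, of b x] that by (simp add: e_def r_def span_base)
      have ne: "norm e = 1" using r0 by (simp add: e_def)
      have "e \<notin> C" using eC[of e] ne by (auto simp: norm_eq_1)
      moreover have "span C \<subseteq> W" using C W by (simp add: span_minimal)
      then have "e \<in> W"
        using onb_expand_in[OF onbC, of "\<lambda>b. x \<bullet> b"] x W
        by (auto simp: e_def r_def intro!: subspace_scale subspace_diff)
      moreover have "pairwise orthogonal (insert e C)"
        using C(4) eC by (auto simp: pairwise_insert orthogonal_def inner_commute)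
      ultimately have "\<exists>C. C \<subseteq> W \<and> finite C \<and> card C = Suc (Greatest P) \<and> pairwise orthogonal C \<and> (\<forall>b\<in>C. norm b = 1)"
        using C ne by (intro exI[of _ "insert e C"]) auto
      then have "P (Suc (Greatest P))"
        by (simp add: fun_cong[OF P_def])
      then have "Suc (Greatest P) \<le> Greatest P"
        by (rule Greatest_le_nat) (use bound in auto)
      then show False by simp
    qed
    then have "x = (\<Sum>b\<in>C. (x \<bullet> b) *\<^sub>R b)" by (simp add: r_def)
    then show "x \<in> span C" using onb_expand_in[OF onbC, of "\<lambda>b. x \<bullet> b"] by simp
  qed
  moreover have "span C \<subseteq> W" using C W by (simp add: span_minimal)
  ultimately show ?thesis using onbC by (auto simp: fin_dim_def)
qed

lemma dim_onb:
  assumes "onb B W" shows "dim W = card B"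
  using assms unfolding onb_def by (metis dim_span_eq_card_independent orthonormal_independent)

text \<open>Maximality of lineality spaces and of singular subspaces is measured by
  \<open>dim\<close>; strictness of this inequality is what turns a proper enlargement into a
  contradiction.\<close>

lemma dim_psubset_fin_dim:
  assumes W': "fin_dim W'" and W: "subspace W" "W \<subset> W'"
  shows "dim W < dim W'"
proof -
  obtain B' where B': "onb B' W'" using W' by (auto simp: fin_dim_def)
  have "fin_dim W" using fin_dim_subspace[OF W'] W by auto
  then obtain B where B: "onb B W" by (auto simp: fin_dim_def)
  obtain x where x: "x \<in> W'" "x \<notin> W" using W by auto
  have "independent B" using B orthonormal_independent by (auto simp: onb_def)
  then have "independent (insert x B)" using x B by (intro independent_insertI) (auto simp: onb_def)
  moreover have "insert x B \<subseteq> span B'" using x W B B' span_superset[of B] by (auto simp: onb_def)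
  ultimately have "card (insert x B) \<le> card B'"
    using independent_span_bound[of B' "insert x B"] B' by (auto simp: onb_def)
  moreover have "x \<notin> B" using x B span_superset[of B] by (auto simp: onb_def)
  ultimately show ?thesis using dim_onb[OF B] dim_onb[OF B'] B by (simp add: onb_def)
qed

section \<open>Compactness of products and of balls in finite-dimensional subspaces\<close>

lemma compact_UNIV_fun:
  assumes "\<And>i. compact (K i)"
  shows "compact {f::'i \<Rightarrow> 'b::topological_space. \<forall>i. f i \<in> K i}"
proof -
  have "compactin (product_topology (\<lambda>i. euclidean) UNIV) (PiE UNIV K)"
    using assms by (simp add: compactin_PiE)
  then have "compact (PiE UNIV K)"
    by (simp add: euclidean_product_topology)
  moreover have "PiE UNIV K = {f. \<forall>i. f i \<in> K i}" by (auto simp: PiE_def Pi_def)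
  ultimately show ?thesis by simp
qed

text \<open>In coordinates of an orthonormal basis the ball is the part inside
  \<open>cball 0 r\<close> of a continuous image of a cube.\<close>

lemma compact_fin_dim_cball:
  assumes "fin_dim S"
  shows "compact (S \<inter> cball 0 r)"
proof -
  obtain B where B: "onb B S" using assms by (auto simp: fin_dim_def)
  define \<phi> where "\<phi> = (\<lambda>u. \<Sum>b\<in>B. u b *\<^sub>R b)"
  \<comment> \<open>The cube is indexed by all vectors of the type so that Tychonoff applies
    directly; \<phi> reads only the coordinates in \<open>B\<close>.\<close>
  define K where "K = {u::'a \<Rightarrow> real. \<forall>b. u b \<in> {-r..r}}"
  have "compact K" unfolding K_def by (rule compact_UNIV_fun) auto
  moreover have "continuous_on K \<phi>"
    unfolding \<phi>_def by (intro continuous_intros continuous_on_subset[OF continuous_on_product_coordinates]) auto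
  ultimately have "compact (\<phi> ` K)" by (rule compact_continuous_image[rotated])
  moreover have "S \<inter> cball 0 r = \<phi> ` K \<inter> cball 0 r"
  proof
    show "S \<inter> cball 0 r \<subseteq> \<phi> ` K \<inter> cball 0 r"
    proof
      fix x assume x: "x \<in> S \<inter> cball 0 r"
      have "\<bar>x \<bullet> b\<bar> \<le> r" if "b \<in> B" for b
        using Cauchy_Schwarz_ineq2[of x b] x B that by (auto simp: onb_def)
      moreover have "0 \<le> r" using x norm_ge_zero[of x] by (auto simp del: norm_ge_zero)
      ultimately have "(\<lambda>b. if b \<in> B then x \<bullet> b else 0) \<in> K"
        by (fastforce simp: K_def abs_le_iff)
      moreover have "x = \<phi> (\<lambda>b. if b \<in> B then x \<bullet> b else 0)"
        using onb_expand[OF B, of x] x by (simp add: \<phi>_def)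
      ultimately show "x \<in> \<phi> ` K \<inter> cball 0 r" using x by blast
    qed
    show "\<phi> ` K \<inter> cball 0 r \<subseteq> S \<inter> cball 0 r"
      using onb_expand_in[OF B] by (auto simp: \<phi>_def)
  qed
  ultimately show ?thesis using compact_Int_closed[OF _ closed_cball] by metis
qed

section \<open>Crystallographic groups contain a lattice of translations\<close>

lemma closed_unit_sphere: "closed (sphere (0::'v::real_inner) 1)"
  unfolding sphere_def by (intro closed_Collect_eq continuous_intros)

text \<open>Values outside \<open>S\<close> are left free and surjectivity is not part of the
  notion; in the group below it comes from inverses.\<close>

definition isometry_on :: "'v::real_inner set \<Rightarrow> ('v \<Rightarrow> 'v) \<Rightarrow> bool" where
  "isometry_on S \<gamma> \<longleftrightarrow> (\<forall>v\<in>S. \<gamma> v \<in> S) \<and> (\<forall>v\<in>S. \<forall>w\<in>S. norm (\<gamma> v - \<gamma> w) = norm (v - w))"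

definition lin_part :: "('v::real_inner \<Rightarrow> 'v) \<Rightarrow> 'v \<Rightarrow> 'v" where
  "lin_part \<gamma> v = \<gamma> v - \<gamma> 0"

lemma lin_part_0 [simp]: "lin_part \<gamma> 0 = 0"
  by (simp add: lin_part_def)

context
  fixes S :: "'v::real_inner set" and \<gamma> :: "'v \<Rightarrow> 'v"
  assumes S: "subspace S" and iso: "isometry_on S \<gamma>"
begin

lemma isometry_on_in: "v \<in> S \<Longrightarrow> \<gamma> v \<in> S"
  using iso by (auto simp: isometry_on_def)

lemma lin_part_in: "v \<in> S \<Longrightarrow> lin_part \<gamma> v \<in> S"
  using S isometry_on_in by (simp add: lin_part_def subspace_diff subspace_0)

lemma lin_part_dist:
  "v \<in> S \<Longrightarrow> w \<in> S \<Longrightarrow> norm (lin_part \<gamma> v - lin_part \<gamma> w) = norm (v - w)"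
  using iso by (auto simp: isometry_on_def lin_part_def)

lemma norm_lin_part: "v \<in> S \<Longrightarrow> norm (lin_part \<gamma> v) = norm v"
  using lin_part_dist[of v 0] subspace_0[OF S] by simp

lemma lin_part_inner:
  assumes "v \<in> S" "w \<in> S"
  shows "lin_part \<gamma> v \<bullet> lin_part \<gamma> w = v \<bullet> w"
  using lin_part_dist[OF assms] norm_lin_part assms by (simp add: dot_norm_neg)

text \<open>Preservation of inner products alone forces additivity: the squared norm of the defect
  expands into inner products and takes the value it has for the identity, namely zero.\<close>

lemma lin_part_add:
  assumes "v \<in> S" "w \<in> S"
  shows "lin_part \<gamma> (v + w) = lin_part \<gamma> v + lin_part \<gamma> w"
proof -
  let ?L = "lin_part \<gamma>"
  have vw: "v + w \<in> S" using assms S by (simp add: subspace_add)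
  let ?d = "?L (v + w) - ?L v - ?L w"
  have "?d \<bullet> ?d = 0"
    using lin_part_inner[OF vw vw] lin_part_inner[OF vw assms(1)] lin_part_inner[OF vw assms(2)]
      lin_part_inner[OF assms(1,1)] lin_part_inner[OF assms(2,2)] lin_part_inner[OF assms]
    by (simp add: inner_simps inner_commute)
  then have "?d = 0" by (simp only: inner_eq_zero_iff)
  then show ?thesis by (simp add: algebra_simps)
qed

lemma lin_part_scale:
  assumes "v \<in> S"
  shows "lin_part \<gamma> (c *\<^sub>R v) = c *\<^sub>R lin_part \<gamma> v"
proof -
  let ?L = "lin_part \<gamma>"
  have cv: "c *\<^sub>R v \<in> S" using assms S by (simp add: subspace_scale)
  let ?d = "?L (c *\<^sub>R v) - c *\<^sub>R ?L v"
  have "?d \<bullet> ?d = 0"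
    using lin_part_inner[OF cv cv] lin_part_inner[OF cv assms] lin_part_inner[OF assms assms]
    by (simp add: inner_simps inner_commute)
  then have "?d = 0" by (simp only: inner_eq_zero_iff)
  then show ?thesis by simp
qed

lemma lin_part_diff:
  assumes "v \<in> S" "w \<in> S"
  shows "lin_part \<gamma> (v - w) = lin_part \<gamma> v - lin_part \<gamma> w"
  using lin_part_add[of v "-1 *\<^sub>R w"] lin_part_scale[of w "-1"] assms S
  by (simp add: subspace_neg)

text \<open>The form \<open>m\<^sup>2\<bar>x\<bar>\<^sup>2 - \<bar>Ax - x\<bar>\<^sup>2\<close> is positive semidefinite for the maximal displacement
  \<open>m\<close>, so its zero set is a subspace.\<close>
lemma maximal_displacement_subspace:
  assumes fd: "fin_dim S" and nontriv: "\<exists>v\<in>S. lin_part \<gamma> v \<noteq> v"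
  obtains m m' E where "0 \<le> m'" "m' < m" "subspace E" "E \<subseteq> S" "\<exists>e\<in>E. e \<noteq> 0"
    "\<And>x. x \<in> S \<Longrightarrow> norm (lin_part \<gamma> x - x) \<le> m * norm x"
    "\<And>x. x \<in> E \<Longrightarrow> norm (lin_part \<gamma> x - x) = m * norm x"
    "\<And>x. x \<in> S \<Longrightarrow> (\<And>e. e \<in> E \<Longrightarrow> x \<bullet> e = 0) \<Longrightarrow> norm (lin_part \<gamma> x - x) \<le> m' * norm x"
    "\<And>x. x \<in> E \<Longrightarrow> lin_part \<gamma> x \<in> E"
    "\<And>x e. x \<in> S \<Longrightarrow> (\<And>e. e \<in> E \<Longrightarrow> x \<bullet> e = 0) \<Longrightarrow> e \<in> E \<Longrightarrow> lin_part \<gamma> x \<bullet> e = 0"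
proof -
  let ?A = "lin_part \<gamma>"
  let ?U = "S \<inter> sphere 0 1"
  define D where "D = (\<lambda>x. norm (?A x - x))"
  have contD: "continuous_on S D"
  proof -
    have "continuous_on S ?A"
      unfolding continuous_on_iff dist_norm using lin_part_dist by metis
    then show ?thesis unfolding D_def by (intro continuous_intros)
  qed
  have "?U = (S \<inter> cball 0 1) \<inter> sphere 0 1" by auto
  then have compU: "compact ?U"
    using compact_Int_closed[OF compact_fin_dim_cball[OF fd, of 1] closed_unit_sphere] by (simp only:)
  obtain v where v: "v \<in> S" "?A v \<noteq> v" using nontriv by blast
  then have v0: "v \<noteq> 0" by auto
  have Dscale: "D (c *\<^sub>R x) = \<bar>c\<bar> * D x" if "x \<in> S" for c x
  proof -
    have "?A (c *\<^sub>R x) - c *\<^sub>R x = c *\<^sub>R (?A x - x)"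
      by (simp add: lin_part_scale[OF that] scaleR_diff_right)
    then show ?thesis by (simp add: D_def)
  qed
  have bound: "D x \<le> k * norm x" if x: "x \<in> V" and V: "V \<subseteq> S" "subspace V"
      and k: "\<And>u. u \<in> V \<Longrightarrow> norm u = 1 \<Longrightarrow> D u \<le> k" for x V k
  proof (cases "x = 0")
    case False
    let ?u = "x /\<^sub>R norm x"
    have "D ?u \<le> k" using False x V by (intro k) (auto intro: subspace_scale)
    moreover have "D x = norm x * D ?u"
      using Dscale[of x "inverse (norm x)"] x V False by (auto simp: field_simps)
    ultimately show ?thesis using mult_left_mono[of "D ?u" k "norm x"] by (simp add: mult.commute)
  qed (simp add: D_def)
  have "v /\<^sub>R norm v \<in> ?U" using v v0 S by (simp add: subspace_scale)
  then have "?U \<noteq> {}" by blast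
  then obtain u where u: "u \<in> ?U" "\<And>x. x \<in> ?U \<Longrightarrow> D x \<le> D u"
    using continuous_attains_sup[OF compU _ continuous_on_subset[OF contD]] by blast
  define m where "m = D u"
  have mmax: "D x \<le> m * norm x" if "x \<in> S" for x
    using bound[OF that _ S] u by (auto simp: m_def)
  have "D v > 0" using v by (simp add: D_def)
  then have mpos: "m > 0"
    using mmax[OF v(1)] v0 by (metis less_le_trans norm_ge_zero zero_less_mult_pos2 zero_less_norm_iff)
  define q where "q = (\<lambda>x y. m\<^sup>2 * (x \<bullet> y) - (?A x - x) \<bullet> (?A y - y))"
  have qpos: "q x x \<ge> 0" if "x \<in> S" for x
  proof -
    have "(D x)\<^sup>2 \<le> (m * norm x)\<^sup>2" using mmax[OF that] by (intro power_mono) (auto simp: D_def)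
    then show ?thesis by (simp add: q_def D_def power2_norm_eq_inner power_mult_distrib)
  qed
  have q0: "q x x = 0 \<longleftrightarrow> D x = m * norm x" for x
  proof -
    have "q x x = (m * norm x)\<^sup>2 - (D x)\<^sup>2"
      by (simp add: q_def D_def power2_norm_eq_inner power_mult_distrib)
    then show ?thesis using mpos by (simp add: D_def power2_eq_iff_nonneg) (metis)
  qed
  have qadd: "q (x + y) z = q x z + q y z" if "x \<in> S" "y \<in> S" for x y z
    using lin_part_add[OF that] by (simp add: q_def inner_simps algebra_simps)
  have qscale: "q (c *\<^sub>R x) z = c * q x z" if "x \<in> S" for c x z
    using lin_part_scale[OF that] by (simp add: q_def inner_simps algebra_simps)
  have qsym: "q x y = q y x" for x y by (simp add: q_def inner_commute)
  \<comment> \<open>A null vector of a positive semidefinite form lies in its radical: the form at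
    \<open>y + s *\<^sub>R e\<close> is affine in \<open>s\<close> and nonnegative for every
    \<open>s\<close>, so its linear coefficient vanishes.\<close>
  have polar: "q e y = 0" if e: "e \<in> S" "q e e = 0" and y: "y \<in> S" for e y
  proof -
    have *: "0 \<le> q y y + 2 * s * q e y" for s
    proof -
      have se: "s *\<^sub>R e \<in> S" using e S by (simp add: subspace_scale)
      have "q (y + s *\<^sub>R e) (y + s *\<^sub>R e) = q y (y + s *\<^sub>R e) + s * q e (y + s *\<^sub>R e)"
        using qadd[OF y se] qscale[OF e(1)] by simp
      also have "\<dots> = q (y + s *\<^sub>R e) y + s * q (y + s *\<^sub>R e) e" by (simp add: qsym)
      also have "\<dots> = q y y + 2 * s * q e y"
        using qadd[OF y se] qscale[OF e(1)] e(2) by (simp add: qsym[of y e] algebra_simps)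
      finally show ?thesis using qpos[of "y + s *\<^sub>R e"] y se S by (simp add: subspace_add)
    qed
    show ?thesis
    proof (rule ccontr)
      assume "q e y \<noteq> 0"
      then show False using *[of "- (q y y + 1) / (2 * q e y)"] by (simp add: field_simps)
    qed
  qed
  define E where "E = {x\<in>S. q x x = 0}"
  have subE: "subspace E"
  proof (rule subspaceI)
    show "0 \<in> E" using S by (simp add: E_def q_def subspace_0)
    show "x + y \<in> E" if "x \<in> E" "y \<in> E" for x y
      using that qadd[of x y] polar[of x "x + y"] polar[of y "x + y"] S
      by (simp add: E_def subspace_add)
    show "c *\<^sub>R x \<in> E" if "x \<in> E" for c x
      using that qscale[of x c "c *\<^sub>R x"] polar[of x "c *\<^sub>R x"] S
      by (simp add: E_def subspace_scale)
  qed
  have E_S: "E \<subseteq> S" by (auto simp: E_def)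
  have uE: "u \<in> E" using u by (simp add: E_def q0) (simp add: m_def)
  \<comment> \<open>The linear part commutes with its own displacement map, so \<open>x\<close> and
    its image are moved equally far.\<close>
  have AE: "?A x \<in> E" if "x \<in> E" for x
  proof -
    have x: "x \<in> S" "D x = m * norm x" using that by (auto simp: E_def q0)
    have "D (?A x) = norm (?A (?A x - x))"
      using lin_part_diff[OF lin_part_in[OF x(1)] x(1)] by (simp add: D_def)
    also have "\<dots> = D x"
      using norm_lin_part[of "?A x - x"] x lin_part_in S by (simp add: D_def subspace_diff)
    finally show ?thesis using x by (simp add: E_def q0 lin_part_in norm_lin_part)
  qed
  \<comment> \<open>Polarity gives \<open>(?A e - e) \<bullet> (?A x - x) = 0\<close>. Of the four
    products three vanish, since \<open>x\<close> is orthogonal to \<open>e\<close> and to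
    \<open>?A e\<close> and inner products are preserved; the fourth is the claim.\<close>
  have Aorth: "?A x \<bullet> e = 0" if x: "x \<in> S" "\<And>e. e \<in> E \<Longrightarrow> x \<bullet> e = 0" and e: "e \<in> E" for x e
  proof -
    have eS: "e \<in> S" and "q e e = 0" using e by (auto simp: E_def)
    then have "q e x = 0" using polar x by blast
    then have "(?A e - e) \<bullet> (?A x - x) = 0" using x(2)[OF e] by (simp add: q_def inner_commute)
    then have "?A e \<bullet> ?A x - ?A e \<bullet> x - e \<bullet> ?A x + e \<bullet> x = 0" by (simp add: inner_simps)
    then show ?thesis
      using lin_part_inner[OF eS x(1)] x(2)[OF e] x(2)[OF AE[OF e]] by (simp add: inner_commute)
  qed
  define Ep where "Ep = {x\<in>S. \<forall>e\<in>E. x \<bullet> e = 0}"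
  have subEp: "subspace Ep"
    using S by (auto simp: Ep_def subspace_def inner_simps)
  have Ep_S: "Ep \<subseteq> S" by (auto simp: Ep_def)
  \<comment> \<open>Compactness of the unit sphere of the orthogonal complement of \<open>E\<close>
    turns strict inequality into a gap below \<open>m\<close>; if that sphere is empty,
    \<open>0\<close> serves.\<close>
  have "\<exists>m'. 0 \<le> m' \<and> m' < m \<and> (\<forall>x\<in>Ep. norm x = 1 \<longrightarrow> D x \<le> m')"
  proof (cases "Ep \<inter> sphere 0 1 = {}")
    case True
    then show ?thesis using mpos by (intro exI[of _ 0]) auto
  next
    case False
    have fEp: "fin_dim Ep" using fin_dim_subspace[OF fd subEp Ep_S] .
    have "Ep \<inter> sphere 0 1 = (Ep \<inter> cball 0 1) \<inter> sphere 0 1" by auto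
    then have "compact (Ep \<inter> sphere 0 1)"
      using compact_Int_closed[OF compact_fin_dim_cball[OF fEp, of 1] closed_unit_sphere] by (simp only:)
    then obtain w where w: "w \<in> Ep" "norm w = 1" "\<And>x. x \<in> Ep \<Longrightarrow> norm x = 1 \<Longrightarrow> D x \<le> D w"
      using continuous_attains_sup[OF _ False continuous_on_subset[OF contD]] Ep_S by fastforce
    have "w \<notin> E"
      using w by (auto simp: Ep_def norm_eq_1)
    then have "D w \<noteq> m" using w by (auto simp: E_def q0 Ep_def)
    moreover have "D w \<le> m" using mmax[of w] w by (auto simp: Ep_def)
    ultimately show ?thesis using w by (intro exI[of _ "D w"]) (auto simp: D_def)
  qed
  then obtain m' where m': "0 \<le> m'" "m' < m" "\<And>x. x \<in> Ep \<Longrightarrow> norm x = 1 \<Longrightarrow> D x \<le> m'"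
    by blast
  show thesis
  proof (rule that[OF m'(1,2) subE E_S])
    show "\<exists>e\<in>E. e \<noteq> 0" using uE u by (intro bexI[of _ u]) auto
    show "norm (?A x - x) \<le> m * norm x" if "x \<in> S" for x using mmax[OF that] by (simp add: D_def)
    show "norm (?A x - x) = m * norm x" if "x \<in> E" for x using that by (simp add: E_def q0) (simp add: D_def)
    show "norm (?A x - x) \<le> m' * norm x" if "x \<in> S" "\<And>e. e \<in> E \<Longrightarrow> x \<bullet> e = 0" for x
      using bound[of x Ep m'] that Ep_S subEp m' by (auto simp: Ep_def D_def)
  qed (use AE Aorth in auto)
qed

end

lemma infinite_small_diameter:
  fixes f :: "nat \<Rightarrow> 'b::metric_space"
  assumes "infinite I" "compact K" "\<And>i. i \<in> I \<Longrightarrow> f i \<in> K" "e > 0"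
  shows "\<exists>J\<subseteq>I. infinite J \<and> (\<forall>i\<in>J. \<forall>j\<in>J. dist (f i) (f j) < e)"
proof -
  obtain T where T: "finite T" "K \<subseteq> (\<Union>x\<in>T. ball x (e / 2))"
    using compact_eq_totally_bounded[of K] assms by (meson half_gt_zero)
  then have "\<forall>i\<in>I. \<exists>x\<in>T. dist x (f i) < e / 2"
    using assms(3) by fastforce
  then obtain h where h: "\<And>i. i \<in> I \<Longrightarrow> h i \<in> T \<and> dist (h i) (f i) < e / 2" by metis
  then have "h ` I \<subseteq> T" by blast
  then have "finite (h ` I)" using T(1) by (rule finite_subset)
  then obtain i0 where "i0 \<in> I" "infinite {i\<in>I. h i = h i0}"
    using pigeonhole_infinite[OF assms(1)] by blast
  moreover have "dist (f i) (f j) < e" if "i \<in> I" "j \<in> I" "h i = h i0" "h j = h i0" for i j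
    using h[OF that(1)] h[OF that(2)] that dist_triangle_half_r[of "h i0" "f i" e "f j"] by simp
  ultimately show ?thesis
    by (intro exI[of _ "{i\<in>I. h i = h i0}"]) auto
qed

text \<open>Pigeonhole for rotations: the index set is thinned once for each vector of an
  orthonormal basis, keeping it infinite, until the images of all basis vectors are close.\<close>

lemma lin_parts_cluster:
  assumes fd: "fin_dim S" and iso: "\<And>i. isometry_on S (\<gamma> i)" and e: "e > 0"
  shows "\<exists>J::nat set. infinite J \<and> (\<forall>i\<in>J. \<forall>j\<in>J. \<forall>v\<in>S. norm (lin_part (\<gamma> i) v - lin_part (\<gamma> j) v) \<le> e * norm v)"
proof -
  obtain B where B: "onb B S" using fd by (auto simp: fin_dim_def)
  have S: "subspace S" using fd fin_dim_imp_subspace by blast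
  have finB: "finite B" and BS: "B \<subseteq> S" using B by (auto simp: onb_def span_base)
  \<comment> \<open>The errors at the basis vectors add up to at most \<open>card B * d\<close>; the
    added one keeps the quotient meaningful for an empty basis.\<close>
  define d where "d = e / (card B + 1)"
  have d: "d > 0" using e by (simp add: d_def add_nonneg_pos)
  have "\<exists>J::nat set. infinite J \<and> (\<forall>i\<in>J. \<forall>j\<in>J. \<forall>b\<in>C. dist (lin_part (\<gamma> i) b) (lin_part (\<gamma> j) b) < d)"
    if "finite C" "C \<subseteq> B" for C
    using that
  proof (induction C)
    case empty
    show ?case by (intro exI[of _ UNIV]) auto
  next
    case (insert b C)
    then obtain I where I: "infinite I" "\<forall>i\<in>I. \<forall>j\<in>I. \<forall>b\<in>C. dist (lin_part (\<gamma> i) b) (lin_part (\<gamma> j) b) < d"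
      by auto
    have bS: "b \<in> S" using insert BS by auto
    obtain J where "J \<subseteq> I" "infinite J" "\<forall>i\<in>J. \<forall>j\<in>J. dist (lin_part (\<gamma> i) b) (lin_part (\<gamma> j) b) < d"
      using infinite_small_diameter[OF I(1) compact_fin_dim_cball[OF fd, of "norm b"], of "\<lambda>i. lin_part (\<gamma> i) b" d] d
        lin_part_in[OF S iso bS] norm_lin_part[OF S iso bS] by (auto simp: Ball_def)
    then show ?case using I by (intro exI[of _ J]) blast
  qed
  from this[OF finB subset_refl] obtain J where J: "infinite J"
    "\<And>i j b. i \<in> J \<Longrightarrow> j \<in> J \<Longrightarrow> b \<in> B \<Longrightarrow> norm (lin_part (\<gamma> i) b - lin_part (\<gamma> j) b) < d"
    by (auto simp: dist_norm)
  have expand: "lin_part (\<gamma> i) v = (\<Sum>b\<in>B. (v \<bullet> b) *\<^sub>R lin_part (\<gamma> i) b)" if "v \<in> S" for i v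
  proof -
    have "lin_part (\<gamma> i) (\<Sum>b\<in>C. (v \<bullet> b) *\<^sub>R b) = (\<Sum>b\<in>C. (v \<bullet> b) *\<^sub>R lin_part (\<gamma> i) b)"
      if "finite C" "C \<subseteq> B" for C
      using that
    proof (induction C)
      case (insert b C)
      have "(v \<bullet> b) *\<^sub>R b \<in> S" "(\<Sum>b\<in>C. (v \<bullet> b) *\<^sub>R b) \<in> S" "b \<in> S"
        using insert BS S by (auto intro!: subspace_scale subspace_sum)
      then show ?case
        using insert by (simp add: lin_part_add[OF S iso] lin_part_scale[OF S iso])
    qed simp
    from this[OF finB subset_refl] show ?thesis using onb_expand[OF B that] by simp
  qed
  have "norm (lin_part (\<gamma> i) v - lin_part (\<gamma> j) v) \<le> e * norm v" if ij: "i \<in> J" "j \<in> J" and v: "v \<in> S" for i j v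
  proof -
    have "lin_part (\<gamma> i) v - lin_part (\<gamma> j) v = (\<Sum>b\<in>B. (v \<bullet> b) *\<^sub>R (lin_part (\<gamma> i) b - lin_part (\<gamma> j) b))"
      by (simp add: expand[OF v] scaleR_diff_right sum_subtractf)
    also have "norm \<dots> \<le> (\<Sum>b\<in>B. norm v * d)"
    proof (rule sum_norm_le)
      fix b assume b: "b \<in> B"
      have "\<bar>v \<bullet> b\<bar> \<le> norm v" using Cauchy_Schwarz_ineq2[of v b] B b by (auto simp: onb_def)
      then show "norm ((v \<bullet> b) *\<^sub>R (lin_part (\<gamma> i) b - lin_part (\<gamma> j) b)) \<le> norm v * d"
        using less_imp_le[OF J(2)[OF ij b]] by (auto intro!: mult_mono)
    qed
    also have "\<dots> = (card B * d) * norm v" by simp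
    also have "\<dots> \<le> e * norm v"
      using e by (intro mult_right_mono) (auto simp: d_def field_simps)
    finally show ?thesis .
  qed
  then show ?thesis using J(1) by blast
qed

text \<open>Only the restrictions to \<open>S\<close> matter, so the group laws are required up to
  agreement on \<open>S\<close>. Discreteness and cocompactness are both read off the orbit of
  \<open>0\<close>; the former includes finiteness of the stabiliser of \<open>0\<close>.\<close>

locale crystallographic =
  fixes S :: "'v::real_inner set" and \<Gamma> :: "('v \<Rightarrow> 'v) set"
  assumes fd: "fin_dim S"
    and iso: "\<gamma> \<in> \<Gamma> \<Longrightarrow> isometry_on S \<gamma>"
    and comp: "\<gamma> \<in> \<Gamma> \<Longrightarrow> \<delta> \<in> \<Gamma> \<Longrightarrow> \<exists>\<eta>\<in>\<Gamma>. \<forall>v\<in>S. \<eta> v = \<gamma> (\<delta> v)"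
    and inverse: "\<gamma> \<in> \<Gamma> \<Longrightarrow> \<exists>\<eta>\<in>\<Gamma>. \<forall>v\<in>S. \<eta> (\<gamma> v) = v \<and> \<gamma> (\<eta> v) = v"
    and discrete: "finite {\<gamma> \<in> \<Gamma>. norm (\<gamma> 0) \<le> r}"
    and cocompact: "\<exists>d. \<forall>x\<in>S. \<exists>\<gamma>\<in>\<Gamma>. norm (\<gamma> 0 - x) \<le> d"
begin

lemma sub: "subspace S" using fd fin_dim_imp_subspace by blast

lemma zero_in [simp]: "0 \<in> S" using sub subspace_0 by blast

lemma quotient:
  assumes "\<gamma> \<in> \<Gamma>" "\<delta> \<in> \<Gamma>"
  shows "\<exists>\<eta>\<in>\<Gamma>. \<forall>v\<in>S. \<eta> (\<delta> v) = \<gamma> v"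
proof -
  obtain \<delta>' where \<delta>': "\<delta>' \<in> \<Gamma>" "\<forall>v\<in>S. \<delta>' (\<delta> v) = v" using inverse[OF assms(2)] by blast
  obtain \<eta> where "\<eta> \<in> \<Gamma>" "\<forall>v\<in>S. \<eta> v = \<gamma> (\<delta>' v)" using comp[OF assms(1) \<delta>'(1)] by blast
  then show ?thesis using \<delta>' isometry_on_in[OF sub iso[OF assms(2)]] by (intro bexI[of _ \<eta>]) auto
qed

lemma lin_part_surj:
  assumes "\<gamma> \<in> \<Gamma>" "v \<in> S"
  shows "\<exists>w\<in>S. lin_part \<gamma> w = v \<and> norm w = norm v"
proof -
  obtain \<eta> where \<eta>: "\<eta> \<in> \<Gamma>" "\<forall>v\<in>S. \<gamma> (\<eta> v) = v" using inverse[OF assms(1)] by blast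
  have 1: "v + \<gamma> 0 \<in> S" using assms isometry_on_in[OF sub iso[OF assms(1)]] sub by (simp add: subspace_add)
  then have "\<eta> (v + \<gamma> 0) \<in> S" using isometry_on_in[OF sub iso[OF \<eta>(1)]] by blast
  moreover have "lin_part \<gamma> (\<eta> (v + \<gamma> 0)) = v" using \<eta> 1 by (simp add: lin_part_def)
  ultimately show ?thesis using norm_lin_part[OF sub iso[OF assms(1)]] by metis
qed

lemma lin_part_quotient:
  assumes "\<gamma> \<in> \<Gamma>" "\<delta> \<in> \<Gamma>" "\<eta> \<in> \<Gamma>" "\<forall>v\<in>S. \<eta> (\<delta> v) = \<gamma> v" "v \<in> S"
  shows "lin_part \<eta> (lin_part \<delta> v) = lin_part \<gamma> v"
  using lin_part_diff[OF sub iso[OF assms(3)], of "\<delta> v" "\<delta> 0"] isometry_on_in[OF sub iso[OF assms(2)]] assms(4,5)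
  by (simp add: lin_part_def)

text \<open>Elements that send \<open>0\<close> near \<open>real k *\<^sub>R u\<close> exist for
  every \<open>k\<close>. Two of them with nearly equal rotation have a quotient with small
  rotation, and its translation part points along \<open>u\<close> if one index is much larger than
  the other.\<close>

lemma almost_translation_exists:
  assumes u: "u \<in> S" "norm u = 1" and e: "e > 0"
  shows "\<exists>\<beta>\<in>\<Gamma>. (\<forall>v\<in>S. norm (lin_part \<beta> v - v) \<le> e * norm v) \<and> (\<exists>t>0. norm (\<beta> 0 - t *\<^sub>R u) \<le> e * t)"
proof -
  obtain d where d: "\<forall>x\<in>S. \<exists>\<gamma>\<in>\<Gamma>. norm (\<gamma> 0 - x) \<le> d" using cocompact by blast
  have "\<forall>k::nat. \<exists>\<gamma>\<in>\<Gamma>. norm (\<gamma> 0 - real k *\<^sub>R u) \<le> d"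
    using d u sub by (auto intro: subspace_scale)
  then obtain \<gamma> where \<gamma>: "\<And>k::nat. \<gamma> k \<in> \<Gamma>" "\<And>k. norm (\<gamma> k 0 - real k *\<^sub>R u) \<le> d" by metis
  obtain J where J: "infinite J" "\<forall>i\<in>J. \<forall>j\<in>J. \<forall>v\<in>S. norm (lin_part (\<gamma> i) v - lin_part (\<gamma> j) v) \<le> e * norm v"
    using lin_parts_cluster[of S \<gamma> e, OF fd iso[OF \<gamma>(1)] e] by (elim exE conjE)
  obtain i where i: "i \<in> J" using J(1) infinite_imp_nonempty by blast
  obtain \<delta> where \<delta>: "\<delta> \<in> \<Gamma>" "\<forall>v\<in>S. \<gamma> i (\<delta> v) = v" using inverse[OF \<gamma>(1)[of i]] by blast
  define p where "p = \<delta> 0"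
  have p: "p \<in> S" "\<gamma> i p = 0" using \<delta> isometry_on_in[OF sub iso[OF \<delta>(1)]] by (auto simp: p_def)
  \<comment> \<open>The fixed index contributes the error \<open>norm p\<close> and the net the
    error \<open>d\<close>; such a \<open>j\<close> makes their sum at most
    \<open>e * real j\<close>.\<close>
  obtain j where j: "j \<in> J" "j > nat \<lceil>(norm p + d) / e\<rceil>"
    using J(1) by (meson infinite_nat_iff_unbounded)
  obtain \<beta> where \<beta>: "\<beta> \<in> \<Gamma>" "\<forall>v\<in>S. \<beta> (\<gamma> i v) = \<gamma> j v" using quotient[OF \<gamma>(1) \<gamma>(1)] by blast
  have "norm (lin_part \<beta> v - v) \<le> e * norm v" if v: "v \<in> S" for v
  proof -
    obtain w where "w \<in> S" "lin_part (\<gamma> i) w = v" "norm w = norm v" using lin_part_surj[OF \<gamma>(1) v] by blast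
    then show ?thesis using lin_part_quotient[OF \<gamma>(1) \<gamma>(1) \<beta>, of w] J(2) i j by metis
  qed
  moreover have "norm (\<beta> 0 - real j *\<^sub>R u) \<le> e * real j"
  proof -
    have "\<beta> 0 = \<gamma> j p" using \<beta>(2) p by metis
    moreover have "norm (\<gamma> j p - \<gamma> j 0) = norm p"
      using norm_lin_part[OF sub iso[OF \<gamma>(1)] p(1)] by (simp add: lin_part_def)
    ultimately have "norm (\<beta> 0 - real j *\<^sub>R u) \<le> norm p + d"
      using norm_triangle_ineq[of "\<gamma> j p - \<gamma> j 0" "\<gamma> j 0 - real j *\<^sub>R u"] \<gamma>(2)[of j] by simp
    also have "(norm p + d) / e \<le> real j" using j(2) by linarith
    then have "norm p + d \<le> e * real j" using e by (simp add: field_simps)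
    finally show ?thesis .
  qed
  moreover have "real j > 0" using j by simp
  ultimately show ?thesis using \<beta>(1) by blast
qed

text \<open>Buser's proof of Bieberbach's first theorem: for a nontranslation \<open>\<alpha>\<close> with small rotation and
  minimal translation part, and \<open>\<beta>\<close> almost a translation along the subspace of maximal displacement
  of \<open>\<alpha>\<close>, the commutator of \<open>\<alpha>\<close> and \<open>\<beta>\<close> is shorter than \<open>\<beta>\<close> but of the same kind.\<close>
lemma small_rotation_imp_translation:
  assumes \<gamma>: "\<gamma> \<in> \<Gamma>" "\<And>v. v \<in> S \<Longrightarrow> norm (lin_part \<gamma> v - v) \<le> norm v / 2" and v: "v \<in> S"
  shows "lin_part \<gamma> v = v"
proof (rule ccontr)
  assume contra: "lin_part \<gamma> v \<noteq> v"
  \<comment> \<open>Discreteness leaves finitely many competitors below a given translation length,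
    so a shortest element with a given property exists. This serves both for \<alpha> and for
    \<beta>.\<close>
  have minimal: "\<exists>\<alpha>\<in>\<Gamma>. P \<alpha> \<and> (\<forall>\<delta>\<in>\<Gamma>. P \<delta> \<longrightarrow> norm (\<alpha> 0) \<le> norm (\<delta> 0))" if "\<gamma> \<in> \<Gamma>" "P \<gamma>" for P \<gamma>
  proof -
    let ?M = "{\<delta> \<in> \<Gamma>. norm (\<delta> 0) \<le> norm (\<gamma> 0)} \<inter> Collect P"
    have "finite ?M" using discrete by blast
    moreover have "\<gamma> \<in> ?M" using that by auto
    ultimately obtain \<alpha> where "is_arg_min (\<lambda>\<delta>. norm (\<delta> 0)) (\<lambda>\<delta>. \<delta> \<in> ?M) \<alpha>"
      using ex_is_arg_min_if_finite[of ?M "\<lambda>\<delta>. norm (\<delta> 0)"] by blast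
    then have \<alpha>: "\<alpha> \<in> ?M" "\<And>\<delta>. \<delta> \<in> ?M \<Longrightarrow> norm (\<alpha> 0) \<le> norm (\<delta> 0)"
      by (auto simp: is_arg_min_linorder)
    then show ?thesis by (intro bexI[of _ \<alpha>]) force+
  qed
  let ?P = "\<lambda>\<gamma>. (\<forall>v\<in>S. norm (lin_part \<gamma> v - v) \<le> norm v / 2) \<and> (\<exists>v\<in>S. lin_part \<gamma> v \<noteq> v)"
  obtain \<alpha> where \<alpha>: "\<alpha> \<in> \<Gamma>" "?P \<alpha>" "\<And>\<delta>. \<delta> \<in> \<Gamma> \<Longrightarrow> ?P \<delta> \<Longrightarrow> norm (\<alpha> 0) \<le> norm (\<delta> 0)"
    using minimal[of \<gamma> ?P] \<gamma> v contra by blast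
  define A where "A = lin_part \<alpha>"
  define a where "a = \<alpha> 0"
  have aS: "a \<in> S" using isometry_on_in[OF sub iso[OF \<alpha>(1)]] by (simp add: a_def)
  obtain m m' E where mE: "0 \<le> m'" "m' < m" "subspace E" "E \<subseteq> S" "\<exists>e\<in>E. e \<noteq> 0"
    "\<And>x. x \<in> S \<Longrightarrow> norm (A x - x) \<le> m * norm x"
    "\<And>x. x \<in> E \<Longrightarrow> norm (A x - x) = m * norm x"
    "\<And>x. x \<in> S \<Longrightarrow> (\<And>e. e \<in> E \<Longrightarrow> x \<bullet> e = 0) \<Longrightarrow> norm (A x - x) \<le> m' * norm x"
    "\<And>x. x \<in> E \<Longrightarrow> A x \<in> E"
    "\<And>x e. x \<in> S \<Longrightarrow> (\<And>e. e \<in> E \<Longrightarrow> x \<bullet> e = 0) \<Longrightarrow> e \<in> E \<Longrightarrow> A x \<bullet> e = 0"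
    by (rule maximal_displacement_subspace[OF sub iso[OF \<alpha>(1)] fd, folded A_def]) (use \<alpha>(2) in \<open>auto simp: A_def\<close>)
  obtain e0 where e0: "e0 \<in> E" "e0 \<noteq> 0" using mE(5) by blast
  have m_half: "m \<le> 1/2"
  proof -
    have "e0 \<in> S" using mE(4) e0(1) by blast
    then have "norm (A e0 - e0) \<le> norm e0 / 2" using \<alpha>(2) by (simp add: A_def)
    then have "m * norm e0 \<le> norm e0 / 2" using mE(7)[OF e0(1)] by simp
    then show ?thesis using e0 by (simp add: field_simps)
  qed
  have fE: "fin_dim E" using fin_dim_subspace[OF fd mE(3,4)] .
  \<comment> \<open>With this value the commutator error \<open>2 * \<kappa> * norm b\<close>, at
    most \<open>4 * \<kappa> * norm bE\<close>, is half of the gap \<open>m - m'\<close> times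
    \<open>norm bE\<close>.\<close>
  define \<kappa> where "\<kappa> = (m - m') / 8"
  have \<kappa>: "\<kappa> > 0" "\<kappa> \<le> 1/16" using mE(1,2) m_half by (auto simp: \<kappa>_def)
  let ?pE = "orth_proj E" and ?pp = "\<lambda>x. x - orth_proj E x"
  \<comment> \<open>The class in which \<beta> is shortest: rotation at most \<kappa> and a nonzero
    translation part within 45 degrees of \<open>E\<close>. The contradiction is that a shorter
    commutator belongs to it again.\<close>
  let ?Q = "\<lambda>\<beta>. \<beta> 0 \<noteq> 0 \<and> norm (?pp (\<beta> 0)) \<le> norm (?pE (\<beta> 0)) \<and> (\<forall>v\<in>S. norm (lin_part \<beta> v - v) \<le> \<kappa> * norm v)"
  have "\<exists>\<beta>\<in>\<Gamma>. ?Q \<beta>"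
  proof -
    define u where "u = e0 /\<^sub>R norm e0"
    have u: "u \<in> E" "norm u = 1" using e0 mE(3) by (auto simp: u_def subspace_scale)
    obtain \<beta> t where \<beta>: "\<beta> \<in> \<Gamma>" "\<forall>v\<in>S. norm (lin_part \<beta> v - v) \<le> \<kappa> * norm v" "t > 0" "norm (\<beta> 0 - t *\<^sub>R u) \<le> \<kappa> * t"
      using almost_translation_exists[OF _ u(2) \<kappa>(1)] u mE(4) by blast
    have tu: "t *\<^sub>R u \<in> E" "norm (t *\<^sub>R u) = t" using u mE(3) \<beta>(3) by (auto simp: subspace_scale)
    have small: "\<kappa> * t \<le> t / 16" using \<kappa>(2) \<beta>(3) by simp
    have "norm (?pp (\<beta> 0)) \<le> t / 16"
      using norm_orth_residual_le[OF fE tu(1), of "\<beta> 0"] \<beta>(4) small by linarith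
    moreover have "norm (\<beta> 0) \<ge> t - t / 16"
      using norm_triangle_ineq2[of "t *\<^sub>R u" "\<beta> 0"] \<beta>(4) small tu by (simp add: norm_minus_commute)
    moreover have "norm (\<beta> 0) \<le> norm (?pE (\<beta> 0)) + norm (?pp (\<beta> 0))"
      using norm_triangle_ineq[of "?pE (\<beta> 0)" "?pp (\<beta> 0)"] by simp
    ultimately show ?thesis using \<beta> by (intro bexI[of _ \<beta>]) auto
  qed
  then obtain \<beta> where \<beta>: "\<beta> \<in> \<Gamma>" "?Q \<beta>" "\<And>\<delta>. \<delta> \<in> \<Gamma> \<Longrightarrow> ?Q \<delta> \<Longrightarrow> norm (\<beta> 0) \<le> norm (\<delta> 0)"
    using minimal[of _ ?Q] by blast
  define b where "b = \<beta> 0"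
  define B where "B = lin_part \<beta>"
  have bS: "b \<in> S" using isometry_on_in[OF sub iso[OF \<beta>(1)]] by (simp add: b_def)
  define bE bp where "bE = ?pE b" and "bp = ?pp b"
  have bE: "bE \<in> E" "\<And>e. e \<in> E \<Longrightarrow> bp \<bullet> e = 0" "b = bE + bp" "norm bp \<le> norm bE"
    using orth_proj_in[OF fE] orth_proj_orth[OF fE] \<beta>(2) by (auto simp: bE_def bp_def b_def)
  have bES: "bE \<in> S" "bp \<in> S" using bE(1) mE(4) bS sub by (auto simp: bp_def bE_def subspace_diff)
  have b_le: "norm b \<le> 2 * norm bE" using norm_triangle_ineq[of bE bp] bE by simp
  have bE0: "norm bE > 0" using b_le \<beta>(2) by (simp add: b_def) (metis norm_eq_zero norm_le_zero_iff mult_zero_right)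
  \<comment> \<open>If \<beta> is a translation, the minimality of \<alpha> says nothing about
    \<open>norm b\<close>, but then \<open>B\<close> causes no error at all. Otherwise \<beta>
    competes with \<alpha> and \<open>norm a \<le> norm b\<close>. In both cases
    \<open>\<mu> * norm a \<le> \<mu> * norm b\<close>.\<close>
  define \<mu> where "\<mu> = (if \<forall>v\<in>S. B v = v then 0 else \<kappa>)"
  have \<mu>: "0 \<le> \<mu>" "\<mu> \<le> \<kappa>" "\<And>v. v \<in> S \<Longrightarrow> norm (B v - v) \<le> \<mu> * norm v"
    using \<kappa> \<beta>(2) by (auto simp: \<mu>_def B_def)
  have \<mu>a: "\<mu> * norm a \<le> \<mu> * norm b"
  proof (cases "\<forall>v\<in>S. B v = v")
    case False
    have "norm (lin_part \<beta> v - v) \<le> norm v / 2" if "v \<in> S" for v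
    proof -
      have "\<kappa> * norm v \<le> 1/2 * norm v" using \<kappa> by (intro mult_right_mono) auto
      then show ?thesis using \<beta>(2) that by fastforce
    qed
    then have "norm a \<le> norm b" using \<alpha>(3)[OF \<beta>(1)] False by (auto simp: a_def b_def B_def)
    then show ?thesis using \<mu> by (simp add: mult_left_mono)
  qed (simp add: \<mu>_def)
  obtain \<alpha>\<beta> where \<alpha>\<beta>: "\<alpha>\<beta> \<in> \<Gamma>" "\<forall>v\<in>S. \<alpha>\<beta> v = \<alpha> (\<beta> v)" using comp[OF \<alpha>(1) \<beta>(1)] by blast
  obtain \<beta>\<alpha> where \<beta>\<alpha>: "\<beta>\<alpha> \<in> \<Gamma>" "\<forall>v\<in>S. \<beta>\<alpha> v = \<beta> (\<alpha> v)" using comp[OF \<beta>(1) \<alpha>(1)] by blast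
  \<comment> \<open>On \<open>S\<close> the element \<delta> is the commutator of \<alpha> and
    \<beta>, obtained as the quotient of the two products.\<close>
  obtain \<delta> where \<delta>: "\<delta> \<in> \<Gamma>" "\<forall>v\<in>S. \<delta> (\<beta>\<alpha> v) = \<alpha>\<beta> v" using quotient[OF \<alpha>\<beta>(1) \<beta>\<alpha>(1)] by blast
  define D where "D = lin_part \<delta>"
  note A_S = lin_part_in[OF sub iso[OF \<alpha>(1)], folded A_def] and B_S = lin_part_in[OF sub iso[OF \<beta>(1)], folded B_def]
    and A_n = norm_lin_part[OF sub iso[OF \<alpha>(1)], folded A_def] and B_n = norm_lin_part[OF sub iso[OF \<beta>(1)], folded B_def]
    and A_d = lin_part_diff[OF sub iso[OF \<alpha>(1)], folded A_def] and B_d = lin_part_diff[OF sub iso[OF \<beta>(1)], folded B_def]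
    and A_a = lin_part_add[OF sub iso[OF \<alpha>(1)], folded A_def] and D_a = lin_part_add[OF sub iso[OF \<delta>(1)], folded D_def]
  have lin_ab: "lin_part \<alpha>\<beta> v = A (B v)" if "v \<in> S" for v
  proof -
    have "lin_part \<alpha>\<beta> v = \<alpha> (\<beta> v) - \<alpha> (\<beta> 0)" using \<alpha>\<beta>(2) that by (simp add: lin_part_def)
    also have "\<dots> = A (\<beta> v) - A (\<beta> 0)" by (simp add: A_def lin_part_def)
    also have "\<dots> = A (B v)" using A_d[of "\<beta> v" "\<beta> 0"] isometry_on_in[OF sub iso[OF \<beta>(1)]] that by (simp add: B_def lin_part_def)
    finally show ?thesis .
  qed
  have lin_ba: "lin_part \<beta>\<alpha> v = B (A v)" if "v \<in> S" for v
  proof -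
    have "lin_part \<beta>\<alpha> v = \<beta> (\<alpha> v) - \<beta> (\<alpha> 0)" using \<beta>\<alpha>(2) that by (simp add: lin_part_def)
    also have "\<dots> = B (\<alpha> v) - B (\<alpha> 0)" by (simp add: B_def lin_part_def)
    also have "\<dots> = B (A v)" using B_d[of "\<alpha> v" "\<alpha> 0"] isometry_on_in[OF sub iso[OF \<alpha>(1)]] that by (simp add: A_def lin_part_def)
    finally show ?thesis .
  qed
  have DBA: "D (B (A w)) = A (B w)" if "w \<in> S" for w
    using lin_part_quotient[OF \<alpha>\<beta>(1) \<beta>\<alpha>(1) \<delta> that] that by (simp add: D_def lin_ab lin_ba)
  \<comment> \<open>With \<open>v = B (A w)\<close> the displacement is the commutator of
    \<open>A - 1\<close> and \<open>B - 1\<close> at \<open>w\<close>, of size at most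
    \<open>2 * m * \<mu> * norm w\<close>, and \<open>m \<le> 1/2\<close>.\<close>
  have Dv: "norm (D v - v) \<le> \<mu> * norm v" if v: "v \<in> S" for v
  proof -
    obtain w where w: "w \<in> S" "B (A w) = v" "norm w = norm v"
      using lin_part_surj[OF \<beta>\<alpha>(1) v] lin_ba by metis
    have Bw: "B w - w \<in> S" and Aw: "A w - w \<in> S" using w A_S B_S sub by (auto simp: subspace_diff)
    have "D v - v = A (B w) - B (A w)" using DBA[OF w(1)] w by simp
    also have "\<dots> = (A (B w - w) - (B w - w)) - (B (A w - w) - (A w - w))"
      using A_d[of "B w" w] B_d[of "A w" w] w A_S B_S by simp
    also have "norm \<dots> \<le> m * norm (B w - w) + \<mu> * norm (A w - w)"
      using norm_triangle_ineq4[of "A (B w - w) - (B w - w)" "B (A w - w) - (A w - w)"] mE(6)[OF Bw] \<mu>(3)[OF Aw] by linarith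
    also have "\<dots> \<le> m * (\<mu> * norm w) + \<mu> * (m * norm w)"
      using \<mu>(3)[OF w(1)] mE(6)[OF w(1)] mE(1,2) \<mu>(1) by (intro add_mono mult_left_mono) auto
    also have "\<dots> = (2 * m) * (\<mu> * norm w)" by simp
    also have "\<dots> \<le> 1 * (\<mu> * norm w)" using m_half \<mu>(1) by (intro mult_right_mono) auto
    finally show ?thesis using w by simp
  qed
  obtain c where c: "c \<in> S" "A c = a" "norm c = norm a" using lin_part_surj[OF \<alpha>(1) aS] by (auto simp: A_def)
  \<comment> \<open>The commutator has translation part \<open>A b - b\<close> up to this remainder,
    which collects what the rotations \<open>D\<close> and \<open>B\<close> contribute.\<close>
  define r where "r = (b - D b) + A (c - B c)"
  have \<delta>0: "\<delta> 0 = (A b - b) + r"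
  proof -
    have "\<delta> (\<beta> (\<alpha> 0)) = \<alpha> (\<beta> 0)" using \<delta>(2) \<alpha>\<beta>(2) \<beta>\<alpha>(2) by simp
    moreover have "\<alpha> (\<beta> 0) = A b + a" by (simp add: A_def b_def a_def lin_part_def)
    moreover have "\<beta> (\<alpha> 0) = B a + b" by (simp add: B_def b_def a_def lin_part_def)
    moreover have "\<delta> (B a + b) = D (B a) + D b + \<delta> 0"
      using D_a[of "B a" b] B_S[OF aS] bS by (simp add: D_def lin_part_def)
    moreover have "D (B a) = A (B c)" using DBA[OF c(1)] c by simp
    ultimately have e1: "A (B c) + D b + \<delta> 0 = A b + a" by metis
    have e2: "A (c - B c) = a - A (B c)" using A_d[of c "B c"] c B_S by simp
    have "\<delta> 0 = (A b + a) - (A (B c) + D b)" unfolding e1[symmetric] by simp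
    then show ?thesis unfolding r_def e2 by simp
  qed
  have r_le: "norm r \<le> 2 * \<kappa> * norm b"
  proof -
    have cB: "c - B c \<in> S" using c B_S sub by (simp add: subspace_diff)
    have "norm r \<le> norm (b - D b) + norm (c - B c)"
      unfolding r_def using norm_triangle_ineq[of "b - D b" "A (c - B c)"] A_n[OF cB] by simp
    also have "\<dots> \<le> \<mu> * norm b + \<mu> * norm a"
      using Dv[OF bS] \<mu>(3)[OF c(1)] c(3) by (simp add: norm_minus_commute)
    also have "\<dots> \<le> 2 * \<mu> * norm b" using \<mu>a by simp
    also have "\<dots> \<le> 2 * \<kappa> * norm b" using \<mu>(2) by (simp add: mult_right_mono)
    finally show ?thesis .
  qed
  have r_le': "norm r \<le> (m - m') / 2 * norm bE"
  proof -
    have "2 * \<kappa> * norm b \<le> 2 * \<kappa> * (2 * norm bE)" using b_le \<kappa> by (intro mult_left_mono) auto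
    also have "\<dots> = (m - m') / 2 * norm bE" by (simp add: \<kappa>_def)
    finally show ?thesis using r_le by linarith
  qed
  have Ab: "A b = A bE + A bp" using A_a[OF bES] bE(3) by simp
  have AbE: "A bE - bE \<in> E" using mE(9)[OF bE(1)] bE(1) mE(3) by (simp add: subspace_diff)
  have Abp: "(A bp - bp) \<bullet> e = 0" if "e \<in> E" for e
    using mE(10)[OF bES(2) bE(2) that] bE(2)[OF that] by (simp add: inner_diff_left)
  have pE\<delta>: "?pE (\<delta> 0) = (A bE - bE) + ?pE r"
  proof (rule orth_proj_unique[OF fE])
    show "A bE - bE + ?pE r \<in> E" using AbE orth_proj_in[OF fE] mE(3) by (simp add: subspace_add)
    fix e assume e: "e \<in> E"
    have "\<delta> 0 - (A bE - bE + ?pE r) = (A bp - bp) + ?pp r" using \<delta>0 Ab bE(3) by simp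
    then show "(\<delta> 0 - (A bE - bE + ?pE r)) \<bullet> e = 0"
      using Abp[OF e] orth_proj_orth[OF fE e, of r] by (simp only: inner_add_left)
  qed
  have pp\<delta>: "?pp (\<delta> 0) = (A bp - bp) + ?pp r" using pE\<delta> \<delta>0 Ab bE(3) by simp
  have ppr: "norm (?pp r) \<le> norm r" using norm_orth_residual_le[OF fE subspace_0[OF mE(3)]] by simp
  have pEr: "norm (?pE r) \<le> norm r"
  proof -
    have "(norm r)\<^sup>2 = (norm (?pp r))\<^sup>2 + (norm (?pE r))\<^sup>2"
      using norm_add_Pythagorean[of "?pp r" "?pE r"] orth_proj_orth[OF fE orth_proj_in[OF fE]] by (simp add: orthogonal_def)
    then show ?thesis by (metis norm_ge_zero le_add_same_cancel2 power2_le_imp_le zero_le_power2)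
  qed
  \<comment> \<open>The map \<open>A - 1\<close> stretches by exactly \<open>m\<close> on
    \<open>E\<close> and by at most \<open>m'\<close> across it. The error consumes half of the gap
    on either side, so the two estimates meet at \<open>(m + m') / 2\<close>.\<close>
  have low: "norm (?pE (\<delta> 0)) \<ge> (m + m') / 2 * norm bE"
  proof -
    have "norm (?pE (\<delta> 0)) \<ge> norm (A bE - bE) - norm (?pE r)"
      unfolding pE\<delta> by (metis add.commute norm_diff_ineq)
    then show ?thesis using mE(7)[OF bE(1)] pEr r_le' by (simp add: field_simps)
  qed
  have high: "norm (?pp (\<delta> 0)) \<le> (m + m') / 2 * norm bE"
  proof -
    have "norm (?pp (\<delta> 0)) \<le> m' * norm bp + norm r"
      unfolding pp\<delta> using norm_triangle_ineq[of "A bp - bp" "?pp r"] mE(8)[OF bES(2) bE(2)] ppr by linarith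
    also have "m' * norm bp \<le> m' * norm bE" using bE(4) mE(1) by (rule mult_left_mono)
    finally show ?thesis using r_le' by (simp add: field_simps)
  qed
  have pos: "(m + m') / 2 * norm bE > 0" using mE(1,2) bE0 by simp
  have "?Q \<delta>"
  proof (intro conjI ballI)
    show "\<delta> 0 \<noteq> 0"
    proof
      assume "\<delta> 0 = 0"
      then have "?pE (\<delta> 0) = 0" using orth_proj_id[OF fE subspace_0[OF mE(3)]] by simp
      then show False using low pos by simp
    qed
    show "norm (?pp (\<delta> 0)) \<le> norm (?pE (\<delta> 0))" using low high by linarith
    fix v assume v: "v \<in> S"
    have "\<mu> * norm v \<le> \<kappa> * norm v" using \<mu>(2) by (simp add: mult_right_mono)
    then show "norm (lin_part \<delta> v - v) \<le> \<kappa> * norm v" using Dv[OF v] by (simp add: D_def)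
  qed
  then have "norm b \<le> norm (\<delta> 0)" using \<beta>(3)[OF \<delta>(1)] by (simp add: b_def)
  \<comment> \<open>Together with the minimality of \<beta> this gives
    \<open>norm b \<le> 5/8 * norm b\<close>.\<close>
  moreover have "norm (\<delta> 0) \<le> 1/2 * norm b + 1/8 * norm b"
  proof -
    have "norm (\<delta> 0) \<le> m * norm b + norm r"
      unfolding \<delta>0 using norm_triangle_ineq[of "A b - b" r] mE(6)[OF bS] by linarith
    moreover have "m * norm b \<le> 1/2 * norm b" using m_half by (intro mult_right_mono) auto
    moreover have "2 * \<kappa> * norm b \<le> 1/8 * norm b" using \<kappa> by (intro mult_right_mono) auto
    ultimately show ?thesis using r_le by linarith
  qed
  moreover have "norm b \<ge> 0" by simp
  ultimately have "norm b = 0" by linarith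
  then show False using \<beta>(2) by (simp add: b_def)
qed

text \<open>If the translations formed no net, one could choose \<open>f k\<close> farther from all
  translation vectors than the norms of all earlier \<open>f i 0\<close>. Two of these with close
  rotations have a quotient with small rotation, hence a translation, and its vector differs from
  \<open>f k 0\<close> by exactly \<open>f i 0\<close>.\<close>

theorem translations_cocompact:
  "\<exists>C. \<forall>x\<in>S. \<exists>\<gamma>\<in>\<Gamma>. (\<forall>v\<in>S. \<gamma> v = v + \<gamma> 0) \<and> norm (\<gamma> 0 - x) \<le> C"
proof (rule ccontr)
  define trans where "trans = (\<lambda>\<gamma>. \<forall>v\<in>S. \<gamma> v = v + \<gamma> 0)"
  assume "\<not> ?thesis"
  then have neg: "\<forall>C. \<exists>x\<in>S. \<forall>\<gamma>\<in>\<Gamma>. trans \<gamma> \<longrightarrow> norm (\<gamma> 0 - x) > C"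
    unfolding trans_def by (meson not_le)
  obtain d where d: "\<forall>x\<in>S. \<exists>\<gamma>\<in>\<Gamma>. norm (\<gamma> 0 - x) \<le> d" using cocompact by blast
  have "\<exists>\<gamma>'\<in>\<Gamma>. \<forall>\<delta>\<in>\<Gamma>. trans \<delta> \<longrightarrow> norm (\<delta> 0 - \<gamma>' 0) > C" for C
  proof -
    obtain x where x: "x \<in> S" "\<forall>\<gamma>\<in>\<Gamma>. trans \<gamma> \<longrightarrow> norm (\<gamma> 0 - x) > C + d" using neg by blast
    obtain \<gamma>' where \<gamma>': "\<gamma>' \<in> \<Gamma>" "norm (\<gamma>' 0 - x) \<le> d" using d x by blast
    have "norm (\<delta> 0 - \<gamma>' 0) > C" if "\<delta> \<in> \<Gamma>" "trans \<delta>" for \<delta>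
      using x(2) that \<gamma>'(2) norm_triangle_ineq[of "\<delta> 0 - \<gamma>' 0" "\<gamma>' 0 - x"] by fastforce
    then show ?thesis using \<gamma>' by blast
  qed
  then obtain G where G: "\<And>C. G C \<in> \<Gamma>" "\<And>C \<delta>. \<delta> \<in> \<Gamma> \<Longrightarrow> trans \<delta> \<Longrightarrow> norm (\<delta> 0 - G C 0) > C"
    by metis
  have "\<exists>f. \<forall>k::nat. f k \<in> \<Gamma> \<and> (\<forall>i<k. \<forall>\<delta>\<in>\<Gamma>. trans \<delta> \<longrightarrow> norm (\<delta> 0 - f k 0) > norm (f i 0))"
  proof (rule dependent_wellorder_choice)
    fix k :: nat and f :: "nat \<Rightarrow> 'v \<Rightarrow> 'v"
    let ?C = "Max (insert 0 ((\<lambda>i. norm (f i 0)) ` {..<k}))"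
    have "norm (\<delta> 0 - G ?C 0) > norm (f i 0)" if "i < k" "\<delta> \<in> \<Gamma>" "trans \<delta>" for i \<delta>
    proof -
      have "norm (f i 0) \<le> ?C" using that(1) by (intro Max_ge) auto
      also have "\<dots> < norm (\<delta> 0 - G ?C 0)" using G(2)[OF that(2,3)] .
      finally show ?thesis .
    qed
    then show "\<exists>r. r \<in> \<Gamma> \<and> (\<forall>i<k. \<forall>\<delta>\<in>\<Gamma>. trans \<delta> \<longrightarrow> norm (\<delta> 0 - r 0) > norm (f i 0))"
      using G(1) by blast
  qed auto
  then obtain f :: "nat \<Rightarrow> 'v \<Rightarrow> 'v" where f: "\<And>k. f k \<in> \<Gamma>"
    "\<And>i k. i < k \<Longrightarrow> (\<forall>\<delta>\<in>\<Gamma>. trans \<delta> \<longrightarrow> norm (\<delta> 0 - f k 0) > norm (f i 0))"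
    by blast
  obtain J where J: "infinite J" "\<forall>i\<in>J. \<forall>j\<in>J. \<forall>v\<in>S. norm (lin_part (f i) v - lin_part (f j) v) \<le> 1/2 * norm v"
    using lin_parts_cluster[of S f "1/2", OF fd iso[OF f(1)] half_gt_zero[OF zero_less_one]] by (elim exE conjE)
  obtain i where i: "i \<in> J" using J(1) infinite_imp_nonempty by blast
  obtain k where k: "k \<in> J" "i < k" using J(1) by (meson infinite_nat_iff_unbounded)
  obtain \<eta> where \<eta>: "\<eta> \<in> \<Gamma>" "\<forall>v\<in>S. \<eta> (f i v) = f k v" using quotient[OF f(1) f(1)] by blast
  have small: "norm (lin_part \<eta> v - v) \<le> norm v / 2" if v: "v \<in> S" for v
  proof -
    obtain w where w: "w \<in> S" "lin_part (f i) w = v" "norm w = norm v" using lin_part_surj[OF f(1) v] by blast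
    then have "lin_part \<eta> v = lin_part (f k) w" using lin_part_quotient[OF f(1) f(1) \<eta>, of w] by simp
    then show ?thesis using J(2) i k w by fastforce
  qed
  have \<eta>v: "\<eta> v = v + \<eta> 0" if "v \<in> S" for v
    using small_rotation_imp_translation[OF \<eta>(1) small that] by (simp add: lin_part_def algebra_simps)
  then have trans: "trans \<eta>" by (simp only: trans_def) blast
  have "f k 0 = f i 0 + \<eta> 0" using \<eta>(2) \<eta>v[of "f i 0"] isometry_on_in[OF sub iso[OF f(1)]] by simp
  then have "norm (\<eta> 0 - f k 0) = norm (f i 0)" by simp
  then show False using f(2)[OF k(2), rule_format, OF \<eta>(1) trans] by simp
qed

end

section \<open>Proper CAT(0) spaces\<close>

text \<open>Parametrisation by \<open>{0..1}\<close> proportionally to arclength admits constant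
  paths and makes convexity along geodesics an inequality at equal parameters.\<close>

definition affine_geod :: "(real \<Rightarrow> 'a::metric_space) \<Rightarrow> bool" where
  "affine_geod p \<longleftrightarrow> (\<forall>s\<in>{0..1}. \<forall>t\<in>{0..1}. dist (p s) (p t) = dist (p 0) (p 1) * \<bar>s - t\<bar>)"

lemma affine_geodI:
  assumes "\<And>s t. s \<in> {0..1} \<Longrightarrow> t \<in> {0..1} \<Longrightarrow> dist (p s) (p t) = k * \<bar>s - t\<bar>"
  shows "affine_geod p"
proof -
  have "dist (p 0) (p 1) = k" using assms[of 0 1] by simp
  then show ?thesis unfolding affine_geod_def using assms by (simp only:) blast
qed

lemma affine_geod_dist:
  "affine_geod p \<Longrightarrow> 0 \<le> s \<Longrightarrow> s \<le> 1 \<Longrightarrow> 0 \<le> t \<Longrightarrow> t \<le> 1 \<Longrightarrow> dist (p s) (p t) = dist (p 0) (p 1) * \<bar>s - t\<bar>"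
  unfolding affine_geod_def by (metis atLeastAtMost_iff)

lemma affine_geod_rev:
  assumes "affine_geod p"
  shows "affine_geod (\<lambda>s. p (1 - s))"
proof (rule affine_geodI[where k = "dist (p 0) (p 1)"])
  fix s t :: real assume "s \<in> {0..1}" "t \<in> {0..1}"
  then show "dist (p (1 - s)) (p (1 - t)) = dist (p 0) (p 1) * \<bar>s - t\<bar>"
    using affine_geod_dist[OF assms, of "1 - s" "1 - t"] by (simp add: abs_minus_commute)
qed

lemma affine_geod_imp_seg:
  assumes "affine_geod p" "p 0 \<noteq> p 1"
  shows "geodesic_seg (\<lambda>r. p (r / dist (p 0) (p 1))) (p 0) (p 1)"
  unfolding geodesic_seg_def
proof (intro conjI ballI)
  let ?d = "dist (p 0) (p 1)"
  have d: "?d > 0" using assms(2) by simp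
  then show "p (0 / ?d) = p 0" "p (?d / ?d) = p 1" by simp_all
  fix s t assume "s \<in> {0..?d}" "t \<in> {0..?d}"
  then have "dist (p (s / ?d)) (p (t / ?d)) = ?d * \<bar>s / ?d - t / ?d\<bar>"
    using d by (intro affine_geod_dist[OF assms(1)]) auto
  also have "\<dots> = \<bar>?d * (s / ?d - t / ?d)\<bar>" by (simp add: abs_mult)
  finally show "dist (p (s / ?d)) (p (t / ?d)) = \<bar>s - t\<bar>" using d by (simp add: right_diff_distrib)
qed

lemma seg_imp_affine_geod:
  assumes "geodesic_seg g x y"
  shows "affine_geod (\<lambda>s. g (s * dist x y))"
proof (rule affine_geodI[where k = "dist x y"])
  fix s t :: real assume "s \<in> {0..1}" "t \<in> {0..1}"
  then have "s * dist x y \<in> {0..dist x y}" "t * dist x y \<in> {0..dist x y}"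
    by (auto intro: mult_left_le_one_le)
  then have "dist (g (s * dist x y)) (g (t * dist x y)) = \<bar>s * dist x y - t * dist x y\<bar>"
    using assms by (simp add: geodesic_seg_def)
  also have "\<dots> = dist x y * \<bar>s - t\<bar>"
    by (simp add: abs_mult flip: left_diff_distrib)
  finally show "dist (g (s * dist x y)) (g (t * dist x y)) = dist x y * \<bar>s - t\<bar>" .
qed

lemma geod_rayD: "geod_ray c \<Longrightarrow> 0 \<le> s \<Longrightarrow> 0 \<le> t \<Longrightarrow> dist (c s) (c t) = \<bar>s - t\<bar>"
  by (simp add: geod_ray_def)

lemma geod_ray_affine:
  assumes "geod_ray c" "0 \<le> a" "0 \<le> b"
  shows "affine_geod (\<lambda>s. c (a + s * (b - a)))"
proof (rule affine_geodI[where k = "\<bar>b - a\<bar>"])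
  fix s t :: real assume st: "s \<in> {0..1}" "t \<in> {0..1}"
  have nn: "0 \<le> a + s * (b - a)" if "s \<in> {0..1}" for s :: real
  proof -
    have "a + s * (b - a) = (1 - s) * a + s * b" by algebra
    then show ?thesis using that assms by simp
  qed
  have "dist (c (a + s * (b - a))) (c (a + t * (b - a))) = \<bar>(a + s * (b - a)) - (a + t * (b - a))\<bar>"
    using geod_rayD[OF assms(1) nn[OF st(1)] nn[OF st(2)]] .
  also have "\<dots> = \<bar>(b - a) * (s - t)\<bar>" by (simp add: algebra_simps)
  finally show "dist (c (a + s * (b - a))) (c (a + t * (b - a))) = \<bar>b - a\<bar> * \<bar>s - t\<bar>"
    by (simp add: abs_mult)
qed

lemma comparison_triangle_exists:
  fixes d1 d2 d3 :: real
  assumes "d1 > 0" "d2 \<ge> 0" "d3 \<ge> 0" "d1 \<le> d2 + d3" "d2 \<le> d1 + d3" "d3 \<le> d1 + d2"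
  shows "\<exists>c::complex. norm c = d2 \<and> norm (of_real d1 - c) = d3 \<and> Re c * (2 * d1) = d1\<^sup>2 + d2\<^sup>2 - d3\<^sup>2"
proof -
  \<comment> \<open>The law of cosines prescribes the real part of the third vertex; the triangle
    inequalities make the remaining square nonnegative.\<close>
  define u where "u = (d1\<^sup>2 + d2\<^sup>2 - d3\<^sup>2) / (2 * d1)"
  have u: "u * (2 * d1) = d1\<^sup>2 + d2\<^sup>2 - d3\<^sup>2" using assms by (simp add: u_def)
  have "(d1 - d2)\<^sup>2 \<le> d3\<^sup>2" by (rule abs_le_square_iff[THEN iffD1]) (use assms in auto)
  moreover have "d3\<^sup>2 \<le> (d1 + d2)\<^sup>2" by (rule power_mono) (use assms in auto)
  ultimately have "\<bar>u * (2 * d1)\<bar> \<le> d2 * (2 * d1)"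
    unfolding u by (auto simp: power2_eq_square algebra_simps)
  then have "\<bar>u\<bar> \<le> d2" using assms(1) by (simp add: abs_mult)
  then have u2: "u\<^sup>2 \<le> d2\<^sup>2" by (metis abs_ge_zero power_mono power2_abs)
  define c where "c = Complex u (sqrt (d2\<^sup>2 - u\<^sup>2))"
  have "norm c = d2" using u2 assms by (simp add: c_def complex_norm)
  moreover have "norm (of_real d1 - c) = d3"
  proof -
    have "(d1 - u)\<^sup>2 + (d2\<^sup>2 - u\<^sup>2) = d3\<^sup>2" using u by (simp add: power2_eq_square algebra_simps)
    then have "norm (of_real d1 - c) = sqrt (d3\<^sup>2)"
      using u2 by (simp add: c_def cmod_def)
    then show ?thesis using assms by simp
  qed
  ultimately show ?thesis using u by (intro exI[of _ c]) (simp add: c_def)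
qed

text \<open>The index type may be uncountable, where a convergent subsequence cannot be expected. A
  cluster point of the sequence in the product still gives a finer filter along which all
  coordinates converge.\<close>

lemma tychonoff_subfilter:
  fixes c :: "nat \<Rightarrow> 'i \<Rightarrow> 'b::topological_space"
  assumes "\<And>i. compact (K i)" "\<And>k i. c k i \<in> K i"
  obtains \<Phi> l where "\<Phi> \<le> sequentially" "\<Phi> \<noteq> bot" "\<And>i. ((\<lambda>k. c k i) \<longlongrightarrow> l i) \<Phi>"
proof -
  let ?U = "{f. \<forall>i. f i \<in> K i}"
  have "compact ?U" using compact_UNIV_fun assms(1) by blast
  moreover have "filtermap c sequentially \<noteq> bot" by (simp add: filtermap_bot_iff)
  moreover have "eventually (\<lambda>f. f \<in> ?U) (filtermap c sequentially)"
    using assms(2) by (simp add: eventually_filtermap)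
  ultimately obtain l where l: "inf (nhds l) (filtermap c sequentially) \<noteq> bot"
    unfolding compact_filter by blast
  \<comment> \<open>The neighbourhoods of the cluster point are pulled back to the indices;
    nontriviality is the cluster property.\<close>
  define \<Phi> where "\<Phi> = inf sequentially (filtercomap c (nhds l))"
  have "\<Phi> \<noteq> bot"
  proof
    assume "\<Phi> = bot"
    then obtain P Q where PQ: "eventually P sequentially" "eventually Q (filtercomap c (nhds l))" "\<And>k. \<not> (P k \<and> Q k)"
      using eventually_inf[of "\<lambda>_. False" sequentially "filtercomap c (nhds l)"] by (auto simp: \<Phi>_def)
    then obtain R where R: "eventually R (nhds l)" "\<And>k. R (c k) \<Longrightarrow> Q k"
      by (auto simp: eventually_filtercomap)
    have "eventually (\<lambda>f. \<not> R f) (filtermap c sequentially)"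
      unfolding eventually_filtermap using PQ(1) by eventually_elim (use PQ(3) R(2) in blast)
    then have "eventually (\<lambda>f. False) (inf (nhds l) (filtermap c sequentially))"
      using R(1) unfolding eventually_inf by blast
    then show False using l by (simp add: trivial_limit_def[symmetric] eventually_False)
  qed
  moreover have "filterlim c (nhds l) \<Phi>"
    unfolding \<Phi>_def by (rule filterlim_mono[OF filterlim_filtercomap order_refl inf.cobounded2])
  then have "((\<lambda>k. c k i) \<longlongrightarrow> l i) \<Phi>" for i
  proof -
    have "continuous_on UNIV (\<lambda>f::'i \<Rightarrow> 'b. f i)" by (rule continuous_on_product_coordinates)
    then have "open ((\<lambda>f::'i \<Rightarrow> 'b. f i) -` V)" if "open V" for V using open_vimage[OF that] by blast
    then have "((\<lambda>f::'i \<Rightarrow> 'b. f i) \<longlongrightarrow> l i) (nhds l)"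
      unfolding tendsto_def eventually_nhds by (metis vimageD vimageI2)
    then show ?thesis using \<open>filterlim c (nhds l) \<Phi>\<close> by (rule filterlim_compose)
  qed
  moreover have "\<Phi> \<le> sequentially" by (simp add: \<Phi>_def)
  ultimately show thesis using that by blast
qed

locale hadamard =
  fixes X :: "'a::metric_space itself"
  assumes cat0: "CAT0 TYPE('a)" and loc_compact: "locally compact (UNIV::'a set)"
begin

lemma affine_geod_exists: "\<exists>p. affine_geod p \<and> p 0 = x \<and> p 1 = (y::'a)"
proof -
  obtain g where g: "geodesic_seg g x y" using cat0 unfolding CAT0_def geodesic_space_def by blast
  then show ?thesis
    by (intro exI[of _ "\<lambda>s. g (s * dist x y)"] conjI seg_imp_affine_geod) (auto simp: geodesic_seg_def)
qed

text \<open>Comparison of two points on sides issuing from a common vertex, in lengths only: the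
  last bracket is twice the Euclidean inner product of the two sides. The later distance estimates
  rest on this one inequality.\<close>

lemma hinge:
  fixes p q :: "real \<Rightarrow> 'a"
  assumes p: "affine_geod p" and q: "affine_geod q" and pq: "p 0 = q 0"
    and st: "0 \<le> s" "s \<le> 1" "0 \<le> t" "t \<le> 1"
  shows "(dist (p s) (q t))\<^sup>2 \<le> s\<^sup>2 * (dist (p 0) (p 1))\<^sup>2 + t\<^sup>2 * (dist (q 0) (q 1))\<^sup>2
    - s * t * ((dist (p 0) (p 1))\<^sup>2 + (dist (q 0) (q 1))\<^sup>2 - (dist (p 1) (q 1))\<^sup>2)"
proof -
  define d1 d2 d3 where "d1 = dist (p 0) (p 1)" and "d2 = dist (q 0) (q 1)" and "d3 = dist (p 1) (q 1)"
  \<comment> \<open>A side of length zero is treated apart, because \<open>cmp_pt\<close> divides by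
    the length.\<close>
  consider "d1 = 0" | "d2 = 0" | "d1 > 0" "d2 > 0" using zero_le_dist[of "p 0" "p 1"] zero_le_dist[of "q 0" "q 1"] unfolding d1_def d2_def by linarith
  then show ?thesis
  proof cases
    case 1
    have "dist (p s) (p 0) = 0" using affine_geod_dist[OF p st(1,2), of 0] 1 by (simp add: d1_def)
    then have "dist (p s) (q t) = d2 * t" using affine_geod_dist[OF q, of 0 t] st pq by (simp add: d2_def)
    moreover have "d3 = d2" using 1 pq by (simp add: d1_def d2_def d3_def)
    ultimately show ?thesis using 1 by (simp add: d1_def d2_def d3_def power_mult_distrib mult.commute)
  next
    case 2
    have "dist (q t) (q 0) = 0" using affine_geod_dist[OF q st(3,4), of 0] 2 by (simp add: d2_def)
    then have "dist (p s) (q t) = d1 * s" using affine_geod_dist[OF p, of s 0] st pq by (simp add: d1_def)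
    moreover have "d3 = d1" using 2 pq by (simp add: d1_def d2_def d3_def dist_commute)
    ultimately show ?thesis using 2 by (simp add: d1_def d2_def d3_def power_mult_distrib mult.commute)
  next
    case 3
    define x y z where "x = p 0" and "y = p 1" and "z = q 1"
    have d: "dist x y = d1" "dist z x = d2" "dist y z = d3"
      using pq by (auto simp: x_def y_def z_def d1_def d2_def d3_def dist_commute)
    obtain c where c: "norm c = d2" "norm (of_real d1 - c) = d3" "Re c * (2 * d1) = d1\<^sup>2 + d2\<^sup>2 - d3\<^sup>2"
      using comparison_triangle_exists[of d1 d2 d3] 3 dist_triangle[of x y z] dist_triangle[of z x y] dist_triangle[of y z x]
      by (auto simp: d dist_commute d[unfolded dist_commute[of z x]] d[unfolded dist_commute[of y z]])
    obtain g2 where g2: "geodesic_seg g2 y z" using cat0 unfolding CAT0_def geodesic_space_def by blast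
    define g1 where "g1 = (\<lambda>r. p (r / d1))"
    \<comment> \<open>The sides in \<open>CAT0\<close> run cyclically, so the second side is
      traversed towards the common vertex.\<close>
    define g3 where "g3 = (\<lambda>r. q (1 - r / d2))"
    have g1: "geodesic_seg g1 x y"
      using affine_geod_imp_seg[OF p] 3 by (auto simp: g1_def x_def y_def d1_def)
    have g3: "geodesic_seg g3 z x"
      using affine_geod_imp_seg[OF affine_geod_rev[OF q]] 3 pq by (auto simp: g3_def x_def z_def d2_def dist_commute)
    have "CAT0_ineq [(g1, x, y), (g2, y, z), (g3, z, x)] [(0, of_real d1), (of_real d1, c), (c, 0)]"
    proof -
      have "dist (0::complex) (of_real d1) = dist x y" "dist (of_real d1) c = dist y z" "dist c 0 = dist z x"
        using c 3 by (auto simp: d dist_norm)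
      then show ?thesis using cat0 g1 g2 g3 unfolding CAT0_def by blast
    qed
    then have "dist (fst ([(g1, x, y), (g2, y, z), (g3, z, x)] ! 0) (s * d1)) (fst ([(g1, x, y), (g2, y, z), (g3, z, x)] ! 2) ((1 - t) * d2))
        \<le> dist (cmp_pt 0 (of_real d1) d1 (s * d1)) (cmp_pt c 0 d2 ((1 - t) * d2))"
      unfolding CAT0_ineq_def
      apply (drule_tac spec[of _ 0], simp, drule_tac spec[of _ 2], simp)
      apply (drule_tac bspec[of _ _ "s * d1"])
      using st 3 apply (simp add: d mult_le_cancel_right1)
      apply (drule_tac bspec[of _ _ "(1 - t) * d2"])
      using st 3 apply (simp add: d mult_le_cancel_right1)
      by (simp add: d)
    moreover have "g1 (s * d1) = p s" "g3 ((1 - t) * d2) = q t" using 3 by (auto simp: g1_def g3_def)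
    moreover have "cmp_pt 0 (of_real d1) d1 (s * d1) = of_real (s * d1)" "cmp_pt c 0 d2 ((1 - t) * d2) = of_real t * c"
        using 3 by (auto simp: cmp_pt_def field_simps)
    ultimately have "dist (p s) (q t) \<le> norm (of_real (s * d1) - of_real t * c)" by (simp add: dist_norm)
    then have "(dist (p s) (q t))\<^sup>2 \<le> (norm (of_real (s * d1) - of_real t * c))\<^sup>2" by (intro power_mono) auto
    also have "\<dots> = (s * d1 - t * Re c)\<^sup>2 + (t * Im c)\<^sup>2"
      by (simp add: cmod_power2)
    also have "\<dots> = s\<^sup>2 * d1\<^sup>2 + t\<^sup>2 * (Re c ^ 2 + Im c ^ 2) - s * t * (Re c * (2 * d1))"
      by (simp add: power2_eq_square algebra_simps)
    also have "Re c ^ 2 + Im c ^ 2 = d2\<^sup>2" using c(1) by (metis cmod_power2)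
    finally show ?thesis using c(3) by (simp add: d1_def d2_def d3_def)
  qed
qed

text \<open>The Bruhat-Tits inequality is the hinge comparison with the full second side ending at
  \<open>z\<close>.\<close>

lemma CN_ineq:
  fixes z :: 'a
  assumes p: "affine_geod p" and s: "0 \<le> s" "s \<le> 1"
  shows "(dist z (p s))\<^sup>2 \<le> (1 - s) * (dist z (p 0))\<^sup>2 + s * (dist z (p 1))\<^sup>2 - s * (1 - s) * (dist (p 0) (p 1))\<^sup>2"
proof -
  obtain q where q: "affine_geod q" "q 0 = p 0" "q 1 = z" using affine_geod_exists by blast
  have "(dist (p s) (q 1))\<^sup>2 \<le> s\<^sup>2 * (dist (p 0) (p 1))\<^sup>2 + 1\<^sup>2 * (dist (q 0) (q 1))\<^sup>2
    - s * 1 * ((dist (p 0) (p 1))\<^sup>2 + (dist (q 0) (q 1))\<^sup>2 - (dist (p 1) (q 1))\<^sup>2)"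
    by (rule hinge[OF p q(1)]) (use q s in auto)
  then show ?thesis using q by (simp add: dist_commute power2_eq_square algebra_simps)
qed

lemma convex_common_start:
  fixes p q :: "real \<Rightarrow> 'a"
  assumes "affine_geod p" "affine_geod q" "p 0 = q 0" "0 \<le> s" "s \<le> 1"
  shows "dist (p s) (q s) \<le> s * dist (p 1) (q 1)"
proof -
  have "(dist (p s) (q s))\<^sup>2 \<le> (s * dist (p 1) (q 1))\<^sup>2"
    using hinge[OF assms(1-3) assms(4,5,4,5)] by (simp add: power2_eq_square algebra_simps)
  then show ?thesis by (rule power2_le_imp_le) (use assms in auto)
qed

text \<open>A diagonal cuts the quadrilateral into two triangles with a common vertex, and the two
  estimates add.\<close>

lemma dist_convex:
  fixes p q :: "real \<Rightarrow> 'a"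
  assumes p: "affine_geod p" and q: "affine_geod q" and s: "0 \<le> s" "s \<le> 1"
  shows "dist (p s) (q s) \<le> (1 - s) * dist (p 0) (q 0) + s * dist (p 1) (q 1)"
proof -
  obtain k where k: "affine_geod k" "k 0 = p 0" "k 1 = q 1" using affine_geod_exists by blast
  have "dist (p s) (k s) \<le> s * dist (p 1) (q 1)"
    using convex_common_start[OF p k(1) _ s] k by simp
  moreover have "dist (k s) (q s) \<le> (1 - s) * dist (p 0) (q 0)"
    using convex_common_start[OF affine_geod_rev[OF k(1)] affine_geod_rev[OF q], of "1 - s"] k s by simp
  ultimately show ?thesis using dist_triangle[of "p s" "q s" "k s"] by linarith
qed

lemma affine_geod_unique:
  fixes p q :: "real \<Rightarrow> 'a"
  assumes "affine_geod p" "affine_geod q" "p 0 = q 0" "p 1 = q 1" "0 \<le> s" "s \<le> 1"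
  shows "p s = q s"
  using dist_convex[OF assms(1,2,5,6)] assms(3,4) by simp

lemma ray_dist_convex:
  fixes c c' :: "real \<Rightarrow> 'a"
  assumes "geod_ray c" "geod_ray c'" "0 \<le> s" "s \<le> T" "0 < T"
  shows "dist (c s) (c' s) \<le> (1 - s / T) * dist (c 0) (c' 0) + (s / T) * dist (c T) (c' T)"
  using dist_convex[OF geod_ray_affine[OF assms(1), of 0 T] geod_ray_affine[OF assms(2), of 0 T], of "s / T"] assms(3-5)
  by simp

lemma CN_ray:
  fixes c :: "real \<Rightarrow> 'a"
  assumes "geod_ray c" "0 \<le> s" "s \<le> T" "0 < T"
  shows "(dist z (c s))\<^sup>2 \<le> (1 - s / T) * (dist z (c 0))\<^sup>2 + (s / T) * (dist z (c T))\<^sup>2 - s * (T - s)"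
proof -
  have "(dist z (c s))\<^sup>2 \<le> (1 - s / T) * (dist z (c 0))\<^sup>2 + (s / T) * (dist z (c T))\<^sup>2 - (s / T) * (1 - s / T) * T\<^sup>2"
    using CN_ineq[OF geod_ray_affine[OF assms(1), of 0 T], of "s / T" z] assms geod_rayD[OF assms(1), of 0 T]
    by simp
  also have "(s / T) * (1 - s / T) * T\<^sup>2 = s * (T - s)"
    using assms by (simp add: power2_eq_square field_simps)
  finally show ?thesis .
qed

text \<open>A bounded convex function on a half-line is nonincreasing: the far end enters with
  weight \<open>s / T\<close>, which tends to zero.\<close>

lemma bounded_rays_contract:
  fixes c c' :: "real \<Rightarrow> 'a"
  assumes c: "geod_ray c" "geod_ray c'" and B: "\<And>t. 0 \<le> t \<Longrightarrow> dist (c t) (c' t) \<le> B" and s: "0 \<le> s"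
  shows "dist (c s) (c' s) \<le> dist (c 0) (c' 0)"
proof (rule field_le_epsilon)
  fix e :: real assume e: "e > 0"
  define T where "T = max (s + 1) (s * B / e)"
  have T: "s \<le> T" "0 < T" using s by (auto simp: T_def)
  have "s * B / e \<le> T" by (simp add: T_def)
  then have T': "s * B \<le> e * T" using e by (simp add: pos_divide_le_eq mult.commute)
  have "dist (c s) (c' s) \<le> (1 - s / T) * dist (c 0) (c' 0) + (s / T) * dist (c T) (c' T)"
    using ray_dist_convex[OF c s T(1,2)] .
  also have "\<dots> \<le> 1 * dist (c 0) (c' 0) + (s / T) * B"
    using B[of T] s T by (intro add_mono mult_mono) auto
  also have "(s / T) * B \<le> e" using T T' by (simp add: pos_divide_le_eq)
  finally show "dist (c s) (c' s) \<le> dist (c 0) (c' 0) + e" by simp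
qed

lemma asymptotic_contract:
  assumes "geod_ray c" "geod_ray c'" "asymptotic c (c' :: real \<Rightarrow> 'a)" "0 \<le> s"
  shows "dist (c s) (c' s) \<le> dist (c 0) (c' 0)"
  using assms bounded_rays_contract unfolding asymptotic_def by blast

section \<open>Properness of the space and rays from arbitrary points\<close>

lemma locally_compact_cball:
  obtains e where "e > 0" "compact (cball (x::'a) e)"
proof -
  obtain u v where "x \<in> u" "u \<subseteq> v" "open u" "compact v"
    using loc_compact unfolding locally_compact by (metis UNIV_I openin_open_eq open_UNIV subtopology_UNIV open_openin)
  then obtain e where "e > 0" "cball x e \<subseteq> v" by (meson open_contains_cball subset_trans)
  then have "compact (cball x e)"
    using compact_Int_closed[OF \<open>compact v\<close> closed_cball[of x e]] by (simp add: Int_absorb1)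
  with \<open>e > 0\<close> show thesis by (rule that)
qed

lemma closer_point:
  assumes "dist x z \<le> R + d" "0 < R" "0 < d" "d < R"
  shows "\<exists>w::'a. dist x w \<le> R \<and> dist w z \<le> d"
proof (cases "dist x z \<le> R")
  case True
  then show ?thesis using assms by (intro exI[of _ z]) auto
next
  case False
  obtain p where p: "affine_geod p" "p 0 = x" "p 1 = z" using affine_geod_exists by blast
  define s where "s = R / dist x z"
  have pos: "0 < dist x z" using False assms(2) by linarith
  have s: "0 \<le> s" "s \<le> 1" using False assms pos by (auto simp: s_def pos_divide_le_eq)
  have "dist x z * s = R" using False assms by (auto simp: s_def)
  moreover have "dist x (p s) = dist x z * s" using affine_geod_dist[OF p(1), of 0 s] p s by simp
  moreover have "dist (p s) z = dist x z * (1 - s)" using affine_geod_dist[OF p(1), of s 1] p s by simp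
  ultimately show ?thesis using assms by (intro exI[of _ "p s"]) (simp add: right_diff_distrib)
qed

lemma compact_cball_mono: "compact (cball (x::'a) r) \<Longrightarrow> r' \<le> r \<Longrightarrow> compact (cball x r')"
  using compact_Int_closed[OF _ closed_cball[of x r'], of "cball x r"] by (simp add: Int_absorb1 subset_cball)

text \<open>Hopf--Rinow: the supremum of the radii of compact balls cannot be finite.\<close>
lemma compact_cball: "compact (cball (x::'a) r)"
proof (rule ccontr)
  assume r: "\<not> compact (cball x r)"
  define N where "N = {r. \<not> compact (cball x r)}"
  have rN: "r \<in> N" using r by (simp add: N_def)
  obtain e0 where e0: "e0 > 0" "compact (cball x e0)" by (rule locally_compact_cball)
  have lowN: "e0 \<le> r'" if "r' \<in> N" for r'
    using compact_cball_mono[OF e0(2), of r'] that unfolding N_def by fastforce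
  then have bdd: "bdd_below N" by (auto simp: bdd_below_def)
  define R where "R = Inf N"
  have R0: "R \<ge> e0" unfolding R_def using rN lowN by (intro cInf_greatest) auto
  have below: "compact (cball x r')" if "r' < R" for r'
    using cInf_lower[OF _ bdd, of r'] that by (force simp: N_def R_def)
  have "compact (cball x R)"
    unfolding compact_eq_totally_bounded
  proof (intro conjI allI impI)
    have "complete (UNIV::'a set)" using cat0 by (simp add: CAT0_def)
    then show "complete (cball x R)"
      using complete_Int_closed[of UNIV "cball x R"] by simp
    fix e :: real assume e: "e > 0"
    \<comment> \<open>The share of \<open>e\<close> leaves room beside the balls of radius
      \<open>e / 2\<close>, and the share of \<open>R\<close> keeps \<open>d < R - d\<close>, as
      \<open>closer_point\<close> demands.\<close>
    define d where "d = min (e / 3) (R / 3)"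
    have d: "d > 0" "d < R - d" "d \<le> e / 3" using e R0 e0 by (auto simp: d_def min_def)
    obtain k where k: "finite k" "cball x (R - d) \<subseteq> (\<Union>y\<in>k. ball y (e / 2))"
      using below[of "R - d"] d e unfolding compact_eq_totally_bounded by (auto dest!: spec[of _ "e / 2"])
    have "cball x R \<subseteq> (\<Union>y\<in>k. ball y e)"
    proof
      fix z assume "z \<in> cball x R"
      then obtain w where w: "dist x w \<le> R - d" "dist w z \<le> d"
        using closer_point[of x z "R - d" d] d by auto
      then obtain y where y: "y \<in> k" "dist y w < e / 2" using k by force
      then have "dist y z < e" using dist_triangle[of y z w] w d e by linarith
      then show "z \<in> (\<Union>y\<in>k. ball y e)" using y by auto
    qed
    then show "\<exists>k. finite k \<and> cball x R \<subseteq> (\<Union>y\<in>k. ball y e)" using k(1) by blast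
  qed
  moreover have "\<forall>y::'a. \<exists>e>0. compact (cball y e)" using locally_compact_cball by metis
  then obtain \<epsilon> where \<epsilon>: "\<And>y::'a. \<epsilon> y > 0" "\<And>y. compact (cball y (\<epsilon> y))" by metis
  moreover have "cball x R \<subseteq> (\<Union>y\<in>UNIV. ball y (\<epsilon> y / 2))"
  proof
    fix y show "y \<in> (\<Union>y\<in>UNIV. ball y (\<epsilon> y / 2))" using \<epsilon>(1)[of y] by (intro UN_I[of y]) auto
  qed
  ultimately obtain D where D: "finite D" "cball x R \<subseteq> (\<Union>y\<in>D. ball y (\<epsilon> y / 2))"
    using compactE_image[of "cball x R" UNIV "\<lambda>y. ball y (\<epsilon> y / 2)"] by (metis open_ball)
  \<comment> \<open>The balls of half radius already cover the ball of radius \<open>R\<close>. A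
    point at most \<delta> farther out stays in the compact ball of full radius, so the radius
    \<open>R\<close> can be exceeded.\<close>
  define \<delta> where "\<delta> = Min (insert (R / 2) ((\<lambda>y. \<epsilon> y / 2) ` D))"
  have \<delta>: "\<delta> > 0" "\<delta> \<le> R / 2" "\<And>y. y \<in> D \<Longrightarrow> \<delta> \<le> \<epsilon> y / 2"
    using D(1) \<epsilon>(1) R0 e0 unfolding \<delta>_def by (simp, (intro Min_le; simp)+)
  have "cball x (R + \<delta>) \<subseteq> (\<Union>y\<in>D. cball y (\<epsilon> y))"
  proof
    fix z assume "z \<in> cball x (R + \<delta>)"
    then obtain w where w: "dist x w \<le> R" "dist w z \<le> \<delta>"
      using closer_point[of x z R \<delta>] \<delta> R0 e0 by auto
    then obtain y where y: "y \<in> D" "dist y w < \<epsilon> y / 2" using D by force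
    then have "dist y z \<le> \<epsilon> y" using dist_triangle[of y z w] w \<delta>(3)[OF y(1)] by linarith
    then show "z \<in> (\<Union>y\<in>D. cball y (\<epsilon> y))" using y by auto
  qed
  moreover have "compact (\<Union>y\<in>D. cball y (\<epsilon> y))" using D(1) \<epsilon>(2) by (intro compact_UN) auto
  ultimately have "compact (cball x (R + \<delta>))"
    using compact_Int_closed[OF _ closed_cball[of x "R + \<delta>"]] by (metis Int_absorb1)
  then have "R + \<delta> \<le> r'" if "r' \<in> N" for r'
    using that compact_cball_mono[of x "R + \<delta>" r'] unfolding N_def by fastforce
  then have "R + \<delta> \<le> R" unfolding R_def using rN by (intro cInf_greatest) auto
  then show False using \<delta> by simp
qed

lemma pointwise_limit:
  fixes c :: "nat \<Rightarrow> 'i \<Rightarrow> 'a"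
  assumes "\<And>i. \<exists>x r. \<forall>k. dist x (c k i) \<le> r"
  obtains \<Phi> l where "\<Phi> \<le> sequentially" "\<Phi> \<noteq> bot" "\<And>i. ((\<lambda>k. c k i) \<longlongrightarrow> l i) \<Phi>"
proof -
  obtain x r where "\<And>i k. dist (x i) (c k i) \<le> r i" using assms by metis
  then show thesis
    using tychonoff_subfilter[of "\<lambda>i. cball (x i) (r i)" c] compact_cball that by (metis mem_cball)
qed

text \<open>The segments from \<open>z\<close> to \<open>c (real k)\<close> have pointwise limits by
  properness. Convexity keeps such a segment within \<open>d0\<close> of \<open>c\<close> at
  proportional parameters, and replacing these by arclength costs another \<open>d0\<close>.\<close>

lemma ray_from_point:
  fixes c :: "real \<Rightarrow> 'a"
  assumes c: "geod_ray c"
  obtains c' where "geod_ray c'" "c' 0 = z" "asymptotic c c'"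
proof -
  define d0 where "d0 = dist z (c 0)"
  have d00: "d0 \<ge> 0" by (simp add: d0_def)
  have "\<forall>k::nat. \<exists>p. affine_geod p \<and> p 0 = z \<and> p 1 = c (real k)" using affine_geod_exists by blast
  then obtain p where p: "\<And>k. affine_geod (p k)" "\<And>k. p k 0 = z" "\<And>k::nat. p k 1 = c (real k)"
    by (auto dest!: choice)
  define L where "L = (\<lambda>k::nat. dist z (c (real k)))"
  have L: "\<bar>L k - real k\<bar> \<le> d0" for k
    using dist_triangle[of z "c (real k)" "c 0"] dist_triangle[of "c 0" "c (real k)" z] geod_rayD[OF c, of 0 "real k"]
    by (auto simp: L_def d0_def dist_commute)
  \<comment> \<open>Segments in arclength parametrisation; outside their domain they take the value
    \<open>z\<close>, which keeps every coordinate bounded.\<close>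
  define g where "g = (\<lambda>k t. if 0 \<le> t \<and> t \<le> L k then p k (t / L k) else z)"
  have gd: "dist (g k s) (g k t) = \<bar>s - t\<bar>" if "0 \<le> s" "s \<le> L k" "0 \<le> t" "t \<le> L k" "L k > 0" for k s t
  proof -
    have "dist (g k s) (g k t) = L k * \<bar>s / L k - t / L k\<bar>"
      using affine_geod_dist[OF p(1), of "s / L k" "t / L k" k] that p by (simp add: g_def L_def)
    also have "\<dots> = \<bar>L k * (s / L k - t / L k)\<bar>" using that by (simp add: abs_mult)
    finally show ?thesis using that by (simp add: right_diff_distrib)
  qed
  have g0: "g k 0 = z" for k using p by (simp add: g_def)
  have gz: "dist z (g k t) \<le> \<bar>t\<bar>" for k t
  proof (cases "0 \<le> t \<and> t \<le> L k")
    case True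
    then show ?thesis using gd[of 0 k t] g0 by (cases "t = 0") auto
  next
    case False
    then have "g k t = z" by (auto simp: g_def)
    then show ?thesis by simp
  qed
  obtain \<Phi> l where \<Phi>: "\<Phi> \<le> sequentially" "\<Phi> \<noteq> bot" "\<And>t. ((\<lambda>k. g k t) \<longlongrightarrow> l t) \<Phi>"
    using pointwise_limit[of g] gz by blast
  have large: "eventually (\<lambda>k. T \<le> L k \<and> 0 < L k) \<Phi>" for T
  proof -
    have "eventually (\<lambda>k. real k \<ge> max T 1 + d0) sequentially"
      by (rule eventually_compose_filterlim[OF eventually_ge_at_top filterlim_real_sequentially])
    then have "eventually (\<lambda>k. real k \<ge> max T 1 + d0) \<Phi>" using \<Phi>(1) by (simp add: le_filter_def)
    then show ?thesis
    proof eventually_elim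
      case (elim k)
      then show ?case using L[of k] by (auto simp: abs_le_iff)
    qed
  qed
  have ray: "geod_ray l"
    unfolding geod_ray_def
  proof (intro allI impI)
    fix s t :: real assume st: "0 \<le> s" "0 \<le> t"
    have "((\<lambda>k. dist (g k s) (g k t)) \<longlongrightarrow> dist (l s) (l t)) \<Phi>" by (intro tendsto_intros \<Phi>)
    moreover have "eventually (\<lambda>k. dist (g k s) (g k t) = \<bar>s - t\<bar>) \<Phi>"
      using large[of s] large[of t] by eventually_elim (use gd st in auto)
    then have "((\<lambda>k. dist (g k s) (g k t)) \<longlongrightarrow> \<bar>s - t\<bar>) \<Phi>" by (rule tendsto_eventually)
    ultimately show "dist (l s) (l t) = \<bar>s - t\<bar>" using tendsto_unique[OF \<Phi>(2)] by blast
  qed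
  have "l 0 = z" using tendsto_unique[OF \<Phi>(2) \<Phi>(3)[of 0]] g0 by simp
  moreover have "dist (c t) (l t) \<le> 2 * d0" if t: "0 \<le> t" for t
  proof -
    have "((\<lambda>k. dist (c t) (g k t)) \<longlongrightarrow> dist (c t) (l t)) \<Phi>" by (intro tendsto_intros \<Phi>)
    moreover have "eventually (\<lambda>k. dist (c t) (g k t) \<le> 2 * d0) \<Phi>"
      using large[of t]
    proof eventually_elim
      case (elim k)
      define s where "s = t / L k"
      have s: "0 \<le> s" "s \<le> 1" "s * L k = t" using t elim by (auto simp: s_def)
      have "dist (p k s) (c (0 + s * (real k - 0))) \<le> (1 - s) * dist (p k 0) (c (0 + 0 * (real k - 0))) + s * dist (p k 1) (c (0 + 1 * (real k - 0)))"
        by (rule dist_convex[OF p(1) geod_ray_affine[OF c]]) (use s in auto)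
      also have "\<dots> = (1 - s) * d0" using p by (simp add: d0_def)
      also have "\<dots> \<le> d0" using s d00 by (simp add: mult_left_le_one_le)
      finally have 1: "dist (g k t) (c (s * real k)) \<le> d0" using elim t by (simp add: g_def s_def)
      have "dist (c t) (c (s * real k)) = \<bar>s * L k - s * real k\<bar>" using geod_rayD[OF c t, of "s * real k"] s by simp
      also have "\<dots> = s * \<bar>L k - real k\<bar>" 
        using s abs_mult[of s "L k - real k"] by (simp add: right_diff_distrib)
      also have "\<dots> \<le> 1 * d0" using L s by (intro mult_mono) auto
      finally show ?case using 1 dist_triangle2[of "c t" "g k t" "c (s * real k)"] by simp
    qed
    ultimately show ?thesis using tendsto_upperbound[OF _ _ \<Phi>(2)] by blast
  qed
  then have "asymptotic c l" unfolding asymptotic_def by blast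
  ultimately show thesis using that ray by blast
qed

end

section \<open>Busemann functions and ray fields along a flat\<close>

text \<open>The difference is nonincreasing in the time, so the infimum is the usual limit, and
  every single time already gives an upper bound.\<close>

definition busemann :: "(real \<Rightarrow> 'a::metric_space) \<Rightarrow> 'a \<Rightarrow> real" where
  "busemann c z = (INF t\<in>{0..}. dist z (c t) - t)"

context hadamard
begin

lemma dist_ray_ge:
  assumes "geod_ray (c :: real \<Rightarrow> 'a)" "0 \<le> t"
  shows "- dist z (c 0) \<le> dist z (c t) - t" "dist z (c t) - t \<le> dist z (c 0)"
  using dist_triangle[of "c 0" "c t" z] dist_triangle[of z "c t" "c 0"] geod_rayD[OF assms(1), of 0 t] assms(2)
  by (auto simp: dist_commute)

lemma busemann_bdd:
  assumes "geod_ray (c :: real \<Rightarrow> 'a)"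
  shows "bdd_below ((\<lambda>t. dist z (c t) - t) ` {0..})"
  using dist_ray_ge(1)[OF assms] by (intro bdd_belowI2[where m = "- dist z (c 0)"]) auto

lemma busemann_le:
  assumes "geod_ray (c :: real \<Rightarrow> 'a)" "0 \<le> t"
  shows "busemann c z \<le> dist z (c t) - t"
  unfolding busemann_def using busemann_bdd[OF assms(1)] assms(2) by (intro cINF_lower) auto

lemma busemann_ge:
  assumes "\<And>t. 0 \<le> t \<Longrightarrow> m \<le> dist z (c t) - t"
  shows "m \<le> busemann (c :: real \<Rightarrow> 'a) z"
  unfolding busemann_def using assms by (intro cINF_greatest) auto

lemma dist_ray_antimono:
  assumes "geod_ray (c :: real \<Rightarrow> 'a)" "0 \<le> s" "s \<le> t"
  shows "dist z (c t) - t \<le> dist z (c s) - s"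
  using dist_triangle[of z "c t" "c s"] geod_rayD[OF assms(1), of s t] assms by (simp add: dist_commute)

lemma busemann_tendsto:
  assumes c: "geod_ray (c :: real \<Rightarrow> 'a)"
  shows "((\<lambda>t. dist z (c t) - t) \<longlongrightarrow> busemann c z) at_top"
proof (rule order_tendstoI)
  fix a assume "a < busemann c z"
  then show "eventually (\<lambda>t. a < dist z (c t) - t) at_top"
    by (intro eventually_mono[OF eventually_ge_at_top[of 0]]) (use busemann_le[OF c, of _ z] in \<open>auto intro: less_le_trans\<close>)
next
  fix a assume "busemann c z < a"
  then obtain s where s: "0 \<le> s" "dist z (c s) - s < a"
    unfolding busemann_def by (subst (asm) cINF_less_iff[OF _ busemann_bdd[OF c]]) auto
  show "eventually (\<lambda>t. dist z (c t) - t < a) at_top"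
    using eventually_ge_at_top[of s] by eventually_elim (use dist_ray_antimono[OF c s(1)] s(2) in \<open>auto intro: le_less_trans\<close>)
qed

lemma busemann_lipschitz:
  assumes "geod_ray (c :: real \<Rightarrow> 'a)"
  shows "busemann c z \<le> busemann c w + dist z w"
proof -
  have "busemann c z - dist z w \<le> busemann c w"
  proof (rule busemann_ge)
    fix t :: real assume "0 \<le> t"
    then show "busemann c z - dist z w \<le> dist w (c t) - t"
      using busemann_le[OF assms, of t z] dist_triangle[of z "c t" w] by linarith
  qed
  then show ?thesis by simp
qed

lemma busemann_on_ray:
  assumes "geod_ray (c :: real \<Rightarrow> 'a)" "0 \<le> t"
  shows "busemann c (c t) = - t"
proof (rule antisym)
  show "busemann c (c t) \<le> - t" using busemann_le[OF assms] by (metis dist_self diff_0)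
  show "- t \<le> busemann c (c t)"
    using geod_rayD[OF assms(1,2)] by (intro busemann_ge) (auto simp: abs_if)
qed

text \<open>The Bruhat-Tits inequality on the piece of the ray up to \<open>T\<close>, with
  \<open>T\<close> tending to infinity. It is a law of cosines in which the Busemann function
  replaces the cosine term.\<close>

lemma dist_ray_busemann:
  assumes c: "geod_ray (c :: real \<Rightarrow> 'a)" and t: "0 \<le> t"
  shows "(dist z (c t))\<^sup>2 \<le> (dist z (c 0))\<^sup>2 + t\<^sup>2 + 2 * t * busemann c z"
proof -
  have "((\<lambda>T. (dist z (c 0))\<^sup>2 + t\<^sup>2 + 2 * t * (dist z (c T) - T)) \<longlongrightarrow> (dist z (c 0))\<^sup>2 + t\<^sup>2 + 2 * t * busemann c z) at_top"
    by (intro tendsto_intros busemann_tendsto c)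
  moreover have "eventually (\<lambda>T. (dist z (c t))\<^sup>2 \<le> (dist z (c 0))\<^sup>2 + t\<^sup>2 + 2 * t * (dist z (c T) - T)) at_top"
    using eventually_ge_at_top[of "max t 1"]
  proof eventually_elim
    case (elim T)
    then have T: "t \<le> T" "0 < T" by auto
    define \<beta> where "\<beta> = dist z (c T) - T"
    have "\<bar>\<beta>\<bar> \<le> dist z (c 0)" using dist_ray_ge[OF c, of T z] T by (auto simp: \<beta>_def)
    then have \<beta>: "\<beta>\<^sup>2 \<le> (dist z (c 0))\<^sup>2" by (metis abs_le_square_iff abs_of_nonneg zero_le_dist)
    have "(dist z (c t))\<^sup>2 \<le> (1 - t / T) * (dist z (c 0))\<^sup>2 + (t / T) * (T + \<beta>)\<^sup>2 - t * (T - t)"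
      using CN_ray[OF c t T(1,2), of z] by (simp add: \<beta>_def)
    also have "(t / T) * (T + \<beta>)\<^sup>2 = t * T + 2 * t * \<beta> + (t / T) * \<beta>\<^sup>2"
      using T by (simp add: power2_eq_square field_simps)
    also have "(t / T) * \<beta>\<^sup>2 \<le> (t / T) * (dist z (c 0))\<^sup>2" using \<beta> t T by (intro mult_left_mono) auto
    finally show ?case by (simp add: \<beta>_def power2_eq_square algebra_simps)
  qed
  ultimately show ?thesis using tendsto_lowerbound[OF _ _ trivial_limit_at_top_linorder] by blast
qed

text \<open>A rate for the defining limit that depends on the distance bound alone. It allows
  Busemann functions to pass to pointwise limits of rays.\<close>

lemma busemann_uniform:
  assumes c: "geod_ray (c :: real \<Rightarrow> 'a)" and D: "dist z (c 0) \<le> D" and t: "D < t"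
  shows "dist z (c t) - t \<le> busemann c z + D\<^sup>2 / (t - D)"
proof -
  define \<beta> where "\<beta> = busemann c z"
  have D0: "0 \<le> D" using D zero_le_dist[of z "c 0"] by linarith
  have t0: "0 \<le> t" using D0 t by simp
  have "- D \<le> \<beta>" unfolding \<beta>_def using dist_ray_ge(1)[OF c, of _ z] D by (intro busemann_ge) force
  then have p: "0 < t - D" "t - D \<le> t + \<beta>" using t by auto
  have "(dist z (c 0))\<^sup>2 \<le> D\<^sup>2" using D by (intro power_mono) auto
  then have "(dist z (c t))\<^sup>2 \<le> D\<^sup>2 + t\<^sup>2 + 2 * t * \<beta>"
    using dist_ray_busemann[OF c t0, of z] by (simp add: \<beta>_def)
  also have "\<dots> \<le> (t + \<beta>)\<^sup>2 + 2 * D\<^sup>2 * ((t + \<beta>) / (t - D))"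
  proof -
    have "D\<^sup>2 * 1 \<le> D\<^sup>2 * ((t + \<beta>) / (t - D))" using p by (intro mult_left_mono) (auto simp: pos_le_divide_eq)
    moreover have "0 \<le> D\<^sup>2" "0 \<le> \<beta>\<^sup>2" by simp_all
    moreover have "(t + \<beta>)\<^sup>2 = t\<^sup>2 + \<beta>\<^sup>2 + 2 * t * \<beta>" by (rule power2_sum)
    ultimately show ?thesis by linarith
  qed
  also have "\<dots> \<le> (t + \<beta> + D\<^sup>2 / (t - D))\<^sup>2"
  proof -
    define q where "q = D\<^sup>2 / (t - D)"
    have "2 * D\<^sup>2 * ((t + \<beta>) / (t - D)) = 2 * (t + \<beta>) * q" by (simp add: q_def)
    moreover have "(t + \<beta> + q)\<^sup>2 = (t + \<beta>)\<^sup>2 + q\<^sup>2 + 2 * (t + \<beta>) * q" by (rule power2_sum)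
    ultimately show ?thesis unfolding q_def[symmetric] by simp
  qed
  finally have "dist z (c t) \<le> t + \<beta> + D\<^sup>2 / (t - D)"
    by (rule power2_le_imp_le) (use p in auto)
  then show ?thesis by (simp add: \<beta>_def)
qed

lemma busemann_convex:
  assumes c: "geod_ray (c :: real \<Rightarrow> 'a)" and p: "affine_geod p" and s: "0 \<le> s" "s \<le> 1"
  shows "busemann c (p s) \<le> (1 - s) * busemann c (p 0) + s * busemann c (p 1)"
proof -
  have "((\<lambda>t. (1 - s) * (dist (p 0) (c t) - t) + s * (dist (p 1) (c t) - t)) \<longlongrightarrow> (1 - s) * busemann c (p 0) + s * busemann c (p 1)) at_top"
    by (intro tendsto_intros busemann_tendsto c)
  moreover have "eventually (\<lambda>t. busemann c (p s) \<le> (1 - s) * (dist (p 0) (c t) - t) + s * (dist (p 1) (c t) - t)) at_top"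
    using eventually_ge_at_top[of 0]
  proof eventually_elim
    case (elim t)
    have "affine_geod (\<lambda>_. c t)" by (rule affine_geodI[where k = 0]) auto
    then have "dist (p s) (c t) \<le> (1 - s) * dist (p 0) (c t) + s * dist (p 1) (c t)"
      using dist_convex[OF p _ s] by blast
    then show ?case using busemann_le[OF c elim, of "p s"] by (simp add: algebra_simps)
  qed
  ultimately show ?thesis using tendsto_lowerbound[OF _ _ trivial_limit_at_top_linorder] by blast
qed

text \<open>The Lipschitz bound gives one inequality. For the other, \<open>c'\<close> is viewed
  from the distant point \<open>c s\<close>: its end \<open>c' s\<close> lies within
  \<open>K\<close>, so the Bruhat-Tits bound for the squared distance to \<open>c' t\<close> differs
  from \<open>(s - t + b)\<^sup>2\<close> by a bounded amount.\<close>

lemma busemann_asymptotic_ray: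
  assumes c: "geod_ray c" "geod_ray (c' :: real \<Rightarrow> 'a)" and K: "\<And>t. 0 \<le> t \<Longrightarrow> dist (c t) (c' t) \<le> K" and t: "0 \<le> t"
  shows "busemann c (c' t) = busemann c (c' 0) - t"
proof (rule antisym)
  show "busemann c (c' 0) - t \<le> busemann c (c' t)"
    using busemann_lipschitz[OF c(1), of "c' 0" "c' t"] geod_rayD[OF c(2), of 0 t] t by simp
  show "busemann c (c' t) \<le> busemann c (c' 0) - t"
  proof (rule field_le_epsilon)
    fix e :: real assume e: "e > 0"
    define b where "b = busemann c (c' 0) + e / 2"
    have "eventually (\<lambda>s. dist (c' 0) (c s) - s < b) at_top"
      using busemann_tendsto[OF c(1), of "c' 0"] e by (intro order_tendstoD) (auto simp: b_def)
    then have "eventually (\<lambda>s. dist (c' 0) (c s) - s < b \<and> s \<ge> max 1 (max t (t - b + t * K\<^sup>2 / e))) at_top"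
      using eventually_ge_at_top by (rule eventually_conj)
    then have "\<exists>s. dist (c' 0) (c s) - s < b \<and> s \<ge> max 1 (max t (t - b + t * K\<^sup>2 / e))"
      by (rule eventually_happens'[OF trivial_limit_at_top_linorder])
    then obtain s where s: "dist (c' 0) (c s) - s < b" "1 \<le> s" "t \<le> s" "t - b + t * K\<^sup>2 / e \<le> s"
      by auto
    have K0: "dist (c s) (c' s) \<le> K" using K s by simp
    have "(dist (c s) (c' t))\<^sup>2 \<le> (1 - t / s) * (dist (c s) (c' 0))\<^sup>2 + (t / s) * (dist (c s) (c' s))\<^sup>2 - t * (s - t)"
      using CN_ray[OF c(2) t s(3), of "c s"] s by simp
    also have "\<dots> \<le> (1 - t / s) * (s + b)\<^sup>2 + (t / s) * K\<^sup>2 - t * (s - t)"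
      using s t K0 by (intro diff_right_mono add_mono mult_left_mono power_mono) (auto simp: dist_commute)
    also have "\<dots> = (s - t + b)\<^sup>2 - (t / s) * b\<^sup>2 + (t / s) * K\<^sup>2"
      using s by (simp add: power2_eq_square field_simps)
    also have "\<dots> \<le> (s - t + b)\<^sup>2 + t * K\<^sup>2"
    proof -
      have "(t / s) * K\<^sup>2 \<le> t * K\<^sup>2" using s t by (intro mult_right_mono) (auto simp: divide_le_eq mult_le_cancel_left1)
      moreover have "(t / s) * b\<^sup>2 \<ge> 0" using s t by simp
      ultimately show ?thesis by linarith
    qed
    also have "\<dots> \<le> (s - t + b + e / 2)\<^sup>2"
    proof -
      have "t * K\<^sup>2 / e \<le> s - t + b" using s(4) by simp
      then have "t * K\<^sup>2 \<le> e * (s - t + b)" using e by (simp add: pos_divide_le_eq mult.commute)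
      moreover have "(s - t + b + e / 2)\<^sup>2 = (s - t + b)\<^sup>2 + e * (s - t + b) + (e / 2)\<^sup>2"
        by (simp add: power2_eq_square field_simps)
      moreover have "0 \<le> (e / 2)\<^sup>2" by simp
      ultimately show ?thesis by linarith
    qed
    finally have "dist (c s) (c' t) \<le> s - t + b + e / 2"
    proof (rule power2_le_imp_le)
      have "0 \<le> t * K\<^sup>2 / e" using t e by simp
      then show "0 \<le> s - t + b + e / 2" using s(4) e by linarith
    qed
    then show "busemann c (c' t) \<le> busemann c (c' 0) - t + e"
      using busemann_le[OF c(1), of s "c' t"] s by (simp add: b_def dist_commute)
  qed
qed

lemma weak_quadrilateral:
  fixes x y z w :: 'a
  shows "(dist x z)\<^sup>2 + (dist y w)\<^sup>2 \<le> (dist x y)\<^sup>2 + (dist y z)\<^sup>2 + (dist z w)\<^sup>2 + (dist w x)\<^sup>2"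
proof -
  obtain p where p: "affine_geod p" "p 0 = x" "p 1 = z" using affine_geod_exists by blast
  have y: "(dist y (p (1/2)))\<^sup>2 \<le> (dist y x)\<^sup>2 / 2 + (dist y z)\<^sup>2 / 2 - (dist x z)\<^sup>2 / 4"
    and w: "(dist w (p (1/2)))\<^sup>2 \<le> (dist w x)\<^sup>2 / 2 + (dist w z)\<^sup>2 / 2 - (dist x z)\<^sup>2 / 4"
    using CN_ineq[OF p(1), of "1/2" y] CN_ineq[OF p(1), of "1/2" w] p by auto
  have "(dist y w)\<^sup>2 \<le> (dist y (p (1/2)) + dist w (p (1/2)))\<^sup>2"
    by (intro power_mono dist_triangle2) auto
  also have "\<dots> \<le> 2 * (dist y (p (1/2)))\<^sup>2 + 2 * (dist w (p (1/2)))\<^sup>2"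
    using sum_squares_bound[of "dist y (p (1/2))" "dist w (p (1/2))"] by (simp add: power2_sum)
  finally show ?thesis using y w by (simp add: dist_commute)
qed

text \<open>One inequality holds because the Busemann function falls at unit speed along
  \<open>c'\<close> and is Lipschitz. Exchanging the rays gives the other up to
  \<open>\<beta> + \<beta>'\<close>. A positive sum would make the diagonals of the quadrilateral
  \<open>c 0\<close>, \<open>c s\<close>, \<open>c' s\<close>, \<open>c' 0\<close> too long for its
  sides.\<close>

lemma busemann_base_change:
  assumes c: "geod_ray c" "geod_ray (c' :: real \<Rightarrow> 'a)" and K: "\<And>t. 0 \<le> t \<Longrightarrow> dist (c t) (c' t) \<le> K"
  shows "busemann c' z = busemann c z - busemann c (c' 0)"
proof -
  have le: "busemann d z - busemann d (d' 0) \<le> busemann d' z"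
    if "geod_ray d" "geod_ray d'" "\<And>t. 0 \<le> t \<Longrightarrow> dist (d t) (d' t) \<le> K" for d d' :: "real \<Rightarrow> 'a" and z
  proof (rule busemann_ge)
    fix s :: real assume s: "0 \<le> s"
    show "busemann d z - busemann d (d' 0) \<le> dist z (d' s) - s"
      using busemann_lipschitz[OF that(1), of z "d' s"] busemann_asymptotic_ray[OF that s] by simp
  qed
  define \<beta> \<beta>' where "\<beta> = busemann c (c' 0)" and "\<beta>' = busemann c' (c 0)"
  have "\<beta> + \<beta>' \<le> 0"
  proof (rule ccontr)
    assume pos: "\<not> \<beta> + \<beta>' \<le> 0"
    define Q where "Q = (dist (c 0) (c' 0))\<^sup>2 + K\<^sup>2"
    \<comment> \<open>Large enough that both diagonals are at least \<open>s + \<beta>\<close> and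
      \<open>s + \<beta>'\<close> with nonnegative values, and that
      \<open>s * (\<beta> + \<beta>')\<close> exceeds the bounded sides \<open>Q\<close>.\<close>
    define s where "s = \<bar>\<beta>\<bar> + \<bar>\<beta>'\<bar> + Q / (\<beta> + \<beta>') + 1"
    have Q: "0 \<le> Q / (\<beta> + \<beta>')" using pos by (auto simp: Q_def)
    then have s: "0 \<le> s" "0 \<le> s + \<beta>" "0 \<le> s + \<beta>'" "Q / (\<beta> + \<beta>') < s" by (auto simp: s_def)
    have "(s + \<beta>)\<^sup>2 \<le> (dist (c' 0) (c s))\<^sup>2" "(s + \<beta>')\<^sup>2 \<le> (dist (c 0) (c' s))\<^sup>2"
      using busemann_le[OF c(1) s(1), of "c' 0"] busemann_le[OF c(2) s(1), of "c 0"] s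
      by (auto intro!: power_mono simp: \<beta>_def \<beta>'_def)
    moreover have "(dist (c s) (c' s))\<^sup>2 \<le> K\<^sup>2" using K[OF s(1)] by (intro power_mono) auto
    ultimately have "(s + \<beta>)\<^sup>2 + (s + \<beta>')\<^sup>2 \<le> Q + 2 * s\<^sup>2"
      using weak_quadrilateral[of "c' 0" "c s" "c 0" "c' s"] geod_rayD[OF c(1) s(1), of 0] geod_rayD[OF c(2), of 0 s] s(1)
      by (simp add: Q_def dist_commute)
    then have "2 * (s * (\<beta> + \<beta>')) + (\<beta>\<^sup>2 + \<beta>'\<^sup>2) \<le> Q" by (simp add: power2_eq_square algebra_simps)
    moreover have "Q < s * (\<beta> + \<beta>')" using s(4) pos by (simp add: pos_divide_less_eq)
    moreover have "0 \<le> \<beta>\<^sup>2 + \<beta>'\<^sup>2" by simp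
    moreover have "0 \<le> Q" by (simp add: Q_def)
    ultimately show False by linarith
  qed
  moreover have "busemann c' z - \<beta>' \<le> busemann c z"
    unfolding \<beta>'_def by (rule le[OF c(2,1)]) (use K in \<open>simp add: dist_commute\<close>)
  ultimately show ?thesis using le[OF c K, of z] by (simp add: \<beta>_def)
qed

end

section \<open>Fields of rays issuing from the flat\<close>

definition flat_translation :: "'v::real_inner set \<Rightarrow> ('v \<Rightarrow> 'a::metric_space) \<Rightarrow> ('a \<Rightarrow> 'a) \<Rightarrow> 'v \<Rightarrow> bool" where
  "flat_translation S \<iota> g l \<longleftrightarrow> l \<in> S \<and> (\<forall>x y. dist (g x) (g y) = dist x y) \<and> (\<forall>v\<in>S. g (\<iota> v) = \<iota> (v + l))"

text \<open>The flat is the image of a Euclidean space \<open>S\<close> under coordinates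
  \<open>\<iota>\<close>. Periodicity appears in the sharpened form that isometries translating the
  flat have translation vectors forming a net in \<open>S\<close>.\<close>

locale morse_flat_space = hadamard X for X :: "'a::metric_space itself" +
  fixes S :: "'v::real_inner set" and \<iota> :: "'v \<Rightarrow> 'a" and C0 :: real
  assumes fd: "fin_dim S"
    and isometric: "v \<in> S \<Longrightarrow> w \<in> S \<Longrightarrow> dist (\<iota> v) (\<iota> w) = norm (v - w)"
    and lattice: "x \<in> S \<Longrightarrow> \<exists>g l. flat_translation S \<iota> g l \<and> norm (l - x) \<le> C0"
    and morse: "\<not> (\<exists>H. flat_half_space H (\<iota> ` S))"
begin

lemma subS: "subspace S" using fd fin_dim_imp_subspace by blast

lemmas S_closed [simp] = subspace_0[OF subS] subspace_add[OF subS] subspace_diff[OF subS]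
  subspace_scale[OF subS] subspace_neg[OF subS]

text \<open>A ray field represents a boundary point by the rays issuing from the points of the flat;
  the parameter \<open>y\<close> records how its base map is shifted against \<open>\<iota>\<close>.\<close>
definition ray_field :: "'v \<Rightarrow> ('v \<Rightarrow> real \<Rightarrow> 'a) \<Rightarrow> bool" where
  "ray_field y E \<longleftrightarrow> y \<in> S \<and> (\<forall>v\<in>S. geod_ray (E v) \<and> E v 0 = \<iota> (v + y)) \<and>
     (\<forall>v\<in>S. \<forall>w\<in>S. \<forall>t\<ge>0. dist (E v t) (E w t) \<le> norm (v - w))"

text \<open>This is \<open>b\<close> of the overview in the parameters of the field, normalised to
  vanish at the parameter \<open>0\<close>, that is at the point \<open>\<iota> y\<close>.\<close>

definition bus :: "('v \<Rightarrow> real \<Rightarrow> 'a) \<Rightarrow> 'v \<Rightarrow> real" where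
  "bus E v = busemann (E 0) (E v 0)"

context
  fixes y E assumes E: "ray_field y E"
begin

lemma rf_y: "y \<in> S" and rf_ray: "v \<in> S \<Longrightarrow> geod_ray (E v)" and rf_0: "v \<in> S \<Longrightarrow> E v 0 = \<iota> (v + y)"
  and rf_contract: "v \<in> S \<Longrightarrow> w \<in> S \<Longrightarrow> 0 \<le> t \<Longrightarrow> dist (E v t) (E w t) \<le> norm (v - w)"
  using E by (auto simp: ray_field_def)

lemma rf_base_dist: "v \<in> S \<Longrightarrow> w \<in> S \<Longrightarrow> dist (E v 0) (E w 0) = norm (v - w)"
  using rf_0 rf_y isometric by simp

lemma rf_line_affine: "v \<in> S \<Longrightarrow> w \<in> S \<Longrightarrow> affine_geod (\<lambda>s. E (v + s *\<^sub>R w) 0)"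
proof (rule affine_geodI[where k = "norm w"])
  fix s t :: real assume "v \<in> S" "w \<in> S"
  then have "dist (E (v + s *\<^sub>R w) 0) (E (v + t *\<^sub>R w) 0) = norm ((s - t) *\<^sub>R w)"
    using rf_base_dist[of "v + s *\<^sub>R w" "v + t *\<^sub>R w"] by (simp add: scaleR_diff_left)
  then show "dist (E (v + s *\<^sub>R w) 0) (E (v + t *\<^sub>R w) 0) = norm w * \<bar>s - t\<bar>" by (simp add: mult.commute)
qed

lemma busemann_field: "v \<in> S \<Longrightarrow> busemann (E v) z = busemann (E 0) z - bus E v"
  unfolding bus_def using rf_contract[of 0 v] by (intro busemann_base_change[where K = "norm v"] rf_ray) auto

lemma busemann_field_base: "v \<in> S \<Longrightarrow> w \<in> S \<Longrightarrow> busemann (E v) (E w 0) = bus E w - bus E v"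
  using busemann_field[of v "E w 0"] by (simp add: bus_def[of E w])

lemma busemann_field_ray: "v \<in> S \<Longrightarrow> 0 \<le> t \<Longrightarrow> busemann (E 0) (E v t) = bus E v - t"
  unfolding bus_def using rf_contract[of 0 v] by (intro busemann_asymptotic_ray[where K = "norm v"] rf_ray) auto

lemma bus_0: "bus E 0 = 0"
  unfolding bus_def using busemann_on_ray[OF rf_ray, of 0 0] by simp

lemma bus_lipschitz: "v \<in> S \<Longrightarrow> w \<in> S \<Longrightarrow> bus E v \<le> bus E w + norm (v - w)"
  unfolding bus_def using busemann_lipschitz[OF rf_ray[of 0], of "E v 0" "E w 0"] rf_base_dist[of v w] by simp

lemma bus_convex:
  assumes "v \<in> S" "w \<in> S" "0 \<le> s" "s \<le> 1"
  shows "bus E ((1 - s) *\<^sub>R v + s *\<^sub>R w) \<le> (1 - s) * bus E v + s * bus E w"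
proof -
  have eq: "(1 - s) *\<^sub>R v + s *\<^sub>R w = v + s *\<^sub>R (w - v)" by (simp add: algebra_simps)
  show ?thesis
    unfolding eq using busemann_convex[OF rf_ray[of 0] rf_line_affine[of v "w - v"], of s] assms
    by (simp add: bus_def)
qed

lemma dist_base_ray:
  "v \<in> S \<Longrightarrow> w \<in> S \<Longrightarrow> 0 \<le> t \<Longrightarrow> (dist (E w 0) (E v t))\<^sup>2 \<le> (norm (w - v))\<^sup>2 + t\<^sup>2 + 2 * t * (bus E w - bus E v)"
  using dist_ray_busemann[OF rf_ray[of v], of t "E w 0"] busemann_field_base[of v w] rf_base_dist[of w v] by simp

lemma bus_le_dist:
  "v \<in> S \<Longrightarrow> w \<in> S \<Longrightarrow> 0 \<le> t \<Longrightarrow> bus E w - bus E v + t \<le> dist (E w 0) (E v t)"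
  using busemann_lipschitz[OF rf_ray[of 0], of "E w 0" "E v t"] busemann_field_ray[of v t] by (simp add: bus_def)

context
  fixes v w a
  assumes v: "v \<in> S" and w: "w \<in> S" and aff: "\<And>T. bus E (v + T *\<^sub>R w) = bus E v + T * a"
begin

lemma line_in: "v + T *\<^sub>R w \<in> S" using v w by simp

text \<open>Comparison bounds the distances from \<open>E ?p t\<close> to the points at
  \<open>r\<close> and \<open>-r\<close> from above, with opposite linear terms. The Bruhat-Tits
  inequality at their midpoint bounds the sum of squares from below by the same amount, so both
  bounds are equalities.\<close>

lemma flat_line_base: 
  assumes "0 \<le> t"
  shows "(dist (E (v + T *\<^sub>R w) 0) (E (v + U *\<^sub>R w) t))\<^sup>2 = (T - U)\<^sup>2 * (norm w)\<^sup>2 + t\<^sup>2 + 2 * t * a * (T - U)"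
proof -
  let ?p = "v + U *\<^sub>R w"
  have up: "(dist (E (?p + r *\<^sub>R w) 0) (E ?p t))\<^sup>2 \<le> r\<^sup>2 * (norm w)\<^sup>2 + t\<^sup>2 + 2 * t * a * r" for r
  proof -
    have "bus E (?p + r *\<^sub>R w) - bus E ?p = r * a"
      using aff[of "U + r"] aff[of U] by (simp add: algebra_simps)
    then show ?thesis
      using dist_base_ray[of ?p "?p + r *\<^sub>R w" t] assms v w by (simp add: power_mult_distrib mult.assoc mult.commute[of r a])
  qed
  define r where "r = T - U"
  have m: "?p - r *\<^sub>R w + (1/2) *\<^sub>R ((2 * r) *\<^sub>R w) = ?p" "?p - r *\<^sub>R w + 1 *\<^sub>R ((2 * r) *\<^sub>R w) = ?p + r *\<^sub>R w"
    by (simp_all add: algebra_simps flip: scaleR_add_left)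
  have "(dist (E ?p t) (E ?p 0))\<^sup>2 \<le> (1 - 1/2) * (dist (E ?p t) (E (?p - r *\<^sub>R w) 0))\<^sup>2 + (1/2) * (dist (E ?p t) (E (?p + r *\<^sub>R w) 0))\<^sup>2
     - (1/2) * (1 - 1/2) * (dist (E (?p - r *\<^sub>R w) 0) (E (?p + r *\<^sub>R w) 0))\<^sup>2"
    using CN_ineq[OF rf_line_affine[of "?p - r *\<^sub>R w" "(2 * r) *\<^sub>R w"], of "1/2" "E ?p t"] v w
    unfolding m by simp
  moreover have "dist (E (?p - r *\<^sub>R w) 0) (E (?p + r *\<^sub>R w) 0) = norm ((2 * r) *\<^sub>R w)"
  proof -
    have "(?p + r *\<^sub>R w) - (?p - r *\<^sub>R w) = r *\<^sub>R w + r *\<^sub>R w" by simp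
    also have "\<dots> = (2 * r) *\<^sub>R w" by (simp only: mult_2 scaleR_left_distrib)
    finally have "(?p + r *\<^sub>R w) - (?p - r *\<^sub>R w) = (2 * r) *\<^sub>R w" .
    then show ?thesis
      using rf_base_dist[of "?p + r *\<^sub>R w" "?p - r *\<^sub>R w"] v w by (simp add: dist_commute)
  qed
  moreover have "dist (E ?p t) (E ?p 0) = t" using geod_rayD[OF rf_ray[OF line_in], of t 0] assms by simp
  ultimately have "t\<^sup>2 + r\<^sup>2 * (norm w)\<^sup>2 \<le> (dist (E ?p t) (E (?p - r *\<^sub>R w) 0))\<^sup>2 / 2 + (dist (E ?p t) (E (?p + r *\<^sub>R w) 0))\<^sup>2 / 2"
    by (simp add: power_mult_distrib)
  then have "(dist (E (?p + r *\<^sub>R w) 0) (E ?p t))\<^sup>2 = r\<^sup>2 * (norm w)\<^sup>2 + t\<^sup>2 + 2 * t * a * r"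
    using up[of r] up[of "-r"] by (simp add: dist_commute)
  then show ?thesis by (simp add: r_def algebra_simps)
qed

lemma flat_line_upper:
  assumes "0 \<le> t" "0 \<le> t'"
  shows "(dist (E (v + T *\<^sub>R w) t') (E (v + U *\<^sub>R w) t))\<^sup>2 \<le> (T - U)\<^sup>2 * (norm w)\<^sup>2 + (t - t')\<^sup>2 + 2 * a * (T - U) * (t - t')"
proof -
  let ?p = "v + T *\<^sub>R w" and ?z = "E (v + U *\<^sub>R w) t"
  have beq: "busemann (E ?p) ?z = - t - a * (T - U)"
    using busemann_field[OF line_in[of T], of ?z] busemann_field_ray[OF line_in[of U] assms(1)] aff[of T] aff[of U]
    by (simp add: algebra_simps)
  show ?thesis
    using dist_ray_busemann[OF rf_ray[OF line_in[of T]] assms(2), of ?z]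
    unfolding beq dist_commute[of ?z] flat_line_base[OF assms(1), of T U]
    by (simp add: power2_eq_square algebra_simps)
qed

lemma flat_line_lower:
  assumes t: "0 \<le> t" "t < t'"
  shows "(T - U)\<^sup>2 * (norm w)\<^sup>2 + (t - t')\<^sup>2 + 2 * a * (T - U) * (t - t') \<le> (dist (E (v + T *\<^sub>R w) t') (E (v + U *\<^sub>R w) t))\<^sup>2"
proof -
  define k where "k = t / t'"
  have k: "0 \<le> k" "k < 1" "k * t' = t" using t by (auto simp: k_def)
  \<comment> \<open>In the Euclidean model the points over \<open>R\<close>, \<open>U\<close>,
    \<open>T\<close> at heights \<open>0\<close>, \<open>t\<close>, \<open>t'\<close> are collinear.
    The distances from the base point are known exactly, so the triangle inequality along this line
    gives the bound.\<close>
  define R where "R = (U - k * T) / (1 - k)"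
  have RU: "R - U = k * (R - T)" and UT: "U - T = (1 - k) * (R - T)"
    using k by (auto simp: R_def field_simps)
  let ?P = "E (v + R *\<^sub>R w) 0" and ?A = "E (v + U *\<^sub>R w) t" and ?C = "E (v + T *\<^sub>R w) t'"
  have A: "(dist ?P ?A)\<^sup>2 = (R - U)\<^sup>2 * (norm w)\<^sup>2 + t\<^sup>2 + 2 * t * a * (R - U)"
    and C: "(dist ?P ?C)\<^sup>2 = (R - T)\<^sup>2 * (norm w)\<^sup>2 + t'\<^sup>2 + 2 * t' * a * (R - T)"
    using flat_line_base[of t R U] flat_line_base[of t' R T] t by auto
  have "(dist ?P ?A)\<^sup>2 = (k * (R - T))\<^sup>2 * (norm w)\<^sup>2 + (k * t')\<^sup>2 + 2 * (k * t') * a * (k * (R - T))"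
    using A RU k(3) by simp
  also have "\<dots> = k\<^sup>2 * ((R - T)\<^sup>2 * (norm w)\<^sup>2 + t'\<^sup>2 + 2 * t' * a * (R - T))"
    by (simp add: power2_eq_square algebra_simps)
  finally have "(dist ?P ?A)\<^sup>2 = (k * dist ?P ?C)\<^sup>2" by (simp add: C power_mult_distrib)
  then have "dist ?P ?A = k * dist ?P ?C" using k by (simp add: power2_eq_iff_nonneg)
  then have "(1 - k) * dist ?P ?C \<le> dist ?C ?A"
    using dist_triangle[of ?P ?C ?A] by (simp add: dist_commute algebra_simps)
  then have "((1 - k) * dist ?P ?C)\<^sup>2 \<le> (dist ?C ?A)\<^sup>2" using k by (intro power_mono) auto
  moreover have "((1 - k) * dist ?P ?C)\<^sup>2 = (T - U)\<^sup>2 * (norm w)\<^sup>2 + (t - t')\<^sup>2 + 2 * a * (T - U) * (t - t')"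
  proof -
    have e1: "T - U = - ((1 - k) * (R - T))" using UT by simp
    have e2: "t - t' = - ((1 - k) * t')" using k by (simp add: algebra_simps)
    show ?thesis
      unfolding power_mult_distrib C e1 e2 by (simp add: power2_eq_square algebra_simps)
  qed
  ultimately show ?thesis by simp
qed

lemma flat_line_dist:
  assumes "0 \<le> t" "0 \<le> t'"
  shows "(dist (E (v + T *\<^sub>R w) t') (E (v + U *\<^sub>R w) t))\<^sup>2 = (T - U)\<^sup>2 * (norm w)\<^sup>2 + (t - t')\<^sup>2 + 2 * a * (T - U) * (t - t')"
proof (rule antisym[OF flat_line_upper[OF assms]])
  consider "t < t'" | "t' < t" | "t = t'" by linarith
  then show "(T - U)\<^sup>2 * (norm w)\<^sup>2 + (t - t')\<^sup>2 + 2 * a * (T - U) * (t - t') \<le> (dist (E (v + T *\<^sub>R w) t') (E (v + U *\<^sub>R w) t))\<^sup>2"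
  proof cases
    case 1
    then show ?thesis using flat_line_lower assms by blast
  next
    case 2
    then show ?thesis using flat_line_lower[of t' t U T] assms
      by (simp add: dist_commute power2_commute algebra_simps)
  next
    \<comment> \<open>Equal heights admit no such base point; one of them is raised by
      \<open>h\<close>, which tends to zero.\<close>
    case 3
    let ?d = "dist (E (v + T *\<^sub>R w) t) (E (v + U *\<^sub>R w) t)"
    have "((\<lambda>h. (?d + h)\<^sup>2 - (h\<^sup>2 - 2 * a * (T - U) * h)) \<longlongrightarrow> (?d + 0)\<^sup>2 - (0\<^sup>2 - 2 * a * (T - U) * 0)) (at_right 0)"
      by (intro tendsto_intros)
    moreover have "eventually (\<lambda>h. (T - U)\<^sup>2 * (norm w)\<^sup>2 \<le> (?d + h)\<^sup>2 - (h\<^sup>2 - 2 * a * (T - U) * h)) (at_right 0)"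
      using eventually_at_right_less[of 0]
    proof eventually_elim
      case (elim h)
      have "dist (E (v + T *\<^sub>R w) (t + h)) (E (v + U *\<^sub>R w) t) \<le> ?d + h"
        using dist_triangle[of "E (v + T *\<^sub>R w) (t + h)" "E (v + U *\<^sub>R w) t" "E (v + T *\<^sub>R w) t"]
          geod_rayD[OF rf_ray[OF line_in], of "t + h" t T] elim assms by simp
      then have "(dist (E (v + T *\<^sub>R w) (t + h)) (E (v + U *\<^sub>R w) t))\<^sup>2 \<le> (?d + h)\<^sup>2" by (intro power_mono) auto
      then show ?case using flat_line_lower[of t "t + h" T U] assms elim by (simp add: power2_eq_square)
    qed
    ultimately have "(T - U)\<^sup>2 * (norm w)\<^sup>2 \<le> (?d + 0)\<^sup>2 - (0\<^sup>2 - 2 * a * (T - U) * 0)"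
      by (rule tendsto_lowerbound) simp
    then show ?thesis using 3 by simp
  qed
qed

end

lemma flat_subspace_dist:
  assumes v: "v \<in> S" and w: "w \<in> S" and aff: "\<And>T. bus E (v + T *\<^sub>R w) = bus E v + T * (c \<bullet> w)" and "0 \<le> t" "0 \<le> t'"
  shows "(dist (E (v + w) t') (E v t))\<^sup>2 = (norm w)\<^sup>2 + (t - t')\<^sup>2 + 2 * (c \<bullet> w) * (t - t')"
  using flat_line_dist[OF v w aff assms(4,5), of 1 0] by simp

lemma rf_shift:
  assumes "x \<in> S"
  shows "ray_field (y + x) (\<lambda>v. E (x + v))" and "v \<in> S \<Longrightarrow> bus (\<lambda>v. E (x + v)) v = bus E (x + v) - bus E x"
proof -
  show "ray_field (y + x) (\<lambda>v. E (x + v))"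
    unfolding ray_field_def
  proof (intro conjI ballI allI impI)
    show "y + x \<in> S" using assms rf_y by simp
    fix v assume v: "v \<in> S"
    show "geod_ray (E (x + v))" using rf_ray assms v by simp
    have eq: "x + v + y = v + (y + x)" by (simp add: algebra_simps)
    have "E (x + v) 0 = \<iota> (x + v + y)" using assms v by (intro rf_0) simp
    then show "E (x + v) 0 = \<iota> (v + (y + x))" by (simp only: eq)
    fix w and t :: real assume "w \<in> S" "0 \<le> t"
    then show "dist (E (x + v) t) (E (x + w) t) \<le> norm (v - w)"
      using rf_contract[of "x + v" "x + w" t] assms v by simp
  qed
  show "v \<in> S \<Longrightarrow> bus (\<lambda>v. E (x + v)) v = bus E (x + v) - bus E x"
    using busemann_field_base[of x "x + v"] assms by (simp add: bus_def)
qed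

text \<open>Busemann functions move along with the rays, so only the shift changes. As the isometry
  translates the flat, the parameter \<open>v\<close> keeps its meaning and all directions of
  \<open>S\<close> are preserved.\<close>

lemma rf_translate:
  assumes "flat_translation S \<iota> g l"
  shows "ray_field (y + l) (\<lambda>v t. g (E v t))" and "bus (\<lambda>v t. g (E v t)) = bus E"
proof -
  have g: "dist (g x) (g z) = dist x z" for x z using assms by (simp add: flat_translation_def)
  have gl: "g (\<iota> u) = \<iota> (u + l)" if "u \<in> S" for u using assms that by (simp add: flat_translation_def)
  have l: "l \<in> S" using assms by (simp add: flat_translation_def)
  show "ray_field (y + l) (\<lambda>v t. g (E v t))"
    unfolding ray_field_def
  proof (intro conjI ballI allI impI)
    show "y + l \<in> S" using l rf_y by simp
    fix v assume v: "v \<in> S"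
    show "geod_ray (\<lambda>t. g (E v t))" using rf_ray[OF v] by (simp add: geod_ray_def g)
    show "g (E v 0) = \<iota> (v + (y + l))" using rf_0[OF v] gl[of "v + y"] v rf_y by (simp add: add.assoc)
  qed (simp add: g rf_contract)
  show "bus (\<lambda>v t. g (E v t)) = bus E" by (simp add: fun_eq_iff bus_def busemann_def g)
qed

end

section \<open>Stability of \<open>bus\<close>, compactness, and limits of translates\<close>

lemma bus_uniform:
  assumes E: "ray_field y E" and v: "v \<in> S" "norm v \<le> D" and t: "D < t"
  shows "\<bar>dist (E v 0) (E 0 t) - t - bus E v\<bar> \<le> D\<^sup>2 / (t - D)"
proof -
  have D: "0 \<le> D" using v(2) norm_ge_zero[of v] by linarith
  have "dist (E v 0) (E 0 t) - t \<le> bus E v + D\<^sup>2 / (t - D)"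
    unfolding bus_def using rf_base_dist[OF E v(1), of 0] v(2) t by (intro busemann_uniform[OF rf_ray[OF E]]) auto
  moreover have "bus E v \<le> dist (E v 0) (E 0 t) - t"
    unfolding bus_def using D t by (intro busemann_le[OF rf_ray[OF E]]) auto
  ultimately show ?thesis by simp
qed

text \<open>On a bounded set the Busemann function is known up to a small error from the base points
  and from one ray point at a large time \<open>t\<close>. Closeness at finitely many points
  therefore controls it.\<close>

lemma bus_close:
  assumes E: "ray_field y E" and E': "ray_field y' E'" and v: "v \<in> S" "norm v \<le> D" and t: "D < t"
    and close: "dist (E v 0) (E' v 0) \<le> d" "dist (E 0 t) (E' 0 t) \<le> d"
  shows "\<bar>bus E v - bus E' v\<bar> \<le> 2 * d + 2 * (D\<^sup>2 / (t - D))"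
proof -
  have "\<bar>dist (E v 0) (E 0 t) - dist (E' v 0) (E' 0 t)\<bar> \<le> 2 * d"
    using dist_triangle[of "E v 0" "E 0 t" "E' v 0"] dist_triangle[of "E' v 0" "E 0 t" "E' 0 t"]
      dist_triangle[of "E' v 0" "E' 0 t" "E v 0"] dist_triangle[of "E v 0" "E' 0 t" "E 0 t"] close
    by (simp add: dist_commute)
  then show ?thesis using bus_uniform[OF E v t] bus_uniform[OF E' v t] by linarith
qed

lemma small_error: "e > 0 \<Longrightarrow> \<exists>t>D. 2 * (D\<^sup>2 / (t - D)) \<le> (e::real)"
proof -
  assume e: "e > 0"
  have "2 * (D\<^sup>2 / ((D + 2 * D\<^sup>2 / e + 1) - D)) \<le> e"
  proof -
    have p: "0 < 2 * D\<^sup>2 / e + 1" using e by (simp add: add_nonneg_pos)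
    have "2 * D\<^sup>2 = e * (2 * D\<^sup>2 / e)" using e by simp
    also have "\<dots> \<le> e * (2 * D\<^sup>2 / e + 1)" using e by (intro mult_left_mono) auto
    finally have "2 * D\<^sup>2 / (2 * D\<^sup>2 / e + 1) \<le> e" using p by (simp add: pos_divide_le_eq)
    then show ?thesis by (simp add: add.assoc)
  qed
  moreover have "D + 2 * D\<^sup>2 / e + 1 > D" using e by (simp add: add_nonneg_pos)
  ultimately show ?thesis by blast
qed

lemma bus_tendsto:
  assumes E: "\<And>k. ray_field (y k) (E k)" and E': "ray_field y' E'" and v: "v \<in> S"
    and lim: "\<And>v t. v \<in> S \<Longrightarrow> 0 \<le> t \<Longrightarrow> ((\<lambda>k. E k v t) \<longlongrightarrow> E' v t) \<Phi>"
  shows "((\<lambda>k. bus (E k) v) \<longlongrightarrow> bus E' v) \<Phi>"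
proof (rule tendstoI)
  fix e :: real assume e: "e > 0"
  obtain t where t: "norm v < t" "2 * ((norm v)\<^sup>2 / (t - norm v)) \<le> e / 4" using small_error[of "e / 4" "norm v"] e by auto
  have t0: "0 \<le> t" using t(1) norm_ge_zero[of v] by linarith
  have "eventually (\<lambda>k. dist (E k v 0) (E' v 0) < e / 4) \<Phi>" "eventually (\<lambda>k. dist (E k 0 t) (E' 0 t) < e / 4) \<Phi>"
    using tendstoD[OF lim[OF v, of 0], of "e / 4"] tendstoD[OF lim[of 0 t], of "e / 4"] e t0 by auto
  then show "eventually (\<lambda>k. dist (bus (E k) v) (bus E' v) < e) \<Phi>"
  proof eventually_elim
    case (elim k)
    then show ?case using bus_close[OF E E' v order_refl t(1), of k "e / 4"] t e by (simp add: dist_real_def)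
  qed
qed

lemma ray_field_compact:
  assumes E: "\<And>k. ray_field (y k) (E k)" and y: "\<And>k. norm (y k) \<le> C"
  obtains \<Phi> y' E' where "\<Phi> \<le> sequentially" "\<Phi> \<noteq> bot" "ray_field y' E'" "(y \<longlongrightarrow> y') \<Phi>"
    "\<And>v t. v \<in> S \<Longrightarrow> 0 \<le> t \<Longrightarrow> ((\<lambda>k. E k v t) \<longlongrightarrow> E' v t) \<Phi>"
proof -
  \<comment> \<open>Parameters outside the domain receive a constant value, which makes the family
    pointwise bounded everywhere.\<close>
  define c where "c = (\<lambda>k (v, t). if v \<in> S \<and> 0 \<le> t then E k v t else \<iota> 0)"
  have "\<exists>x r. \<forall>k. dist x (c k i) \<le> r" for i
  proof -
    obtain v t where i: "i = (v, t)" by fastforce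
    have "dist (\<iota> 0) (c k i) \<le> norm v + C + \<bar>t\<bar>" for k
    proof (cases "v \<in> S \<and> 0 \<le> t")
      case True
      have "dist (\<iota> 0) (E k v 0) = norm (0 - (v + y k))"
        using rf_0[OF E] isometric[of 0 "v + y k"] rf_y[OF E] True by simp
      also have "\<dots> = norm (v + y k)" by (simp only: diff_0 norm_minus_cancel)
      also have "\<dots> \<le> norm v + C" using norm_triangle_ineq[of v "y k"] y[of k] by linarith
      finally have "dist (\<iota> 0) (E k v 0) \<le> norm v + C" .
      moreover have "dist (E k v 0) (E k v t) = t" using geod_rayD[OF rf_ray[OF E], of v 0 t] True by simp
      ultimately show ?thesis using dist_triangle[of "\<iota> 0" "E k v t" "E k v 0"] True by (simp add: c_def i)
    next
      case False
      moreover have "0 \<le> C" using y[of k] norm_ge_zero[of "y k"] by linarith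
      ultimately show ?thesis by (auto simp: c_def i)
    qed
    then show ?thesis by blast
  qed
  then obtain \<Phi> l where \<Phi>: "\<Phi> \<le> sequentially" "\<Phi> \<noteq> bot" "\<And>i. ((\<lambda>k. c k i) \<longlongrightarrow> l i) \<Phi>"
    by (rule pointwise_limit[of c]) (rule that)
  define E' where "E' = (\<lambda>v t. l (v, t))"
  have lim: "((\<lambda>k. E k v t) \<longlongrightarrow> E' v t) \<Phi>" if "v \<in> S" "0 \<le> t" for v t
    using \<Phi>(3)[of "(v, t)"] that by (simp add: c_def E'_def)
  have cont: "continuous_on S \<iota>"
    unfolding continuous_on_iff dist_norm[of _ "_::'v"] using isometric by (metis dist_norm)
  have "compact (\<iota> ` (S \<inter> cball 0 C))"
    using compact_continuous_image[OF continuous_on_subset[OF cont] compact_fin_dim_cball[OF fd]] by blast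
  then have "closed (\<iota> ` (S \<inter> cball 0 C))" by (rule compact_imp_closed)
  moreover have "eventually (\<lambda>k. E k 0 0 \<in> \<iota> ` (S \<inter> cball 0 C)) \<Phi>"
    using rf_0[OF E, of 0] rf_y[OF E] y by (intro always_eventually allI) auto
  ultimately have "E' 0 0 \<in> \<iota> ` (S \<inter> cball 0 C)"
    using Lim_in_closed_set[OF _ _ \<Phi>(2) lim[of 0 0]] by simp
  then obtain y' where y': "y' \<in> S" "E' 0 0 = \<iota> y'" by auto
  have ylim: "(y \<longlongrightarrow> y') \<Phi>"
  proof -
    have "((\<lambda>k. dist (E k 0 0) (E' 0 0)) \<longlongrightarrow> 0) \<Phi>" using lim[of 0 0] tendsto_dist_iff by fastforce
    moreover have "dist (E k 0 0) (E' 0 0) = dist (y k) y'" for k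
      using rf_0[OF E, of 0 k] y' isometric[OF rf_y[OF E] y'(1)] by (simp add: dist_norm)
    ultimately show ?thesis using tendsto_dist_iff[of y y' \<Phi>] by simp
  qed
  have "ray_field y' E'"
    unfolding ray_field_def
  proof (intro conjI ballI allI impI)
    show "y' \<in> S" using y' by simp
    fix v assume v: "v \<in> S"
    show "geod_ray (E' v)"
      unfolding geod_ray_def
    proof (intro allI impI)
      fix s t :: real assume st: "0 \<le> s" "0 \<le> t"
      have "((\<lambda>k. dist (E k v s) (E k v t)) \<longlongrightarrow> dist (E' v s) (E' v t)) \<Phi>"
        by (intro tendsto_dist lim v st)
      moreover have "(\<lambda>k. dist (E k v s) (E k v t)) = (\<lambda>k. \<bar>s - t\<bar>)"
        using geod_rayD[OF rf_ray[OF E v] st] by simp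
      ultimately have "((\<lambda>k::nat. \<bar>s - t\<bar>) \<longlongrightarrow> dist (E' v s) (E' v t)) \<Phi>" by simp
      then show "dist (E' v s) (E' v t) = \<bar>s - t\<bar>" using tendsto_unique[OF \<Phi>(2) tendsto_const] by metis
    qed
    have "((\<lambda>k. dist (E k v 0) (\<iota> (v + y'))) \<longlongrightarrow> dist (E' v 0) (\<iota> (v + y'))) \<Phi>"
      by (intro tendsto_dist lim v tendsto_const order_refl)
    moreover have "dist (E k v 0) (\<iota> (v + y')) = dist (y k) y'" for k
      using rf_0[OF E v, of k] isometric[of "v + y k" "v + y'"] v rf_y[OF E, of k] y' by (simp add: dist_norm)
    moreover have "((\<lambda>k. dist (y k) y') \<longlongrightarrow> 0) \<Phi>" using ylim tendsto_dist_iff by blast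
    ultimately have "((\<lambda>k. dist (y k) y') \<longlongrightarrow> dist (E' v 0) (\<iota> (v + y'))) \<Phi>" "((\<lambda>k. dist (y k) y') \<longlongrightarrow> 0) \<Phi>"
      by simp_all
    then have "dist (E' v 0) (\<iota> (v + y')) = 0" by (rule tendsto_unique[OF \<Phi>(2)])
    then show "E' v 0 = \<iota> (v + y')" by simp
    fix w t assume w: "w \<in> S" and t: "(0::real) \<le> t"
    have "((\<lambda>k. dist (E k v t) (E k w t)) \<longlongrightarrow> dist (E' v t) (E' w t)) \<Phi>"
      by (intro tendsto_dist lim v w t)
    then show "dist (E' v t) (E' w t) \<le> norm (v - w)"
      by (rule tendsto_upperbound[OF _ _ \<Phi>(2)]) (use rf_contract[OF E v w t] in auto)
  qed
  with that \<Phi>(1,2) ylim lim show thesis by blast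
qed

text \<open>Membership in the closure of all recentred translates under pointwise convergence,
  stated with finite sets and tolerances. In this form transitivity is an argument with two halves
  of \<open>e\<close> and no filters need to be composed.\<close>

definition translate_limit :: "('v \<Rightarrow> real \<Rightarrow> 'a) \<Rightarrow> ('v \<Rightarrow> real \<Rightarrow> 'a) \<Rightarrow> bool" where
  "translate_limit E E' \<longleftrightarrow> (\<exists>y'. ray_field y' E') \<and>
     (\<forall>A e. finite A \<and> A \<subseteq> S \<times> {0..} \<and> e > 0 \<longrightarrow>
        (\<exists>x\<in>S. \<exists>g l. flat_translation S \<iota> g l \<and> (\<forall>(v, t)\<in>A. dist (g (E (x + v) t)) (E' v t) < e)))"

lemma flat_translation_comp:
  "flat_translation S \<iota> g l \<Longrightarrow> flat_translation S \<iota> h m \<Longrightarrow> flat_translation S \<iota> (\<lambda>x. h (g x)) (l + m)"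
  by (auto simp: flat_translation_def add.assoc)

lemma translate_limit_trans:
  assumes "translate_limit E E'" "translate_limit E' E''"
  shows "translate_limit E E''"
  unfolding translate_limit_def
proof (intro conjI allI impI)
  show "\<exists>y'. ray_field y' E''" using assms(2) by (simp add: translate_limit_def)
  fix A :: "('v \<times> real) set" and e :: real assume A: "finite A \<and> A \<subseteq> S \<times> {0..} \<and> e > 0"
  obtain x' h m where x': "x' \<in> S" "flat_translation S \<iota> h m" "\<forall>(v, t)\<in>A. dist (h (E' (x' + v) t)) (E'' v t) < e / 2"
    using assms(2) A unfolding translate_limit_def by (meson half_gt_zero)
  \<comment> \<open>The outer approximation looks at the middle field shifted by \<open>x'\<close>,
    so the inner one has to be good at the shifted parameters.\<close>
  define A' where "A' = (\<lambda>(v, t). (x' + v, t)) ` A"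
  have "finite A' \<and> A' \<subseteq> S \<times> {0..} \<and> e / 2 > 0" using A x'(1) by (auto simp: A'_def)
  then obtain x g l where x: "x \<in> S" "flat_translation S \<iota> g l" "\<forall>(v, t)\<in>A'. dist (g (E (x + v) t)) (E' v t) < e / 2"
    using assms(1) unfolding translate_limit_def by meson
  have "dist (h (g (E (x + x' + v) t))) (E'' v t) < e" if vt: "(v, t) \<in> A" for v t
  proof -
    have "dist (g (E (x + (x' + v)) t)) (E' (x' + v) t) < e / 2" using x(3) vt by (force simp: A'_def)
    then have "dist (h (g (E (x + x' + v) t))) (h (E' (x' + v) t)) < e / 2"
      using x'(2) by (simp add: flat_translation_def add.assoc)
    moreover have "dist (h (E' (x' + v) t)) (E'' v t) < e / 2" using x'(3) vt by auto
    ultimately show ?thesis using dist_triangle[of "h (g (E (x + x' + v) t))" "E'' v t" "h (E' (x' + v) t)"] by linarith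
  qed
  then show "\<exists>x\<in>S. \<exists>g l. flat_translation S \<iota> g l \<and> (\<forall>(v, t)\<in>A. dist (g (E (x + v) t)) (E'' v t) < e)"
    using flat_translation_comp[OF x(2) x'(2)] x(1) x'(1)
    by (intro bexI[of _ "x + x'"] exI[of _ "\<lambda>x. h (g x)"] exI[of _ "l + m"]) auto
qed

lemma translate_limit_refl: "ray_field y E \<Longrightarrow> translate_limit E E"
proof -
  assume "ray_field y E"
  moreover have "flat_translation S \<iota> id 0" by (simp add: flat_translation_def)
  ultimately show ?thesis
    unfolding translate_limit_def by (auto intro!: bexI[of _ 0] exI[of _ id])
qed

lemma translate_limit_bus:
  assumes E: "ray_field y E" and lim: "translate_limit E E'" and A: "finite A" "A \<subseteq> S" and e: "e > 0"
  shows "\<exists>x\<in>S. \<forall>v\<in>A. \<bar>bus E' v - (bus E (x + v) - bus E x)\<bar> < e"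
proof -
  obtain y' where E': "ray_field y' E'" using lim by (auto simp: translate_limit_def)
  define D where "D = Max (insert 0 (norm ` A))"
  have D: "norm v \<le> D" if "v \<in> A" for v using that A by (simp add: D_def)
  have D0: "0 \<le> D" using A by (simp add: D_def)
  obtain t where t: "D < t" "2 * (D\<^sup>2 / (t - D)) \<le> e / 4" using small_error[of "e / 4" D] e by auto
  \<comment> \<open>The base points and one distant point of the ray over \<open>0\<close> are all
    that \<open>bus_close\<close> asks for.\<close>
  define Q where "Q = insert (0, t) ((\<lambda>v. (v, 0::real)) ` A)"
  have "finite Q \<and> Q \<subseteq> S \<times> {0..} \<and> e / 4 > 0" using A e t D0 by (auto simp: Q_def)
  then obtain x g l where x: "x \<in> S" "flat_translation S \<iota> g l" "\<forall>(v, t)\<in>Q. dist (g (E (x + v) t)) (E' v t) < e / 4"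
    using lim unfolding translate_limit_def by meson
  define E1 where "E1 = (\<lambda>v t. g (E (x + v) t))"
  have E1: "ray_field (y + x + l) E1" unfolding E1_def by (rule rf_translate(1)[OF rf_shift(1)[OF E x(1)] x(2)])
  have "\<bar>bus E' v - (bus E (x + v) - bus E x)\<bar> < e" if v: "v \<in> A" for v
  proof -
    have vS: "v \<in> S" using v A by auto
    have "bus E1 v = bus E (x + v) - bus E x"
      unfolding E1_def rf_translate(2)[OF rf_shift(1)[OF E x(1)] x(2)] using rf_shift(2)[OF E x(1) vS] .
    moreover have "dist (E1 v 0) (E' v 0) \<le> e / 4" "dist (E1 0 t) (E' 0 t) \<le> e / 4"
      using x(3) v by (force simp: Q_def E1_def)+
    ultimately show ?thesis using bus_close[OF E1 E' vS D[OF v] t(1), of "e / 4"] t(2) e by (simp add: abs_minus_commute)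
  qed
  then show ?thesis using x(1) by blast
qed

lemma translate_limit_exists:
  assumes E: "ray_field y E" and x: "\<And>k::nat. x k \<in> S"
  obtains \<Phi> E' where "\<Phi> \<le> sequentially" "\<Phi> \<noteq> bot" "translate_limit E E'"
    "\<And>v. v \<in> S \<Longrightarrow> ((\<lambda>k. bus E (x k + v) - bus E (x k)) \<longlongrightarrow> bus E' v) \<Phi>"
proof -
  \<comment> \<open>A lattice vector close to \<open>- (y + x k)\<close> returns the shifted field
    to within \<open>C0\<close> of \<open>\<iota> 0\<close>, where compactness applies.\<close>
  have "\<exists>g l. flat_translation S \<iota> g l \<and> norm (l - (- (y + x k))) \<le> C0" for k
    using lattice[of "- (y + x k)"] rf_y[OF E] x by (metis S_closed(2) S_closed(5))
  then obtain g l where gl: "\<And>k. flat_translation S \<iota> (g k) (l k)" "\<And>k. norm (l k - (- (y + x k))) \<le> C0" by metis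
  define E1 where "E1 = (\<lambda>k v t. g k (E (x k + v) t))"
  have E1: "ray_field (y + x k + l k) (E1 k)" for k
    unfolding E1_def by (rule rf_translate(1)[OF rf_shift(1)[OF E x] gl(1)])
  have bnd: "norm (y + x k + l k) \<le> C0" for k using gl(2)[of k] by (simp add: algebra_simps)
  obtain \<Phi> y' E' where \<Phi>: "\<Phi> \<le> sequentially" "\<Phi> \<noteq> bot" "ray_field y' E'"
    "\<And>v t. v \<in> S \<Longrightarrow> 0 \<le> t \<Longrightarrow> ((\<lambda>k. E1 k v t) \<longlongrightarrow> E' v t) \<Phi>"
    by (rule ray_field_compact[of "\<lambda>k. y + x k + l k" E1 C0]) (use E1 bnd in blast)+
  have "translate_limit E E'"
    unfolding translate_limit_def
  proof (intro conjI allI impI)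
    show "\<exists>y'. ray_field y' E'" using \<Phi>(3) by blast
    fix A :: "('v \<times> real) set" and e :: real assume A: "finite A \<and> A \<subseteq> S \<times> {0..} \<and> e > 0"
    have "eventually (\<lambda>k. \<forall>i\<in>A. dist (E1 k (fst i) (snd i)) (E' (fst i) (snd i)) < e) \<Phi>"
    proof (rule eventually_ball_finite)
      show "\<forall>i\<in>A. eventually (\<lambda>k. dist (E1 k (fst i) (snd i)) (E' (fst i) (snd i)) < e) \<Phi>"
        using A by (auto intro!: tendstoD[OF \<Phi>(4)])
    qed (use A in simp)
    then obtain k where "\<forall>i\<in>A. dist (E1 k (fst i) (snd i)) (E' (fst i) (snd i)) < e"
      using eventually_happens'[OF \<Phi>(2)] by blast
    then show "\<exists>x\<in>S. \<exists>g l. flat_translation S \<iota> g l \<and> (\<forall>(v, t)\<in>A. dist (g (E (x + v) t)) (E' v t) < e)"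
      using gl(1) x by (intro bexI[of _ "x k"] exI[of _ "g k"] exI[of _ "l k"]) (auto simp: E1_def)
  qed
  moreover have "((\<lambda>k. bus E (x k + v) - bus E (x k)) \<longlongrightarrow> bus E' v) \<Phi>" if v: "v \<in> S" for v
  proof -
    have "bus (E1 k) v = bus E (x k + v) - bus E (x k)" for k
      unfolding E1_def rf_translate(2)[OF rf_shift(1)[OF E x] gl(1)] using rf_shift(2)[OF E x v] .
    then show ?thesis using bus_tendsto[OF E1 \<Phi>(3) v \<Phi>(4)] by simp
  qed
  ultimately show thesis using that \<Phi>(1,2) by blast
qed

end

section \<open>The Morse condition\<close>

context morse_flat_space
begin

context
  fixes y E c
  assumes E: "ray_field y E" and c: "c \<in> S" and lin: "\<And>v. v \<in> S \<Longrightarrow> bus E v = c \<bullet> v"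
begin

lemma linear_dist:
  assumes "v \<in> S" "w \<in> S" "0 \<le> t" "0 \<le> t'"
  shows "(dist (E (v + w) t') (E v t))\<^sup>2 = (norm w)\<^sup>2 + (t - t')\<^sup>2 + 2 * (c \<bullet> w) * (t - t')"
  by (rule flat_subspace_dist[OF E assms(1,2) _ assms(3,4)]) (use assms c lin in \<open>simp add: inner_add_right\<close>)

text \<open>Advancing by \<open>\<tau> *\<^sub>R c\<close> in the flat while flowing for time \<tau>
  is a motion orthogonal to the flat with speed \<open>sqrt (1 - (norm c)\<^sup>2)\<close>. Division
  by \<open>r\<close> turns the parameter into height.\<close>

definition half_param :: "real \<Rightarrow> 'v \<times> real \<Rightarrow> 'a" where
  "half_param r p = E (fst p + (snd p / r) *\<^sub>R c) (snd p / r)"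

lemma half_param_dist:
  assumes r: "r > 0" "r\<^sup>2 = 1 - (norm c)\<^sup>2" and p: "fst p \<in> S" "0 \<le> snd p" and q: "fst q \<in> S" "0 \<le> snd q"
  shows "dist (half_param r p) (half_param r q) = dist p q"
proof -
  obtain v s where pv: "p = (v, s)" by fastforce
  obtain u s' where qu: "q = (u, s')" by fastforce
  define h where "h = (s - s') / r"
  define d where "d = v - u"
  have hr: "h * r = s - s'" using r by (simp add: h_def)
  have eq: "v + (s / r) *\<^sub>R c = (u + (s' / r) *\<^sub>R c) + (d + h *\<^sub>R c)"
    by (simp add: d_def h_def diff_divide_distrib scaleR_diff_left)
  have vs: "v \<in> S" "u \<in> S" "0 \<le> s" "0 \<le> s'" using p q by (auto simp: pv qu)
  have "(dist (half_param r p) (half_param r q))\<^sup>2 = (norm (d + h *\<^sub>R c))\<^sup>2 + (s' / r - s / r)\<^sup>2 + 2 * (c \<bullet> (d + h *\<^sub>R c)) * (s' / r - s / r)"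
    unfolding half_param_def pv qu fst_conv snd_conv eq
    by (rule linear_dist) (use vs c r in \<open>auto simp: d_def\<close>)
  also have "s' / r - s / r = - h" by (simp add: h_def diff_divide_distrib)
  also have "(norm (d + h *\<^sub>R c))\<^sup>2 = (norm d)\<^sup>2 + 2 * h * (c \<bullet> d) + h\<^sup>2 * (norm c)\<^sup>2"
    unfolding power2_norm_eq_inner by (simp add: inner_simps inner_commute power2_eq_square algebra_simps)
  also have "(norm d)\<^sup>2 + 2 * h * (c \<bullet> d) + h\<^sup>2 * (norm c)\<^sup>2 + (- h)\<^sup>2 + 2 * (c \<bullet> (d + h *\<^sub>R c)) * (- h)
      = (norm d)\<^sup>2 + h\<^sup>2 * (1 - (norm c)\<^sup>2)"
    unfolding power2_norm_eq_inner by (simp add: inner_simps power2_eq_square algebra_simps)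
  also have "\<dots> = (norm d)\<^sup>2 + (h * r)\<^sup>2" using r by (simp add: power_mult_distrib)
  also have "\<dots> = (dist p q)\<^sup>2" by (simp add: pv qu norm_Pair hr d_def dist_norm)
  finally show ?thesis by (simp add: power2_eq_iff_nonneg)
qed

text \<open>For a shorter \<open>c\<close> the rays embed the product of \<open>S\<close> and a
  half-line isometrically. Compactness of bounded pieces makes the image closed and uniqueness of
  geodesics makes it convex, so it is a flat half-space bounded by the flat.\<close>

lemma linear_norm_ge_1: "norm c \<ge> 1"
proof (rule ccontr)
  assume "\<not> norm c \<ge> 1"
  then have "(norm c)\<^sup>2 < 1" by (simp add: power_less_one_iff abs_square_less_1)
  define r where "r = sqrt (1 - (norm c)\<^sup>2)"
  have r: "r > 0" "r\<^sup>2 = 1 - (norm c)\<^sup>2" using \<open>(norm c)\<^sup>2 < 1\<close> by (auto simp: r_def)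
  define D where "D = S \<times> {0::real..}"
  define H where "H = half_param r ` D"
  have iso: "dist (half_param r p) (half_param r q) = dist p q" if "p \<in> D" "q \<in> D" for p q
    using half_param_dist[OF r] that by (auto simp: D_def)
  have convD: "p + s *\<^sub>R (q - p) \<in> D" if "p \<in> D" "q \<in> D" "0 \<le> s" "s \<le> 1" for p q s
  proof -
    have "snd p + s * (snd q - snd p) = (1 - s) * snd p + s * snd q" by algebra
    then show ?thesis using that by (auto simp: D_def mem_Times_iff)
  qed
  have "closed H"
    unfolding closed_sequential_limits
  proof (intro allI impI, elim conjE)
    fix z l assume z: "\<forall>k. z k \<in> H" "z \<longlonglongrightarrow> l"
    then have "\<forall>k. \<exists>p. p \<in> D \<and> z k = half_param r p" unfolding H_def by blast
    then have "\<exists>p. \<forall>k. p k \<in> D \<and> z k = half_param r (p k)" by (rule choice)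
    then obtain p where p: "\<And>k. p k \<in> D" "\<And>k. z k = half_param r (p k)" by blast
    have "bounded (range z)" using z(2) by (rule convergent_imp_bounded)
    have D0: "0 \<in> D" by (simp add: D_def zero_prod_def)
    obtain R where R: "\<And>k. dist (half_param r 0) (z k) \<le> R"
      using \<open>bounded (range z)\<close> unfolding bounded_any_center[of _ "half_param r 0"] by auto
    define K where "K = (S \<inter> cball 0 R) \<times> {0..R}"
    have "p k \<in> K" for k
    proof -
      have "norm (p k) \<le> R" using R[of k] iso[OF D0 p(1)[of k]] p(2) by simp
      then have "norm (fst (p k)) \<le> R" "\<bar>snd (p k)\<bar> \<le> R"
        using norm_fst_le[of "fst (p k)" "snd (p k)"] norm_snd_le[of "snd (p k)" "fst (p k)"] by auto
      then show ?thesis using p(1)[of k] by (auto simp: K_def D_def mem_Times_iff)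
    qed
    moreover have KD: "K \<subseteq> D" by (auto simp: K_def D_def)
    have "compact K" unfolding K_def by (intro compact_Times compact_fin_dim_cball[OF fd] compact_Icc)
    moreover have "continuous_on K (half_param r)"
      unfolding continuous_on_iff using iso KD by (metis subsetD)
    ultimately have "compact (half_param r ` K)" by (intro compact_continuous_image)
    then have "closed (half_param r ` K)" by (rule compact_imp_closed)
    moreover have "\<forall>k. z k \<in> half_param r ` K" using p(2) \<open>\<And>k. p k \<in> K\<close> by blast
    ultimately have "l \<in> half_param r ` K" using z(2) closed_sequentially by blast
    then show "l \<in> H" using KD by (auto simp: H_def)
  qed
  moreover have "convex_set H"
    unfolding convex_set_def
  proof (intro ballI allI impI)
    fix x z g assume x: "x \<in> H" and z: "z \<in> H" and g: "geodesic_seg g x z"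
    obtain p q where pq: "p \<in> D" "q \<in> D" "x = half_param r p" "z = half_param r q" using x z by (auto simp: H_def)
    have a1: "affine_geod (\<lambda>s. g (s * dist x z))" using g by (rule seg_imp_affine_geod)
    have a2: "affine_geod (\<lambda>s. half_param r (p + s *\<^sub>R (q - p)))"
    proof (rule affine_geodI[where k = "norm (q - p)"])
      fix s t :: real assume st: "s \<in> {0..1}" "t \<in> {0..1}"
      have "dist (half_param r (p + s *\<^sub>R (q - p))) (half_param r (p + t *\<^sub>R (q - p))) = dist (p + s *\<^sub>R (q - p)) (p + t *\<^sub>R (q - p))"
        using st pq by (intro iso convD) auto
      also have "\<dots> = norm ((s - t) *\<^sub>R (q - p))" by (simp add: dist_norm scaleR_diff_left)
      finally show "dist (half_param r (p + s *\<^sub>R (q - p))) (half_param r (p + t *\<^sub>R (q - p))) = norm (q - p) * \<bar>s - t\<bar>"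
        by simp
    qed
    have ends: "g 0 = x" "g (dist x z) = z" using g by (auto simp: geodesic_seg_def)
    show "g ` {0..dist x z} \<subseteq> H"
    proof
      fix b assume "b \<in> g ` {0..dist x z}"
      then obtain \<tau> where \<tau>: "0 \<le> \<tau>" "\<tau> \<le> dist x z" "b = g \<tau>" by auto
      show "b \<in> H"
      proof (cases "dist x z = 0")
        case True
        then show ?thesis using \<tau> ends x by simp
      next
        case False
        then have pos: "0 < dist x z" using zero_le_dist[of x z] by linarith
        define s where "s = \<tau> / dist x z"
        have s: "0 \<le> s" "s \<le> 1" "s * dist x z = \<tau>" using \<tau> pos by (auto simp: s_def)
        have "g (s * dist x z) = half_param r (p + s *\<^sub>R (q - p))"
          using affine_geod_unique[OF a1 a2 _ _ s(1,2)] ends pq by simp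
        then show ?thesis using convD[OF pq(1,2) s(1,2)] s \<tau> by (simp add: H_def)
      qed
    qed
  qed
  moreover have "\<exists>n f. n \<ge> 1 \<and> isom_embedding n {x \<in> eucl_space n. x 0 \<ge> 0} f \<and>
        H = f ` {x \<in> eucl_space n. x 0 \<ge> 0} \<and> \<iota> ` S = f ` {x \<in> eucl_space n. x 0 = 0}"
  proof -
    obtain B where B: "onb B S" using fd by (auto simp: fin_dim_def)
    define n where "n = card B"
    obtain e where e: "bij_betw e {0..<n} B"
      using ex_bij_betw_nat_finite[of B] B by (auto simp: n_def onb_def)
    \<comment> \<open>Coordinate \<open>0\<close> of the model is the height above the flat, hence
      the index of the coordinates of \<open>S\<close> is shifted by one.\<close>
    define V where "V = (\<lambda>x::nat \<Rightarrow> real. \<Sum>i<n. x (Suc i) *\<^sub>R e i)"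
    define f where "f = (\<lambda>x. half_param r (V x, x 0))"
    have VB: "V x = (\<Sum>b\<in>B. x (Suc (the_inv_into {0..<n} e b)) *\<^sub>R b)" for x
    proof -
      have "V x = (\<Sum>i\<in>{0..<n}. x (Suc (the_inv_into {0..<n} e (e i))) *\<^sub>R e i)"
        unfolding V_def using e by (intro sum.cong) (auto simp: the_inv_into_f_f bij_betw_def)
      then show ?thesis
        using sum.reindex_bij_betw[OF e, of "\<lambda>b. x (Suc (the_inv_into {0..<n} e b)) *\<^sub>R b"] by simp
    qed
    have V_S: "V x \<in> S" for x unfolding VB by (rule onb_expand_in[OF B])
    have Vdist: "(norm (V x - V z))\<^sup>2 = (\<Sum>i<n. (x (Suc i) - z (Suc i))\<^sup>2)" for x z
    proof -
      have "V x - V z = V (\<lambda>i. x i - z i)" by (simp add: V_def scaleR_diff_left sum_subtractf)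
      then have "(norm (V x - V z))\<^sup>2 = (\<Sum>b\<in>B. (x (Suc (the_inv_into {0..<n} e b)) - z (Suc (the_inv_into {0..<n} e b)))\<^sup>2)"
        unfolding power2_norm_eq_inner by (simp add: VB onb_norm_sum[OF B] power2_eq_square)
      also have "\<dots> = (\<Sum>i\<in>{0..<n}. (x (Suc (the_inv_into {0..<n} e (e i))) - z (Suc (the_inv_into {0..<n} e (e i))))\<^sup>2)"
        by (rule sum.reindex_bij_betw[OF e, symmetric])
      also have "\<dots> = (\<Sum>i<n. (x (Suc i) - z (Suc i))\<^sup>2)"
        using e by (intro sum.cong) (auto simp: the_inv_into_f_f bij_betw_def)
      finally show ?thesis .
    qed
    have Vsurj: "\<exists>x\<in>eucl_space (Suc n). V x = v \<and> x 0 = a" if v: "v \<in> S" for v a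
    proof -
      define x where "x = (\<lambda>i. case i of 0 \<Rightarrow> a | Suc j \<Rightarrow> if j < n then v \<bullet> e j else 0)"
      have "V x = (\<Sum>i\<in>{0..<n}. (v \<bullet> e i) *\<^sub>R e i)" unfolding V_def x_def by (intro sum.cong) auto
      also have "\<dots> = v" using sum.reindex_bij_betw[OF e, of "\<lambda>b. (v \<bullet> b) *\<^sub>R b"] onb_expand[OF B v] by simp
      finally have "V x = v" .
      moreover have "x \<in> eucl_space (Suc n)" by (auto simp: eucl_space_def x_def split: nat.split)
      ultimately show ?thesis by (intro bexI[of _ x]) (auto simp: x_def)
    qed
    have "isom_embedding (Suc n) {x \<in> eucl_space (Suc n). x 0 \<ge> 0} f"
      unfolding isom_embedding_def
    proof (intro ballI)
      fix x z assume "x \<in> {x \<in> eucl_space (Suc n). x 0 \<ge> 0}" "z \<in> {x \<in> eucl_space (Suc n). x 0 \<ge> 0}"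
      then have "dist (f x) (f z) = dist (V x, x 0) (V z, z 0)"
        unfolding f_def by (intro iso) (auto simp: D_def V_S)
      also have "\<dots> = sqrt ((norm (V x - V z))\<^sup>2 + (x 0 - z 0)\<^sup>2)" by (simp add: norm_Pair dist_norm)
      also have "\<dots> = eucl_dist (Suc n) x z"
        unfolding eucl_dist_def Vdist by (simp only: sum.lessThan_Suc_shift) (simp add: add.commute)
      finally show "dist (f x) (f z) = eucl_dist (Suc n) x z" .
    qed
    moreover have "H = f ` {x \<in> eucl_space (Suc n). x 0 \<ge> 0}"
    proof
      show "f ` {x \<in> eucl_space (Suc n). x 0 \<ge> 0} \<subseteq> H" by (auto simp: H_def f_def D_def V_S)
      show "H \<subseteq> f ` {x \<in> eucl_space (Suc n). x 0 \<ge> 0}"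
      proof
        fix h assume "h \<in> H"
        then obtain v a where "v \<in> S" "0 \<le> a" "h = half_param r (v, a)" by (auto simp: H_def D_def)
        then show "h \<in> f ` {x \<in> eucl_space (Suc n). x 0 \<ge> 0}"
          using Vsurj[of v a] by (auto simp: f_def image_iff)
      qed
    qed
    moreover have "\<iota> ` S = f ` {x \<in> eucl_space (Suc n). x 0 = 0}"
    proof
      have f0: "f x = \<iota> (V x + y)" if "x 0 = 0" for x
        using that rf_0[OF E V_S] by (simp add: f_def half_param_def)
      show "f ` {x \<in> eucl_space (Suc n). x 0 = 0} \<subseteq> \<iota> ` S" using f0 V_S rf_y[OF E] by auto
      show "\<iota> ` S \<subseteq> f ` {x \<in> eucl_space (Suc n). x 0 = 0}"
      proof
        fix h assume "h \<in> \<iota> ` S"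
        then obtain v where v: "v \<in> S" "h = \<iota> v" by blast
        then obtain x where "x \<in> eucl_space (Suc n)" "V x = v - y" "x 0 = 0" using Vsurj[of "v - y" 0] rf_y[OF E] by auto
        then show "h \<in> f ` {x \<in> eucl_space (Suc n). x 0 = 0}" using f0[of x] v by force
      qed
    qed
    ultimately show ?thesis by (intro exI[of _ "Suc n"] exI[of _ f]) auto
  qed
  ultimately have "flat_half_space H (\<iota> ` S)" unfolding flat_half_space_def by blast
  then show False using morse by blast
qed

lemma linear_unit: "norm c = 1"
proof -
  have "c \<bullet> c \<le> norm c" using bus_lipschitz[OF E c, of 0] lin[OF c] bus_0[OF E] by simp
  then have "norm c * norm c \<le> 1 * norm c" by (simp add: power2_norm_eq_inner[symmetric] power2_eq_square)
  then have "norm c \<le> 1" using linear_norm_ge_1 by (metis mult_right_le_imp_le less_le_trans zero_less_one)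
  then show ?thesis using linear_norm_ge_1 by simp
qed

text \<open>For a unit gradient the perpendicular speed is zero: the distance formula places
  \<open>E v t\<close> at distance zero from a point of the flat.\<close>

lemma linear_ray:
  assumes "v \<in> S" "0 \<le> t"
  shows "E v t = \<iota> (v + y - t *\<^sub>R c)"
proof -
  have "(dist (E (v + (- t) *\<^sub>R c) 0) (E v t))\<^sup>2 = (norm ((- t) *\<^sub>R c))\<^sup>2 + (t - 0)\<^sup>2 + 2 * (c \<bullet> ((- t) *\<^sub>R c)) * (t - 0)"
    by (rule linear_dist) (use assms c in auto)
  also have "\<dots> = 0" using linear_unit by (simp add: power_mult_distrib power2_norm_eq_inner[symmetric] power2_eq_square)
  finally have "E v t = E (v + (- t) *\<^sub>R c) 0" by simp
  also have "\<dots> = \<iota> (v + (- t) *\<^sub>R c + y)" using assms c by (intro rf_0[OF E]) simp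
  also have "v + (- t) *\<^sub>R c + y = v + y - t *\<^sub>R c" by simp
  finally show ?thesis .
qed

end

section \<open>Convex analysis of Busemann functions on the flat\<close>

definition lineality :: "('v \<Rightarrow> real \<Rightarrow> 'a) \<Rightarrow> 'v set" where
  "lineality E = {w\<in>S. \<forall>v\<in>S. \<forall>T. bus E (v + T *\<^sub>R w) = bus E v + T * bus E w}"

lemma linealityD: "w \<in> lineality E \<Longrightarrow> v \<in> S \<Longrightarrow> bus E (v + T *\<^sub>R w) = bus E v + T * bus E w"
  and lineality_S: "w \<in> lineality E \<Longrightarrow> w \<in> S"
  by (auto simp: lineality_def)

lemma lineality_add:
  assumes E: "ray_field y E" and w: "w \<in> lineality E" "w' \<in> lineality E"
  shows "bus E (w + w') = bus E w + bus E w'" and "bus E (k *\<^sub>R w) = k * bus E w"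
  using linealityD[OF w(2) lineality_S[OF w(1)], of 1] linealityD[OF w(1), of 0 k] bus_0[OF E] by auto

lemma subspace_lineality:
  assumes E: "ray_field y E"
  shows "subspace (lineality E)"
proof (rule subspaceI)
  show "0 \<in> lineality E" using bus_0[OF E] by (simp add: lineality_def)
  fix w w' assume w: "w \<in> lineality E" "w' \<in> lineality E"
  have "bus E (v + T *\<^sub>R (w + w')) = bus E v + T * bus E (w + w')" if v: "v \<in> S" for v T
  proof -
    have "bus E ((v + T *\<^sub>R w) + T *\<^sub>R w') = bus E (v + T *\<^sub>R w) + T * bus E w'"
      using v lineality_S[OF w(1)] by (intro linealityD[OF w(2)]) simp
    moreover have "(v + T *\<^sub>R w) + T *\<^sub>R w' = v + T *\<^sub>R (w + w')" by (simp add: scaleR_add_right)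
    ultimately show ?thesis using linealityD[OF w(1) v, of T] lineality_add(1)[OF E w] by (simp add: distrib_left)
  qed
  then show "w + w' \<in> lineality E" using lineality_S[OF w(1)] lineality_S[OF w(2)] by (simp add: lineality_def)
  fix k
  have "bus E (v + T *\<^sub>R (k *\<^sub>R w)) = bus E v + T * bus E (k *\<^sub>R w)" if v: "v \<in> S" for v T
    using linealityD[OF w(1) v, of "T * k"] lineality_add(2)[OF E w(1) w(1), of k] by simp
  then show "k *\<^sub>R w \<in> lineality E" using lineality_S[OF w(1)] by (simp add: lineality_def)
qed

lemma lineality_riesz:
  assumes E: "ray_field y E"
  obtains c where "c \<in> lineality E" "\<And>w. w \<in> lineality E \<Longrightarrow> bus E w = c \<bullet> w"
proof -
  have sub: "subspace (lineality E)" by (rule subspace_lineality[OF E])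
  then have "fin_dim (lineality E)" using fin_dim_subspace[OF fd sub] lineality_S by blast
  then obtain B where B: "onb B (lineality E)" by (auto simp: fin_dim_def)
  define c where "c = (\<Sum>b\<in>B. bus E b *\<^sub>R b)"
  have BL: "b \<in> lineality E" if "b \<in> B" for b using B that span_base[of b B] by (auto simp: onb_def)
  have "bus E w = c \<bullet> w" if w: "w \<in> lineality E" for w
  proof -
    have sumb: "bus E (\<Sum>b\<in>C. u b *\<^sub>R b) = (\<Sum>b\<in>C. u b * bus E b)" if C: "finite C" "C \<subseteq> B" for C u
      using C
    proof (induction C)
      case empty
      show ?case using bus_0[OF E] by simp
    next
      case (insert b C)
      have "(\<Sum>b\<in>C. u b *\<^sub>R b) \<in> lineality E" using insert BL by (intro subspace_sum[OF sub] subspace_scale[OF sub]) auto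
      moreover have "u b *\<^sub>R b \<in> lineality E" "b \<in> lineality E" using insert BL by (auto intro: subspace_scale[OF sub])
      ultimately show ?case using insert lineality_add[OF E] by simp
    qed
    have fB: "finite B" using B by (simp add: onb_def)
    have "bus E w = bus E (\<Sum>b\<in>B. (w \<bullet> b) *\<^sub>R b)" using onb_expand[OF B w] by simp
    also have "\<dots> = (\<Sum>b\<in>B. (w \<bullet> b) * bus E b)" using sumb[OF fB subset_refl] .
    also have "\<dots> = (\<Sum>b\<in>B. bus E b * (b \<bullet> w))" by (intro sum.cong) (simp_all add: inner_commute)
    also have "\<dots> = c \<bullet> w" by (simp add: c_def inner_sum_left)
    finally show ?thesis .
  qed
  moreover have "c \<in> lineality E" unfolding c_def by (rule onb_expand_in[OF B])
  ultimately show thesis using that by blast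
qed

text \<open>Affineness with a given slope is a closed condition on differences of \<open>b\<close>,
  and recentring alters \<open>b\<close> only by a shift and a constant. Lineality spaces can
  therefore only grow in limits, and slopes persist.\<close>

lemma translate_limit_lineality:
  assumes E: "ray_field y E" and lim: "translate_limit E E'" and w: "w \<in> lineality E"
  shows "w \<in> lineality E'" and "bus E' w = bus E w"
proof -
  have wS: "w \<in> S" using lineality_S[OF w] .
  obtain y' where E': "ray_field y' E'" using lim by (auto simp: translate_limit_def)
  have eq: "bus E' (v + T *\<^sub>R w) = bus E' v + T * bus E w" if v: "v \<in> S" for v T
  proof -
    have small: "\<bar>bus E' (v + T *\<^sub>R w) - bus E' v - T * bus E w\<bar> \<le> e" if e: "e > 0" for e
    proof -
      obtain x where x: "x \<in> S" "\<forall>z\<in>{v + T *\<^sub>R w, v}. \<bar>bus E' z - (bus E (x + z) - bus E x)\<bar> < e / 2"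
        using translate_limit_bus[OF E lim, of "{v + T *\<^sub>R w, v}" "e / 2"] v wS e by auto
      have "bus E (x + (v + T *\<^sub>R w)) = bus E (x + v) + T * bus E w"
        using linealityD[OF w, of "x + v" T] x v by (simp add: add.assoc)
      then show ?thesis using x(2) by (simp add: abs_if split: if_splits)
    qed
    have "\<bar>bus E' (v + T *\<^sub>R w) - bus E' v - T * bus E w\<bar> \<le> 0"
    proof (rule field_le_epsilon)
      fix e :: real assume "0 < e"
      from small[OF this] show "\<bar>bus E' (v + T *\<^sub>R w) - bus E' v - T * bus E w\<bar> \<le> 0 + e" by linarith
    qed
    then show ?thesis by simp
  qed
  show "bus E' w = bus E w" using eq[of 0 1] bus_0[OF E'] by simp
  then show "w \<in> lineality E'" using eq wS by (simp add: lineality_def)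
qed

section \<open>Subgradients and regularised minima\<close>

definition subgrad :: "('v \<Rightarrow> real \<Rightarrow> 'a) \<Rightarrow> 'v \<Rightarrow> 'v \<Rightarrow> bool" where
  "subgrad E x k \<longleftrightarrow> x \<in> S \<and> k \<in> S \<and> (\<forall>v\<in>S. bus E x + k \<bullet> (v - x) \<le> bus E v)"

lemma continuous_bus: "ray_field y E \<Longrightarrow> continuous_on S (bus E)"
  unfolding continuous_on_iff
proof (intro ballI allI impI)
  fix x and e :: real assume E: "ray_field y E" and x: "x \<in> S" and e: "e > 0"
  have "dist (bus E x') (bus E x) \<le> norm (x' - x)" if "x' \<in> S" for x'
    using bus_lipschitz[OF E x that] bus_lipschitz[OF E that x] by (simp add: dist_real_def norm_minus_commute)
  then show "\<exists>d>0. \<forall>x'\<in>S. dist x' x < d \<longrightarrow> dist (bus E x') (bus E x) < e"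
    using e by (intro exI[of _ e]) (auto simp: dist_norm intro: le_less_trans)
qed

lemma regularised_min:
  assumes E: "ray_field y E" and u: "u \<in> S" and e: "e > 0"
  obtains x where "x \<in> S" "\<And>v. v \<in> S \<Longrightarrow> bus E x - u \<bullet> x + e / 2 * (norm x)\<^sup>2 \<le> bus E v - u \<bullet> v + e / 2 * (norm v)\<^sup>2"
proof -
  define \<phi> where "\<phi> = (\<lambda>v. bus E v - u \<bullet> v + e / 2 * (norm v)\<^sup>2)"
  \<comment> \<open>Outside this radius the quadratic dominates the linear bound
    \<open>(1 + norm u) * norm v\<close>, so the function is nonnegative there, while it vanishes at
    \<open>0\<close>.\<close>
  define R where "R = 2 * (1 + norm u) / e"
  have R: "R > 0" using e by (simp add: R_def add_pos_nonneg)
  have "continuous_on (S \<inter> cball 0 R) \<phi>"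
    unfolding \<phi>_def by (intro continuous_intros continuous_on_subset[OF continuous_bus[OF E]]) auto
  moreover have "0 \<in> S \<inter> cball 0 R" using R by simp
  then have "S \<inter> cball 0 R \<noteq> {}" by blast
  ultimately obtain x where x: "x \<in> S \<inter> cball 0 R" "\<And>v. v \<in> S \<inter> cball 0 R \<Longrightarrow> \<phi> x \<le> \<phi> v"
    using continuous_attains_inf[OF compact_fin_dim_cball[OF fd]] by blast
  have "\<phi> x \<le> \<phi> v" if v: "v \<in> S" for v
  proof (cases "norm v \<le> R")
    case True
    then show ?thesis using x v by auto
  next
    case False
    have "- norm v \<le> bus E v" using bus_lipschitz[OF E, of 0 v] bus_0[OF E] v by simp
    moreover have "u \<bullet> v \<le> norm u * norm v" by (rule norm_cauchy_schwarz)
    moreover have "(1 + norm u) * norm v \<le> e / 2 * (norm v)\<^sup>2"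
    proof -
      have "2 * (1 + norm u) \<le> e * norm v" using False e by (simp add: R_def pos_divide_less_eq not_le mult.commute)
      then have "2 * (1 + norm u) * norm v \<le> e * norm v * norm v" by (rule mult_right_mono) simp
      moreover have "e / 2 * (norm v)\<^sup>2 = e * norm v * norm v / 2" by (simp add: power2_eq_square)
      ultimately show ?thesis by linarith
    qed
    ultimately have "0 \<le> \<phi> v" by (simp add: \<phi>_def algebra_simps)
    moreover have "\<phi> x \<le> \<phi> 0" using x R by simp
    moreover have "\<phi> 0 = 0" using bus_0[OF E] by (simp add: \<phi>_def)
    ultimately show ?thesis by simp
  qed
  then show thesis using that[of x] x by (simp add: \<phi>_def)
qed

text \<open>First-order optimality without derivatives: minimality is tested along the segment
  towards \<open>v\<close>, convexity bounds \<open>bus\<close>, and after division by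
  \<open>l\<close> the quadratic remainder vanishes with \<open>l\<close>.\<close>

lemma regularised_min_subgrad:
  assumes E: "ray_field y E" and u: "u \<in> S" and e: "e > 0" and x: "x \<in> S"
    and min: "\<And>v. v \<in> S \<Longrightarrow> bus E x - u \<bullet> x + e / 2 * (norm x)\<^sup>2 \<le> bus E v - u \<bullet> v + e / 2 * (norm v)\<^sup>2"
  shows "subgrad E x (u - e *\<^sub>R x)"
  unfolding subgrad_def
proof (intro conjI ballI)
  show "x \<in> S" "u - e *\<^sub>R x \<in> S" using x u by auto
  fix v assume v: "v \<in> S"
  define d where "d = v - x"
  define A where "A = bus E v - bus E x - (u - e *\<^sub>R x) \<bullet> d"
  have "- (e / 2 * l * (norm d)\<^sup>2) \<le> A" if l: "0 < l" "l \<le> 1" for l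
  proof -
    have "bus E ((1 - l) *\<^sub>R x + l *\<^sub>R v) \<le> (1 - l) * bus E x + l * bus E v"
      using bus_convex[OF E x v] l by simp
    moreover have "(1 - l) *\<^sub>R x + l *\<^sub>R v = x + l *\<^sub>R d" by (simp add: d_def algebra_simps)
    ultimately have "bus E (x + l *\<^sub>R d) \<le> bus E x + l * (bus E v - bus E x)" by (simp add: algebra_simps)
    moreover have "bus E x - u \<bullet> x + e / 2 * (norm x)\<^sup>2 \<le> bus E (x + l *\<^sub>R d) - u \<bullet> (x + l *\<^sub>R d) + e / 2 * (norm (x + l *\<^sub>R d))\<^sup>2"
      using x v by (intro min) (simp add: d_def)
    moreover have "(norm (x + l *\<^sub>R d))\<^sup>2 = (norm x)\<^sup>2 + 2 * l * (x \<bullet> d) + l\<^sup>2 * (norm d)\<^sup>2"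
      unfolding power2_norm_eq_inner by (simp add: inner_simps inner_commute power2_eq_square algebra_simps)
    ultimately have "0 \<le> l * (bus E v - bus E x) - l * (u \<bullet> d) + e / 2 * (2 * l * (x \<bullet> d) + l\<^sup>2 * (norm d)\<^sup>2)"
      by (simp add: inner_add_right algebra_simps)
    also have "\<dots> = l * (A + e / 2 * l * (norm d)\<^sup>2)"
      by (simp add: A_def inner_simps power2_eq_square algebra_simps)
    finally show ?thesis using l by (simp add: zero_le_mult_iff)
  qed
  then have ev: "eventually (\<lambda>l. - (e / 2 * l * (norm d)\<^sup>2) \<le> A) (at_right 0)"
    unfolding eventually_at_right_field by (intro exI[of _ 1]) auto
  have "((\<lambda>l. - (e / 2 * l * (norm d)\<^sup>2)) \<longlongrightarrow> - (e / 2 * 0 * (norm d)\<^sup>2)) (at_right 0)" by (intro tendsto_intros)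
  then have "- (e / 2 * 0 * (norm d)\<^sup>2) \<le> A" by (rule tendsto_upperbound[OF _ ev]) simp
  then show "bus E x + (u - e *\<^sub>R x) \<bullet> (v - x) \<le> bus E v" by (simp add: A_def d_def)
qed

lemma subgrad_norm_le:
  assumes E: "ray_field y E" and k: "subgrad E x k"
  shows "norm k \<le> 1"
proof -
  have kS: "k \<in> S" "x \<in> S" using k by (auto simp: subgrad_def)
  have "k \<bullet> k \<le> bus E (x + k) - bus E x" using k kS unfolding subgrad_def by (auto dest!: bspec[of _ _ "x + k"])
  also have "\<dots> \<le> norm k" using bus_lipschitz[OF E, of "x + k" x] kS by simp
  finally have "norm k * norm k \<le> 1 * norm k" by (simp add: power2_norm_eq_inner[symmetric] power2_eq_square)
  then show ?thesis by (cases "k = 0") (auto simp: mult_le_cancel_right)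
qed

lemma subgrad_lineality:
  assumes k: "subgrad E x k" and w: "w \<in> lineality E"
  shows "k \<bullet> w = bus E w"
proof -
  have x: "x \<in> S" and wS: "w \<in> S" using k lineality_S[OF w] by (auto simp: subgrad_def)
  have "k \<bullet> (T *\<^sub>R w) \<le> T * bus E w" for T
    using k x wS linealityD[OF w x, of T] unfolding subgrad_def by (auto dest!: bspec[of _ _ "x + T *\<^sub>R w"])
  from this[of 1] this[of "-1"] show ?thesis by simp
qed

lemma subgrad_monotone:
  assumes "subgrad E x k" "subgrad E x' k'"
  shows "0 \<le> (k - k') \<bullet> (x - x')"
proof -
  have "bus E x + k \<bullet> (x' - x) \<le> bus E x'" "bus E x' + k' \<bullet> (x - x') \<le> bus E x"
    using assms by (auto simp: subgrad_def)
  then show ?thesis by (simp add: inner_simps)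
qed

text \<open>Near every point \<open>p\<close> there is a point with a subgradient, the minimiser of
  \<open>b\<close> plus a steep quadratic centred at \<open>p\<close>. If all these equal
  \<open>k\<close>, the supporting inequality with slope \<open>k\<close> passes to
  \<open>p\<close>, and using it in both directions makes \<open>b\<close> linear.\<close>

lemma unique_subgrad_linear:
  assumes E: "ray_field y E" and k: "k \<in> S" and uniq: "\<And>x k'. subgrad E x k' \<Longrightarrow> k' = k" and v: "v \<in> S"
  shows "bus E v = k \<bullet> v"
proof -
  have le: "bus E p + k \<bullet> (q - p) \<le> bus E q" if p: "p \<in> S" and q: "q \<in> S" for p q
  proof -
    have "bus E p + k \<bullet> (q - p) - 2 * (1 + norm k) / N \<le> bus E q" if N: "N > 0" for N :: real
    proof -
      have NpS: "N *\<^sub>R p \<in> S" using p by simp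
      \<comment> \<open>Up to a constant the function minimised is
        \<open>bus E x + N / 2 * (norm (x - p))\<^sup>2\<close>; the Lipschitz bound then puts
        \<open>x\<close> within \<open>2 / N\<close> of \<open>p\<close>.\<close>
      obtain x where x: "x \<in> S" "\<And>v. v \<in> S \<Longrightarrow> bus E x - (N *\<^sub>R p) \<bullet> x + N / 2 * (norm x)\<^sup>2 \<le> bus E v - (N *\<^sub>R p) \<bullet> v + N / 2 * (norm v)\<^sup>2"
        using regularised_min[OF E NpS N] by blast
      have "subgrad E x (N *\<^sub>R p - N *\<^sub>R x)" by (rule regularised_min_subgrad[OF E NpS N x])
      then have sk: "subgrad E x k" using uniq by metis
      have eq: "(norm (x - p))\<^sup>2 = (norm x)\<^sup>2 - 2 * (p \<bullet> x) + (norm p)\<^sup>2"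
        unfolding power2_norm_eq_inner by (simp add: inner_simps inner_commute)
      have "bus E x + N / 2 * (norm (x - p))\<^sup>2 = (bus E x - (N *\<^sub>R p) \<bullet> x + N / 2 * (norm x)\<^sup>2) + N / 2 * (norm p)\<^sup>2"
        unfolding eq by (simp add: algebra_simps)
      also have "\<dots> \<le> (bus E p - (N *\<^sub>R p) \<bullet> p + N / 2 * (norm p)\<^sup>2) + N / 2 * (norm p)\<^sup>2" using x(2)[OF p] by simp
      also have "\<dots> = bus E p" by (simp add: power2_norm_eq_inner)
      also have "\<dots> \<le> bus E x + norm (x - p)" using bus_lipschitz[OF E p x(1)] by (simp add: norm_minus_commute)
      finally have "(N * norm (x - p)) * norm (x - p) \<le> 2 * norm (x - p)" by (simp add: power2_eq_square)
      then have "N * norm (x - p) \<le> 2" by (cases "norm (x - p) = 0") (auto simp: mult_le_cancel_right)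
      then have xp: "norm (x - p) \<le> 2 / N" using N by (simp add: pos_le_divide_eq mult.commute)
      have "bus E p + k \<bullet> (q - p) \<le> bus E x + norm (x - p) + k \<bullet> (q - x) + k \<bullet> (x - p)"
        using bus_lipschitz[OF E p x(1)] by (simp add: norm_minus_commute inner_simps)
      also have "k \<bullet> (x - p) \<le> norm k * norm (x - p)" by (rule norm_cauchy_schwarz)
      also have "bus E x + norm (x - p) + k \<bullet> (q - x) + norm k * norm (x - p) \<le> bus E q + (1 + norm k) * norm (x - p)"
        using sk q by (auto simp: subgrad_def algebra_simps)
      also have "\<dots> \<le> bus E q + (1 + norm k) * (2 / N)" using xp by (intro add_left_mono mult_left_mono) auto
      finally show ?thesis by (simp add: mult.commute)
    qed
    then have "eventually (\<lambda>N. bus E p + k \<bullet> (q - p) - 2 * (1 + norm k) / N \<le> bus E q) at_top"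
      by (intro eventually_mono[OF eventually_gt_at_top[of 0]])
    moreover have "((\<lambda>N. bus E p + k \<bullet> (q - p) - 2 * (1 + norm k) / N) \<longlongrightarrow> bus E p + k \<bullet> (q - p) - 0) at_top"
      by (intro tendsto_intros tendsto_divide_0[OF tendsto_const] filterlim_at_top_imp_at_infinity filterlim_ident)
    ultimately have "bus E p + k \<bullet> (q - p) - 0 \<le> bus E q"
      using tendsto_upperbound[OF _ _ trivial_limit_at_top_linorder] by blast
    then show ?thesis by simp
  qed
  have "0 + k \<bullet> v \<le> bus E v" "bus E v + k \<bullet> (0 - v) \<le> 0" using le[of 0 v] le[of v 0] v bus_0[OF E] by auto
  then show ?thesis by (simp add: inner_diff_right)
qed

text \<open>Translating a convex Lipschitz function to infinity in the direction \<open>\<zeta>\<close> makes it affine in that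
  direction, with slope the asymptotic slope.\<close>
lemma limit_at_infinity_lineality:
  assumes E: "ray_field y E" and E': "ray_field y' E'" and x: "\<And>k. x k \<in> S" and \<Phi>: "\<Phi> \<noteq> bot"
    and lim: "\<And>v. v \<in> S \<Longrightarrow> ((\<lambda>k. bus E (x k + v) - bus E (x k)) \<longlongrightarrow> bus E' v) \<Phi>"
    and inf: "filterlim (\<lambda>k. norm (x k)) at_top \<Phi>" and \<zeta>: "((\<lambda>k. x k /\<^sub>R norm (x k)) \<longlongrightarrow> \<zeta>) \<Phi>" and \<zeta>S: "\<zeta> \<in> S" "norm \<zeta> = 1"
  shows "\<zeta> \<in> lineality E'"
proof -
  have lip0: "bus E v \<le> norm v" if "v \<in> S" for v
    using bus_lipschitz[OF E that, of 0] bus_0[OF E] by simp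
  \<comment> \<open>The asymptotic slope along \<zeta>; difference quotients from a fixed point
    increase by convexity, so it is their supremum as well as their limit.\<close>
  define h where "h = (SUP s\<in>{0<..}. bus E (s *\<^sub>R \<zeta>) / s)"
  have bdd: "bdd_above ((\<lambda>s. bus E (s *\<^sub>R \<zeta>) / s) ` {0<..})"
  proof (rule bdd_aboveI2[where M = 1])
    fix s :: real assume "s \<in> {0<..}"
    then show "bus E (s *\<^sub>R \<zeta>) / s \<le> 1" using lip0[of "s *\<^sub>R \<zeta>"] \<zeta>S by simp
  qed
  have h_ge: "bus E (s *\<^sub>R \<zeta>) \<le> s * h" if "s > 0" for s
  proof -
    have "bus E (s *\<^sub>R \<zeta>) / s \<le> h" unfolding h_def using that by (intro cSUP_upper bdd) auto
    then show ?thesis using that by (simp add: pos_divide_le_eq mult.commute)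
  qed
  have slope: "T * (bus E (p + s *\<^sub>R \<zeta>) - bus E p) \<ge> s * (bus E (p + T *\<^sub>R \<zeta>) - bus E p)" if "p \<in> S" "0 \<le> T" "T \<le> s" "0 < s" for p T s
  proof -
    have "bus E ((1 - T / s) *\<^sub>R p + (T / s) *\<^sub>R (p + s *\<^sub>R \<zeta>)) \<le> (1 - T / s) * bus E p + (T / s) * bus E (p + s *\<^sub>R \<zeta>)"
      using that \<zeta>S by (intro bus_convex[OF E]) auto
    moreover have "(1 - T / s) *\<^sub>R p + (T / s) *\<^sub>R (p + s *\<^sub>R \<zeta>) = p + T *\<^sub>R \<zeta>"
      using that by (simp add: algebra_simps)
    ultimately show ?thesis using that by (simp add: field_simps)
  qed
  \<comment> \<open>Changing the line by a parallel displacement \<open>p\<close> alters quotients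
    over length \<open>s\<close> by at most \<open>2 * norm p / s\<close>, so no parallel line
    exceeds the slope \<open>h\<close>.\<close>
  have up: "bus E (p + T *\<^sub>R \<zeta>) - bus E p \<le> T * h" if p: "p \<in> S" and T: "T \<ge> 0" for p T
  proof -
    have "bus E (p + T *\<^sub>R \<zeta>) - bus E p \<le> T * h + 2 * T * norm p / s" if s: "s \<ge> max T 1" for s
    proof -
      have s': "T \<le> s" "0 < s" using s by auto
      have "bus E (p + s *\<^sub>R \<zeta>) \<le> bus E (s *\<^sub>R \<zeta>) + norm p"
        using bus_lipschitz[OF E, of "p + s *\<^sub>R \<zeta>" "s *\<^sub>R \<zeta>"] p \<zeta>S by simp
      moreover have "- bus E p \<le> norm p" using bus_lipschitz[OF E, of 0 p] p bus_0[OF E] by simp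
      ultimately have "bus E (p + s *\<^sub>R \<zeta>) - bus E p \<le> s * h + 2 * norm p" using h_ge[OF s'(2)] by linarith
      then have "s * (bus E (p + T *\<^sub>R \<zeta>) - bus E p) \<le> T * (s * h + 2 * norm p)"
        using slope[OF p T s'] T by (meson mult_left_mono order_trans)
      then have "bus E (p + T *\<^sub>R \<zeta>) - bus E p \<le> T * (s * h + 2 * norm p) / s" using s' by (simp add: pos_le_divide_eq mult.commute)
      also have "\<dots> = T * h + 2 * T * norm p / s" using s' by (simp add: field_simps)
      finally show ?thesis .
    qed
    then have "eventually (\<lambda>s. bus E (p + T *\<^sub>R \<zeta>) - bus E p \<le> T * h + 2 * T * norm p / s) at_top"
      by (intro eventually_mono[OF eventually_ge_at_top])
    moreover have "((\<lambda>s. T * h + 2 * T * norm p / s) \<longlongrightarrow> T * h + 0) at_top"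
      by (intro tendsto_intros tendsto_divide_0[OF tendsto_const] filterlim_at_top_imp_at_infinity filterlim_ident)
    ultimately show ?thesis using tendsto_lowerbound[OF _ _ trivial_limit_at_top_linorder, of _ "T * h + 0"] by simp
  qed
  have hlim: "h - e < bus E (s *\<^sub>R \<zeta>) / s" if "e > 0" and s0: "h - e < bus E (s0 *\<^sub>R \<zeta>) / s0" "0 < s0" "s0 \<le> s" for e s0 s
  proof -
    have "s0 * bus E (s *\<^sub>R \<zeta>) \<ge> s * bus E (s0 *\<^sub>R \<zeta>)" using slope[of 0 s0 s] that bus_0[OF E] by simp
    then have "bus E (s0 *\<^sub>R \<zeta>) / s0 \<le> bus E (s *\<^sub>R \<zeta>) / s" using that by (simp add: field_simps)
    then show ?thesis using s0 by simp
  qed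
  have htend: "((\<lambda>s. bus E (s *\<^sub>R \<zeta>) / s) \<longlongrightarrow> h) at_top"
  proof (rule tendstoI)
    fix e :: real assume e: "e > 0"
    have "h - e < (SUP s\<in>{0<..}. bus E (s *\<^sub>R \<zeta>) / s)" using e by (simp add: h_def)
    then have "\<exists>s0\<in>{0<..}. h - e < bus E (s0 *\<^sub>R \<zeta>) / s0"
      by (subst (asm) less_cSUP_iff[OF _ bdd]) auto
    then obtain s0 where s0: "0 < s0" "h - e < bus E (s0 *\<^sub>R \<zeta>) / s0" by auto
    show "eventually (\<lambda>s. dist (bus E (s *\<^sub>R \<zeta>) / s) h < e) at_top"
      using eventually_ge_at_top[of s0]
    proof eventually_elim
      case (elim s)
      then have "bus E (s *\<^sub>R \<zeta>) / s \<le> h" using h_ge[of s] s0 by (simp add: pos_divide_le_eq mult.commute)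
      then show ?case using hlim[OF e s0(2,1) elim] by (simp add: dist_real_def)
    qed
  qed
  have low: "T * h \<le> bus E' (v + T *\<^sub>R \<zeta>) - bus E' v" if v: "v \<in> S" and T: "T \<ge> 0" for v T
  proof -
    define M where "M = (\<lambda>k. norm (x k))"
    define g where "g = (\<lambda>k. T * (bus E (M k *\<^sub>R \<zeta>) / M k - 2 * (norm v / M k) - 2 * norm (x k /\<^sub>R M k - \<zeta>)))"
    have "((\<lambda>k. bus E (M k *\<^sub>R \<zeta>) / M k) \<longlongrightarrow> h) \<Phi>"
      using filterlim_compose[OF htend inf] by (simp add: M_def)
    moreover have "((\<lambda>k. norm v / M k) \<longlongrightarrow> 0) \<Phi>"
      unfolding M_def by (rule tendsto_divide_0[OF tendsto_const filterlim_at_top_imp_at_infinity[OF inf]])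
    moreover have "((\<lambda>k. norm (x k /\<^sub>R M k - \<zeta>)) \<longlongrightarrow> 0) \<Phi>"
      using \<zeta> unfolding M_def by (metis LIM_zero tendsto_norm_zero)
    ultimately have "(g \<longlongrightarrow> T * (h - 2 * 0 - 2 * 0)) \<Phi>" unfolding g_def by (intro tendsto_intros)
    moreover have "((\<lambda>k. (bus E (x k + (v + T *\<^sub>R \<zeta>)) - bus E (x k)) - (bus E (x k + v) - bus E (x k))) \<longlongrightarrow> bus E' (v + T *\<^sub>R \<zeta>) - bus E' v) \<Phi>"
      using v \<zeta>S by (intro tendsto_diff lim) auto
    moreover have "eventually (\<lambda>k. g k \<le> (bus E (x k + (v + T *\<^sub>R \<zeta>)) - bus E (x k)) - (bus E (x k + v) - bus E (x k))) \<Phi>"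
    proof -
      have "eventually (\<lambda>k. M k > 0) \<Phi>" unfolding M_def by (rule filterlim_at_top_dense[THEN iffD1, rule_format, OF inf])
      then show ?thesis
      proof eventually_elim
        case (elim k)
        define p where "p = x k + v"
        \<comment> \<open>Going back from \<open>p\<close> by \<open>M k\<close> along \<zeta> ends
          at a point whose norm is small compared with \<open>M k\<close>. The chord from there to
          \<open>p\<close> has slope nearly \<open>h\<close>, and convexity carries this slope
          beyond \<open>p\<close>.\<close>
        define q where "q = p - M k *\<^sub>R \<zeta>"
        have pS: "p \<in> S" and qS: "q \<in> S" using x v \<zeta>S by (auto simp: p_def q_def)
        have "x k - M k *\<^sub>R \<zeta> = M k *\<^sub>R (x k /\<^sub>R M k - \<zeta>)" using elim by (simp add: scaleR_diff_right)
        then have "q = v + M k *\<^sub>R (x k /\<^sub>R M k - \<zeta>)" by (simp add: q_def p_def)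
        then have nq: "norm q \<le> norm v + M k * norm (x k /\<^sub>R M k - \<zeta>)"
          using norm_triangle_ineq[of v "M k *\<^sub>R (x k /\<^sub>R M k - \<zeta>)"] elim by simp
        have qp: "q + M k *\<^sub>R \<zeta> = p" by (simp add: q_def)
        have "bus E q \<le> norm q" using lip0[OF qS] .
        moreover have "bus E (M k *\<^sub>R \<zeta>) \<le> bus E p + norm q"
          using bus_lipschitz[OF E, of "M k *\<^sub>R \<zeta>" p] pS \<zeta>S by (simp add: q_def norm_minus_commute)
        ultimately have 1: "bus E (M k *\<^sub>R \<zeta>) - 2 * norm q \<le> bus E p - bus E q" by linarith
        have qT: "q + (M k + T) *\<^sub>R \<zeta> = p + T *\<^sub>R \<zeta>" by (simp add: q_def scaleR_add_left)
        have "(M k + T) * (bus E p - bus E q) \<le> M k * (bus E (p + T *\<^sub>R \<zeta>) - bus E q)"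
          using slope[OF qS, of "M k" "M k + T"] elim T unfolding qp qT by simp
        then have "T * (bus E p - bus E q) \<le> M k * (bus E (p + T *\<^sub>R \<zeta>) - bus E p)"
          by (simp add: algebra_simps)
        then have "T * (bus E (M k *\<^sub>R \<zeta>) - 2 * norm q) \<le> M k * (bus E (p + T *\<^sub>R \<zeta>) - bus E p)"
          using 1 T by (meson mult_left_mono order_trans)
        moreover have "T * (bus E (M k *\<^sub>R \<zeta>) - 2 * (norm v + M k * norm (x k /\<^sub>R M k - \<zeta>))) \<le> T * (bus E (M k *\<^sub>R \<zeta>) - 2 * norm q)"
          using nq T by (intro mult_left_mono) auto
        moreover have "M k * g k = T * (bus E (M k *\<^sub>R \<zeta>) - 2 * (norm v + M k * norm (x k /\<^sub>R M k - \<zeta>)))"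
          using elim unfolding g_def by (simp add: field_simps)
        ultimately have "M k * g k \<le> M k * (bus E (p + T *\<^sub>R \<zeta>) - bus E p)" by linarith
        then have "g k \<le> bus E (p + T *\<^sub>R \<zeta>) - bus E p" using elim by (simp add: mult_le_cancel_left)
        then show ?case by (simp add: p_def add.assoc)
      qed
    qed
    ultimately have "T * (h - 2 * 0 - 2 * 0) \<le> bus E' (v + T *\<^sub>R \<zeta>) - bus E' v"
      by (intro tendsto_le[OF \<Phi>])
    then show ?thesis by simp
  qed
  have hi: "bus E' (v + T *\<^sub>R \<zeta>) - bus E' v \<le> T * h" if v: "v \<in> S" and T: "T \<ge> 0" for v T
  proof -
    have "((\<lambda>k. (bus E (x k + (v + T *\<^sub>R \<zeta>)) - bus E (x k)) - (bus E (x k + v) - bus E (x k))) \<longlongrightarrow> bus E' (v + T *\<^sub>R \<zeta>) - bus E' v) \<Phi>"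
      using v \<zeta>S by (intro tendsto_diff lim) auto
    moreover have "(bus E (x k + (v + T *\<^sub>R \<zeta>)) - bus E (x k)) - (bus E (x k + v) - bus E (x k)) \<le> T * h" for k
      using up[of "x k + v" T] x v T by (simp add: add.assoc)
    ultimately show ?thesis using tendsto_upperbound[OF _ _ \<Phi>] by (metis (no_types, lifting) always_eventually)
  qed
  have pos: "bus E' (v + T *\<^sub>R \<zeta>) = bus E' v + T * h" if "v \<in> S" "T \<ge> 0" for v T
    using low[OF that] hi[OF that] by linarith
  have all: "bus E' (v + T *\<^sub>R \<zeta>) = bus E' v + T * h" if v: "v \<in> S" for v T
  proof (cases "T \<ge> 0")
    case True
    then show ?thesis using pos v by blast
  next
    case False
    then show ?thesis using pos[of "v + T *\<^sub>R \<zeta>" "- T"] v \<zeta>S by simp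
  qed
  have "bus E' \<zeta> = h" using all[of 0 1] bus_0[OF E'] by simp
  then show ?thesis using all \<zeta>S by (simp add: lineality_def)
qed

end

section \<open>Rigid boundary points\<close>

context morse_flat_space
begin

text \<open>On the cosets of \<open>W\<close> the Busemann function is affine with gradient \<open>c\<close>; transversally to \<open>W\<close> it grows
  as fast as its Lipschitz constant permits.\<close>
definition rigid :: "'v \<Rightarrow> ('v \<Rightarrow> real \<Rightarrow> 'a) \<Rightarrow> 'v set \<Rightarrow> 'v \<Rightarrow> bool" where
  "rigid y E W c \<longleftrightarrow> ray_field y E \<and> subspace W \<and> W \<subseteq> S \<and> c \<in> W \<and> norm c < 1 \<and>
     (\<forall>v\<in>S. \<forall>w\<in>W. bus E (v + w) = bus E v + c \<bullet> w) \<and>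
     (\<forall>e>0. \<exists>C. \<forall>\<nu>\<in>S. norm \<nu> = 1 \<longrightarrow> (\<forall>w\<in>W. \<nu> \<bullet> w = 0) \<longrightarrow>
        (\<forall>s\<ge>0. (sqrt (1 - (norm c)\<^sup>2) - e) * s - C \<le> bus E (s *\<^sub>R \<nu>)))"

section \<open>Existence of rigid limits\<close>

definition linear_bus :: "('v \<Rightarrow> real \<Rightarrow> 'a) \<Rightarrow> bool" where
  "linear_bus E \<longleftrightarrow> (\<exists>c\<in>S. \<forall>v\<in>S. bus E v = c \<bullet> v)"

lemma nonlinear_two_subgrads:
  assumes E: "ray_field y E" and nl: "\<not> linear_bus E"
  shows "\<exists>x1 k1 x2 k2. subgrad E x1 k1 \<and> subgrad E x2 k2 \<and> k1 \<noteq> k2"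
proof (rule ccontr)
  assume neg: "\<not> ?thesis"
  obtain x where x: "x \<in> S" "\<And>v. v \<in> S \<Longrightarrow> bus E x - 0 \<bullet> x + 1 / 2 * (norm x)\<^sup>2 \<le> bus E v - 0 \<bullet> v + 1 / 2 * (norm v)\<^sup>2"
    by (rule regularised_min[OF E, of 0 1]) auto
  have "subgrad E x (0 - 1 *\<^sub>R x)" by (rule regularised_min_subgrad[OF E _ _ x]) auto
  then obtain k where k: "subgrad E x k" by blast
  then have kS: "k \<in> S" by (simp add: subgrad_def)
  have "bus E v = k \<bullet> v" if "v \<in> S" for v
    by (rule unique_subgrad_linear[OF E kS _ that]) (use neg k in blast)
  then show False using nl kS by (auto simp: linear_bus_def)
qed

lemma norm_midpoint_less:
  fixes k1 k2 :: 'v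
  assumes "norm k1 \<le> 1" "norm k2 \<le> 1" "k1 \<noteq> k2"
  shows "norm ((1/2) *\<^sub>R (k1 + k2)) < 1"
proof -
  have "(norm (k1 + k2))\<^sup>2 + (norm (k1 - k2))\<^sup>2 = 2 * (norm k1)\<^sup>2 + 2 * (norm k2)\<^sup>2"
    unfolding power2_norm_eq_inner by (simp add: inner_simps)
  moreover have "(norm k1)\<^sup>2 \<le> 1" "(norm k2)\<^sup>2 \<le> 1" using assms by (auto simp: power_le_one)
  moreover have "0 < (norm (k1 - k2))\<^sup>2" using assms(3) by simp
  ultimately have "(norm (k1 + k2))\<^sup>2 < 4" by linarith
  then have "(norm (k1 + k2))\<^sup>2 < 2\<^sup>2" by simp
  then have "norm (k1 + k2) < 2" by (rule power_less_imp_less_base) simp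
  then show ?thesis by simp
qed

lemma halfspace_closed_convex: "closed {k::'v. a \<bullet> k \<le> b}" "convex {k::'v. a \<bullet> k \<le> b}"
  by (intro closed_Collect_le continuous_intros) (rule convex_halfspace_le)

text \<open>The set of all subgradients need be neither closed nor convex; its closed convex hull is
  accessible through the half-spaces that contain every subgradient.\<close>

definition subgrad_hull :: "('v \<Rightarrow> real \<Rightarrow> 'a) \<Rightarrow> 'v set" where
  "subgrad_hull E = closure (convex hull {k. \<exists>x. subgrad E x k})"

lemma subgrad_hull_le:
  assumes "\<And>x k. subgrad E x k \<Longrightarrow> a \<bullet> k \<le> b" "k \<in> subgrad_hull E"
  shows "a \<bullet> k \<le> b"
proof -
  have "convex hull {k. \<exists>x. subgrad E x k} \<subseteq> {k. a \<bullet> k \<le> b}"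
    using assms(1) by (intro hull_minimal halfspace_closed_convex) auto
  then have "subgrad_hull E \<subseteq> {k. a \<bullet> k \<le> b}"
    unfolding subgrad_hull_def by (intro closure_minimal halfspace_closed_convex)
  then show ?thesis using assms(2) by blast
qed

lemma subgrad_in_hull: "subgrad E x k \<Longrightarrow> k \<in> subgrad_hull E"
  unfolding subgrad_hull_def by (intro closure_subset[THEN subsetD] hull_inc) blast

text \<open>A point \<open>u\<close> outside the closed hull of the subgradients is approached by regularised minimisers that
  escape to infinity, and their subgradients converge to the projection of \<open>u\<close> to the hull.\<close>
lemma outside_hull_limit:
  assumes E: "ray_field y E" and u: "u \<in> S" "u \<notin> subgrad_hull E" "\<And>w. w \<in> lineality E \<Longrightarrow> u \<bullet> w = bus E w"
  obtains E' k' \<zeta> where "translate_limit E E'" "k' \<in> S" "\<And>v. v \<in> S \<Longrightarrow> k' \<bullet> v \<le> bus E' v"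
    "\<zeta> \<in> lineality E'" "\<zeta> \<notin> lineality E" "\<And>k. k \<in> subgrad_hull E \<Longrightarrow> norm (k' - k) \<le> norm (u - k)"
proof -
  define \<epsilon> where "\<epsilon> = (\<lambda>j::nat. 1 / (real j + 1))"
  have \<epsilon>: "\<epsilon> j > 0" for j by (simp add: \<epsilon>_def)
  have "\<exists>x. x \<in> S \<and> subgrad E x (u - \<epsilon> j *\<^sub>R x)" for j
    using regularised_min[OF E u(1) \<epsilon>[of j]] regularised_min_subgrad[OF E u(1) \<epsilon>[of j]] by metis
  then obtain x where x: "\<And>j. x j \<in> S" "\<And>j. subgrad E (x j) (u - \<epsilon> j *\<^sub>R x j)" by metis
  define k where "k = (\<lambda>j. u - \<epsilon> j *\<^sub>R x j)"
  have k: "subgrad E (x j) (k j)" for j using x(2) by (simp add: k_def)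
  have kS: "k j \<in> S" and kn: "norm (k j) \<le> 1" for j
    using k[of j] subgrad_norm_le[OF E k] by (auto simp: subgrad_def)
  have "closed (subgrad_hull E)" by (simp add: subgrad_hull_def)
  then have "open (- subgrad_hull E)" by (simp add: open_Compl)
  then obtain \<delta> where \<delta>: "\<delta> > 0" "ball u \<delta> \<subseteq> - subgrad_hull E" using u(2) by (meson ComplI openE)
  \<comment> \<open>The subgradient \<open>k j\<close> belongs to the hull and so differs from
    \<open>u\<close> by at least \<delta>; this difference is the minimiser scaled by
    \<open>\<epsilon> j\<close>.\<close>
  have far: "\<delta> * (real j + 1) \<le> norm (x j)" for j
  proof -
    have "k j \<notin> ball u \<delta>" using \<delta>(2) subgrad_in_hull[OF k[of j]] by blast
    then have "\<delta> \<le> norm (\<epsilon> j *\<^sub>R x j)" by (simp add: dist_norm k_def)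
    then show ?thesis using \<epsilon>[of j] by (simp add: \<epsilon>_def field_simps)
  qed
  have xpos: "norm (x j) > 0" for j using far[of j] \<delta>(1) by (metis less_le_trans mult_pos_pos of_nat_0_le_iff add_nonneg_pos zero_less_one)
  \<comment> \<open>Since \<open>u\<close> agrees with \<open>b\<close> on the old lineality space,
    the minimisers are orthogonal to it, and their limiting direction is new.\<close>
  have perp: "x j \<bullet> w = 0" if w: "w \<in> lineality E" for j w
  proof -
    have "k j \<bullet> w = u \<bullet> w" using subgrad_lineality[OF k w] u(3)[OF w] by simp
    then show ?thesis using \<epsilon>[of j] by (simp add: k_def inner_diff_left)
  qed
  define K where "K = (S \<inter> cball 0 1) \<times> (S \<inter> cball (0::'v) 1)"
  have "compact K" unfolding K_def by (intro compact_Times compact_fin_dim_cball[OF fd])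
  moreover have "\<forall>j. (k j, x j /\<^sub>R norm (x j)) \<in> K" using kS kn x(1) xpos by (auto simp: K_def)
  ultimately obtain l \<sigma> where l: "l \<in> K" "strict_mono (\<sigma> :: nat \<Rightarrow> nat)" "((\<lambda>j. (k j, x j /\<^sub>R norm (x j))) \<circ> \<sigma>) \<longlonglongrightarrow> l"
    using compact_imp_seq_compact seq_compact_def by (metis (no_types, lifting) seq_compactE)
  define k' \<zeta> where "k' = fst l" and "\<zeta> = snd l"
  have k'S: "k' \<in> S" and \<zeta>S: "\<zeta> \<in> S" using l(1) by (auto simp: K_def k'_def \<zeta>_def)
  have klim: "(\<lambda>j. k (\<sigma> j)) \<longlonglongrightarrow> k'" and \<zeta>lim: "(\<lambda>j. x (\<sigma> j) /\<^sub>R norm (x (\<sigma> j))) \<longlonglongrightarrow> \<zeta>"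
    using tendsto_fst[OF l(3)] tendsto_snd[OF l(3)] by (auto simp: o_def k'_def \<zeta>_def)
  have \<zeta>n: "norm \<zeta> = 1"
  proof -
    have "(\<lambda>j. norm (x (\<sigma> j) /\<^sub>R norm (x (\<sigma> j)))) \<longlonglongrightarrow> norm \<zeta>" by (rule tendsto_norm[OF \<zeta>lim])
    moreover have "(\<lambda>j. norm (x (\<sigma> j) /\<^sub>R norm (x (\<sigma> j)))) = (\<lambda>j. 1)" using xpos by simp
    ultimately have "(\<lambda>j::nat. 1::real) \<longlonglongrightarrow> norm \<zeta>" by (simp only:)
    then show ?thesis using LIMSEQ_unique tendsto_const by blast
  qed
  have \<zeta>perp: "\<zeta> \<bullet> w = 0" if "w \<in> lineality E" for w
  proof -
    have "(\<lambda>j. (x (\<sigma> j) /\<^sub>R norm (x (\<sigma> j))) \<bullet> w) \<longlonglongrightarrow> \<zeta> \<bullet> w" by (intro tendsto_intros \<zeta>lim)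
    moreover have "(\<lambda>j. (x (\<sigma> j) /\<^sub>R norm (x (\<sigma> j))) \<bullet> w) = (\<lambda>j. 0)" using perp[OF that] by simp
    ultimately have "(\<lambda>j::nat. 0::real) \<longlonglongrightarrow> \<zeta> \<bullet> w" by (simp only:)
    then show ?thesis using LIMSEQ_unique tendsto_const by blast
  qed
  have xs: "x (\<sigma> j) \<in> S" for j using x(1) .
  obtain \<Phi> E' where \<Phi>: "\<Phi> \<le> sequentially" "\<Phi> \<noteq> bot" "translate_limit E E'"
    "\<And>v. v \<in> S \<Longrightarrow> ((\<lambda>j. bus E (x (\<sigma> j) + v) - bus E (x (\<sigma> j))) \<longlongrightarrow> bus E' v) \<Phi>"
    by (rule translate_limit_exists[OF E xs]) (rule that)
  obtain y' where E': "ray_field y' E'" using \<Phi>(3) by (auto simp: translate_limit_def)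
  have "filterlim (\<lambda>j. norm (x j)) at_top sequentially"
  proof (rule filterlim_at_top_mono)
    show "filterlim (\<lambda>j. \<delta> * real j) at_top sequentially"
      by (rule filterlim_tendsto_pos_mult_at_top[OF tendsto_const \<delta>(1) filterlim_real_sequentially])
    have "\<delta> * real j \<le> norm (x j)" for j using far[of j] \<delta>(1) by (simp add: distrib_left)
    then show "eventually (\<lambda>j. \<delta> * real j \<le> norm (x j)) sequentially" by simp
  qed
  then have "filterlim (\<lambda>j. norm (x (\<sigma> j))) at_top sequentially"
    by (rule filterlim_compose) (rule filterlim_subseq[OF l(2)])
  then have inf: "filterlim (\<lambda>j. norm (x (\<sigma> j))) at_top \<Phi>" by (rule filterlim_mono[OF _ order_refl \<Phi>(1)])
  have "\<zeta> \<in> lineality E'"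
    by (rule limit_at_infinity_lineality[OF E E' xs \<Phi>(2,4) inf tendsto_mono[OF \<Phi>(1) \<zeta>lim] \<zeta>S \<zeta>n])
  moreover have "\<zeta> \<notin> lineality E" using \<zeta>perp[of \<zeta>] \<zeta>n by (auto simp: norm_eq_1)
  moreover have "k' \<bullet> v \<le> bus E' v" if v: "v \<in> S" for v
  proof (rule tendsto_le[OF \<Phi>(2) \<Phi>(4)[OF v]])
    show "((\<lambda>j. k (\<sigma> j) \<bullet> v) \<longlongrightarrow> k' \<bullet> v) \<Phi>" by (intro tendsto_intros tendsto_mono[OF \<Phi>(1) klim])
    have "k (\<sigma> j) \<bullet> v \<le> bus E (x (\<sigma> j) + v) - bus E (x (\<sigma> j))" for j
      using k[of "\<sigma> j"] x(1) v unfolding subgrad_def by (auto dest!: bspec[of _ _ "x (\<sigma> j) + v"])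
    then show "eventually (\<lambda>j. k (\<sigma> j) \<bullet> v \<le> bus E (x (\<sigma> j) + v) - bus E (x (\<sigma> j))) \<Phi>" by simp
  qed
  moreover have "norm (k' - a) \<le> norm (u - a)" if a: "a \<in> subgrad_hull E" for a
  proof -
    \<comment> \<open>Monotonicity of subgradients between \<open>x (\<sigma> j)\<close> and
      \<open>p\<close>, multiplied by \<open>\<epsilon> (\<sigma> j)\<close>, loses its dependence
      on \<open>p\<close> in the limit. What remains is the variational inequality for the nearest
      point of the hull.\<close>
    have mono: "(u - k') \<bullet> b \<le> (u - k') \<bullet> k'" if b: "subgrad E p b" for p b
    proof -
      have "0 \<le> (k j - b) \<bullet> (u - k j) - \<epsilon> j * ((k j - b) \<bullet> p)" for j
      proof -
        have "0 \<le> \<epsilon> j * ((k j - b) \<bullet> (x j - p))" using subgrad_monotone[OF k[of j] b] \<epsilon>[of j] by simp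
        also have "\<dots> = (k j - b) \<bullet> (\<epsilon> j *\<^sub>R x j) - \<epsilon> j * ((k j - b) \<bullet> p)" by (simp add: inner_diff_right right_diff_distrib)
        also have "\<epsilon> j *\<^sub>R x j = u - k j" by (simp add: k_def)
        finally show ?thesis .
      qed
      then have nn: "0 \<le> (k (\<sigma> j) - b) \<bullet> (u - k (\<sigma> j)) - \<epsilon> (\<sigma> j) * ((k (\<sigma> j) - b) \<bullet> p)" for j by blast
      have "(\<lambda>j. \<epsilon> j) \<longlonglongrightarrow> 0" unfolding \<epsilon>_def using LIMSEQ_inverse_real_of_nat by (simp add: inverse_eq_divide add.commute)
      then have "(\<lambda>j. \<epsilon> (\<sigma> j)) \<longlonglongrightarrow> 0" using LIMSEQ_subseq_LIMSEQ[OF _ l(2)] by (auto simp: o_def)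
      then have "(\<lambda>j. (k (\<sigma> j) - b) \<bullet> (u - k (\<sigma> j)) - \<epsilon> (\<sigma> j) * ((k (\<sigma> j) - b) \<bullet> p)) \<longlonglongrightarrow> (k' - b) \<bullet> (u - k') - 0 * ((k' - b) \<bullet> p)"
        by (intro tendsto_intros klim)
      then have "0 \<le> (k' - b) \<bullet> (u - k') - 0 * ((k' - b) \<bullet> p)"
        by (rule LIMSEQ_le_const) (use nn in blast)
      then show ?thesis by (simp add: inner_simps inner_commute)
    qed
    have "(u - k') \<bullet> a \<le> (u - k') \<bullet> k'" using subgrad_hull_le[OF mono a] .
    then have "(k' - a) \<bullet> (k' - a) \<le> (k' - a) \<bullet> (u - a)" by (simp add: inner_simps inner_commute)
    also have "\<dots> \<le> norm (k' - a) * norm (u - a)" by (rule norm_cauchy_schwarz)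
    finally have "norm (k' - a) * norm (k' - a) \<le> norm (k' - a) * norm (u - a)"
      by (simp add: power2_norm_eq_inner[symmetric] power2_eq_square)
    then show ?thesis by (cases "norm (k' - a) = 0") (auto simp: mult_le_cancel_left)
  qed
  ultimately show thesis using that \<Phi>(3) k'S by blast
qed

text \<open>Among nonaffine limits one with the largest lineality space is rigid. A further limit
  that gains a direction must be affine, so the Morse condition gives it a unit gradient; this
  excludes gaps in the hull inside the unit ball.\<close>

lemma rigid_limit_exists:
  assumes E: "ray_field y E" and nl: "\<not> linear_bus E"
  obtains y' E' W c where "translate_limit E E'" "rigid y' E' W c"
proof -
  define P where "P = (\<lambda>E'. translate_limit E E' \<and> \<not> linear_bus E')"
  have PE: "P E" using translate_limit_refl[OF E] nl by (simp add: P_def)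
  have bound: "dim (lineality E') \<le> dim S" if PE': "P E'" for E'
  proof (cases "lineality E' = S")
    case False
    obtain y' where "ray_field y' E'" using PE' by (auto simp: P_def translate_limit_def)
    then show ?thesis using dim_psubset_fin_dim[OF fd subspace_lineality] False lineality_S[of _ E'] by (metis less_imp_le psubsetI subsetI)
  qed simp
  have "\<exists>E'. P E' \<and> (\<forall>E''. P E'' \<longrightarrow> dim (lineality E'') \<le> dim (lineality E'))"
    using PE by (rule ex_has_greatest_nat[of P E "\<lambda>E'. dim (lineality E')" "Suc (dim S)"]) (simp add: bound less_Suc_eq_le)
  then obtain E' where E': "P E'" "\<And>E''. P E'' \<Longrightarrow> dim (lineality E'') \<le> dim (lineality E')" by blast
  have tl: "translate_limit E E'" and nl': "\<not> linear_bus E'" using E'(1) by (auto simp: P_def)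
  obtain y' where rf: "ray_field y' E'" using tl by (auto simp: translate_limit_def)
  define W where "W = lineality E'"
  have subW: "subspace W" and WS: "W \<subseteq> S" using subspace_lineality[OF rf] lineality_S by (auto simp: W_def)
  obtain c where c: "c \<in> W" "\<And>w. w \<in> W \<Longrightarrow> bus E' w = c \<bullet> w" using lineality_riesz[OF rf] unfolding W_def by blast
  obtain x1 k1 x2 k2 where k: "subgrad E' x1 k1" "subgrad E' x2 k2" "k1 \<noteq> k2" using nonlinear_two_subgrads[OF rf nl'] by blast
  have kc: "norm k \<le> 1" "k \<in> S" "\<And>w. w \<in> W \<Longrightarrow> k \<bullet> w = c \<bullet> w" if "subgrad E' x k" for x k
    using subgrad_norm_le[OF rf that] subgrad_lineality[OF that] that c(2) by (auto simp: W_def subgrad_def)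
  have kc2: "(norm k)\<^sup>2 = (norm c)\<^sup>2 + (norm (k - c))\<^sup>2" if "subgrad E' x k" for x k
    using kc(3)[OF that c(1)] unfolding power2_norm_eq_inner by (simp add: inner_simps inner_commute)
  have nc: "norm c < 1"
  proof -
    obtain x k where xk: "subgrad E' x k" "k \<noteq> c" using k by metis
    have "0 < (norm (k - c))\<^sup>2" using xk by simp
    moreover have "(norm k)\<^sup>2 \<le> 1" using kc(1)[OF xk(1)] by (simp add: power_le_one)
    ultimately have "(norm c)\<^sup>2 < 1" using kc2[OF xk(1)] by linarith
    then show ?thesis by (simp add: power_less_one_iff abs_square_less_1)
  qed
  define r where "r = sqrt (1 - (norm c)\<^sup>2)"
  have "(norm c)\<^sup>2 < 1" using nc by (simp add: abs_square_less_1)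
  then have r: "r > 0" "r\<^sup>2 = 1 - (norm c)\<^sup>2" by (auto simp: r_def)
  have ball: "u \<in> subgrad_hull E'" if u: "u \<in> S" "norm u < 1" "\<And>w. w \<in> W \<Longrightarrow> u \<bullet> w = c \<bullet> w" for u
  proof (rule ccontr)
    assume out: "u \<notin> subgrad_hull E'"
    \<comment> \<open>The midpoint of two distinct subgradients lies in the hull and strictly inside
      the unit ball. The segment from it to \<open>u\<close> therefore stays inside the ball and has
      a last point in the hull.\<close>
    define u0 where "u0 = (1/2) *\<^sub>R (k1 + k2)"
    have u0: "norm u0 < 1" "u0 \<in> S" "\<And>w. w \<in> W \<Longrightarrow> u0 \<bullet> w = c \<bullet> w"
      using norm_midpoint_less[OF kc(1)[OF k(1)] kc(1)[OF k(2)] k(3)] kc(2,3)[OF k(1)] kc(2,3)[OF k(2)]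
      by (auto simp: u0_def inner_add_left)
    have convK: "convex (subgrad_hull E')" unfolding subgrad_hull_def by (intro convex_closure convex_convex_hull)
    have "u0 \<in> subgrad_hull E'"
      using convexD[OF convK subgrad_in_hull[OF k(1)] subgrad_in_hull[OF k(2)], of "1/2" "1/2"] by (simp add: u0_def scaleR_add_right)
    define q where "q = (\<lambda>s::real. u0 + s *\<^sub>R (u - u0))"
    define A where "A = {s\<in>{0..1}. q s \<in> subgrad_hull E'}"
    have "closed A"
    proof -
      have "closed (q -` subgrad_hull E' \<inter> {0..1})"
        unfolding q_def by (intro continuous_closed_preimage continuous_intros) (auto simp: subgrad_hull_def Int_commute)
      moreover have "A = q -` subgrad_hull E' \<inter> {0..1}" by (auto simp: A_def)
      ultimately show ?thesis by simp
    qed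
    moreover have "0 \<in> A" using \<open>u0 \<in> subgrad_hull E'\<close> by (simp add: A_def q_def)
    moreover have bddA: "bdd_above A" by (auto simp: A_def bdd_above_def)
    ultimately have sA: "Sup A \<in> A" by (intro closed_contains_Sup) auto
    define s where "s = Sup A"
    have s: "0 \<le> s" "s \<le> 1" "q s \<in> subgrad_hull E'" using sA by (auto simp: A_def s_def)
    have "s \<noteq> 1" using s(3) out by (auto simp: q_def)
    then have s1: "s < 1" using s by simp
    have qn: "norm (q \<tau>) < 1" if "0 \<le> \<tau>" "\<tau> \<le> 1" for \<tau>
    proof -
      have "q \<tau> = (1 - \<tau>) *\<^sub>R u0 + \<tau> *\<^sub>R u" by (simp add: q_def algebra_simps)
      then have "q \<tau> \<in> ball 0 1" using convexD[OF convex_ball, of u0 0 1 u "1 - \<tau>" \<tau>] u0 u that by simp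
      then show ?thesis by simp
    qed
    \<comment> \<open>The point just outside is so close to \<open>q s\<close> that its nearest
      point in the hull, no farther from \<open>q s\<close>, still has norm less than one.\<close>
    define \<eta> where "\<eta> = min (1 - s) ((1 - norm (q s)) / (2 * (norm (u - u0) + 1)))"
    have np: "0 < norm (u - u0) + 1" by (simp add: add_nonneg_pos)
    have \<eta>: "0 < \<eta>" "s + \<eta> \<le> 1" "\<eta> * norm (u - u0) < 1 - norm (q s)"
    proof -
      have gap: "1 - norm (q s) > 0" using qn[OF s(1,2)] by simp
      show "0 < \<eta>" "s + \<eta> \<le> 1" using s1 gap np by (auto simp: \<eta>_def)
      have "\<eta> * norm (u - u0) \<le> (1 - norm (q s)) / (2 * (norm (u - u0) + 1)) * (norm (u - u0) + 1)"
        using gap np by (intro mult_mono) (auto simp: \<eta>_def)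
      also have "\<dots> = (1 - norm (q s)) / 2" using np by (simp add: field_simps)
      finally show "\<eta> * norm (u - u0) < 1 - norm (q s)" using gap by simp
    qed
    define u' where "u' = q (s + \<eta>)"
    have "u' \<notin> subgrad_hull E'"
    proof
      assume "u' \<in> subgrad_hull E'"
      then have "s + \<eta> \<in> A" using s \<eta> by (simp add: A_def u'_def)
      then have "s + \<eta> \<le> s" unfolding s_def by (rule cSup_upper[OF _ bddA])
      then show False using \<eta> by simp
    qed
    moreover have "u' \<in> S" using u(1) u0(2) by (simp add: u'_def q_def)
    moreover have "u' \<bullet> w = bus E' w" if "w \<in> lineality E'" for w
      using u(3)[of w] u0(3)[of w] c(2)[of w] that by (simp add: u'_def q_def W_def inner_simps)
    ultimately obtain E'' k' \<zeta> where E'': "translate_limit E' E''" "k' \<in> S" "\<And>v. v \<in> S \<Longrightarrow> k' \<bullet> v \<le> bus E'' v"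
      "\<zeta> \<in> lineality E''" "\<zeta> \<notin> lineality E'" "\<And>k. k \<in> subgrad_hull E' \<Longrightarrow> norm (k' - k) \<le> norm (u' - k)"
      using outside_hull_limit[OF rf] by metis
    have "norm k' < 1"
    proof -
      have "u' - q s = \<eta> *\<^sub>R (u - u0)" by (simp add: u'_def q_def algebra_simps)
      then have "norm (k' - q s) < 1 - norm (q s)" using E''(6)[OF s(3)] \<eta> by simp
      then show ?thesis using norm_triangle_ineq2[of k' "q s"] by linarith
    qed
    obtain y'' where rf'': "ray_field y'' E''" using E''(1) by (auto simp: translate_limit_def)
    have "lineality E' \<subset> lineality E''" using translate_limit_lineality(1)[OF rf E''(1)] E''(4,5) by blast
    then have "dim (lineality E') < dim (lineality E'')"
      using fin_dim_subspace[OF fd subspace_lineality[OF rf'']] lineality_S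
      by (intro dim_psubset_fin_dim subspace_lineality[OF rf]) auto
    then have "\<not> P E''" using E'(2)[of E''] by linarith
    then obtain c'' where c'': "c'' \<in> S" "\<And>v. v \<in> S \<Longrightarrow> bus E'' v = c'' \<bullet> v"
      using translate_limit_trans[OF tl E''(1)] by (auto simp: P_def linear_bus_def)
    \<comment> \<open>The linear function of \<open>k'\<close> lies below that of
      \<open>c''\<close>; evaluation at the difference of the two gradients makes them
      equal.\<close>
    have "k' \<bullet> (k' - c'') \<le> c'' \<bullet> (k' - c'')" using E''(3)[of "k' - c''"] c''(2)[of "k' - c''"] E''(2) c''(1) by simp
    then have "(k' - c'') \<bullet> (k' - c'') \<le> 0" by (simp add: inner_diff_left)
    then have "k' = c''" by (metis inner_eq_zero_iff inner_ge_zero order_antisym eq_iff_diff_eq_0)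
    then show False using linear_unit[OF rf'' c''] \<open>norm k' < 1\<close> by simp
  qed
  have growth: "\<exists>C. \<forall>\<nu>\<in>S. norm \<nu> = 1 \<longrightarrow> (\<forall>w\<in>W. \<nu> \<bullet> w = 0) \<longrightarrow> (\<forall>s\<ge>0. (r - e) * s - C \<le> bus E' (s *\<^sub>R \<nu>))" if e: "e > 0" for e
  proof -
    define U where "U = {\<nu>\<in>S. norm \<nu> = 1 \<and> (\<forall>w\<in>W. \<nu> \<bullet> w = 0)}"
    have "\<exists>x k. subgrad E' x k \<and> r - e / 2 \<le> k \<bullet> \<nu>" if \<nu>: "\<nu> \<in> U" for \<nu>
    proof (rule ccontr)
      assume neg: "\<not> ?thesis"
      define d where "d = max 0 (r - e / 4)"
      \<comment> \<open>For \<open>d < r\<close> the vector \<open>c + d *\<^sub>R \<nu>\<close>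
        stays in the open unit ball and hence in the hull, so some subgradient has component at
        least \<open>r - e / 2\<close> along \<nu>.\<close>
      have d: "0 \<le> d" "d < r" "r - e / 2 < d" using e r by (auto simp: d_def)
      define u where "u = c + d *\<^sub>R \<nu>"
      have c\<nu>: "c \<bullet> \<nu> = 0" "\<nu> \<bullet> \<nu> = 1" using \<nu> c(1) by (auto simp: U_def inner_commute norm_eq_1)
      have "(norm u)\<^sup>2 = (norm c)\<^sup>2 + d\<^sup>2"
        using c\<nu> unfolding power2_norm_eq_inner u_def by (simp add: inner_simps inner_commute power2_eq_square)
      also have "\<dots> < (norm c)\<^sup>2 + r\<^sup>2" using d by (intro add_strict_left_mono power_strict_mono) auto
      finally have "norm u < 1" using r by (simp add: abs_square_less_1)
      moreover have "u \<in> S" using c(1) WS \<nu> by (auto simp: u_def U_def)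
      moreover have "u \<bullet> w = c \<bullet> w" if "w \<in> W" for w using \<nu> that by (simp add: u_def U_def inner_add_left)
      ultimately have "u \<in> subgrad_hull E'" using ball by blast
      have "\<nu> \<bullet> k \<le> r - e / 2" if "subgrad E' x k" for x k using neg that by (force simp: inner_commute not_le)
      then have "\<nu> \<bullet> u \<le> r - e / 2" using subgrad_hull_le[OF _ \<open>u \<in> subgrad_hull E'\<close>] by blast
      moreover have "\<nu> \<bullet> u = d" using c\<nu> by (simp add: u_def inner_add_right inner_commute)
      ultimately show False using d by simp
    qed
    then obtain X K where XK: "\<And>\<nu>. \<nu> \<in> U \<Longrightarrow> subgrad E' (X \<nu>) (K \<nu>) \<and> r - e / 2 \<le> K \<nu> \<bullet> \<nu>" by metis
    have "closed {\<nu>. \<forall>w\<in>W. \<nu> \<bullet> w = 0}"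
    proof -
      have "{\<nu>. \<forall>w\<in>W. \<nu> \<bullet> w = 0} = (\<Inter>w\<in>W. {\<nu>. \<nu> \<bullet> w = 0})" by auto
      moreover have "closed {\<nu>::'v. \<nu> \<bullet> w = 0}" for w by (intro closed_Collect_eq continuous_intros)
      ultimately show ?thesis by (simp add: closed_INT)
    qed
    then have "closed (sphere 0 1 \<inter> {\<nu>. \<forall>w\<in>W. \<nu> \<bullet> w = 0})" by (intro closed_Int closed_unit_sphere)
    moreover have "U = (S \<inter> cball 0 1) \<inter> (sphere 0 1 \<inter> {\<nu>. \<forall>w\<in>W. \<nu> \<bullet> w = 0})" by (auto simp: U_def)
    ultimately have compU: "compact U" using compact_Int_closed[OF compact_fin_dim_cball[OF fd, of 1]] by (simp only:)
    have cover: "U \<subseteq> (\<Union>\<nu>\<in>U. ball \<nu> (e / 2))" using e by auto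
    obtain T where T: "T \<subseteq> U" "finite T" "U \<subseteq> (\<Union>\<nu>\<in>T. ball \<nu> (e / 2))"
      by (rule compactE_image[OF compU open_ball cover])
    \<comment> \<open>One subgradient serves all normals within \<open>e / 2\<close>, by the norm
      bound; by compactness finitely many suffice, and \<open>C\<close> is their largest
      offset.\<close>
    define C where "C = Max (insert 0 ((\<lambda>\<nu>. K \<nu> \<bullet> X \<nu> - bus E' (X \<nu>)) ` T))"
    have "(r - e) * s - C \<le> bus E' (s *\<^sub>R \<nu>)" if \<nu>: "\<nu> \<in> U" and s: "s \<ge> 0" for \<nu> s
    proof -
      obtain \<mu> where \<mu>: "\<mu> \<in> T" "norm (\<mu> - \<nu>) < e / 2" using T(3) \<nu> by (auto simp: dist_norm)
      then have \<mu>U: "\<mu> \<in> U" using T by blast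
      note sg = conjunct1[OF XK[OF \<mu>U]] and low = conjunct2[OF XK[OF \<mu>U]]
      have "K \<mu> \<bullet> (\<mu> - \<nu>) \<le> norm (K \<mu>) * norm (\<mu> - \<nu>)" by (rule norm_cauchy_schwarz)
      also have "\<dots> \<le> 1 * (e / 2)" using kc(1)[OF sg] \<mu>(2) by (intro mult_mono) auto
      finally have "r - e \<le> K \<mu> \<bullet> \<nu>" using low by (simp add: inner_diff_right)
      then have "(r - e) * s \<le> (K \<mu> \<bullet> \<nu>) * s" using s by (rule mult_right_mono)
      also have "\<dots> = K \<mu> \<bullet> (s *\<^sub>R \<nu>)" by simp
      also have "\<dots> \<le> bus E' (s *\<^sub>R \<nu>) + (K \<mu> \<bullet> X \<mu> - bus E' (X \<mu>))"
      proof -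
        have "s *\<^sub>R \<nu> \<in> S" using \<nu> by (simp add: U_def)
        then have "bus E' (X \<mu>) + K \<mu> \<bullet> (s *\<^sub>R \<nu> - X \<mu>) \<le> bus E' (s *\<^sub>R \<nu>)" using sg unfolding subgrad_def by blast
        then show ?thesis by (simp add: inner_diff_right)
      qed
      also have "K \<mu> \<bullet> X \<mu> - bus E' (X \<mu>) \<le> C" unfolding C_def using T(2) \<mu>(1) by (intro Max_ge) auto
      finally show ?thesis by simp
    qed
    then show ?thesis by (intro exI[of _ C]) (auto simp: U_def)
  qed
  have "rigid y' E' W c"
    unfolding rigid_def
  proof (intro conjI rf subW WS c(1) nc)
    show "\<forall>v\<in>S. \<forall>w\<in>W. bus E' (v + w) = bus E' v + c \<bullet> w"
      using linealityD[of _ E' _ 1] c(2) by (simp add: W_def)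
    show "\<forall>e>0. \<exists>C. \<forall>\<nu>\<in>S. norm \<nu> = 1 \<longrightarrow> (\<forall>w\<in>W. \<nu> \<bullet> w = 0) \<longrightarrow>
        (\<forall>s\<ge>0. (sqrt (1 - (norm c)\<^sup>2) - e) * s - C \<le> bus E' (s *\<^sub>R \<nu>))"
      using growth unfolding r_def by blast
  qed
  with tl show thesis by (rule that)
qed

section \<open>Geometry of a rigid field\<close>

context
  fixes y E W c
  assumes R: "rigid y E W c"
begin

text \<open>With gradient \<open>c\<close> along \<open>W\<close> and Lipschitz constant one, this
  is the largest slope possible across \<open>W\<close>.\<close>

definition rad :: real where "rad = sqrt (1 - (norm c)\<^sup>2)"

lemma rigid_field: "ray_field y E" and rigid_sub: "subspace W" and rigid_S: "W \<subseteq> S" and rigid_c: "c \<in> W" "c \<in> S"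
  and rigid_nc: "norm c < 1" and rigid_aff: "v \<in> S \<Longrightarrow> w \<in> W \<Longrightarrow> bus E (v + w) = bus E v + c \<bullet> w"
  using R by (auto simp: rigid_def)

lemma rad: "0 < rad" "rad \<le> 1" "rad\<^sup>2 = 1 - (norm c)\<^sup>2"
proof -
  have "(norm c)\<^sup>2 < 1" using rigid_nc by (simp add: abs_square_less_1)
  then show "0 < rad" "rad \<le> 1" "rad\<^sup>2 = 1 - (norm c)\<^sup>2" by (auto simp: rad_def)
qed

lemma rigid_growth:
  assumes "0 < e"
  shows "\<exists>C. \<forall>\<nu>\<in>S. norm \<nu> = 1 \<longrightarrow> (\<forall>w\<in>W. \<nu> \<bullet> w = 0) \<longrightarrow> (\<forall>s\<ge>0. (rad - e) * s - C \<le> bus E (s *\<^sub>R \<nu>))"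
proof -
  have all: "\<forall>e>0. \<exists>C. \<forall>\<nu>\<in>S. norm \<nu> = 1 \<longrightarrow> (\<forall>w\<in>W. \<nu> \<bullet> w = 0) \<longrightarrow>
      (\<forall>s\<ge>0. (rad - e) * s - C \<le> bus E (s *\<^sub>R \<nu>))"
    using R unfolding rigid_def rad_def by (elim conjE)
  show ?thesis by (rule mp[OF spec[OF all] assms])
qed

lemma rigid_dist:
  assumes "v \<in> S" "w \<in> W" "0 \<le> t" "0 \<le> t'"
  shows "(dist (E (v + w) t') (E v t))\<^sup>2 = (norm w)\<^sup>2 + (t - t')\<^sup>2 + 2 * (c \<bullet> w) * (t - t')"
proof (rule flat_subspace_dist[OF rigid_field assms(1) _ _ assms(3,4)])
  show "w \<in> S" using assms(2) rigid_S by blast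
  show "bus E (v + T *\<^sub>R w) = bus E v + T * (c \<bullet> w)" for T
    using rigid_aff[OF assms(1) subspace_scale[OF rigid_sub assms(2)], of T] by simp
qed

text \<open>Far out along \<nu> the function falls almost at unit rate in the direction
  \<open>- (c + rad *\<^sub>R \<nu>)\<close>. By the law of cosines for Busemann functions the ray
  then almost coincides with the flat ray in that direction.\<close>

lemma rigid_far:
  assumes t: "0 \<le> t" and e: "e > 0"
  obtains s0 where "0 < s0" "\<And>s \<nu> w. s0 \<le> s \<Longrightarrow> \<nu> \<in> S \<Longrightarrow> norm \<nu> = 1 \<Longrightarrow> (\<And>w. w \<in> W \<Longrightarrow> \<nu> \<bullet> w = 0) \<Longrightarrow> w \<in> W \<Longrightarrow>
     dist (E (s *\<^sub>R \<nu> + w) t) (E (s *\<^sub>R \<nu> + w - t *\<^sub>R (c + rad *\<^sub>R \<nu>)) 0) \<le> e"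
proof -
  \<comment> \<open>The squared distance comes out as at most \<open>4 * t\<^sup>2 * e1\<close>; the
    added one covers \<open>t = 0\<close>.\<close>
  define e1 where "e1 = e\<^sup>2 / (4 * t\<^sup>2 + 1)"
  have pos: "0 < 4 * t\<^sup>2 + 1" by (simp add: add_nonneg_pos)
  have e1: "e1 > 0" using e pos by (simp add: e1_def)
  obtain C where C0: "\<forall>\<nu>\<in>S. norm \<nu> = 1 \<longrightarrow> (\<forall>w\<in>W. \<nu> \<bullet> w = 0) \<longrightarrow> (\<forall>s\<ge>0. (rad - e1) * s - C \<le> bus E (s *\<^sub>R \<nu>))"
    using rigid_growth[OF e1] by (rule exE)
  have C: "(rad - e1) * s - C \<le> bus E (s *\<^sub>R \<nu>)" if "\<nu> \<in> S" "norm \<nu> = 1" "\<And>w. w \<in> W \<Longrightarrow> \<nu> \<bullet> w = 0" "0 \<le> s" for \<nu> s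
    using C0 that by simp
  define s0 where "s0 = t * rad + \<bar>C\<bar> / e1 + 1"
  have s0: "0 < s0" using t rad e1 by (simp add: s0_def add_nonneg_pos)
  show thesis
  proof (rule that[OF s0])
    fix s \<nu> w assume s: "s0 \<le> s" and \<nu>: "\<nu> \<in> S" "norm \<nu> = 1" "\<And>w. w \<in> W \<Longrightarrow> \<nu> \<bullet> w = 0" and w: "w \<in> W"
    define a where "a = s - t * rad"
    have a: "0 < a" "\<bar>C\<bar> / e1 \<le> a" "a + t * rad = s" using s e1 by (auto simp: a_def s0_def add_nonneg_pos)
      (smt (verit) divide_nonneg_pos abs_ge_zero)
    have Ca: "C \<le> e1 * a" using a(2) e1 by (simp add: pos_divide_le_eq mult.commute)
    have trad: "0 \<le> t * rad" using t rad by simp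
    have as: "0 \<le> a / s" "a / s \<le> 1" "0 < s" using a trad by (auto simp: divide_le_eq_1)
    have low: "(rad - 2 * e1) * a \<le> bus E (a *\<^sub>R \<nu>)"
      using C[OF \<nu>, of a] a Ca by (simp add: algebra_simps)
    \<comment> \<open>Slopes of chords increase: between \<open>a\<close> and \<open>s\<close> the
      function grows at least as fast as on average between \<open>0\<close> and \<open>a\<close>,
      where the growth condition bounds it below.\<close>
    have "bus E ((1 - a / s) *\<^sub>R 0 + (a / s) *\<^sub>R (s *\<^sub>R \<nu>)) \<le> (1 - a / s) * bus E 0 + (a / s) * bus E (s *\<^sub>R \<nu>)"
      using as \<nu> by (intro bus_convex[OF rigid_field]) auto
    then have "bus E (a *\<^sub>R \<nu>) \<le> (a / s) * bus E (s *\<^sub>R \<nu>)" using as bus_0[OF rigid_field] by simp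
    then have "s * bus E (a *\<^sub>R \<nu>) \<le> a * bus E (s *\<^sub>R \<nu>)" using as by (simp add: field_simps)
    then have "t * rad * bus E (a *\<^sub>R \<nu>) \<le> a * (bus E (s *\<^sub>R \<nu>) - bus E (a *\<^sub>R \<nu>))"
      using a(3)[symmetric] by (simp add: algebra_simps)
    moreover have "t * rad * ((rad - 2 * e1) * a) \<le> t * rad * bus E (a *\<^sub>R \<nu>)" using low trad by (rule mult_left_mono)
    ultimately have "a * (t * rad * (rad - 2 * e1)) \<le> a * (bus E (s *\<^sub>R \<nu>) - bus E (a *\<^sub>R \<nu>))" by (simp add: mult.commute mult.left_commute)
    then have diff: "t * rad * (rad - 2 * e1) \<le> bus E (s *\<^sub>R \<nu>) - bus E (a *\<^sub>R \<nu>)" using a(1) by (simp add: mult_le_cancel_left)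
    define z z' where "z = s *\<^sub>R \<nu> + w" and "z' = z - t *\<^sub>R (c + rad *\<^sub>R \<nu>)"
    have wS: "w \<in> S" using w rigid_S by blast
    have zS: "z \<in> S" "z' \<in> S" using \<nu> wS rigid_c by (auto simp: z_def z'_def)
    have z'eq: "z' = a *\<^sub>R \<nu> + (w - t *\<^sub>R c)" by (simp add: z'_def z_def a_def algebra_simps)
    have wc: "w - t *\<^sub>R c \<in> W" using w rigid_c rigid_sub by (simp add: subspace_diff subspace_scale)
    have "bus E z = bus E (s *\<^sub>R \<nu>) + c \<bullet> w" unfolding z_def using rigid_aff w \<nu> by simp
    moreover have "bus E z' = bus E (a *\<^sub>R \<nu>) + c \<bullet> (w - t *\<^sub>R c)" unfolding z'eq using rigid_aff wc \<nu> by simp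
    ultimately have "bus E z' - bus E z \<le> - t * (norm c)\<^sup>2 - t * rad * (rad - 2 * e1)"
      using diff by (simp add: inner_diff_right power2_norm_eq_inner)
    also have "\<dots> = - t * ((norm c)\<^sup>2 + rad\<^sup>2) + 2 * t * rad * e1" by (simp add: power2_eq_square algebra_simps)
    also have "(norm c)\<^sup>2 + rad\<^sup>2 = 1" using rad(3) by simp
    finally have bd: "bus E z' - bus E z \<le> - t + 2 * t * rad * e1" by simp
    have c\<nu>: "c \<bullet> \<nu> = 0" "\<nu> \<bullet> \<nu> = 1" using \<nu>(2) \<nu>(3)[OF rigid_c(1)] by (auto simp: inner_commute norm_eq_1)
    have "(norm (c + rad *\<^sub>R \<nu>))\<^sup>2 = (norm c)\<^sup>2 + rad\<^sup>2"
      using c\<nu> unfolding power2_norm_eq_inner by (simp add: inner_simps inner_commute power2_eq_square)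
    then have n1: "norm (c + rad *\<^sub>R \<nu>) = 1" using rad(3) by (simp add: power2_eq_1_iff) (smt (verit) norm_ge_zero)
    have "(dist (E z' 0) (E z t))\<^sup>2 \<le> (norm (z' - z))\<^sup>2 + t\<^sup>2 + 2 * t * (bus E z' - bus E z)"
      by (rule dist_base_ray[OF rigid_field zS t])
    also have "norm (z' - z) = t" using n1 t by (simp add: z'_def)
    also have "t\<^sup>2 + t\<^sup>2 + 2 * t * (bus E z' - bus E z) \<le> t\<^sup>2 + t\<^sup>2 + 2 * t * (- t + 2 * t * rad * e1)"
      using bd t by (intro add_left_mono mult_left_mono) auto
    also have "\<dots> = 4 * t\<^sup>2 * e1 * rad" by (simp add: power2_eq_square algebra_simps)
    also have "\<dots> \<le> 4 * t\<^sup>2 * e1 * 1" using rad e1 by (intro mult_left_mono) auto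
    also have "\<dots> \<le> (4 * t\<^sup>2 + 1) * e1" using e1 by (simp add: algebra_simps)
    also have "\<dots> = e\<^sup>2" using pos by (simp add: e1_def)
    finally have "dist (E z' 0) (E z t) \<le> e" by (rule power2_le_imp_le) (use e in simp)
    then show "dist (E (s *\<^sub>R \<nu> + w) t) (E (s *\<^sub>R \<nu> + w - t *\<^sub>R (c + rad *\<^sub>R \<nu>)) 0) \<le> e"
      by (simp add: z_def z'_def dist_commute)
  qed
qed

text \<open>A field close to a rigid one at time \<open>t\<close> which is affine in a direction \<open>p\<close> outside \<open>W\<close> would have to
  stay close to it along \<open>p\<close>, but the rigid field turns into the flat in opposite directions at the two ends.\<close>
lemma rigid_neighbour_lineality:
  "\<exists>t. 0 \<le> t \<and> (\<forall>E'' p. ray_field y E'' \<longrightarrow> dist (E'' 0 t) (E 0 t) \<le> 1 \<longrightarrow> p \<in> lineality E'' \<longrightarrow> p \<in> W)"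
proof -
  \<comment> \<open>Half of the defect \<open>1 - norm c\<close>: one half pays for the
    approximation of the rigid ray by a flat point, the other remains as separation of the two
    fields at time one.\<close>
  define \<kappa> where "\<kappa> = (1 - norm c) / 2"
  have \<kappa>: "\<kappa> > 0" using rigid_nc by (simp add: \<kappa>_def)
  obtain s where s: "0 < s" "\<And>s' \<nu> w. s \<le> s' \<Longrightarrow> \<nu> \<in> S \<Longrightarrow> norm \<nu> = 1 \<Longrightarrow> (\<And>w. w \<in> W \<Longrightarrow> \<nu> \<bullet> w = 0) \<Longrightarrow> w \<in> W \<Longrightarrow>
     dist (E (s' *\<^sub>R \<nu> + w) 1) (E (s' *\<^sub>R \<nu> + w - 1 *\<^sub>R (c + rad *\<^sub>R \<nu>)) 0) \<le> \<kappa>"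
    using rigid_far[OF zero_le_one \<kappa>] by blast
  \<comment> \<open>Separation \<kappa> at time one grows at least linearly, and at this time it
    exceeds the bound \<open>1 + 2 * s\<close> that affineness along \<open>p\<close>
    imposes.\<close>
  define t where "t = (2 * s + 2) / \<kappa> + 1"
  have "t * \<kappa> = (2 * s + 2) / \<kappa> * \<kappa> + \<kappa>" by (simp only: t_def distrib_right mult_1)
  then have "t * \<kappa> = 2 * s + 2 + \<kappa>" using \<kappa> by (simp only: nonzero_eq_divide_eq times_divide_eq_left) simp
  then have t: "1 \<le> t" "2 * s + 2 < t * \<kappa>" using s(1) \<kappa> by (auto simp: t_def)
  have fW: "fin_dim W" using fin_dim_subspace[OF fd rigid_sub rigid_S] .
  show ?thesis
  proof (intro exI[of _ t] conjI allI impI)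
    show "0 \<le> t" using t by simp
    fix E'' p assume E'': "ray_field y E''" and close: "dist (E'' 0 t) (E 0 t) \<le> 1" and p: "p \<in> lineality E''"
    show "p \<in> W"
    proof (rule ccontr)
      assume pW: "p \<notin> W"
      have pS: "p \<in> S" using lineality_S[OF p] .
      define q where "q = orth_proj W p"
      have q: "q \<in> W" using orth_proj_in[OF fW] by (simp add: q_def)
      have qS: "q \<in> S" using q rigid_S by blast
      define \<delta> where "\<delta> = norm (p - q)"
      have \<delta>: "\<delta> > 0" using pW q by (auto simp: \<delta>_def)
      define \<nu> where "\<nu> = (p - q) /\<^sub>R \<delta>"
      have \<nu>: "\<nu> \<in> S" "norm \<nu> = 1" "\<And>w. w \<in> W \<Longrightarrow> \<nu> \<bullet> w = 0"
        using pS qS \<delta> orth_proj_orth[OF fW, of _ p] by (auto simp: \<nu>_def \<delta>_def q_def)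
      define P Q where "P = (s / \<delta>) *\<^sub>R p" and "Q = (s / \<delta>) *\<^sub>R q"
      have PQ: "P = s *\<^sub>R \<nu> + Q" using \<delta> by (simp add: P_def Q_def \<nu>_def algebra_simps divide_inverse)
      have QW: "Q \<in> W" using q rigid_sub by (simp add: Q_def subspace_scale)
      have PS: "P \<in> S" "Q \<in> S" using pS qS by (auto simp: P_def Q_def)
      have PL: "P \<in> lineality E''" unfolding P_def by (rule subspace_scale[OF subspace_lineality[OF E''] p])
      have base: "E'' v 0 = E v 0" if "v \<in> S" for v using rf_0[OF E'' that] rf_0[OF rigid_field that] by simp
      \<comment> \<open>The flat point \<open>z\<close> is almost reached by the rigid ray from
        \<open>x\<close> at time one. In \<open>E''\<close> it lies at most \<open>norm c\<close>
        below \<open>x\<close>, while the ray of \<open>E''\<close> has descended by one, so the two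
        rays are at least \<kappa> apart.\<close>
      have bound: "t * \<kappa> \<le> 1 + 2 * s" if \<sigma>: "\<sigma> = 1 \<or> \<sigma> = -1" and lowb: "- norm c \<le> bus E'' (- (c + rad *\<^sub>R (\<sigma> *\<^sub>R \<nu>)))" for \<sigma> :: real
      proof -
        define x where "x = \<sigma> *\<^sub>R P"
        define z where "z = x - (c + rad *\<^sub>R (\<sigma> *\<^sub>R \<nu>))"
        have xS: "x \<in> S" and zS: "z \<in> S" using PS \<nu> rigid_c by (auto simp: x_def z_def)
        have ns: "norm (\<sigma> *\<^sub>R \<nu>) = 1" using \<sigma> \<nu> by auto
        have xL: "x \<in> lineality E''" unfolding x_def by (rule subspace_scale[OF subspace_lineality[OF E''] PL])
        have xeq: "x = s *\<^sub>R (\<sigma> *\<^sub>R \<nu>) + \<sigma> *\<^sub>R Q" by (simp add: x_def PQ algebra_simps)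
        have d1: "dist (E x 1) (E z 0) \<le> \<kappa>"
          using s(2)[OF order_refl _ ns, of "\<sigma> *\<^sub>R Q"] \<nu> QW rigid_sub unfolding z_def xeq by (simp add: subspace_scale)
        have "bus E'' z = bus E'' (- (c + rad *\<^sub>R (\<sigma> *\<^sub>R \<nu>))) + bus E'' x"
        proof -
          have "- (c + rad *\<^sub>R (\<sigma> *\<^sub>R \<nu>)) \<in> S" using rigid_c \<nu> by simp
          then have "bus E'' (- (c + rad *\<^sub>R (\<sigma> *\<^sub>R \<nu>)) + 1 *\<^sub>R x) = bus E'' (- (c + rad *\<^sub>R (\<sigma> *\<^sub>R \<nu>))) + 1 * bus E'' x"
            by (rule linealityD[OF xL])
          moreover have "- (c + rad *\<^sub>R (\<sigma> *\<^sub>R \<nu>)) + 1 *\<^sub>R x = z" by (simp add: z_def)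
          ultimately show ?thesis by (simp only: mult_1)
        qed
        then have "1 - norm c \<le> dist (E'' z 0) (E'' x 1)"
          using bus_le_dist[OF E'' xS zS, of 1] lowb by simp
        then have "\<kappa> \<le> dist (E'' x 1) (E x 1)"
          using d1 dist_triangle[of "E'' z 0" "E'' x 1" "E x 1"] base[OF zS] by (simp add: \<kappa>_def dist_commute)
        also have "dist (E'' x 1) (E x 1) \<le> (1 / t) * dist (E'' x t) (E x t)"
          using ray_dist_convex[OF rf_ray[OF E'' xS] rf_ray[OF rigid_field xS], of 1 t] t base[OF xS] by simp
        finally have "t * \<kappa> \<le> dist (E'' x t) (E x t)" using t by (simp add: field_simps)
        also have "\<dots> \<le> dist (E'' x t) (E (\<sigma> *\<^sub>R Q) t) + s"
        proof -
          have "dist (E (\<sigma> *\<^sub>R Q) t) (E x t) \<le> norm (\<sigma> *\<^sub>R Q - x)"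
            using t xS PS by (intro rf_contract[OF rigid_field]) auto
          also have "\<sigma> *\<^sub>R Q - x = - (s *\<^sub>R (\<sigma> *\<^sub>R \<nu>))" unfolding xeq by simp
          also have "norm (- (s *\<^sub>R (\<sigma> *\<^sub>R \<nu>))) = s" unfolding norm_minus_cancel norm_scaleR[of s] ns using s(1) by simp
          finally show ?thesis using dist_triangle[of "E'' x t" "E x t" "E (\<sigma> *\<^sub>R Q) t"] by simp
        qed
        also have "dist (E'' x t) (E (\<sigma> *\<^sub>R Q) t) \<le> 1 + s"
        proof -
          \<comment> \<open>Affineness makes the points at height \<open>t\<close> over the two
            lines geodesics. They start at distance at most one and at parameter \<open>M\<close>
            are at most \<open>2 * t + M * s\<close> apart, so by convexity the distance at
            parameter one is at most \<open>1 + s\<close> in the limit.\<close>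
          have "dist (E'' x t) (E (\<sigma> *\<^sub>R Q) t) \<le> 1 + s + 2 * t / M" if M: "M \<ge> 1" for M
          proof -
            define g where "g = (\<lambda>\<tau>. E'' (0 + (\<tau> * M) *\<^sub>R x) t)"
            define h where "h = (\<lambda>\<tau>. E (\<tau> *\<^sub>R (M *\<^sub>R (\<sigma> *\<^sub>R Q))) t)"
            have "affine_geod g"
            proof (rule affine_geodI[where k = "M * norm x"])
              fix \<tau> \<tau>' :: real
              have "(dist (g \<tau>) (g \<tau>'))\<^sup>2 = (\<tau> * M - \<tau>' * M)\<^sup>2 * (norm x)\<^sup>2 + (t - t)\<^sup>2 + 2 * bus E'' x * (\<tau> * M - \<tau>' * M) * (t - t)"
                unfolding g_def by (rule flat_line_dist[OF E'' _ xS linealityD[OF xL]]) (use t in auto)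
              also have "\<dots> = (M * norm x * \<bar>\<tau> - \<tau>'\<bar>)\<^sup>2" by (simp add: power_mult_distrib left_diff_distrib[symmetric])
              finally show "dist (g \<tau>) (g \<tau>') = M * norm x * \<bar>\<tau> - \<tau>'\<bar>" using M by (simp add: power2_eq_iff_nonneg)
            qed
            moreover have "affine_geod h"
            proof (rule affine_geodI[where k = "norm (M *\<^sub>R (\<sigma> *\<^sub>R Q))"])
              fix \<tau> \<tau>' :: real
              define w where "w = M *\<^sub>R (\<sigma> *\<^sub>R Q)"
              have wW: "w \<in> W" "w \<in> S" using QW PS rigid_sub by (auto simp: w_def subspace_scale)
              have "(dist (E (\<tau>' *\<^sub>R w + (\<tau> - \<tau>') *\<^sub>R w) t) (E (\<tau>' *\<^sub>R w) t))\<^sup>2 = (norm ((\<tau> - \<tau>') *\<^sub>R w))\<^sup>2 + (t - t)\<^sup>2 + 2 * (c \<bullet> ((\<tau> - \<tau>') *\<^sub>R w)) * (t - t)"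
                using t wW rigid_sub by (intro rigid_dist) (auto simp: subspace_scale)
              moreover have "\<tau>' *\<^sub>R w + (\<tau> - \<tau>') *\<^sub>R w = \<tau> *\<^sub>R w" by (simp flip: scaleR_add_left)
              ultimately have "(dist (h \<tau>) (h \<tau>'))\<^sup>2 = (norm w * \<bar>\<tau> - \<tau>'\<bar>)\<^sup>2"
                unfolding h_def w_def by (simp add: power_mult_distrib mult.commute)
              then show "dist (h \<tau>) (h \<tau>') = norm (M *\<^sub>R (\<sigma> *\<^sub>R Q)) * \<bar>\<tau> - \<tau>'\<bar>"
                unfolding w_def by (simp add: power2_eq_iff_nonneg)
            qed
            ultimately have "dist (g (1 / M)) (h (1 / M)) \<le> (1 - 1 / M) * dist (g 0) (h 0) + (1 / M) * dist (g 1) (h 1)"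
              using M by (intro dist_convex) auto
            moreover have "g (1 / M) = E'' x t" "h (1 / M) = E (\<sigma> *\<^sub>R Q) t" using M by (auto simp: g_def h_def)
            moreover have "dist (g 0) (h 0) \<le> 1" using close by (simp add: g_def h_def)
            then have "(1 - 1 / M) * dist (g 0) (h 0) \<le> 1 * 1" using M by (intro mult_mono) auto
            moreover have "dist (g 1) (h 1) \<le> 2 * t + M * s"
            proof -
              have MS: "M *\<^sub>R x \<in> S" "M *\<^sub>R (\<sigma> *\<^sub>R Q) \<in> S" using xS PS by auto
              have "dist (g 1) (E'' (M *\<^sub>R x) 0) = t" "dist (h 1) (E (M *\<^sub>R (\<sigma> *\<^sub>R Q)) 0) = t"
                using geod_rayD[OF rf_ray[OF E'' MS(1)], of t 0] geod_rayD[OF rf_ray[OF rigid_field MS(2)], of t 0] t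
                by (auto simp: g_def h_def)
              moreover have "dist (E'' (M *\<^sub>R x) 0) (E (M *\<^sub>R (\<sigma> *\<^sub>R Q)) 0) = M * s"
              proof -
                have "M *\<^sub>R x - M *\<^sub>R (\<sigma> *\<^sub>R Q) = (M * s) *\<^sub>R (\<sigma> *\<^sub>R \<nu>)" by (simp add: xeq algebra_simps)
                then have "norm (M *\<^sub>R x - M *\<^sub>R (\<sigma> *\<^sub>R Q)) = M * s"
                  using M s(1) by (simp only: norm_scaleR[of "M * s"] ns) simp
                then show ?thesis
                  unfolding base[OF MS(1)] rf_base_dist[OF rigid_field MS] .
              qed
              ultimately show ?thesis
                using dist_triangle[of "g 1" "h 1" "E'' (M *\<^sub>R x) 0"] dist_triangle[of "E'' (M *\<^sub>R x) 0" "h 1" "E (M *\<^sub>R (\<sigma> *\<^sub>R Q)) 0"]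
                by (simp add: dist_commute)
            qed
            then have "(1 / M) * dist (g 1) (h 1) \<le> (1 / M) * (2 * t + M * s)" using M by (intro mult_left_mono) auto
            moreover have "(1 / M) * (2 * t + M * s) = 2 * t / M + s" using M by (simp add: field_simps)
            ultimately show ?thesis by simp
          qed
          then have "eventually (\<lambda>M. dist (E'' x t) (E (\<sigma> *\<^sub>R Q) t) \<le> 1 + s + 2 * t / M) at_top"
            by (intro eventually_mono[OF eventually_ge_at_top[of 1]])
          moreover have "((\<lambda>M. 1 + s + 2 * t / M) \<longlongrightarrow> 1 + s + 0) at_top"
            by (intro tendsto_intros tendsto_divide_0[OF tendsto_const] filterlim_at_top_imp_at_infinity filterlim_ident)
          ultimately have "dist (E'' x t) (E (\<sigma> *\<^sub>R Q) t) \<le> 1 + s + 0"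
            using tendsto_lowerbound[OF _ _ trivial_limit_at_top_linorder] by blast
          then show ?thesis by simp
        qed
        finally show ?thesis by simp
      qed
      \<comment> \<open>The two candidates for the sign have midpoint \<open>- c\<close>, where the
        function is at least \<open>- norm c\<close>; by convexity one of them satisfies the
        hypothesis of \<open>bound\<close>.\<close>
      have h1: "bus E'' ((1 - 1/2) *\<^sub>R (- (c + rad *\<^sub>R \<nu>)) + (1/2) *\<^sub>R (- (c - rad *\<^sub>R \<nu>))) \<le> (1 - 1/2) * bus E'' (- (c + rad *\<^sub>R \<nu>)) + (1/2) * bus E'' (- (c - rad *\<^sub>R \<nu>))"
        using rigid_c \<nu> by (intro bus_convex[OF E'']) auto
      have h2: "(1 - 1/2) *\<^sub>R (- (c + rad *\<^sub>R \<nu>)) + (1/2) *\<^sub>R (- (c - rad *\<^sub>R \<nu>)) = - c"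
      proof -
        have "(1 - 1/2) *\<^sub>R (- (c + rad *\<^sub>R \<nu>)) + (1/2) *\<^sub>R (- (c - rad *\<^sub>R \<nu>)) = (1/2) *\<^sub>R (- (c + rad *\<^sub>R \<nu>) + - (c - rad *\<^sub>R \<nu>))"
          unfolding scaleR_add_right by simp
        also have "- (c + rad *\<^sub>R \<nu>) + - (c - rad *\<^sub>R \<nu>) = 2 *\<^sub>R (- c)" by (simp add: scaleR_2)
        finally show ?thesis by simp
      qed
      have h3: "- norm c \<le> bus E'' (- c)" using bus_lipschitz[OF E'', of 0 "- c"] bus_0[OF E''] rigid_c by simp
      define b1 b2 where "b1 = bus E'' (- (c + rad *\<^sub>R \<nu>))" and "b2 = bus E'' (- (c - rad *\<^sub>R \<nu>))"
      have "- norm c \<le> (1 - 1/2) * b1 + (1/2) * b2" using h1[unfolded h2] h3 unfolding b1_def b2_def by (rule order_trans[rotated])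
      then have "- norm c \<le> b1 \<or> - norm c \<le> b2" by (cases "- norm c \<le> b1") auto
      then have "- norm c \<le> bus E'' (- (c + rad *\<^sub>R \<nu>)) \<or> - norm c \<le> bus E'' (- (c - rad *\<^sub>R \<nu>))" unfolding b1_def b2_def .
      then show False using bound[of 1] bound[of "-1"] t(2) by auto
    qed
  qed
qed

text \<open>Straightening: the direction perpendicular to \<open>W\<close> in the flat half-spaces spanned by \<open>W\<close> and the field.\<close>
lemma rigid_perpendicular: "\<exists>E'. rigid y E' W 0"
proof -
  \<comment> \<open>As in the flat half-space, sliding along \<open>c\<close> while flowing is
    orthogonal to \<open>W\<close>, and division by \<open>rad\<close> restores unit speed.\<close>
  define E' where "E' = (\<lambda>v t. E (v + (t / rad) *\<^sub>R c) (t / rad))"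
  have cs: "v + a *\<^sub>R c \<in> S" if "v \<in> S" for v a using that rigid_c by simp
  have E'_ray: "geod_ray (E' v)" if v: "v \<in> S" for v
    unfolding geod_ray_def
  proof (intro allI impI)
    fix s t :: real assume st: "0 \<le> s" "0 \<le> t"
    define h where "h = (s - t) / rad"
    have eq: "v + (s / rad) *\<^sub>R c = (v + (t / rad) *\<^sub>R c) + h *\<^sub>R c"
      by (simp add: h_def diff_divide_distrib scaleR_diff_left)
    have "(dist (E' v s) (E' v t))\<^sup>2 = (norm (h *\<^sub>R c))\<^sup>2 + (t / rad - s / rad)\<^sup>2 + 2 * (c \<bullet> (h *\<^sub>R c)) * (t / rad - s / rad)"
      unfolding E'_def eq using st rad rigid_c rigid_sub by (intro rigid_dist cs v) (auto simp: subspace_scale)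
    also have "t / rad - s / rad = - h" by (simp add: h_def diff_divide_distrib)
    also have "(norm (h *\<^sub>R c))\<^sup>2 + (- h)\<^sup>2 + 2 * (c \<bullet> (h *\<^sub>R c)) * (- h) = h\<^sup>2 * (1 - (norm c)\<^sup>2)"
      unfolding power2_norm_eq_inner by (simp add: power2_eq_square algebra_simps)
    also have "\<dots> = (h * rad)\<^sup>2" using rad(3) by (simp add: power_mult_distrib)
    also have "\<dots> = \<bar>s - t\<bar>\<^sup>2" using rad(1) by (simp add: h_def)
    finally show "dist (E' v s) (E' v t) = \<bar>s - t\<bar>" by (metis abs_ge_zero power2_eq_iff_nonneg zero_le_dist)
  qed
  have E'_0: "E' v 0 = E v 0" for v by (simp add: E'_def)
  have rf: "ray_field y E'"
    unfolding ray_field_def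
  proof (intro conjI ballI allI impI)
    fix v w and t :: real assume vw: "v \<in> S" "w \<in> S" and t: "0 \<le> t"
    show "dist (E' v t) (E' w t) \<le> norm (v - w)"
      using rf_contract[OF rigid_field cs[OF vw(1)] cs[OF vw(2)], of "t / rad" "t / rad" "t / rad"] t rad by (simp add: E'_def)
  qed (use E'_ray E'_0 rf_0[OF rigid_field] rf_y[OF rigid_field] in auto)
  \<comment> \<open>The exact distance \<open>(norm w)\<^sup>2 + 1\<close> saturates the law of
    cosines for the Busemann function, which leaves a nonnegative increment; applied to
    \<open>- w\<close> as well it gives constancy along \<open>W\<close>.\<close>
  have W_ge: "bus E' v \<le> bus E' (v + w)" if v: "v \<in> S" and w: "w \<in> W" for v w
  proof -
    have wS: "w \<in> S" using w rigid_S by blast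
    have "(dist (E' (v + w) 0) (E' v 1))\<^sup>2 = (norm w)\<^sup>2 + 1"
    proof -
      define h where "h = 1 / rad"
      define w' where "w' = w - h *\<^sub>R c"
      have w'W: "w' \<in> W" using w rigid_c rigid_sub by (simp add: w'_def subspace_diff subspace_scale)
      have "(dist (E ((v + h *\<^sub>R c) + w') 0) (E (v + h *\<^sub>R c) h))\<^sup>2 = (norm w')\<^sup>2 + (h - 0)\<^sup>2 + 2 * (c \<bullet> w') * (h - 0)"
        using rad by (intro rigid_dist cs v w'W) (auto simp: h_def)
      moreover have vw: "(v + h *\<^sub>R c) + w' = v + w" by (simp add: w'_def)
      moreover have "(norm w')\<^sup>2 + (h - 0)\<^sup>2 + 2 * (c \<bullet> w') * (h - 0) = (norm w)\<^sup>2 + h\<^sup>2 * (1 - (norm c)\<^sup>2)"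
        unfolding w'_def power2_norm_eq_inner by (simp add: inner_simps inner_commute power2_eq_square algebra_simps)
      moreover have "h\<^sup>2 * (1 - (norm c)\<^sup>2) = 1" using rad by (simp add: h_def power_divide flip: rad(3))
      ultimately have "(dist (E (v + w) 0) (E (v + h *\<^sub>R c) h))\<^sup>2 = (norm w)\<^sup>2 + 1" unfolding vw by (simp only:)
      then show ?thesis by (simp add: E'_def h_def)
    qed
    then show ?thesis using dist_base_ray[OF rf v, of "v + w" 1] v wS by simp
  qed
  have W_eq: "bus E' (v + w) = bus E' v" if v: "v \<in> S" and w: "w \<in> W" for v w
    using W_ge[OF v w] W_ge[of "v + w" "- w"] v w rigid_S rigid_sub by (auto simp: subspace_neg)
  have "\<exists>C. \<forall>\<nu>\<in>S. norm \<nu> = 1 \<longrightarrow> (\<forall>w\<in>W. \<nu> \<bullet> w = 0) \<longrightarrow> (\<forall>s\<ge>0. (sqrt (1 - (norm (0::'v))\<^sup>2) - e) * s - C \<le> bus E' (s *\<^sub>R \<nu>))"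
    if e: "e > 0" for e
  proof -
    have "0 \<le> 1 / rad" using rad by simp
    then obtain s0 where s0: "0 < s0" "\<And>s \<nu> w. s0 \<le> s \<Longrightarrow> \<nu> \<in> S \<Longrightarrow> norm \<nu> = 1 \<Longrightarrow> (\<And>w. w \<in> W \<Longrightarrow> \<nu> \<bullet> w = 0) \<Longrightarrow> w \<in> W \<Longrightarrow>
     dist (E (s *\<^sub>R \<nu> + w) (1 / rad)) (E (s *\<^sub>R \<nu> + w - (1 / rad) *\<^sub>R (c + rad *\<^sub>R \<nu>)) 0) \<le> e"
      using rigid_far[of "1 / rad" e] e by blast
    \<comment> \<open>The unit step ending at \<open>s1\<close> has slope at least
      \<open>1 - e\<close>, and convexity keeps this slope beyond. Up to \<open>s1\<close> the
      Lipschitz bound is enough, and the constant \<open>2 * s1\<close> pays for it.\<close>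
    define s1 where "s1 = s0 + 1"
    have s1: "1 < s1" "s0 \<le> s1" using s0 by (auto simp: s1_def)
    have "(1 - e) * s - 2 * s1 \<le> bus E' (s *\<^sub>R \<nu>)"
      if \<nu>: "\<nu> \<in> S" "norm \<nu> = 1" "\<And>w. w \<in> W \<Longrightarrow> \<nu> \<bullet> w = 0" and s: "0 \<le> s" for \<nu> s
    proof -
      have lip: "- \<tau> \<le> bus E' (\<tau> *\<^sub>R \<nu>)" if "0 \<le> \<tau>" for \<tau>
        using bus_lipschitz[OF rf, of 0 "\<tau> *\<^sub>R \<nu>"] bus_0[OF rf] \<nu> that by simp
      show ?thesis
      proof (cases "s \<le> s1")
        case True
        have "(1 - e) * s \<le> 1 * s" using e s by (intro mult_right_mono) auto
        then show ?thesis using lip[OF s] True by simp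
      next
        case False
        have eqp: "s1 *\<^sub>R \<nu> + (1 / rad) *\<^sub>R c - (1 / rad) *\<^sub>R (c + rad *\<^sub>R \<nu>) = (s1 - 1) *\<^sub>R \<nu>"
          using rad by (simp add: algebra_simps)
        have "dist (E' (s1 *\<^sub>R \<nu>) 1) (E' ((s1 - 1) *\<^sub>R \<nu>) 0) \<le> e"
          using s0(2)[OF s1(2) \<nu>, of "(1 / rad) *\<^sub>R c"] rigid_c rigid_sub unfolding eqp by (simp add: E'_def subspace_scale)
        then have "dist (E' ((s1 - 1) *\<^sub>R \<nu>) 0) (E' (s1 *\<^sub>R \<nu>) 1) \<le> e" by (simp add: dist_commute)
        then have step: "1 - e \<le> bus E' (s1 *\<^sub>R \<nu>) - bus E' ((s1 - 1) *\<^sub>R \<nu>)"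
        proof -
          have "bus E' ((s1 - 1) *\<^sub>R \<nu>) \<le> busemann (E' 0) (E' (s1 *\<^sub>R \<nu>) 1) + dist (E' ((s1 - 1) *\<^sub>R \<nu>) 0) (E' (s1 *\<^sub>R \<nu>) 1)"
            unfolding bus_def by (rule busemann_lipschitz[OF rf_ray[OF rf]]) simp
          also have "busemann (E' 0) (E' (s1 *\<^sub>R \<nu>) 1) = bus E' (s1 *\<^sub>R \<nu>) - 1"
            using \<nu> by (intro busemann_field_ray[OF rf]) auto
          finally show ?thesis using \<open>dist (E' ((s1 - 1) *\<^sub>R \<nu>) 0) (E' (s1 *\<^sub>R \<nu>) 1) \<le> e\<close> by linarith
        qed
        define l where "l = 1 / (s - s1 + 1)"
        have l: "0 < l" "l \<le> 1" using False by (auto simp: l_def)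
        have "bus E' ((1 - l) *\<^sub>R ((s1 - 1) *\<^sub>R \<nu>) + l *\<^sub>R (s *\<^sub>R \<nu>)) \<le> (1 - l) * bus E' ((s1 - 1) *\<^sub>R \<nu>) + l * bus E' (s *\<^sub>R \<nu>)"
          using l \<nu> by (intro bus_convex[OF rf]) auto
        moreover have "(1 - l) *\<^sub>R ((s1 - 1) *\<^sub>R \<nu>) + l *\<^sub>R (s *\<^sub>R \<nu>) = s1 *\<^sub>R \<nu>"
        proof -
          have "(1 - l) * (s1 - 1) + l * s = (s1 - 1) + l * (s - s1 + 1)" by (simp add: algebra_simps)
          also have "\<dots> = s1" using False by (simp add: l_def)
          finally show ?thesis by (simp flip: scaleR_add_left)
        qed
        ultimately have "bus E' (s1 *\<^sub>R \<nu>) \<le> (1 - l) * bus E' ((s1 - 1) *\<^sub>R \<nu>) + l * bus E' (s *\<^sub>R \<nu>)" by (simp only:)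
        then have "bus E' (s1 *\<^sub>R \<nu>) - bus E' ((s1 - 1) *\<^sub>R \<nu>) \<le> l * (bus E' (s *\<^sub>R \<nu>) - bus E' ((s1 - 1) *\<^sub>R \<nu>))"
          by (simp only: left_diff_distrib right_diff_distrib mult_1)
        then have "1 - e \<le> (bus E' (s *\<^sub>R \<nu>) - bus E' ((s1 - 1) *\<^sub>R \<nu>)) / (s - s1 + 1)" using step by (simp add: l_def)
        then have "(1 - e) * (s - s1 + 1) \<le> bus E' (s *\<^sub>R \<nu>) - bus E' ((s1 - 1) *\<^sub>R \<nu>)" using False by (simp add: pos_le_divide_eq)
        moreover have "- (s1 - 1) \<le> bus E' ((s1 - 1) *\<^sub>R \<nu>)" using lip[of "s1 - 1"] s1 by simp
        moreover have "(1 - e) * s - 2 * s1 \<le> (1 - e) * (s - s1 + 1) - (s1 - 1)"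
        proof -
          have "(1 - e) * (s1 - 1) \<le> 1 * (s1 - 1)" using e s1 by (intro mult_right_mono) auto
          then show ?thesis using s1 by (simp add: algebra_simps)
        qed
        ultimately show ?thesis by linarith
      qed
    qed
    then show ?thesis by (intro exI[of _ "2 * s1"]) auto
  qed
  then have "rigid y E' W 0"
    unfolding rigid_def using rf rigid_sub rigid_S W_eq by (simp add: subspace_0)
  then show ?thesis by blast
qed

end

end

section \<open>Finitely many maximal singular subspaces\<close>

context morse_flat_space
begin

text \<open>The zero subspace is excluded because it contains no direction and hence yields no
  sphere.\<close>

definition singular_subspace :: "'v set \<Rightarrow> bool" where
  "singular_subspace W \<longleftrightarrow> W \<noteq> {0} \<and> (\<exists>y E c. rigid y E W c)"

definition maximal_singular :: "'v set \<Rightarrow> bool" where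
  "maximal_singular W \<longleftrightarrow> singular_subspace W \<and> (\<forall>W'. singular_subspace W' \<and> W \<subseteq> W' \<longrightarrow> W' = W)"

lemma singular_subspace_props: "singular_subspace W \<Longrightarrow> subspace W" "singular_subspace W \<Longrightarrow> W \<subseteq> S"
  by (auto simp: singular_subspace_def dest: rigid_sub rigid_S)

lemma singular_subspace_le_maximal:
  assumes W: "singular_subspace W"
  obtains M where "maximal_singular M" "W \<subseteq> M"
proof -
  define P where "P = (\<lambda>M. singular_subspace M \<and> W \<subseteq> M)"
  have bound: "dim M \<le> dim S" if "P M" for M
  proof (cases "M = S")
    case False
    then have "M \<subset> S" "subspace M" using that singular_subspace_props by (auto simp: P_def)
    then show ?thesis using dim_psubset_fin_dim[OF fd] by (simp add: less_imp_le)
  qed simp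
  have PW: "P W" using W by (simp add: P_def)
  have "\<exists>M. P M \<and> (\<forall>M'. P M' \<longrightarrow> dim M' \<le> dim M)"
    using PW by (rule ex_has_greatest_nat[of P W dim "Suc (dim S)"]) (simp add: bound less_Suc_eq_le)
  then obtain M where M: "P M" "\<And>M'. P M' \<Longrightarrow> dim M' \<le> dim M" by blast
  have "M' = M" if M': "singular_subspace M'" "M \<subseteq> M'" for M'
  proof (rule ccontr)
    assume "M' \<noteq> M"
    then have "M \<subset> M'" using M' by blast
    moreover have "fin_dim M'" using fin_dim_subspace[OF fd] singular_subspace_props[OF M'(1)] by blast
    ultimately have "dim M < dim M'" using M(1) singular_subspace_props by (intro dim_psubset_fin_dim) (auto simp: P_def)
    moreover have "P M'" using M(1) M' by (auto simp: P_def)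
    ultimately show False using M(2)[of M'] by linarith
  qed
  then have "maximal_singular M" using M(1) by (simp add: maximal_singular_def P_def)
  then show thesis using that M(1) by (simp add: P_def)
qed

text \<open>The function is constant along \<open>W\<close> and grows across it, so its minimum is
  attained on a bounded piece. Minima are the centres at which limits of such fields remain
  nonaffine.\<close>

lemma rigid_minimum:
  assumes R: "rigid y E W 0"
  shows "\<exists>x\<in>S. \<forall>v\<in>S. bus E x \<le> bus E v"
proof -
  note E = rigid_field[OF R]
  have fW: "fin_dim W" using fin_dim_subspace[OF fd rigid_sub[OF R] rigid_S[OF R]] .
  have half: "0 < (1/2::real)" by simp
  obtain C where C0: "\<forall>\<nu>\<in>S. norm \<nu> = 1 \<longrightarrow> (\<forall>w\<in>W. \<nu> \<bullet> w = 0) \<longrightarrow> (\<forall>s\<ge>0. (rad 0 - 1/2) * s - C \<le> bus E (s *\<^sub>R \<nu>))"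
    using rigid_growth[OF R half] by (rule exE)
  have eq: "(rad (0::'v) - 1/2) * s = s / 2" for s by (simp add: rad_def[OF R])
  have C: "s / 2 - C \<le> bus E (s *\<^sub>R \<nu>)" if "\<nu> \<in> S" "norm \<nu> = 1" "\<And>w. w \<in> W \<Longrightarrow> \<nu> \<bullet> w = 0" "0 \<le> s" for \<nu> s
    using C0 that unfolding eq by simp
  define r where "r = 2 * \<bar>C\<bar> + 1"
  have r: "0 \<le> r" by (simp add: r_def)
  have "continuous_on (S \<inter> cball 0 r) (bus E)" by (rule continuous_on_subset[OF continuous_bus[OF E]]) auto
  moreover have "0 \<in> S \<inter> cball 0 r" using r by simp
  then have "S \<inter> cball 0 r \<noteq> {}" by blast
  ultimately obtain x where x: "x \<in> S \<inter> cball 0 r" "\<And>v. v \<in> S \<inter> cball 0 r \<Longrightarrow> bus E x \<le> bus E v"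
    using continuous_attains_inf[OF compact_fin_dim_cball[OF fd]] by blast
  have x0: "bus E x \<le> 0" using x(2)[OF \<open>0 \<in> S \<inter> cball 0 r\<close>] bus_0[OF E] by simp
  have "bus E x \<le> bus E v" if v: "v \<in> S" for v
  proof -
    define w u where "w = orth_proj W v" and "u = v - w"
    have w: "w \<in> W" "w \<in> S" using orth_proj_in[OF fW] rigid_S[OF R] by (auto simp: w_def)
    have uS: "u \<in> S" using v w by (simp add: u_def)
    have u: "u \<bullet> z = 0" if "z \<in> W" for z using orth_proj_orth[OF fW that] by (simp add: u_def w_def)
    have "bus E v = bus E (u + w)" by (simp add: u_def)
    also have "\<dots> = bus E u" using rigid_aff[OF R uS w(1)] by simp
    finally have vu: "bus E v = bus E u" .
    show ?thesis
    proof (cases "norm u \<le> r")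
      case True
      then show ?thesis using x(2)[of u] uS vu by simp
    next
      case False
      then have pos: "0 < norm u" using r by linarith
      have "norm u / 2 - C \<le> bus E (norm u *\<^sub>R (u /\<^sub>R norm u))"
        using uS u pos by (intro C) auto
      also have "norm u *\<^sub>R (u /\<^sub>R norm u) = u" using pos by simp
      finally show ?thesis using x0 False vu by (simp add: r_def abs_if split: if_splits)
    qed
  qed
  then show ?thesis using x(1) by blast
qed

text \<open>An affine \<open>b\<close> has unit slope by the Morse condition and is unbounded
  below.\<close>

lemma nonneg_nonlinear:
  assumes E: "ray_field y E" and nn: "\<And>v. v \<in> S \<Longrightarrow> 0 \<le> bus E v"
  shows "\<not> linear_bus E"
proof
  assume "linear_bus E"
  then obtain c where c: "c \<in> S" "\<And>v. v \<in> S \<Longrightarrow> bus E v = c \<bullet> v" by (auto simp: linear_bus_def)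
  have "0 \<le> c \<bullet> (- c)" using nn[of "- c"] c by simp
  then have "c \<bullet> c \<le> 0" by simp
  then have "c = 0" by (metis inner_eq_zero_iff inner_ge_zero order_antisym)
  then show False using linear_unit[OF E c] by simp
qed

text \<open>Limits of perpendicular fields for infinitely many maximal singular subspaces would have a nearby rigid
  field, whose singular subspace contains almost all of them.\<close>
lemma finite_maximal_singular: "finite {W. maximal_singular W}"
proof (rule ccontr)
  assume "infinite {W. maximal_singular W}"
  then obtain M :: "nat \<Rightarrow> 'v set" where M: "inj M" "range M \<subseteq> {W. maximal_singular W}"
    using infinite_countable_subset by blast
  then have Mmax: "maximal_singular (M k)" for k by blast
  \<comment> \<open>Without recentring at a minimum the limit could be affine, and no rigid field
    would be found near it. Minima are available because the perpendicular fields have gradient zero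
    along \<open>M k\<close>.\<close>
  have "\<exists>y E x. rigid y E (M k) 0 \<and> x \<in> S \<and> (\<forall>v\<in>S. bus E x \<le> bus E v)" for k
  proof -
    obtain y E c where "rigid y E (M k) c" using Mmax[of k] by (auto simp: maximal_singular_def singular_subspace_def)
    then obtain E' where E': "rigid y E' (M k) 0" using rigid_perpendicular by blast
    have "\<exists>x\<in>S. \<forall>v\<in>S. bus E' x \<le> bus E' v" by (rule rigid_minimum[OF E'])
    then show ?thesis using E' by blast
  qed
  then have "\<exists>y. \<forall>k. \<exists>E x. rigid (y k) E (M k) 0 \<and> x \<in> S \<and> (\<forall>v\<in>S. bus E x \<le> bus E v)" by (intro choice) blast
  then obtain y where "\<forall>k. \<exists>E x. rigid (y k) E (M k) 0 \<and> x \<in> S \<and> (\<forall>v\<in>S. bus E x \<le> bus E v)" by blast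
  then have "\<exists>E. \<forall>k. \<exists>x. rigid (y k) (E k) (M k) 0 \<and> x \<in> S \<and> (\<forall>v\<in>S. bus (E k) x \<le> bus (E k) v)" by (rule choice)
  then obtain E where "\<forall>k. \<exists>x. rigid (y k) (E k) (M k) 0 \<and> x \<in> S \<and> (\<forall>v\<in>S. bus (E k) x \<le> bus (E k) v)" by blast
  then have "\<exists>x. \<forall>k. rigid (y k) (E k) (M k) 0 \<and> x k \<in> S \<and> (\<forall>v\<in>S. bus (E k) (x k) \<le> bus (E k) v)" by (rule choice)
  then obtain x where R: "\<And>k. rigid (y k) (E k) (M k) 0" and x: "\<And>k. x k \<in> S" "\<And>k v. v \<in> S \<Longrightarrow> bus (E k) (x k) \<le> bus (E k) v"
    by blast
  have RF: "ray_field (y k) (E k)" for k using rigid_field[OF R] .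
  have "\<exists>g l. flat_translation S \<iota> g l \<and> norm (l - (- (y k + x k))) \<le> C0" for k
    by (rule lattice) (simp add: rf_y[OF RF] x(1))
  then have "\<exists>g. \<forall>k. \<exists>l. flat_translation S \<iota> (g k) l \<and> norm (l - (- (y k + x k))) \<le> C0" by (intro choice) blast
  then obtain g where "\<forall>k. \<exists>l. flat_translation S \<iota> (g k) l \<and> norm (l - (- (y k + x k))) \<le> C0" by blast
  then have "\<exists>l. \<forall>k. flat_translation S \<iota> (g k) (l k) \<and> norm (l k - (- (y k + x k))) \<le> C0" by (rule choice)
  then obtain l where gl: "\<And>k. flat_translation S \<iota> (g k) (l k)" "\<And>k. norm (l k - (- (y k + x k))) \<le> C0" by blast
  define F where "F = (\<lambda>k v t. g k (E k (x k + v) t))"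
  have F: "ray_field (y k + x k + l k) (F k)" for k
    unfolding F_def by (rule rf_translate(1)[OF rf_shift(1)[OF RF x(1)] gl(1)])
  have F_bus: "bus (F k) v = bus (E k) (x k + v) - bus (E k) (x k)" if "v \<in> S" for k v
    unfolding F_def rf_translate(2)[OF rf_shift(1)[OF RF x(1)] gl(1)] by (rule rf_shift(2)[OF RF x(1) that])
  have bnd: "norm (y k + x k + l k) \<le> C0" for k using gl(2)[of k] by (simp add: algebra_simps)
  obtain \<Phi> y' E' where \<Phi>: "\<Phi> \<le> sequentially" "\<Phi> \<noteq> bot" "ray_field y' E'"
    "\<And>v t. v \<in> S \<Longrightarrow> 0 \<le> t \<Longrightarrow> ((\<lambda>k. F k v t) \<longlongrightarrow> E' v t) \<Phi>"
    by (rule ray_field_compact[of "\<lambda>k. y k + x k + l k" F C0]) (use F bnd in blast)+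
  have "0 \<le> bus E' v" if v: "v \<in> S" for v
  proof (rule tendsto_lowerbound[OF bus_tendsto[OF F \<Phi>(3) v \<Phi>(4)] _ \<Phi>(2)])
    show "eventually (\<lambda>k. 0 \<le> bus (F k) v) \<Phi>"
      using F_bus[OF v] x v by (intro always_eventually) simp
  qed
  then have nl: "\<not> linear_bus E'" using nonneg_nonlinear[OF \<Phi>(3)] by blast
  obtain y1 E1 W c where E1: "translate_limit E' E1" "rigid y1 E1 W c"
    by (rule rigid_limit_exists[OF \<Phi>(3) nl])
  note R1 = rigid_field[OF E1(2)]
  obtain t where "0 \<le> t \<and> (\<forall>E'' p. ray_field y1 E'' \<longrightarrow> dist (E'' 0 t) (E1 0 t) \<le> 1 \<longrightarrow> p \<in> lineality E'' \<longrightarrow> p \<in> W)"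
    using rigid_neighbour_lineality[OF E1(2)] by (rule exE)
  note t = this[THEN conjunct1] this[THEN conjunct2, rule_format]
  have fin: "finite {(0::'v, 0::real), (0, t)} \<and> {(0, 0), (0, t)} \<subseteq> S \<times> {0..} \<and> (1/4::real) > 0" using t by simp
  have all: "\<forall>A e. finite A \<and> A \<subseteq> S \<times> {0..} \<and> e > 0 \<longrightarrow>
        (\<exists>x\<in>S. \<exists>g l. flat_translation S \<iota> g l \<and> (\<forall>(v, t)\<in>A. dist (g (E' (x + v) t)) (E1 v t) < e))"
    using E1(1) unfolding translate_limit_def by (elim conjE)
  obtain a h m where a: "a \<in> S" "flat_translation S \<iota> h m" "\<forall>(v, s)\<in>{(0, 0), (0, t)}. dist (h (E' (a + v) s)) (E1 v s) < 1/4"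
    using mp[OF spec[OF spec[OF all]] fin] by blast
  have close: "dist (h (E' a 0)) (E1 0 0) < 1/4" "dist (h (E' a t)) (E1 0 t) < 1/4" using a(3) by auto
  have sub: "M k \<subseteq> W" if k: "dist (F k a 0) (E' a 0) < 1/4" "dist (F k a t) (E' a t) < 1/4" for k
  proof -
    define H where "H = (\<lambda>v s. h (F k (a + v) s))"
    define yk where "yk = y k + x k + l k + a + m"
    have H: "ray_field yk H" unfolding H_def yk_def by (rule rf_translate(1)[OF rf_shift(1)[OF F a(1)] a(2)])
    have Hb: "bus H v = bus (F k) (a + v) - bus (F k) a" if "v \<in> S" for v
      unfolding H_def rf_translate(2)[OF rf_shift(1)[OF F a(1)] a(2)] by (rule rf_shift(2)[OF F a(1) that])
    have hiso: "dist (h p) (h q) = dist p q" for p q using a(2) by (simp add: flat_translation_def)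
    have d0: "dist (H 0 0) (E1 0 0) < 1/2" and dt: "dist (H 0 t) (E1 0 t) < 1/2"
      using close k hiso dist_triangle[of "H 0 0" "E1 0 0" "h (E' a 0)"] dist_triangle[of "H 0 t" "E1 0 t" "h (E' a t)"]
      by (auto simp: H_def)
    \<comment> \<open>\<open>rigid_neighbour_lineality\<close> compares fields with the same shift.
      The two shifts differ by less than \<open>1/2\<close>, so reparametrising keeps the total
      discrepancy at time \<open>t\<close> below one.\<close>
    define b where "b = y1 - yk"
    have ykS: "yk \<in> S" "y1 \<in> S" using rf_y[OF H] rf_y[OF R1] by auto
    have bS: "b \<in> S" using ykS by (simp add: b_def)
    have nb: "norm b < 1/2" using d0 rf_0[OF H, of 0] rf_0[OF R1, of 0] isometric[OF ykS] by (simp add: b_def norm_minus_commute)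
    define H' where "H' = (\<lambda>v. H (b + v))"
    have "ray_field (yk + b) H'" unfolding H'_def by (rule rf_shift(1)[OF H bS])
    then have H': "ray_field y1 H'" by (simp add: b_def)
    have H'b: "bus H' v = bus H (b + v) - bus H b" if "v \<in> S" for v
      unfolding H'_def by (rule rf_shift(2)[OF H bS that])
    have "dist (H' 0 t) (H 0 t) \<le> norm b"
      using rf_contract[OF H bS _ t(1), of 0] by (simp add: H'_def)
    then have "dist (H' 0 t) (E1 0 t) \<le> 1" using dt nb dist_triangle[of "H' 0 t" "E1 0 t" "H 0 t"] by linarith
    then have Wt: "p \<in> W" if "p \<in> lineality H'" for p using t(2)[OF H' _ that] by blast
    show "M k \<subseteq> W"
    proof
      fix p assume p: "p \<in> M k"
      have pS: "p \<in> S" using p rigid_S[OF R] by blast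
      have const: "bus (E k) (v + T *\<^sub>R p) = bus (E k) v" if "v \<in> S" for v T
        using rigid_aff[OF R that subspace_scale[OF rigid_sub[OF R] p]] by simp
      have "bus H' (v + T *\<^sub>R p) = bus H' v" if v: "v \<in> S" for v T
      proof -
        have e: "bus H' u = bus (E k) (x k + (a + (b + u))) - bus (E k) (x k + (a + b))" if "u \<in> S" for u
          using that bS a(1) by (simp add: H'b Hb F_bus)
        have eq: "x k + (a + (b + (v + T *\<^sub>R p))) = (x k + (a + (b + v))) + T *\<^sub>R p" by (simp add: algebra_simps)
        have "bus (E k) (x k + (a + (b + (v + T *\<^sub>R p)))) = bus (E k) (x k + (a + (b + v)))"
          unfolding eq by (rule const) (use v x(1) a(1) bS in simp)
        then show ?thesis using e[of "v + T *\<^sub>R p"] e[OF v] v pS by simp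
      qed
      moreover from this[of 0 1] have "bus H' p = 0" using bus_0[OF H'] by simp
      ultimately have "p \<in> lineality H'" using pS by (simp add: lineality_def)
      then show "p \<in> W" by (rule Wt)
    qed
  qed
  have ev: "eventually (\<lambda>k. dist (F k a 0) (E' a 0) < 1/4 \<and> dist (F k a t) (E' a t) < 1/4) \<Phi>"
    using a(1) t(1) by (intro eventually_conj tendstoD[OF \<Phi>(4)]) auto
  then obtain k where k: "dist (F k a 0) (E' a 0) < 1/4 \<and> dist (F k a t) (E' a t) < 1/4"
    using eventually_happens'[OF \<Phi>(2)] by blast
  have "eventually (\<lambda>j. k < j) \<Phi>" using \<Phi>(1) eventually_gt_at_top[of k] by (simp add: le_filter_def)
  with ev have "eventually (\<lambda>j. (dist (F j a 0) (E' a 0) < 1/4 \<and> dist (F j a t) (E' a t) < 1/4) \<and> k < j) \<Phi>"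
    by (rule eventually_conj)
  then obtain j where j: "dist (F j a 0) (E' a 0) < 1/4 \<and> dist (F j a t) (E' a t) < 1/4" "k < j"
    using eventually_happens'[OF \<Phi>(2)] by blast
  \<comment> \<open>Once \<open>W\<close> is known to be singular, maximality identifies it with
    every \<open>M k\<close> it contains; two different indices contradict injectivity.\<close>
  have "singular_subspace W"
  proof -
    have "M k \<noteq> {0}" "0 \<in> M k" using Mmax[of k] subspace_0[OF rigid_sub[OF R]] by (auto simp: maximal_singular_def singular_subspace_def)
    then have "W \<noteq> {0}" using sub[of k] k by blast
    then show ?thesis using E1(2) by (auto simp: singular_subspace_def)
  qed
  then have "M k = W" "M j = W"
    using sub[of k] sub[of j] k j Mmax[of k] Mmax[of j] unfolding maximal_singular_def by blast+
  then show False using M(1) j(2) by (metis injD less_irrefl)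
qed

text \<open>The descent along \<open>u\<close> survives in a rigid limit. Across \<open>W\<close>
  the limit is bounded below, so all of the descent comes from the projection \<open>w\<close>:
  \<open>c \<bullet> w \<le> - cos e\<close>. As \<open>norm c < 1\<close>, the projection has
  length at least \<open>cos e\<close>.\<close>

lemma direction_near_singular:
  assumes E: "ray_field y E" and nl: "\<not> linear_bus E" and u: "u \<in> S" "norm u = 1" and e: "0 < e" "e < pi / 2"
    and slope: "\<And>v. v \<in> S \<Longrightarrow> bus E (v + u) - bus E v \<le> - cos e"
  shows "\<exists>M. maximal_singular M \<and> norm (u - orth_proj M u) \<le> sin e"
proof -
  obtain y' E' W c where E': "translate_limit E E'" "rigid y' E' W c" by (rule rigid_limit_exists[OF E nl])
  note R = E'(2) and rf = rigid_field[OF E'(2)]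
  have fW: "fin_dim W" using fin_dim_subspace[OF fd rigid_sub[OF R] rigid_S[OF R]] .
  have slope': "bus E' (v + u) - bus E' v \<le> - cos e" if v: "v \<in> S" for v
  proof (rule field_le_epsilon)
    fix d :: real assume d: "0 < d"
    obtain x where x: "x \<in> S" "\<forall>z\<in>{v + u, v}. \<bar>bus E' z - (bus E (x + z) - bus E x)\<bar> < d / 2"
      using translate_limit_bus[OF E E'(1), of "{v + u, v}" "d / 2"] v u d by auto
    then show "bus E' (v + u) - bus E' v \<le> - cos e + d"
      using slope[of "x + v"] v by (simp add: add.assoc abs_if split: if_splits)
  qed
  have iter: "bus E' (real n *\<^sub>R u) \<le> - real n * cos e" for n
  proof (induction n)
    case (Suc n)
    have "real (Suc n) *\<^sub>R u = real n *\<^sub>R u + u" by (simp add: scaleR_add_left add.commute)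
    then show ?case using Suc slope'[of "real n *\<^sub>R u"] u by (simp add: algebra_simps)
  qed (use bus_0[OF rf] in simp)
  define w where "w = orth_proj W u"
  define d where "d = norm (u - w)"
  have w: "w \<in> W" "w \<in> S" using orth_proj_in[OF fW] rigid_S[OF R] by (auto simp: w_def)
  have orth: "(u - w) \<bullet> z = 0" if "z \<in> W" for z using orth_proj_orth[OF fW that] by (simp add: w_def)
  have cw: "c \<bullet> w \<le> - cos e"
  proof (cases "u = w")
    case True
    then have "bus E' u = c \<bullet> w" using rigid_aff[OF R, of 0 w] w bus_0[OF rf] by simp
    then show ?thesis using iter[of 1] by simp
  next
    case False
    then have d0: "d > 0" by (simp add: d_def)
    define \<nu> where "\<nu> = (u - w) /\<^sub>R d"
    have \<nu>: "\<nu> \<in> S" "norm \<nu> = 1" "\<forall>z\<in>W. \<nu> \<bullet> z = 0"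
      using d0 u w orth by (auto simp: \<nu>_def d_def)
    \<comment> \<open>The growth condition with tolerance \<open>rad c\<close> has coefficient zero
      and is just a lower bound on transversal rays.\<close>
    obtain C where C0: "\<forall>\<nu>\<in>S. norm \<nu> = 1 \<longrightarrow> (\<forall>w\<in>W. \<nu> \<bullet> w = 0) \<longrightarrow> (\<forall>s\<ge>0. (rad c - rad c) * s - C \<le> bus E' (s *\<^sub>R \<nu>))"
      using rigid_growth[OF R rad(1)[OF R]] by (rule exE)
    have C: "- C \<le> bus E' (s *\<^sub>R \<nu>)" if "0 \<le> s" for s
      using C0 \<nu> that by simp
    have "real n * (c \<bullet> w + cos e) \<le> C" for n
    proof -
      have "real n *\<^sub>R u = (real n * d) *\<^sub>R \<nu> + real n *\<^sub>R w" 
      proof -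
        have "(real n * d) *\<^sub>R \<nu> = real n *\<^sub>R (u - w)" using d0 by (simp add: \<nu>_def)
        then show ?thesis by (simp add: scaleR_diff_right)
      qed
      then have "bus E' (real n *\<^sub>R u) = bus E' ((real n * d) *\<^sub>R \<nu>) + c \<bullet> (real n *\<^sub>R w)"
        using rigid_aff[OF R, of "(real n * d) *\<^sub>R \<nu>" "real n *\<^sub>R w"] \<nu>(1) w(1) rigid_sub[OF R] by (simp add: subspace_scale)
      then show ?thesis using iter[of n] C[of "real n * d"] d0 by (simp add: algebra_simps)
    qed
    then have "c \<bullet> w + cos e \<le> 0"
      by (metis linorder_not_le mult.commute reals_Archimedean3)
    then show ?thesis by simp
  qed
  have cpos: "0 < cos e" using e by (intro cos_gt_zero_pi) auto
  have "cos e \<le> norm c * norm w" using cw norm_cauchy_schwarz[of c "- w"] by simp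
  also have "\<dots> \<le> 1 * norm w" using rigid_nc[OF R] by (intro mult_right_mono) auto
  finally have nw: "cos e \<le> norm w" by simp
  have "(norm u)\<^sup>2 = (norm (u - w))\<^sup>2 + (norm w)\<^sup>2"
    using norm_add_Pythagorean[of "u - w" w] orth[OF w(1)] by (simp add: orthogonal_def)
  moreover have "(cos e)\<^sup>2 \<le> (norm w)\<^sup>2" using nw cpos by (intro power_mono) auto
  moreover have "(norm u)\<^sup>2 = 1" using u(2) by simp
  ultimately have "(norm (u - w))\<^sup>2 \<le> (sin e)\<^sup>2" using sin_cos_squared_add[of e] by linarith
  then have uw: "norm (u - w) \<le> sin e" by (rule power2_le_imp_le) (use e in \<open>intro sin_ge_zero; simp\<close>)
  have "w \<noteq> 0" using nw cpos by auto
  then have "singular_subspace W" using w(1) R by (auto simp: singular_subspace_def)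
  then obtain M where M: "maximal_singular M" "W \<subseteq> M" by (rule singular_subspace_le_maximal)
  have "fin_dim M"
    using M(1) singular_subspace_props fin_dim_subspace[OF fd] by (auto simp: maximal_singular_def)
  then have "norm (u - orth_proj M u) \<le> norm (u - w)" using w(1) M(2) by (intro norm_orth_residual_le) auto
  then show ?thesis using uw M(1) by (intro exI[of _ M]) auto
qed

text \<open>Finitely many subspaces have a least distance from \<open>u\<close>, and it is positive
  if none of them contains \<open>u\<close>.\<close>

lemma direction_in_singular:
  assumes u: "u \<in> S" and near: "\<And>e. 0 < e \<Longrightarrow> \<exists>M. maximal_singular M \<and> norm (u - orth_proj M u) \<le> e"
  shows "\<exists>M. maximal_singular M \<and> u \<in> M"
proof (rule ccontr)
  assume neg: "\<not> ?thesis"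
  define d where "d = Min (insert 1 ((\<lambda>M. norm (u - orth_proj M u)) ` {W. maximal_singular W}))"
  have pos: "0 < norm (u - orth_proj M u)" if "maximal_singular M" for M
  proof -
    have "fin_dim M"
      using that singular_subspace_props fin_dim_subspace[OF fd] by (auto simp: maximal_singular_def)
    then have "orth_proj M u \<in> M" by (rule orth_proj_in)
    then show ?thesis using neg that by auto
  qed
  have d: "0 < d" unfolding d_def using finite_maximal_singular pos by (subst Min_gr_iff) auto
  obtain M where M: "maximal_singular M" "norm (u - orth_proj M u) \<le> d / 2" using near[of "d / 2"] d by auto
  have "d \<le> norm (u - orth_proj M u)" unfolding d_def using finite_maximal_singular M(1) by (intro Min_le) auto
  then show False using M(2) d by simp
qed

end

section \<open>Angles and Tits distances\<close>

definition ray_class :: "(real \<Rightarrow> 'a::metric_space) \<Rightarrow> (real \<Rightarrow> 'a) set" where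
  "ray_class c = {c'. geod_ray c' \<and> asymptotic c c'}"

lemma asymptotic_refl: "asymptotic c c"
  unfolding asymptotic_def by (intro exI[of _ 0]) simp

lemma asymptotic_sym: "asymptotic c c' \<Longrightarrow> asymptotic c' c"
  unfolding asymptotic_def by (simp add: dist_commute)

lemma asymptotic_trans:
  assumes "asymptotic c c'" "asymptotic c' c''"
  shows "asymptotic c c''"
proof -
  obtain B B' where "\<forall>t\<ge>0. dist (c t) (c' t) \<le> B" "\<forall>t\<ge>0. dist (c' t) (c'' t) \<le> B'"
    using assms unfolding asymptotic_def by blast
  then have "\<forall>t\<ge>0. dist (c t) (c'' t) \<le> B + B'"
    by (meson add_mono dist_triangle order_trans)
  then show ?thesis unfolding asymptotic_def by blast
qed

lemma ray_class_self: "geod_ray c \<Longrightarrow> c \<in> ray_class c"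
  by (simp add: ray_class_def asymptotic_refl)

lemma ray_class_eq: "asymptotic c c' \<Longrightarrow> ray_class c = ray_class c'"
  unfolding ray_class_def using asymptotic_sym asymptotic_trans by blast

lemma ideal_boundary_eq: "ideal_boundary TYPE('a::metric_space) = {ray_class c |c::real \<Rightarrow> 'a. geod_ray c}"
  by (simp add: ideal_boundary_def ray_class_def)

lemma ray_class_boundary: "geod_ray (c :: real \<Rightarrow> 'a::metric_space) \<Longrightarrow> ray_class c \<in> ideal_boundary TYPE('a)"
  unfolding ideal_boundary_eq by blast

lemma boundary_ray_class:
  assumes "\<xi> \<in> ideal_boundary TYPE('a::metric_space)" "c \<in> \<xi>"
  shows "geod_ray c" "\<xi> = ray_class c"
proof -
  obtain d :: "real \<Rightarrow> 'a" where d: "\<xi> = ray_class d" using assms(1) by (auto simp: ideal_boundary_eq)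
  then show "geod_ray c" "\<xi> = ray_class c" using assms(2) ray_class_eq[of d c] by (auto simp: ray_class_def)
qed

lemma comparison_angle_rays:
  assumes "geod_ray c" "geod_ray c'" "c 0 = c' 0" "0 < s" "0 < t"
  shows "comparison_angle (c 0) (c s) (c' t) = arccos ((s\<^sup>2 + t\<^sup>2 - (dist (c s) (c' t))\<^sup>2) / (2 * s * t))"
proof -
  have "dist (c 0) (c s) = s" "dist (c 0) (c' t) = t"
    using geod_rayD[OF assms(1), of 0 s] geod_rayD[OF assms(2), of 0 t] assms by auto
  then show ?thesis by (simp add: comparison_angle_def)
qed

lemma comparison_cos_bounds:
  assumes "geod_ray c" "geod_ray c'" "c 0 = c' 0" "0 < s" "0 < t"
  shows "-1 \<le> (s\<^sup>2 + t\<^sup>2 - (dist (c s) (c' t))\<^sup>2) / (2 * s * t)" "(s\<^sup>2 + t\<^sup>2 - (dist (c s) (c' t))\<^sup>2) / (2 * s * t) \<le> 1"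
proof -
  let ?d = "dist (c s) (c' t)"
  have e: "dist (c 0) (c s) = s" "dist (c 0) (c' t) = t"
    using geod_rayD[OF assms(1), of 0 s] geod_rayD[OF assms(2), of 0 t] assms by auto
  have "?d \<le> s + t" using dist_triangle[of "c s" "c' t" "c 0"] e by (simp add: dist_commute)
  then have "?d\<^sup>2 \<le> (s + t)\<^sup>2" by (intro power_mono) auto
  moreover have "\<bar>s - t\<bar> \<le> ?d" using dist_triangle[of "c 0" "c s" "c' t"] dist_triangle[of "c 0" "c' t" "c s"] e by (auto simp: dist_commute)
  then have "\<bar>s - t\<bar>\<^sup>2 \<le> ?d\<^sup>2" by (intro power_mono) auto
  then have "(s - t)\<^sup>2 \<le> ?d\<^sup>2" by simp
  ultimately have "- (2 * s * t) \<le> s\<^sup>2 + t\<^sup>2 - ?d\<^sup>2" "s\<^sup>2 + t\<^sup>2 - ?d\<^sup>2 \<le> 2 * s * t"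
    by (auto simp: power2_sum power2_diff)
  moreover have "0 < 2 * s * t" using assms by simp
  ultimately show "-1 \<le> (s\<^sup>2 + t\<^sup>2 - ?d\<^sup>2) / (2 * s * t)" "(s\<^sup>2 + t\<^sup>2 - ?d\<^sup>2) / (2 * s * t) \<le> 1"
    by (simp_all add: pos_le_divide_eq pos_divide_le_eq)
qed

lemma comparison_angle_bounds:
  assumes "geod_ray c" "geod_ray c'" "c 0 = c' 0" "0 < s" "0 < t"
  shows "0 \<le> comparison_angle (c 0) (c s) (c' t)" "comparison_angle (c 0) (c s) (c' t) \<le> pi"
  unfolding comparison_angle_rays[OF assms]
  using comparison_cos_bounds[OF assms] by (auto intro: arccos_lbound arccos_ubound)

context
  fixes c c' :: "real \<Rightarrow> 'a::metric_space"
  assumes c: "geod_ray c" "geod_ray c'" "c 0 = c' 0"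
begin

definition angle_sups :: "real \<Rightarrow> real set" where
  "angle_sups e = {comparison_angle (c 0) (c t) (c' t') | t t'. 0 < t \<and> t < e \<and> 0 < t' \<and> t' < e}"

lemma angle_sups_bdd: "bdd_above (angle_sups e)"
  unfolding angle_sups_def bdd_above_def using comparison_angle_bounds(2)[OF c] by blast

lemma angle_sups_Sup_nonneg:
  assumes "e > 0"
  shows "0 \<le> Sup (angle_sups e)"
proof -
  have "comparison_angle (c 0) (c (e / 2)) (c' (e / 2)) \<in> angle_sups e"
    unfolding angle_sups_def using assms by (intro CollectI exI[of _ "e / 2"]) auto
  then show ?thesis
    using comparison_angle_bounds(1)[OF c, of "e / 2" "e / 2"] assms cSup_upper[OF _ angle_sups_bdd] by fastforce
qed

lemma alex_angle_eq: "alex_angle c c' = Inf {Sup (angle_sups e) | e. e > 0}"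
  by (simp add: alex_angle_def angle_sups_def)

lemma alex_angle_le_Sup:
  assumes "e > 0"
  shows "alex_angle c c' \<le> Sup (angle_sups e)"
proof -
  have "bdd_below {Sup (angle_sups e) | e. e > 0}"
    using angle_sups_Sup_nonneg unfolding bdd_below_def by blast
  then show ?thesis unfolding alex_angle_eq using assms by (intro cInf_lower) auto
qed

lemma alex_angle_le:
  assumes e: "e > 0" and le: "\<And>t t'. 0 < t \<Longrightarrow> t < e \<Longrightarrow> 0 < t' \<Longrightarrow> t' < e \<Longrightarrow> comparison_angle (c 0) (c t) (c' t') \<le> m"
  shows "alex_angle c c' \<le> m"
proof -
  have "angle_sups e \<noteq> {}" unfolding angle_sups_def using e by (auto intro!: exI[of _ "e / 2"])
  moreover have "a \<le> m" if "a \<in> angle_sups e" for a using that le unfolding angle_sups_def by blast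
  ultimately have "Sup (angle_sups e) \<le> m" by (rule cSup_least)
  then show ?thesis using alex_angle_le_Sup[OF e] by simp
qed

lemma alex_angle_ge:
  assumes "\<And>e m. e > 0 \<Longrightarrow> m < \<theta> \<Longrightarrow> \<exists>t t'. 0 < t \<and> t < e \<and> 0 < t' \<and> t' < e \<and> m \<le> comparison_angle (c 0) (c t) (c' t')"
  shows "\<theta> \<le> alex_angle c c'"
  unfolding alex_angle_eq
proof (rule cInf_greatest)
  show "{Sup (angle_sups e) | e. e > 0} \<noteq> {}" using zero_less_one by blast
  fix a assume "a \<in> {Sup (angle_sups e) | e. e > 0}"
  then obtain e where e: "e > 0" "a = Sup (angle_sups e)" by blast
  show "\<theta> \<le> a"
  proof (rule dense_le)
    fix m assume "m < \<theta>"
    then obtain t t' where t: "0 < t \<and> t < e \<and> 0 < t' \<and> t' < e" "m \<le> comparison_angle (c 0) (c t) (c' t')"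
      using assms[OF e(1)] by blast
    then have "comparison_angle (c 0) (c t) (c' t') \<in> angle_sups e" unfolding angle_sups_def by blast
    then show "m \<le> a" unfolding e(2) using cSup_upper[OF _ angle_sups_bdd] t(2) by (meson order_trans)
  qed
qed

lemma alex_angle_nonneg: "0 \<le> alex_angle c c'"
  unfolding alex_angle_eq
  by (rule cInf_greatest) (use angle_sups_Sup_nonneg zero_less_one in blast)+

lemma alex_angle_le_pi: "alex_angle c c' \<le> pi"
  by (rule alex_angle_le[OF zero_less_one]) (rule comparison_angle_bounds(2)[OF c])

end

lemma bd_angle_ge:
  assumes "\<xi> \<in> ideal_boundary TYPE('a::metric_space)" "\<eta> \<in> ideal_boundary TYPE('a)"
    and "c \<in> \<xi>" "c' \<in> \<eta>" "c 0 = (c' 0 :: 'a)"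
  shows "alex_angle c c' \<le> bd_angle \<xi> \<eta>"
  unfolding bd_angle_def
proof (rule cSup_upper)
  show "alex_angle c c' \<in> {alex_angle c c' | c c'. c \<in> \<xi> \<and> c' \<in> \<eta> \<and> c 0 = c' 0}" using assms by blast
  show "bdd_above {alex_angle c c' | c c'. c \<in> \<xi> \<and> c' \<in> \<eta> \<and> c 0 = c' 0}"
    unfolding bdd_above_def using alex_angle_le_pi boundary_ray_class(1)[OF assms(1)] boundary_ray_class(1)[OF assms(2)]
    by (intro exI[of _ pi]) blast
qed

lemma alex_angle_commute:
  assumes "c 0 = c' 0" shows "alex_angle c c' = alex_angle c' c"
proof -
  have "comparison_angle (c 0) (c t) (c' t') = comparison_angle (c' 0) (c' t') (c t)" for t t'
    by (simp add: comparison_angle_def assms dist_commute add.commute mult.commute mult.left_commute)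
  then have "{comparison_angle (c 0) (c t) (c' t') | t t'. 0 < t \<and> t < e \<and> 0 < t' \<and> t' < e} =
    {comparison_angle (c' 0) (c' t) (c t') | t t'. 0 < t \<and> t < e \<and> 0 < t' \<and> t' < e}" for e
    by (simp only:) blast
  then show ?thesis by (simp only: alex_angle_def)
qed

lemma bd_angle_commute: "bd_angle \<xi> \<eta> = bd_angle \<eta> (\<xi> :: (real \<Rightarrow> 'a::metric_space) set)"
proof -
  have "{alex_angle c c' | c c'. c \<in> \<xi> \<and> c' \<in> \<eta> \<and> c 0 = c' 0} \<subseteq> {alex_angle c c' | c c'. c \<in> \<eta> \<and> c' \<in> \<xi> \<and> c 0 = c' 0}" for \<xi> \<eta> :: "(real \<Rightarrow> 'a::metric_space) set"
  proof
    fix a assume "a \<in> {alex_angle c c' | c c'. c \<in> \<xi> \<and> c' \<in> \<eta> \<and> c 0 = c' 0}"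
    then obtain c c' where c: "a = alex_angle c c'" "c \<in> \<xi>" "c' \<in> \<eta>" "c 0 = c' 0" by blast
    show "a \<in> {alex_angle c c' | c c'. c \<in> \<eta> \<and> c' \<in> \<xi> \<and> c 0 = c' 0}"
      using trans[OF c(1) alex_angle_commute[of c c', OF c(4)]] c(2,3) c(4)[symmetric] by blast
  qed
  then have "{alex_angle c c' | c c'. c \<in> \<xi> \<and> c' \<in> \<eta> \<and> c 0 = c' 0} = {alex_angle c c' | c c'. c \<in> \<eta> \<and> c' \<in> \<xi> \<and> c 0 = c' 0}"
    by (intro equalityI)
  then show ?thesis by (simp only: bd_angle_def)
qed

text \<open>The partition with endpoints only already gives this lower bound for the length of every
  path.\<close>

lemma tits_dist_ge: "ereal (bd_angle \<xi> \<eta>) \<le> tits_dist \<xi> \<eta>"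
  unfolding tits_dist_def
proof (rule Inf_greatest)
  fix a assume "a \<in> {angle_length p | p. p 0 = \<xi> \<and> p 1 = \<eta> \<and> p ` {0..1} \<subseteq> ideal_boundary TYPE('a) \<and> angle_continuous p}"
  then obtain p where p: "a = angle_length p" "p 0 = \<xi>" "p 1 = \<eta>" by blast
  have "partition01 [0, 1]" by (simp add: partition01_def)
  then have "ereal (\<Sum>i<length [0::real, 1] - 1. bd_angle (p ([0, 1] ! i)) (p ([0, 1] ! Suc i))) \<le> angle_length p"
    unfolding angle_length_def by (intro Sup_upper) blast
  then show "ereal (bd_angle \<xi> \<eta>) \<le> a" using p by simp
qed

section \<open>Great arcs and maps from spheres to the Tits boundary\<close>

lemma orthogonal_vector_exists:
  assumes k: "1 \<le> k" and x: "x \<in> std_sphere k"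
  obtains z where "z \<in> std_sphere k" "(\<Sum>i\<le>k. x i * z i) = 0"
proof -
  have set2: "{..k} = {0, 1} \<union> {2..k}" using k by auto
  have sum2: "(\<Sum>i\<le>k. f i) = f 0 + f 1 + (\<Sum>i=2..k. f i)" for f :: "nat \<Rightarrow> real"
    unfolding set2 by (subst sum.union_disjoint) auto
  define q where "q = sqrt ((x 0)\<^sup>2 + (x 1)\<^sup>2)"
  show thesis
  proof (cases "q = 0")
    case True
    then have "x 0 = 0" by (simp add: q_def sum_power2_eq_zero_iff)
    moreover define z where "z = (\<lambda>i::nat. if i = 0 then 1 else 0::real)"
    moreover have "z \<in> std_sphere k" by (auto simp: std_sphere_def z_def sum2)
    ultimately show thesis using that[of z] by (simp add: sum2)
  next
    case False
    define z where "z = (\<lambda>i::nat. if i = 0 then - x 1 / q else if i = 1 then x 0 / q else 0)"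
    have "q\<^sup>2 = (x 0)\<^sup>2 + (x 1)\<^sup>2" by (simp add: q_def)
    then have "(x 1)\<^sup>2 / q\<^sup>2 + (x 0)\<^sup>2 / q\<^sup>2 = q\<^sup>2 / q\<^sup>2" unfolding add_divide_distrib[symmetric] by (simp only: add.commute)
    then have "(x 1)\<^sup>2 / q\<^sup>2 + (x 0)\<^sup>2 / q\<^sup>2 = 1" using False by simp
    then have "z \<in> std_sphere k" using k by (auto simp: std_sphere_def z_def sum2 power_divide)
    moreover have "(\<Sum>i\<le>k. x i * z i) = 0" by (simp add: sum2 z_def)
    ultimately show thesis by (rule that)
  qed
qed

lemma sum_prod_bound:
  assumes "x \<in> std_sphere k" "y \<in> std_sphere k"
  shows "\<bar>\<Sum>i\<le>k. x i * y i\<bar> \<le> 1"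
proof -
  have 1: "(\<Sum>i\<le>k. (x i)\<^sup>2) = 1" "(\<Sum>i\<le>k. (y i)\<^sup>2) = 1" using assms by (auto simp: std_sphere_def)
  have "0 \<le> (\<Sum>i\<le>k. (x i - y i)\<^sup>2)" "0 \<le> (\<Sum>i\<le>k. (x i + y i)\<^sup>2)" by (simp_all add: sum_nonneg)
  then have "0 \<le> 2 - 2 * (\<Sum>i\<le>k. x i * y i)" "0 \<le> 2 + 2 * (\<Sum>i\<le>k. x i * y i)"
    using 1 by (simp_all add: power2_diff power2_sum sum.distrib sum_subtractf sum_distrib_left mult.assoc)
  then show ?thesis by simp
qed

lemma great_arc:
  assumes k: "1 \<le> k" and x: "x \<in> std_sphere k" and y: "y \<in> std_sphere k"
  shows "\<exists>\<gamma>. \<gamma> 0 = x \<and> \<gamma> 1 = y \<and> (\<forall>s. \<gamma> s \<in> std_sphere k) \<and>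
    (\<forall>s\<in>{0..1::real}. \<forall>t\<in>{0..1}. sph_dist k (\<gamma> s) (\<gamma> t) = sph_dist k x y * \<bar>s - t\<bar>)"
proof -
  define a where "a = (\<Sum>i\<le>k. x i * y i)"
  define L where "L = arccos a"
  have a: "-1 \<le> a" "a \<le> 1" using sum_prod_bound[OF x y] by (auto simp: a_def)
  have L: "cos L = a" "0 \<le> L" "L \<le> pi" using a by (auto simp: L_def arccos_lbound arccos_ubound)
  have xx: "(\<Sum>i\<le>k. x i * x i) = 1" "(\<Sum>i\<le>k. y i * y i) = 1" and xy0: "\<And>i. i > k \<Longrightarrow> x i = 0" "\<And>i. i > k \<Longrightarrow> y i = 0"
    using x y by (auto simp: std_sphere_def power2_eq_square)
  \<comment> \<open>The plane of the arc is spanned by \<open>x\<close> and \<open>z\<close>. For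
    equal or antipodal points it is arbitrary, and \<open>1 \<le> k\<close> guarantees a
    choice.\<close>
  have "\<exists>z. z \<in> std_sphere k \<and> (\<Sum>i\<le>k. x i * z i) = 0 \<and> y = (\<lambda>i. cos L * x i + sin L * z i)"
  proof (cases "sin L = 0")
    case True
    obtain z where z: "z \<in> std_sphere k" "(\<Sum>i\<le>k. x i * z i) = 0" by (rule orthogonal_vector_exists[OF k x])
    have "a\<^sup>2 = 1" using sin_cos_squared_add[of L] True L(1) by simp
    have "(\<Sum>i\<le>k. (y i - a * x i)\<^sup>2) = (\<Sum>i\<le>k. y i * y i) - 2 * a * (\<Sum>i\<le>k. x i * y i) + a\<^sup>2 * (\<Sum>i\<le>k. x i * x i)"
      unfolding sum_distrib_left sum_subtractf[symmetric] sum.distrib[symmetric]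
      by (intro sum.cong) (auto simp: power2_eq_square algebra_simps)
    also have "\<dots> = 0" using xx \<open>a\<^sup>2 = 1\<close> by (simp add: a_def[symmetric] power2_eq_square)
    finally have "\<forall>i\<in>{..k}. (y i - a * x i)\<^sup>2 = 0" by (subst (asm) sum_nonneg_eq_0_iff) auto
    then have "y i = a * x i" for i using xy0 by (cases "i \<le> k") auto
    then have "y = (\<lambda>i. cos L * x i + sin L * z i)" using L(1) True by auto
    then show ?thesis using z by blast
  next
    case False
    define z where "z = (\<lambda>i. (y i - a * x i) / sin L)"
    have s2: "(sin L)\<^sup>2 = 1 - a\<^sup>2" using sin_cos_squared_add[of L] L(1) by simp
    have "(\<Sum>i\<le>k. (y i - a * x i)\<^sup>2) = (\<Sum>i\<le>k. y i * y i) - 2 * a * (\<Sum>i\<le>k. x i * y i) + a\<^sup>2 * (\<Sum>i\<le>k. x i * x i)"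
      unfolding sum_distrib_left sum_subtractf[symmetric] sum.distrib[symmetric]
      by (intro sum.cong) (auto simp: power2_eq_square algebra_simps)
    also have "\<dots> = (sin L)\<^sup>2" using xx s2 by (simp add: a_def[symmetric] power2_eq_square)
    finally have "(\<Sum>i\<le>k. (z i)\<^sup>2) = 1" using False by (simp add: z_def power_divide sum_divide_distrib[symmetric])
    then have "z \<in> std_sphere k" using xy0 by (simp add: std_sphere_def z_def)
    moreover have "(\<Sum>i\<le>k. x i * z i) = (\<Sum>i\<le>k. x i * y i - a * (x i * x i)) / sin L"
      unfolding sum_divide_distrib by (intro sum.cong) (auto simp: z_def algebra_simps)
    then have "(\<Sum>i\<le>k. x i * z i) = 0" using xx by (simp add: sum_subtractf sum_distrib_left[symmetric] a_def[symmetric])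
    moreover have "y = (\<lambda>i. cos L * x i + sin L * z i)" using False L(1) by (auto simp: z_def)
    ultimately show ?thesis by blast
  qed
  then obtain z where z: "z \<in> std_sphere k" "(\<Sum>i\<le>k. x i * z i) = 0" "y = (\<lambda>i. cos L * x i + sin L * z i)" by blast
  have zz: "(\<Sum>i\<le>k. z i * z i) = 1" and z0: "\<And>i. i > k \<Longrightarrow> z i = 0" using z(1) by (auto simp: std_sphere_def power2_eq_square)
  define \<gamma> where "\<gamma> = (\<lambda>s i. cos (s * L) * x i + sin (s * L) * z i)"
  have inner: "(\<Sum>i\<le>k. \<gamma> s i * \<gamma> t i) = cos ((s - t) * L)" for s t
  proof -
    have "(\<Sum>i\<le>k. \<gamma> s i * \<gamma> t i) = cos (s * L) * cos (t * L) * (\<Sum>i\<le>k. x i * x i) + (cos (s * L) * sin (t * L) + sin (s * L) * cos (t * L)) * (\<Sum>i\<le>k. x i * z i) + sin (s * L) * sin (t * L) * (\<Sum>i\<le>k. z i * z i)"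
      unfolding sum_distrib_left sum.distrib[symmetric] \<gamma>_def by (intro sum.cong) (auto simp: algebra_simps)
    also have "\<dots> = cos (s * L - t * L)" using xx z zz by (simp add: cos_diff)
    finally show ?thesis by (simp add: left_diff_distrib)
  qed
  show ?thesis
  proof (intro exI[of _ \<gamma>] conjI allI ballI)
    show "\<gamma> 0 = x" by (simp add: \<gamma>_def)
    show "\<gamma> 1 = y" using z(3) by (simp add: \<gamma>_def)
    show "\<gamma> s \<in> std_sphere k" for s
      using inner[of s s] xy0 z0 by (simp add: std_sphere_def power2_eq_square) (simp add: \<gamma>_def)
    fix s t :: real assume "s \<in> {0..1}" "t \<in> {0..1}"
    then have st: "0 \<le> s" "s \<le> 1" "0 \<le> t" "t \<le> 1" by auto
    have "cos ((s - t) * L) = cos (\<bar>s - t\<bar> * L)" by (cases "s \<le> t") (auto simp: abs_if left_diff_distrib cos_diff)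
    moreover have "\<bar>s - t\<bar> \<le> 1" using st by (simp add: abs_le_iff)
    then have "\<bar>s - t\<bar> * L \<le> 1 * pi" using L by (intro mult_mono) auto
    moreover have "0 \<le> \<bar>s - t\<bar> * L" using L by simp
    ultimately have "arccos (cos ((s - t) * L)) = \<bar>s - t\<bar> * L" by (simp add: arccos_cos)
    then show "sph_dist k (\<gamma> s) (\<gamma> t) = sph_dist k x y * \<bar>s - t\<bar>"
      unfolding sph_dist_def inner a_def[symmetric] L_def[symmetric] by (simp add: mult.commute)
  qed
qed

text \<open>Angles bound Tits distances from below. The image of a great arc has angles proportional
  to parameters, so its length telescopes to the spherical distance and the bound is
  attained.\<close>

lemma tits_isometry_from_angles:
  fixes \<Phi> :: "(nat \<Rightarrow> real) \<Rightarrow> (real \<Rightarrow> 'a::metric_space) set"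
  assumes k: "1 \<le> k" and bd: "\<And>x. x \<in> std_sphere k \<Longrightarrow> \<Phi> x \<in> ideal_boundary TYPE('a)"
    and ang: "\<And>x y. x \<in> std_sphere k \<Longrightarrow> y \<in> std_sphere k \<Longrightarrow> bd_angle (\<Phi> x) (\<Phi> y) = sph_dist k x y"
    and A: "A \<subseteq> std_sphere k"
  shows "tits_isometry k A \<Phi> (\<Phi> ` A)"
proof -
  have inj: "x = y" if x: "x \<in> std_sphere k" and y: "y \<in> std_sphere k" and eq: "\<Phi> x = \<Phi> y" for x y
  proof -
    have n: "(\<Sum>i\<le>k. x i * x i) = 1" "(\<Sum>i\<le>k. y i * y i) = 1" using x y by (auto simp: std_sphere_def power2_eq_square)
    have "sph_dist k x y = sph_dist k x x" using ang[OF x y] ang[OF x x] eq by simp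
    then have "arccos (\<Sum>i\<le>k. x i * y i) = arccos 1" using n by (simp add: sph_dist_def)
    then have "cos (arccos (\<Sum>i\<le>k. x i * y i)) = 1" by simp
    then have xy: "(\<Sum>i\<le>k. x i * y i) = 1" using sum_prod_bound[OF x y] by (simp add: cos_arccos_abs)
    have "(\<Sum>i\<le>k. (x i - y i)\<^sup>2) = (\<Sum>i\<le>k. x i * x i) - 2 * (\<Sum>i\<le>k. x i * y i) + (\<Sum>i\<le>k. y i * y i)"
      unfolding sum_distrib_left sum_subtractf[symmetric] sum.distrib[symmetric]
      by (intro sum.cong) (auto simp: power2_eq_square algebra_simps)
    then have "(\<Sum>i\<le>k. (x i - y i)\<^sup>2) = 0" using n xy by simp
    then have "\<forall>i\<in>{..k}. (x i - y i)\<^sup>2 = 0" by (subst (asm) sum_nonneg_eq_0_iff) auto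
    moreover have "x i = y i" if "i > k" for i using x y that by (simp add: std_sphere_def)
    ultimately show "x = y" by (metis atMost_iff eq_iff_diff_eq_0 ext linorder_not_le zero_eq_power2)
  qed
  have tits: "tits_dist (\<Phi> x) (\<Phi> y) = ereal (sph_dist k x y)" if x: "x \<in> std_sphere k" and y: "y \<in> std_sphere k" for x y
  proof (rule antisym)
    show "ereal (sph_dist k x y) \<le> tits_dist (\<Phi> x) (\<Phi> y)" using tits_dist_ge[of "\<Phi> x" "\<Phi> y"] ang[OF x y] by simp
    obtain \<gamma> where \<gamma>: "\<gamma> (0::real) = x" "\<gamma> 1 = y" "\<And>s. \<gamma> s \<in> std_sphere k"
      and arc: "\<forall>s\<in>{0..1}. \<forall>t\<in>{0..1}. sph_dist k (\<gamma> s) (\<gamma> t) = sph_dist k x y * \<bar>s - t\<bar>"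
      using great_arc[OF k x y] by blast
    define L where "L = sph_dist k x y"
    have L: "0 \<le> L" using sum_prod_bound[OF x y] by (auto simp: L_def sph_dist_def intro!: arccos_lbound)
    define p where "p = (\<lambda>s. \<Phi> (\<gamma> s))"
    have pd: "bd_angle (p s) (p t) = L * \<bar>s - t\<bar>" if "0 \<le> s" "s \<le> 1" "0 \<le> t" "t \<le> 1" for s t
      using ang[OF \<gamma>(3) \<gamma>(3)] arc that by (simp add: p_def L_def)
    have "angle_continuous p"
      unfolding angle_continuous_def
    proof (intro ballI allI impI)
      fix t e :: real assume t: "t \<in> {0..1}" and e: "0 < e"
      show "\<exists>d>0. \<forall>s\<in>{0..1}. \<bar>s - t\<bar> < d \<longrightarrow> bd_angle (p s) (p t) < e"
      proof (intro exI[of _ "e / (L + 1)"] conjI ballI impI)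
        show "0 < e / (L + 1)" using e L by simp
        fix s assume s: "s \<in> {0..1}" "\<bar>s - t\<bar> < e / (L + 1)"
        have "L * \<bar>s - t\<bar> \<le> (L + 1) * \<bar>s - t\<bar>" by (intro mult_right_mono) auto
        also have "\<dots> < e" using s(2) L by (simp add: pos_less_divide_eq mult.commute)
        finally show "bd_angle (p s) (p t) < e" using pd[of s t] s(1) t by simp
      qed
    qed
    moreover have "p ` {0..1} \<subseteq> ideal_boundary TYPE('a)" using bd[OF \<gamma>(3)] by (auto simp: p_def)
    ultimately have "tits_dist (\<Phi> x) (\<Phi> y) \<le> angle_length p"
      unfolding tits_dist_def using \<gamma>(1,2) by (intro Inf_lower) (auto simp: p_def)
    also have "\<dots> \<le> ereal L"
      unfolding angle_length_def
    proof (rule Sup_least)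
      fix a assume "a \<in> {ereal (\<Sum>i<length ts - 1. bd_angle (p (ts ! i)) (p (ts ! Suc i))) | ts. partition01 ts}"
      then obtain ts where ts: "partition01 ts" and a: "a = ereal (\<Sum>i<length ts - 1. bd_angle (p (ts ! i)) (p (ts ! Suc i)))" by blast
      have ne: "ts \<noteq> []" and sorted: "sorted ts" and h: "ts ! 0 = 0" and l: "ts ! (length ts - 1) = 1"
        using ts by (auto simp: partition01_def hd_conv_nth last_conv_nth)
      have rng: "0 \<le> ts ! i" "ts ! i \<le> 1" if "i < length ts" for i
        using sorted_nth_mono[OF sorted, of 0 i] sorted_nth_mono[OF sorted, of i "length ts - 1"] that h l by auto
      have "(\<Sum>i<length ts - 1. bd_angle (p (ts ! i)) (p (ts ! Suc i))) = (\<Sum>i<length ts - 1. L * (ts ! Suc i) - L * (ts ! i))"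
      proof (rule sum.cong[OF refl])
        fix i assume "i \<in> {..<length ts - 1}"
        then have i: "i < length ts" "Suc i < length ts" by auto
        have "ts ! i \<le> ts ! Suc i" using sorted_nth_mono[OF sorted, of i "Suc i"] i by simp
        then show "bd_angle (p (ts ! i)) (p (ts ! Suc i)) = L * (ts ! Suc i) - L * (ts ! i)"
          using pd[of "ts ! i" "ts ! Suc i"] rng i by (simp add: abs_if right_diff_distrib)
      qed
      also have "\<dots> = L * ts ! (length ts - 1) - L * ts ! 0" by (rule sum_lessThan_telescope)
      finally show "a \<le> ereal L" using a h l by simp
    qed
    finally show "tits_dist (\<Phi> x) (\<Phi> y) \<le> ereal (sph_dist k x y)" by (simp add: L_def)
  qed
  show ?thesis
    unfolding tits_isometry_def bij_betw_def
  proof (intro conjI inj_onI ballI refl)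
    fix x y assume "x \<in> A" "y \<in> A"
    then have xy: "x \<in> std_sphere k" "y \<in> std_sphere k" using A by auto
    show "tits_dist (\<Phi> x) (\<Phi> y) = ereal (sph_dist k x y)" by (rule tits[OF xy])
    show "x = y" if "\<Phi> x = \<Phi> y" by (rule inj[OF xy that])
  qed
qed

context hadamard
begin

lemma comparison_angle_mono:
  fixes c c' :: "real \<Rightarrow> 'a"
  assumes c: "geod_ray c" "geod_ray c'" "c 0 = c' 0" and s: "0 < s" "s \<le> T" and t: "0 < t" "t \<le> T"
  shows "comparison_angle (c 0) (c s) (c' t) \<le> comparison_angle (c 0) (c T) (c' T)"
proof -
  have T: "0 < T" using s by simp
  define D where "D = dist (c T) (c' T)"
  have cT: "dist (c 0) (c T) = T" "dist (c' 0) (c' T) = T" using geod_rayD[OF c(1), of 0 T] geod_rayD[OF c(2), of 0 T] T by auto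
  have "(dist (c s) (c' t))\<^sup>2 \<le> (s / T)\<^sup>2 * T\<^sup>2 + (t / T)\<^sup>2 * T\<^sup>2 - (s / T) * (t / T) * (T\<^sup>2 + T\<^sup>2 - D\<^sup>2)"
    using hinge[OF geod_ray_affine[OF c(1), of 0 T] geod_ray_affine[OF c(2), of 0 T], of "s / T" "t / T"] s t T c(3) cT
    by (simp add: D_def)
  also have "\<dots> = s\<^sup>2 + t\<^sup>2 - s * t * ((T\<^sup>2 + T\<^sup>2 - D\<^sup>2) / T\<^sup>2)"
    using T by (simp add: power2_eq_square field_simps)
  finally have "s * t * ((T\<^sup>2 + T\<^sup>2 - D\<^sup>2) / T\<^sup>2) \<le> s\<^sup>2 + t\<^sup>2 - (dist (c s) (c' t))\<^sup>2" by simp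
  then have "(T\<^sup>2 + T\<^sup>2 - D\<^sup>2) / (2 * T * T) \<le> (s\<^sup>2 + t\<^sup>2 - (dist (c s) (c' t))\<^sup>2) / (2 * s * t)"
    using s t T by (simp add: pos_le_divide_eq power2_eq_square) (simp add: field_simps)
  then show ?thesis
    unfolding comparison_angle_rays[OF c s(1) t(1)] comparison_angle_rays[OF c T T] D_def[symmetric]
    using comparison_cos_bounds[OF c s(1) t(1)] comparison_cos_bounds[OF c T T]
    by (intro arccos_le_arccos) (auto simp: D_def)
qed

lemma alex_angle_le_comparison:
  fixes c c' :: "real \<Rightarrow> 'a"
  assumes c: "geod_ray c" "geod_ray c'" "c 0 = c' 0" and T: "0 < T"
  shows "alex_angle c c' \<le> comparison_angle (c 0) (c T) (c' T)"
  by (rule alex_angle_le[OF c T]) (rule comparison_angle_mono[OF c]; simp)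

text \<open>Rays at angle \<alpha> from a common point are at least
  \<open>2 * t * sin (\<alpha> / 2)\<close> apart at time \<open>t\<close>. Passing to asymptotic
  rays changes distances by a bounded amount only, so the linear growth rate limits every angle in
  the supremum.\<close>

lemma bd_angle_le:
  fixes c c' :: "real \<Rightarrow> 'a"
  assumes c: "geod_ray c" "geod_ray c'" and \<theta>: "0 \<le> \<theta>" "\<theta> \<le> pi"
    and B: "\<And>t. 0 \<le> t \<Longrightarrow> dist (c t) (c' t) \<le> 2 * t * sin (\<theta> / 2) + B"
  shows "bd_angle (ray_class c) (ray_class c') \<le> \<theta>"
  unfolding bd_angle_def
proof (rule cSup_least)
  obtain d where "geod_ray d" "d 0 = c 0" "asymptotic c' d" using ray_from_point[OF c(2), of "c 0"] by metis
  then have "alex_angle c d \<in> {alex_angle d d' | d d'. d \<in> ray_class c \<and> d' \<in> ray_class c' \<and> d 0 = d' 0}"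
    using ray_class_self[OF c(1)] by (intro CollectI exI[of _ c] exI[of _ d]) (auto simp: ray_class_def)
  then show "{alex_angle d d' | d d'. d \<in> ray_class c \<and> d' \<in> ray_class c' \<and> d 0 = d' 0} \<noteq> {}" by blast
  fix \<alpha> assume "\<alpha> \<in> {alex_angle d d' | d d'. d \<in> ray_class c \<and> d' \<in> ray_class c' \<and> d 0 = d' 0}"
  then obtain d d' where d: "\<alpha> = alex_angle d d'" "geod_ray d" "asymptotic c d" "geod_ray d'" "asymptotic c' d'" "d 0 = d' 0"
    by (auto simp: ray_class_def)
  obtain B1 B2 where B12: "\<forall>t\<ge>0. dist (c t) (d t) \<le> B1" "\<forall>t\<ge>0. dist (c' t) (d' t) \<le> B2" using d unfolding asymptotic_def by blast
  have \<alpha>: "0 \<le> \<alpha>" "\<alpha> \<le> pi" using alex_angle_nonneg[OF d(2,4,6)] alex_angle_le_pi[OF d(2,4,6)] d(1) by auto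
  have s2: "0 \<le> sin (\<alpha> / 2)" using \<alpha> by (intro sin_ge_zero) auto
  have key: "sin (\<alpha> / 2) \<le> sin (\<theta> / 2) + (B + B1 + B2) / (2 * t)" if t: "0 < t" for t
  proof -
    define D where "D = dist (d t) (d' t)"
    define z where "z = (t\<^sup>2 + t\<^sup>2 - D\<^sup>2) / (2 * t * t)"
    have z: "-1 \<le> z" "z \<le> 1" using comparison_cos_bounds[OF d(2,4,6) t t] by (auto simp: z_def D_def)
    have "\<alpha> \<le> arccos z"
      using alex_angle_le_comparison[OF d(2,4,6) t] comparison_angle_rays[OF d(2,4,6) t t] d(1) by (simp add: z_def D_def)
    then have "cos (arccos z) \<le> cos \<alpha>" using \<alpha> arccos_ubound[OF z] by (intro cos_monotone_0_pi_le) auto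
    then have "z \<le> cos \<alpha>" using z by simp
    also have "cos \<alpha> = 1 - 2 * (sin (\<alpha> / 2))\<^sup>2" using cos_double_sin[of "\<alpha> / 2"] by simp
    finally have "2 * (sin (\<alpha> / 2))\<^sup>2 \<le> 1 - z" by simp
    also have "1 - z = D\<^sup>2 / (2 * t\<^sup>2)" using t by (simp add: z_def power2_eq_square field_simps)
    finally have "(2 * t * sin (\<alpha> / 2))\<^sup>2 \<le> D\<^sup>2" using t by (simp add: power_mult_distrib pos_le_divide_eq mult.commute)
    then have "2 * t * sin (\<alpha> / 2) \<le> D" by (rule power2_le_imp_le) (simp add: D_def)
    also have "D \<le> dist (c t) (c' t) + B1 + B2"
      using B12 t dist_triangle[of "d t" "d' t" "c t"] dist_triangle[of "c t" "d' t" "c' t"]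
      by (simp add: D_def dist_commute) (smt (verit))
    also have "\<dots> \<le> 2 * t * sin (\<theta> / 2) + (B + B1 + B2)" using B[of t] t by simp
    finally have "sin (\<alpha> / 2) * (2 * t) \<le> sin (\<theta> / 2) * (2 * t) + (B + B1 + B2)" by (simp add: mult.commute)
    then show ?thesis using t by (simp add: field_simps)
  qed
  have "((\<lambda>t. sin (\<theta> / 2) + (B + B1 + B2) / (2 * t)) \<longlongrightarrow> sin (\<theta> / 2) + 0) at_top"
    by (intro tendsto_intros tendsto_divide_0[OF tendsto_const] filterlim_at_top_imp_at_infinity
        filterlim_tendsto_pos_mult_at_top[OF tendsto_const] filterlim_ident) simp
  moreover have "eventually (\<lambda>t. sin (\<alpha> / 2) \<le> sin (\<theta> / 2) + (B + B1 + B2) / (2 * t)) at_top"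
    using key by (intro eventually_mono[OF eventually_gt_at_top[of 0]])
  ultimately have "sin (\<alpha> / 2) \<le> sin (\<theta> / 2) + 0" using tendsto_lowerbound[OF _ _ trivial_limit_at_top_linorder] by blast
  then have "\<alpha> / 2 \<le> \<theta> / 2" using \<alpha> \<theta> sin_mono_le_eq[of "\<alpha> / 2" "\<theta> / 2"] by simp
  then show "\<alpha> \<le> \<theta>" by simp
qed

lemma half_angle_chord:
  assumes "-1 \<le> a" "a \<le> 1" "0 \<le> t"
  shows "2 * t * sin (arccos a / 2) = t * sqrt (2 - 2 * a)"
proof -
  have "(2 * sin (arccos a / 2))\<^sup>2 = 2 - 2 * a"
    using cos_double_sin[of "arccos a / 2"] assms by (simp add: power_mult_distrib)
  moreover have "0 \<le> sin (arccos a / 2)" using arccos_lbound[of a] arccos_ubound[of a] assms by (intro sin_ge_zero) auto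
  ultimately have "sqrt (2 - 2 * a) = 2 * sin (arccos a / 2)" by (metis mult_nonneg_nonneg real_sqrt_unique zero_le_numeral)
  then show ?thesis by simp
qed

lemma bd_angle_flat_sector:
  fixes c c' :: "real \<Rightarrow> 'a"
  assumes c: "geod_ray c" "geod_ray c'" "c 0 = c' 0" and a: "-1 \<le> a" "a \<le> 1"
    and d: "\<And>t t'. 0 \<le> t \<Longrightarrow> 0 \<le> t' \<Longrightarrow> (dist (c t) (c' t'))\<^sup>2 = t\<^sup>2 + t'\<^sup>2 - 2 * t * t' * a"
  shows "bd_angle (ray_class c) (ray_class c') = arccos a"
proof (rule antisym)
  show "bd_angle (ray_class c) (ray_class c') \<le> arccos a"
  proof (rule bd_angle_le[OF c(1,2)])
    show "0 \<le> arccos a" "arccos a \<le> pi" using a by (auto intro: arccos_lbound arccos_ubound)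
    fix t :: real assume t: "0 \<le> t"
    have "(dist (c t) (c' t))\<^sup>2 = (t * sqrt (2 - 2 * a))\<^sup>2" using d[OF t t] a by (simp add: power_mult_distrib power2_eq_square algebra_simps)
    then have "dist (c t) (c' t) = t * sqrt (2 - 2 * a)" using t a by (simp add: power2_eq_iff_nonneg)
    then show "dist (c t) (c' t) \<le> 2 * t * sin (arccos a / 2) + 0" unfolding half_angle_chord[OF a t] by simp
  qed
  have "arccos a \<le> alex_angle c c'"
  proof (rule alex_angle_ge[OF c])
    fix e m :: real assume e: "e > 0" and m: "m < arccos a"
    have "comparison_angle (c 0) (c (e / 2)) (c' (e / 2)) = arccos a"
      using comparison_angle_rays[OF c, of "e / 2" "e / 2"] d[of "e / 2" "e / 2"] e by simp
    then show "\<exists>t t'. 0 < t \<and> t < e \<and> 0 < t' \<and> t' < e \<and> m \<le> comparison_angle (c 0) (c t) (c' t')"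
      using e m by (intro exI[of _ "e / 2"]) auto
  qed
  also have "\<dots> \<le> bd_angle (ray_class c) (ray_class c')"
    by (rule bd_angle_ge[OF ray_class_boundary[OF c(1)] ray_class_boundary[OF c(2)] ray_class_self[OF c(1)] ray_class_self[OF c(2)] c(3)])
  finally show "arccos a \<le> bd_angle (ray_class c) (ray_class c')" .
qed

end

context morse_flat_space
begin

lemma rf_asymptotic: "ray_field y E \<Longrightarrow> v \<in> S \<Longrightarrow> asymptotic (E 0) (E v)"
  unfolding asymptotic_def using rf_contract[of y E 0 v] by (intro exI[of _ "norm v"]) auto

lemma flat_ray:
  assumes E: "ray_field y E" and z: "z \<in> S" and u: "u \<in> S" "norm u = 1"
  shows "geod_ray (\<lambda>t. E (z + t *\<^sub>R u) 0)" "asymptotic (\<lambda>t. E (z + t *\<^sub>R u) 0) (\<lambda>t. \<iota> (t *\<^sub>R u))"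
proof -
  show "geod_ray (\<lambda>t. E (z + t *\<^sub>R u) 0)"
    unfolding geod_ray_def
  proof (intro allI impI)
    fix s t :: real
    have "dist (E (z + s *\<^sub>R u) 0) (E (z + t *\<^sub>R u) 0) = norm ((s - t) *\<^sub>R u)"
      using rf_base_dist[OF E, of "z + s *\<^sub>R u" "z + t *\<^sub>R u"] z u by (simp add: scaleR_diff_left)
    then show "dist (E (z + s *\<^sub>R u) 0) (E (z + t *\<^sub>R u) 0) = \<bar>s - t\<bar>" using u by simp
  qed
  have "dist (E (z + t *\<^sub>R u) 0) (\<iota> (t *\<^sub>R u)) = norm (z + y)" for t
    using rf_0[OF E, of "z + t *\<^sub>R u"] isometric[of "z + t *\<^sub>R u + y" "t *\<^sub>R u"] z u rf_y[OF E] by (simp add: algebra_simps)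
  then show "asymptotic (\<lambda>t. E (z + t *\<^sub>R u) 0) (\<lambda>t. \<iota> (t *\<^sub>R u))" unfolding asymptotic_def by (metis order_refl)
qed

definition flat_point :: "'v \<Rightarrow> (real \<Rightarrow> 'a) set" where
  "flat_point u = ray_class (\<lambda>t. \<iota> (t *\<^sub>R u))"

lemma iota_ray: "u \<in> S \<Longrightarrow> norm u = 1 \<Longrightarrow> geod_ray (\<lambda>t. \<iota> (t *\<^sub>R u))"
  using isometric[of "_ *\<^sub>R u" "_ *\<^sub>R u"] by (auto simp: geod_ray_def simp flip: scaleR_diff_left)

lemma flat_point_boundary: "u \<in> S \<Longrightarrow> norm u = 1 \<Longrightarrow> flat_point u \<in> ideal_boundary TYPE('a)"
  unfolding flat_point_def by (intro ray_class_boundary iota_ray)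

lemma flat_point_eq: "ray_field y E \<Longrightarrow> z \<in> S \<Longrightarrow> u \<in> S \<Longrightarrow> norm u = 1 \<Longrightarrow> flat_point u = ray_class (\<lambda>t. E (z + t *\<^sub>R u) 0)"
  unfolding flat_point_def by (rule ray_class_eq[symmetric]) (rule flat_ray(2))

lemma flat_point_angle:
  assumes "u \<in> S" "norm u = 1" "u' \<in> S" "norm u' = 1"
  shows "bd_angle (flat_point u) (flat_point u') = arccos (u \<bullet> u')"
  unfolding flat_point_def
proof (rule bd_angle_flat_sector[OF iota_ray[OF assms(1,2)] iota_ray[OF assms(3,4)]])
  show "-1 \<le> u \<bullet> u'" "u \<bullet> u' \<le> 1" using Cauchy_Schwarz_ineq2[of u u'] assms by auto
  fix t t' :: real
  have "u \<bullet> u = 1" "u' \<bullet> u' = 1" using assms by (auto simp: norm_eq_1)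
  then show "(dist (\<iota> (t *\<^sub>R u)) (\<iota> (t' *\<^sub>R u')))\<^sup>2 = t\<^sup>2 + t'\<^sup>2 - 2 * t * t' * (u \<bullet> u')"
    unfolding isometric[OF subspace_scale[OF subS assms(1)] subspace_scale[OF subS assms(3)]] power2_norm_eq_inner
    by (simp add: inner_simps inner_commute power2_eq_square algebra_simps)
qed simp

text \<open>If \<open>bus\<close> grows with slope \<open>s\<close> along \<open>u\<close>, then
  \<open>E z t\<close> is at least \<open>t + h * s\<close> away from the flat point at distance
  \<open>h\<close>; for \<open>h\<close> small compared with \<open>t\<close> this makes the
  comparison angle almost \<open>arccos (- s)\<close>.\<close>

lemma slope_imp_angle_ge:
  assumes E: "ray_field y E" and z: "z \<in> S" and u: "u \<in> S" "norm u = 1" and s: "-1 \<le> s" "s \<le> 1"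
    and slope: "\<And>h. 0 < h \<Longrightarrow> h * s \<le> bus E (z + h *\<^sub>R u) - bus E z"
  shows "arccos (- s) \<le> bd_angle (ray_class (E 0)) (flat_point u)"
proof -
  let ?c' = "\<lambda>t. E (z + t *\<^sub>R u) 0"
  have c: "geod_ray (E z)" "geod_ray ?c'" "E z 0 = ?c' 0" using rf_ray[OF E z] flat_ray(1)[OF E z u] by auto
  have "arccos (- s) \<le> alex_angle (E z) ?c'"
  proof (rule alex_angle_ge[OF c])
    fix e m :: real assume e: "e > 0" and m: "m < arccos (- s)"
    show "\<exists>t h. 0 < t \<and> t < e \<and> 0 < h \<and> h < e \<and> m \<le> comparison_angle (E z 0) (E z t) (?c' h)"
    proof (cases "m \<le> 0")
      case True
      then show ?thesis using comparison_angle_bounds(1)[OF c, of "e / 2" "e / 2"] e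
        by (intro exI[of _ "e / 2"]) auto
    next
      case False
      have mpi: "m < pi" using m arccos_ubound[of "- s"] s by simp
      have "cos (arccos (- s)) < cos m" using m False arccos_ubound[of "- s"] s by (intro cos_monotone_0_pi) auto
      then have gap: "0 < cos m + s" using s by simp
      define t where "t = e / 2"
      \<comment> \<open>The second-order term \<open>h * h\<close> must not exceed the first-order
        slack \<open>h * (2 * t * (cos m + s))\<close>.\<close>
      define h where "h = min t (2 * t * (cos m + s))"
      have th: "0 < t" "t < e" "0 < h" "h \<le> t" "h < e" using e gap by (auto simp: t_def h_def)
      define D where "D = dist (E z t) (?c' h)"
      have "t + h * s \<le> D"
        using bus_le_dist[OF E z, of "z + h *\<^sub>R u" t] slope[OF th(3)] z u th by (simp add: D_def dist_commute)
      moreover have "h * s \<ge> - h" using s th by (simp add: mult_le_cancel_left1) (metis le_minus_iff mult_le_cancel_left_pos mult_minus1_right)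
      then have "0 \<le> t + h * s" using th by linarith
      ultimately have "(t + h * s)\<^sup>2 \<le> D\<^sup>2" by (intro power_mono) auto
      then have "t\<^sup>2 + h\<^sup>2 - D\<^sup>2 \<le> h\<^sup>2 * (1 - s\<^sup>2) - 2 * t * h * s"
        by (simp add: power2_eq_square algebra_simps)
      also have "\<dots> \<le> h\<^sup>2 * 1 - 2 * t * h * s" by (intro diff_right_mono mult_left_mono) auto
      finally have "t\<^sup>2 + h\<^sup>2 - D\<^sup>2 \<le> h * h - 2 * t * h * s" by (simp add: power2_eq_square)
      also have "h * h \<le> h * (2 * t * (cos m + s))" using th by (intro mult_left_mono) (auto simp: h_def)
      also have "h * (2 * t * (cos m + s)) - 2 * t * h * s = cos m * (2 * t * h)" by (simp add: algebra_simps)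
      finally have "t\<^sup>2 + h\<^sup>2 - D\<^sup>2 \<le> cos m * (2 * t * h)" by simp
      then have "(t\<^sup>2 + h\<^sup>2 - D\<^sup>2) / (2 * t * h) \<le> cos m" using th by (simp add: pos_divide_le_eq)
      then have "arccos (cos m) \<le> arccos ((t\<^sup>2 + h\<^sup>2 - D\<^sup>2) / (2 * t * h))"
        using comparison_cos_bounds(1)[OF c th(1,3)] by (intro arccos_le_arccos) (auto simp: D_def)
      then have "m \<le> comparison_angle (E z 0) (E z t) (?c' h)"
        using comparison_angle_rays[OF c th(1,3)] False mpi by (simp add: D_def arccos_cos)
      then show ?thesis using th by blast
    qed
  qed
  also have "\<dots> \<le> bd_angle (ray_class (E 0)) (flat_point u)"
  proof (rule bd_angle_ge)
    show "ray_class (E 0) \<in> ideal_boundary TYPE('a)" using rf_ray[OF E, of 0] by (intro ray_class_boundary) simp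
    show "flat_point u \<in> ideal_boundary TYPE('a)" using flat_point_boundary u by blast
    show "E z \<in> ray_class (E 0)" using rf_asymptotic[OF E z] c(1) by (simp add: ray_class_def)
    show "?c' \<in> flat_point u" unfolding flat_point_eq[OF E z u] using ray_class_self[OF c(2)] .
  qed (use c(3) in simp)
  finally show ?thesis .
qed

lemma bus_slope_mono:
  assumes E: "ray_field y E" and v: "v \<in> S" and u: "u \<in> S" and h: "0 < h"
  shows "h * (bus E (v + u) - bus E v) \<le> bus E ((v + u) + h *\<^sub>R u) - bus E (v + u)"
proof -
  define l where "l = 1 / (1 + h)"
  have l: "0 \<le> l" "l \<le> 1" "l * (1 + h) = 1" using h by (auto simp: l_def)
  have "bus E ((1 - l) *\<^sub>R v + l *\<^sub>R (v + u + h *\<^sub>R u)) \<le> (1 - l) * bus E v + l * bus E (v + u + h *\<^sub>R u)"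
    using v u l by (intro bus_convex[OF E]) auto
  moreover have "(1 - l) *\<^sub>R v + l *\<^sub>R (v + u + h *\<^sub>R u) = v + (l * (1 + h)) *\<^sub>R u" by (simp add: algebra_simps)
  ultimately have "bus E (v + u) \<le> (1 - l) * bus E v + l * bus E (v + u + h *\<^sub>R u)" using l by simp
  then have "(1 + h) * bus E (v + u) \<le> (1 + h) * ((1 - l) * bus E v + l * bus E (v + u + h *\<^sub>R u))" using h by (intro mult_left_mono) auto
  also have "\<dots> = ((1 + h) - l * (1 + h)) * bus E v + (l * (1 + h)) * bus E (v + u + h *\<^sub>R u)" by (simp add: algebra_simps)
  finally have "(1 + h) * bus E (v + u) \<le> ((1 + h) - l * (1 + h)) * bus E v + (l * (1 + h)) * bus E (v + u + h *\<^sub>R u)" .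
  then show ?thesis unfolding l(3) by (simp add: algebra_simps)
qed

text \<open>A steeper slope persists along the ray beyond \<open>v + u\<close> by convexity and
  would force an angle larger than \<open>e\<close>.\<close>

lemma angle_imp_slope_le:
  assumes E: "ray_field y E" and v: "v \<in> S" and u: "u \<in> S" "norm u = 1" and e: "0 < e" "e < pi"
    and ang: "bd_angle (flat_point u) (ray_class (E 0)) < e"
  shows "bus E (v + u) - bus E v \<le> - cos e"
proof (rule ccontr)
  assume neg: "\<not> ?thesis"
  define s where "s = bus E (v + u) - bus E v"
  have s: "- cos e < s" "s \<le> 1" using neg bus_lipschitz[OF E, of "v + u" v] v u by (auto simp: s_def)
  have "-1 \<le> s" using s(1) cos_le_one[of e] by linarith
  have slope: "h * s \<le> bus E ((v + u) + h *\<^sub>R u) - bus E (v + u)" if h: "0 < h" for h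
    unfolding s_def by (rule bus_slope_mono[OF E v u(1) h])
  have "arccos (- s) \<le> bd_angle (ray_class (E 0)) (flat_point u)"
    by (rule slope_imp_angle_ge[OF E _ u \<open>-1 \<le> s\<close> s(2) slope]) (use v u in auto)
  then have "arccos (- s) < e" using ang bd_angle_commute by (metis order_le_less_trans)
  then have "cos e < cos (arccos (- s))" using e s \<open>-1 \<le> s\<close> by (intro cos_monotone_0_pi) (auto intro: arccos_lbound)
  then show False using s \<open>-1 \<le> s\<close> by simp
qed

end

section \<open>Singular hemispheres\<close>

lemma onb_coordinates:
  fixes W :: "'v::real_inner set"
  assumes "fin_dim W"
  obtains vec :: "(nat \<Rightarrow> real) \<Rightarrow> 'v" where "\<And>x. vec x \<in> W" "\<And>x y. vec x \<bullet> vec y = (\<Sum>i<dim W. x i * y i)"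
    "\<And>w. w \<in> W \<Longrightarrow> \<exists>x. (\<forall>i\<ge>dim W. x i = 0) \<and> vec x = w"
proof -
  obtain B where B: "onb B W" using assms by (auto simp: fin_dim_def)
  then have "finite B" by (simp add: onb_def)
  then obtain h where h: "bij_betw h {0..<card B} B" using ex_bij_betw_nat_finite by blast
  have h: "bij_betw h {..<dim W} B" using h dim_onb[OF B] by (simp add: lessThan_atLeast0)
  define g where "g = inv_into {..<dim W} h"
  have gh: "g (h i) = i" if "i < dim W" for i
    using h that by (simp add: g_def bij_betw_def)
  have hg: "g b < dim W" "h (g b) = b" if "b \<in> B" for b
    using h that bij_betw_inv_into_right[OF h that] inv_into_into[of b h "{..<dim W}"] by (auto simp: g_def bij_betw_def)
  define vec where "vec = (\<lambda>x :: nat \<Rightarrow> real. \<Sum>b\<in>B. x (g b) *\<^sub>R b)"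
  show thesis
  proof (rule that[of vec])
    show "vec x \<in> W" for x unfolding vec_def by (rule onb_expand_in[OF B])
    show "vec x \<bullet> vec y = (\<Sum>i<dim W. x i * y i)" for x y
    proof -
      have "vec x \<bullet> vec y = (\<Sum>b\<in>B. x (g b) * y (g b))" unfolding vec_def by (rule onb_norm_sum[OF B])
      also have "\<dots> = (\<Sum>i<dim W. x (g (h i)) * y (g (h i)))" by (rule sum.reindex_bij_betw[OF h, symmetric])
      also have "\<dots> = (\<Sum>i<dim W. x i * y i)" using gh by (intro sum.cong) auto
      finally show ?thesis .
    qed
    fix w assume w: "w \<in> W"
    define x where "x = (\<lambda>i. if i < dim W then w \<bullet> h i else 0)"
    have "vec x = (\<Sum>b\<in>B. (w \<bullet> b) *\<^sub>R b)" unfolding vec_def using hg by (intro sum.cong) (auto simp: x_def)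
    then have "vec x = w" using onb_expand[OF B w] by simp
    then show "\<exists>x. (\<forall>i\<ge>dim W. x i = 0) \<and> vec x = w" by (intro exI[of _ x]) (simp add: x_def)
  qed
qed

lemma dim_pos_fin_dim:
  assumes "fin_dim (W :: 'v::real_inner set)" "W \<noteq> {0}"
  shows "1 \<le> dim W"
proof (rule ccontr)
  assume "\<not> 1 \<le> dim W"
  then have "dim W = 0" by simp
  obtain B where B: "onb B W" using assms by (auto simp: fin_dim_def)
  then have "B = {}" using dim_onb[OF B] \<open>dim W = 0\<close> by (simp add: onb_def)
  then show False using B assms(2) by (simp add: onb_def)
qed

lemma unit_combination:
  fixes u w \<nu> :: "'v::real_inner"
  assumes "norm u = 1" "norm w = 1" "norm \<nu> = 1" "\<nu> \<bullet> w = 0" "u \<bullet> \<nu> = s" "u \<bullet> w = r" "s\<^sup>2 + r\<^sup>2 = 1"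
  shows "u = r *\<^sub>R w + s *\<^sub>R \<nu>"
proof -
  have "u \<bullet> u = 1" "w \<bullet> w = 1" "\<nu> \<bullet> \<nu> = 1" using assms by (auto simp: norm_eq_1)
  then have "(u - (r *\<^sub>R w + s *\<^sub>R \<nu>)) \<bullet> (u - (r *\<^sub>R w + s *\<^sub>R \<nu>)) = 1 - (s\<^sup>2 + r\<^sup>2)"
    using assms(4-6) by (simp add: inner_simps inner_commute power2_eq_square)
  then show ?thesis using assms(7) by simp
qed

lemma unit_inner_bounds:
  fixes u v :: "'v::real_inner"
  assumes "norm u = 1" "norm v = 1"
  shows "-1 \<le> u \<bullet> v" "u \<bullet> v \<le> 1"
  using Cauchy_Schwarz_ineq2[of u v] assms by auto

context morse_flat_space
begin

lemma boundary_ray_field: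
  assumes \<eta>: "\<eta> \<in> ideal_boundary TYPE('a)"
  obtains E where "ray_field 0 E" "ray_class (E 0) = \<eta>"
proof -
  obtain c :: "real \<Rightarrow> 'a" where c: "geod_ray c" "\<eta> = ray_class c" using \<eta> by (auto simp: ideal_boundary_eq)
  have "\<forall>v. \<exists>d. geod_ray d \<and> d 0 = \<iota> v \<and> asymptotic c d"
  proof
    fix v
    obtain d where "geod_ray d" "d 0 = \<iota> v" "asymptotic c d" by (rule ray_from_point[OF c(1)])
    then show "\<exists>d. geod_ray d \<and> d 0 = \<iota> v \<and> asymptotic c d" by blast
  qed
  then have "\<exists>E. \<forall>v. geod_ray (E v) \<and> E v 0 = \<iota> v \<and> asymptotic c (E v)" by (rule choice)
  then obtain E where E: "\<And>v. geod_ray (E v)" "\<And>v. E v 0 = \<iota> v" "\<And>v. asymptotic c (E v)" by blast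
  have "ray_field 0 E"
    unfolding ray_field_def
  proof (intro conjI ballI allI impI)
    fix v w and t :: real assume vw: "v \<in> S" "w \<in> S" and t: "0 \<le> t"
    have "dist (E v t) (E w t) \<le> dist (E v 0) (E w 0)"
      by (rule asymptotic_contract[OF E(1) E(1) asymptotic_trans[OF asymptotic_sym[OF E(3)] E(3)] t])
    then show "dist (E v t) (E w t) \<le> norm (v - w)" unfolding E(2) isometric[OF vw] .
  qed (simp_all add: E)
  moreover have "ray_class (E 0) = \<eta>" using ray_class_eq[OF E(3)] c(2) by simp
  ultimately show thesis by (rule that)
qed

lemma bd_of_flat: "bd_of (\<iota> ` S) = {flat_point u | u. u \<in> S \<and> norm u = 1}"
proof (intro equalityI subsetI)
  fix \<xi> assume "\<xi> \<in> bd_of (\<iota> ` S)"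
  then obtain c where c: "\<xi> \<in> ideal_boundary TYPE('a)" "c \<in> \<xi>" "c ` {0..} \<subseteq> \<iota> ` S" by (auto simp: bd_of_def)
  note ray = boundary_ray_class[OF c(1,2)]
  have "\<exists>x. 0 \<le> t \<longrightarrow> x \<in> S \<and> c t = \<iota> x" for t
    using c(3) by (cases "0 \<le> t") auto
  then have "\<exists>x. \<forall>t. 0 \<le> t \<longrightarrow> x t \<in> S \<and> c t = \<iota> (x t)" by (intro choice) blast
  then obtain x where x: "\<And>t. 0 \<le> t \<Longrightarrow> x t \<in> S" "\<And>t. 0 \<le> t \<Longrightarrow> c t = \<iota> (x t)" by blast
  have xd: "norm (x t - x s) = \<bar>t - s\<bar>" if "0 \<le> s" "0 \<le> t" for s t
    using geod_rayD[OF ray(1) that(2,1)] x that isometric[of "x t" "x s"] by simp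
  \<comment> \<open>Equality in the triangle inequality for \<open>x 0\<close>, \<open>x t\<close>,
    \<open>x T\<close> makes the two increments proportional, so a ray inside the flat is a straight
    half-line.\<close>
  have ratio: "T *\<^sub>R (x t - x 0) = t *\<^sub>R (x T - x 0)" if t: "0 \<le> t" "t \<le> T" for t T
  proof -
    define a b where "a = x t - x 0" and "b = x T - x t"
    have sum: "x T - x 0 = a + b" by (simp add: a_def b_def)
    have n: "norm a = t" "norm b = T - t" "norm (a + b) = T"
      using xd[of 0 t] xd[of t T] xd[of 0 T] t by (auto simp: a_def b_def)
    have sq: "a \<bullet> a = t\<^sup>2" "b \<bullet> b = (T - t)\<^sup>2" "(a + b) \<bullet> (a + b) = T\<^sup>2"
      unfolding power2_norm_eq_inner[symmetric] n by simp_all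
    have "a \<bullet> a + b \<bullet> b + 2 * (a \<bullet> b) = T\<^sup>2" using sq(3) by (simp add: inner_simps inner_commute)
    then have ab: "a \<bullet> b = t * (T - t)" unfolding sq(1,2) by (simp add: power2_eq_square algebra_simps)
    have "((T - t) *\<^sub>R a - t *\<^sub>R b) \<bullet> ((T - t) *\<^sub>R a - t *\<^sub>R b)
      = (T - t)\<^sup>2 * (a \<bullet> a) - 2 * t * (T - t) * (a \<bullet> b) + t\<^sup>2 * (b \<bullet> b)"
      by (simp add: inner_simps inner_commute power2_eq_square algebra_simps)
    also have "\<dots> = 0" unfolding sq(1,2) ab by (simp add: power2_eq_square algebra_simps)
    finally have "(T - t) *\<^sub>R a = t *\<^sub>R b" by simp
    then show ?thesis unfolding sum a_def[symmetric] by (simp add: scaleR_diff_left scaleR_add_right algebra_simps)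
  qed
  define u where "u = x 1 - x 0"
  have u: "u \<in> S" "norm u = 1" using x(1)[of 1] x(1)[of 0] xd[of 0 1] by (auto simp: u_def)
  have xt: "x t = x 0 + t *\<^sub>R u" if "0 \<le> t" for t
  proof (cases "t \<le> 1")
    case True
    then show ?thesis using ratio[of t 1] that by (simp add: u_def algebra_simps)
  next
    case False
    then show ?thesis using ratio[of 1 t] by (simp add: u_def algebra_simps)
  qed
  have "dist (\<iota> (t *\<^sub>R u)) (c t) \<le> norm (x 0)" if t: "0 \<le> t" for t
    using x(1)[of 0] isometric[of "t *\<^sub>R u" "x 0 + t *\<^sub>R u"] u by (simp add: x(2)[OF t] xt[OF t])
  then have "asymptotic (\<lambda>t. \<iota> (t *\<^sub>R u)) c" unfolding asymptotic_def by blast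
  then have "\<xi> = flat_point u" unfolding flat_point_def ray(2) by (rule ray_class_eq[symmetric])
  then show "\<xi> \<in> {flat_point u | u. u \<in> S \<and> norm u = 1}" using u by blast
next
  fix \<xi> assume "\<xi> \<in> {flat_point u | u. u \<in> S \<and> norm u = 1}"
  then obtain u where u: "\<xi> = flat_point u" "u \<in> S" "norm u = 1" by blast
  have "(\<lambda>t. \<iota> (t *\<^sub>R u)) \<in> \<xi>" unfolding u(1) flat_point_def by (rule ray_class_self[OF iota_ray[OF u(2,3)]])
  moreover have "(\<lambda>t. \<iota> (t *\<^sub>R u)) ` {0..} \<subseteq> \<iota> ` S" using u(2) by auto
  ultimately show "\<xi> \<in> bd_of (\<iota> ` S)" unfolding bd_of_def using flat_point_boundary[OF u(2,3)] u(1) by blast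
qed

lemma linear_bus_boundary:
  assumes E: "ray_field y E" and lin: "linear_bus E"
  shows "ray_class (E 0) \<in> bd_of (\<iota> ` S)"
proof -
  obtain c where c: "c \<in> S" "\<And>v. v \<in> S \<Longrightarrow> bus E v = c \<bullet> v" using lin by (auto simp: linear_bus_def)
  have "norm c = 1" by (rule linear_unit[OF E c])
  have "dist (E 0 t) (\<iota> (t *\<^sub>R (- c))) \<le> norm y" if "0 \<le> t" for t
    using linear_ray[OF E c, of 0 t] that isometric[of "0 + y - t *\<^sub>R c" "t *\<^sub>R (- c)"] c(1) rf_y[OF E] by simp
  then have "asymptotic (E 0) (\<lambda>t. \<iota> (t *\<^sub>R (- c)))" unfolding asymptotic_def by blast
  then have "ray_class (E 0) = flat_point (- c)" unfolding flat_point_def by (rule ray_class_eq)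
  then show ?thesis unfolding bd_of_flat using c(1) \<open>norm c = 1\<close> by (intro CollectI exI[of _ "- c"]) simp
qed

lemma flat_point_inj:
  assumes "u \<in> S" "norm u = 1" "u' \<in> S" "norm u' = 1" "flat_point u = flat_point u'"
  shows "u = u'"
proof -
  have "arccos (u \<bullet> u') = arccos (u \<bullet> u)"
    using flat_point_angle[OF assms(1-4)] flat_point_angle[OF assms(1,2,1,2)] assms(5) by simp
  then have "u \<bullet> u' = 1" using arccos_eq_iff[of "u \<bullet> u'" "u \<bullet> u"] unit_inner_bounds[OF assms(2,4)] assms(2) by (auto simp: norm_eq_1 abs_le_iff)
  then have "(u - u') \<bullet> (u - u') = 0" using assms(2,4) by (simp add: norm_eq_1 inner_simps inner_commute)
  then show ?thesis by simp
qed

text \<open>The arcs that realise the distance consist of flat directions; the two ends of a line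
  would have none between them, hence the dimension bound.\<close>

lemma flat_point_tits:
  assumes n: "2 \<le> dim S" and u: "u \<in> S" "norm u = 1" and u': "u' \<in> S" "norm u' = 1"
  shows "tits_dist (flat_point u) (flat_point u') = ereal (arccos (u \<bullet> u'))"
proof -
  obtain vec where vec: "\<And>x. vec x \<in> S" "\<And>x y. vec x \<bullet> vec y = (\<Sum>i<dim S. x i * y i)"
    "\<And>w. w \<in> S \<Longrightarrow> \<exists>x. (\<forall>i\<ge>dim S. x i = 0) \<and> vec x = w"
    using onb_coordinates[OF fd] by blast
  define k where "k = dim S - 1"
  have k: "1 \<le> k" "{..<dim S} = {..k}" using n by (auto simp: k_def)
  have inner: "vec x \<bullet> vec y = (\<Sum>i\<le>k. x i * y i)" for x y using vec(2) k(2) by simp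
  have unit: "norm (vec x) = 1" if "x \<in> std_sphere k" for x
    using that by (simp add: norm_eq_1 inner std_sphere_def power2_eq_square)
  have "tits_isometry k (std_sphere k) (\<lambda>x. flat_point (vec x)) ((\<lambda>x. flat_point (vec x)) ` std_sphere k)"
    using unit by (intro tits_isometry_from_angles[OF k(1)]) (auto simp: flat_point_boundary flat_point_angle vec(1) sph_dist_def inner)
  then have tits: "tits_dist (flat_point (vec x)) (flat_point (vec y)) = ereal (sph_dist k x y)"
    if "x \<in> std_sphere k" "y \<in> std_sphere k" for x y using that by (auto simp: tits_isometry_def)
  have ex: "\<exists>x. x \<in> std_sphere k \<and> vec x = w" if w: "w \<in> S" "norm w = 1" for w
  proof -
    obtain x where x: "\<forall>i\<ge>dim S. x i = 0" "vec x = w" using vec(3)[OF w(1)] by blast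
    have "(\<Sum>i\<le>k. (x i)\<^sup>2) = 1" using inner[of x x] x(2) w(2) by (simp add: norm_eq_1 power2_eq_square)
    then have "x \<in> std_sphere k" using x(1) by (simp add: std_sphere_def k_def)
    then show ?thesis using x(2) by blast
  qed
  obtain x x' where "x \<in> std_sphere k" "vec x = u" "x' \<in> std_sphere k" "vec x' = u'" using ex[OF u] ex[OF u'] by blast
  then show ?thesis using tits[of x x'] inner[of x x'] by (simp add: sph_dist_def)
qed

text \<open>\<open>W\<close> may be a line, whose sphere consists of two points. The distances are
  therefore taken from the sphere of \<open>S\<close>, where antipodes are joined by arcs.\<close>

lemma flat_sphere_dim:
  assumes n: "2 \<le> dim S" and W: "subspace W" "W \<subseteq> S" "W \<noteq> {0}"
  shows "round_sphere_dim {flat_point w | w. w \<in> W \<and> norm w = 1} (dim W - 1)"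
proof -
  have fW: "fin_dim W" by (rule fin_dim_subspace[OF fd W(1,2)])
  obtain vec where vec: "\<And>x. vec x \<in> W" "\<And>x y. vec x \<bullet> vec y = (\<Sum>i<dim W. x i * y i)"
    "\<And>w. w \<in> W \<Longrightarrow> \<exists>x. (\<forall>i\<ge>dim W. x i = 0) \<and> vec x = w"
    using onb_coordinates[OF fW] by blast
  define k where "k = dim W - 1"
  have k: "{..<dim W} = {..k}" "dim W = Suc k" using dim_pos_fin_dim[OF fW W(3)] by (auto simp: k_def)
  have inner: "vec x \<bullet> vec y = (\<Sum>i\<le>k. x i * y i)" for x y using vec(2) k(1) by simp
  have vS: "vec x \<in> S" for x using vec(1) W(2) by blast
  have unit: "norm (vec x) = 1" if "x \<in> std_sphere k" for x
    using that by (simp add: norm_eq_1 inner std_sphere_def power2_eq_square)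
  have tits: "tits_dist (flat_point (vec x)) (flat_point (vec y)) = ereal (sph_dist k x y)"
    if "x \<in> std_sphere k" "y \<in> std_sphere k" for x y
    using flat_point_tits[OF n vS unit[OF that(1)] vS unit[OF that(2)]] by (simp add: inner sph_dist_def)
  have "x = y" if x: "x \<in> std_sphere k" and y: "y \<in> std_sphere k" and eq: "flat_point (vec x) = flat_point (vec y)" for x y
  proof -
    have v: "vec x = vec y" by (rule flat_point_inj[OF vS unit[OF x] vS unit[OF y] eq])
    have "(\<Sum>i\<le>k. (x i - y i)\<^sup>2) = vec x \<bullet> vec x - 2 * (vec x \<bullet> vec y) + vec y \<bullet> vec y"
      unfolding inner sum_distrib_left sum_subtractf[symmetric] sum.distrib[symmetric]
      by (intro sum.cong) (auto simp: power2_eq_square algebra_simps)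
    also have "\<dots> = 0" by (simp add: v)
    finally have "\<forall>i\<in>{..k}. (x i - y i)\<^sup>2 = 0" by (subst (asm) sum_nonneg_eq_0_iff) auto
    moreover have "x i = y i" if "i > k" for i using x y that by (simp add: std_sphere_def)
    ultimately show "x = y" by (metis atMost_iff eq_iff_diff_eq_0 ext linorder_not_le zero_eq_power2)
  qed
  then have inj: "inj_on (\<lambda>x. flat_point (vec x)) (std_sphere k)" by (intro inj_onI) blast
  have img: "(\<lambda>x. flat_point (vec x)) ` std_sphere k = {flat_point w | w. w \<in> W \<and> norm w = 1}"
  proof (intro equalityI subsetI)
    fix \<xi> assume "\<xi> \<in> {flat_point w | w. w \<in> W \<and> norm w = 1}"
    then obtain w where w: "\<xi> = flat_point w" "w \<in> W" "norm w = 1" by blast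
    obtain x where x: "\<forall>i\<ge>dim W. x i = 0" "vec x = w" using vec(3)[OF w(2)] by blast
    have "(\<Sum>i\<le>k. (x i)\<^sup>2) = 1" using inner[of x x] x(2) w(3) by (simp add: norm_eq_1 power2_eq_square)
    then have "x \<in> std_sphere k" using x(1) k(2) by (simp add: std_sphere_def)
    then show "\<xi> \<in> (\<lambda>x. flat_point (vec x)) ` std_sphere k" using x(2) w(1) by blast
  qed (use vec(1) unit in blast)
  have "tits_isometry k (std_sphere k) (\<lambda>x. flat_point (vec x)) {flat_point w | w. w \<in> W \<and> norm w = 1}"
    unfolding tits_isometry_def bij_betw_def using inj img tits by simp
  moreover have "{flat_point w | w. w \<in> W \<and> norm w = 1} \<subseteq> ideal_boundary TYPE('a)"
    using W(2) flat_point_boundary by blast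
  ultimately show ?thesis unfolding round_sphere_dim_def k_def[symmetric] by blast
qed

section \<open>The hemisphere spanned by a rigid subspace and its perpendicular field\<close>

context
  fixes y E W
  assumes R: "rigid y E W 0" and W0: "W \<noteq> {0}"
begin

lemma W_props: "ray_field y E" "subspace W" "W \<subseteq> S" "fin_dim W" "1 \<le> dim W"
  using rigid_field[OF R] rigid_sub[OF R] rigid_S[OF R] fin_dim_subspace[OF fd rigid_sub[OF R] rigid_S[OF R]]
    dim_pos_fin_dim[OF _ W0] by auto

lemma W_in_S: "w \<in> W \<Longrightarrow> w \<in> S"
  using W_props(3) by blast

text \<open>For \<open>W = S\<close> the function would vanish identically, against the unit slope
  of affine functions.\<close>

lemma normal_exists: "\<exists>\<nu>. \<nu> \<in> S \<and> norm \<nu> = 1 \<and> (\<forall>w\<in>W. \<nu> \<bullet> w = 0)"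
proof -
  have "W \<noteq> S"
  proof
    assume "W = S"
    then have "bus E v = 0 \<bullet> v" if "v \<in> S" for v
      using rigid_aff[OF R, of 0 v] that bus_0[OF W_props(1)] by simp
    then have "norm (0::'v) = 1" by (intro linear_unit[OF W_props(1)]) auto
    then show False by simp
  qed
  then obtain p where p: "p \<in> S" "p \<notin> W" using W_props(3) by blast
  define q where "q = p - orth_proj W p"
  have oW: "orth_proj W p \<in> W" by (rule orth_proj_in[OF W_props(4)])
  have "q \<noteq> 0" using oW p(2) by (auto simp: q_def)
  moreover have "q \<in> S" using p(1) W_in_S[OF oW] by (simp add: q_def)
  moreover have "q \<bullet> w = 0" if "w \<in> W" for w using orth_proj_orth[OF W_props(4) that] by (simp add: q_def)
  ultimately show ?thesis by (intro exI[of _ "q /\<^sub>R norm q"]) auto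
qed

lemma dim_W_less: "dim W < dim S"
proof -
  obtain \<nu> where \<nu>: "\<nu> \<in> S" "norm \<nu> = 1" "\<And>w. w \<in> W \<Longrightarrow> \<nu> \<bullet> w = 0" using normal_exists by blast
  then have "\<nu> \<notin> W" by (auto simp: norm_eq_1)
  then show ?thesis using \<nu>(1) W_props by (intro dim_psubset_fin_dim[OF fd]) auto
qed

text \<open>\<open>W\<close> and the perpendicular field span flat half-spaces; this is the
  direction with component \<open>w\<close> along \<open>W\<close> and height \<open>s\<close>, and
  \<open>s = 0\<close> gives the directions of \<open>W\<close> itself.\<close>

definition hemi :: "real \<Rightarrow> 'v \<Rightarrow> (real \<Rightarrow> 'a) set" where
  "hemi s w = ray_class (\<lambda>t. E (t *\<^sub>R w) (t * s))"

lemma hemi_dist: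
  assumes "v \<in> S" "w \<in> W" "w' \<in> W" "0 \<le> t" "0 \<le> t'"
  shows "(dist (E (v + w) t) (E (v + w') t'))\<^sup>2 = (norm (w - w'))\<^sup>2 + (t - t')\<^sup>2"
proof -
  have "(dist (E ((v + w') + (w - w')) t) (E (v + w') t'))\<^sup>2 = (norm (w - w'))\<^sup>2 + (t' - t)\<^sup>2 + 2 * (0 \<bullet> (w - w')) * (t' - t)"
    using assms W_in_S W_props(2) by (intro rigid_dist[OF R]) (auto simp: subspace_diff)
  moreover have "(v + w') + (w - w') = v + w" by simp
  ultimately show ?thesis by (simp add: power2_commute)
qed

lemma hemi_dist0:
  assumes "w \<in> W" "w' \<in> W" "0 \<le> t" "0 \<le> t'"
  shows "(dist (E w t) (E w' t'))\<^sup>2 = (norm (w - w'))\<^sup>2 + (t - t')\<^sup>2"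
  using hemi_dist[OF _ assms, of 0] by simp

lemma hemi_ray_at:
  assumes "v \<in> S" "w \<in> W" "0 \<le> s" "(norm w)\<^sup>2 + s\<^sup>2 = 1"
  shows "geod_ray (\<lambda>t. E (v + t *\<^sub>R w) (t * s))"
  unfolding geod_ray_def
proof (intro allI impI)
  fix a b :: real assume ab: "0 \<le> a" "0 \<le> b"
  have "(dist (E (v + a *\<^sub>R w) (a * s)) (E (v + b *\<^sub>R w) (b * s)))\<^sup>2 = (norm (a *\<^sub>R w - b *\<^sub>R w))\<^sup>2 + (a * s - b * s)\<^sup>2"
    using assms ab W_props(2) by (intro hemi_dist) (auto simp: subspace_scale)
  also have "\<dots> = \<bar>a - b\<bar>\<^sup>2 * ((norm w)\<^sup>2 + s\<^sup>2)"
    by (simp add: power_mult_distrib distrib_left flip: scaleR_diff_left left_diff_distrib)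
  finally show "dist (E (v + a *\<^sub>R w) (a * s)) (E (v + b *\<^sub>R w) (b * s)) = \<bar>a - b\<bar>"
    unfolding assms(4) mult_1_right by (rule power2_eq_imp_eq) auto
qed

lemma hemi_ray:
  "w \<in> W \<Longrightarrow> 0 \<le> s \<Longrightarrow> (norm w)\<^sup>2 + s\<^sup>2 = 1 \<Longrightarrow> geod_ray (\<lambda>t. E (t *\<^sub>R w) (t * s))"
  using hemi_ray_at[of 0 w s] by simp

lemma hemi_boundary: "w \<in> W \<Longrightarrow> 0 \<le> s \<Longrightarrow> (norm w)\<^sup>2 + s\<^sup>2 = 1 \<Longrightarrow> hemi s w \<in> ideal_boundary TYPE('a)"
  unfolding hemi_def by (intro ray_class_boundary hemi_ray)

lemma hemi_0: "w \<in> W \<Longrightarrow> norm w = 1 \<Longrightarrow> hemi 0 w = flat_point w"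
  using flat_point_eq[OF W_props(1), of 0 w] W_in_S by (simp add: hemi_def)

lemma hemi_angle:
  assumes "w \<in> W" "0 \<le> s" "(norm w)\<^sup>2 + s\<^sup>2 = 1" "w' \<in> W" "0 \<le> s'" "(norm w')\<^sup>2 + s'\<^sup>2 = 1"
  shows "bd_angle (hemi s w) (hemi s' w') = arccos (w \<bullet> w' + s * s')"
  unfolding hemi_def
proof (rule bd_angle_flat_sector[OF hemi_ray[OF assms(1-3)] hemi_ray[OF assms(4-6)]])
  have n: "w \<bullet> w + s * s = 1" "w' \<bullet> w' + s' * s' = 1"
    using assms(3,6) unfolding power2_norm_eq_inner by (simp_all add: power2_eq_square)
  have "0 \<le> (w - w') \<bullet> (w - w') + (s - s') * (s - s')" "0 \<le> (w + w') \<bullet> (w + w') + (s + s') * (s + s')"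
    by (intro add_nonneg_nonneg inner_ge_zero zero_le_square)+
  then show "-1 \<le> w \<bullet> w' + s * s'" "w \<bullet> w' + s * s' \<le> 1"
    using n by (simp_all add: inner_simps inner_commute algebra_simps)
  fix t t' :: real assume t: "0 \<le> t" "0 \<le> t'"
  have "(dist (E (t *\<^sub>R w) (t * s)) (E (t' *\<^sub>R w') (t' * s')))\<^sup>2 = (norm (t *\<^sub>R w - t' *\<^sub>R w'))\<^sup>2 + (t * s - t' * s')\<^sup>2"
    using assms t W_props(2) by (intro hemi_dist0) (auto simp: subspace_scale)
  also have "\<dots> = t\<^sup>2 * (w \<bullet> w + s * s) + t'\<^sup>2 * (w' \<bullet> w' + s' * s') - 2 * t * t' * (w \<bullet> w' + s * s')"
    unfolding power2_norm_eq_inner by (simp add: inner_simps inner_commute power2_eq_square algebra_simps)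
  finally show "(dist (E (t *\<^sub>R w) (t * s)) (E (t' *\<^sub>R w') (t' * s')))\<^sup>2 = t\<^sup>2 + t'\<^sup>2 - 2 * t * t' * (w \<bullet> w' + s * s')"
    unfolding n by simp
qed simp

lemma hemi_field:
  assumes w: "w \<in> W" "0 \<le> s" "(norm w)\<^sup>2 + s\<^sup>2 = 1"
  shows "ray_field y (\<lambda>v t. E (v + t *\<^sub>R w) (t * s))"
  unfolding ray_field_def
proof (intro conjI ballI allI impI)
  show "y \<in> S" by (rule rf_y[OF W_props(1)])
  fix v assume v: "v \<in> S"
  show "geod_ray (\<lambda>t. E (v + t *\<^sub>R w) (t * s))" by (rule hemi_ray_at[OF v w])
  show "E (v + 0 *\<^sub>R w) (0 * s) = \<iota> (v + y)" using rf_0[OF W_props(1) v] by simp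
  fix v' and t :: real assume v': "v' \<in> S" and t: "0 \<le> t"
  show "dist (E (v + t *\<^sub>R w) (t * s)) (E (v' + t *\<^sub>R w) (t * s)) \<le> norm (v - v')"
    using rf_contract[OF W_props(1), of "v + t *\<^sub>R w" "v' + t *\<^sub>R w" "t * s"] v v' t w W_in_S by simp
qed

context
  fixes w w' s s' \<nu>
  assumes w: "w \<in> W" "0 \<le> s" "(norm w)\<^sup>2 + s\<^sup>2 = 1" and w': "w' \<in> W" "0 \<le> s'" "(norm w')\<^sup>2 + s'\<^sup>2 = 1"
    and \<nu>: "\<nu> \<in> S" "norm \<nu> = 1" "\<And>w. w \<in> W \<Longrightarrow> \<nu> \<bullet> w = 0"
begin

lemma mixed_unit: "w' + s' *\<^sub>R \<nu> \<in> S" "norm (w' + s' *\<^sub>R \<nu>) = 1"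
proof -
  show "w' + s' *\<^sub>R \<nu> \<in> S" using W_in_S[OF w'(1)] \<nu>(1) by simp
  have "(w' + s' *\<^sub>R \<nu>) \<bullet> (w' + s' *\<^sub>R \<nu>) = w' \<bullet> w' + s' * s' * (\<nu> \<bullet> \<nu>)"
    using \<nu>(3)[OF w'(1)] by (simp add: inner_simps inner_commute)
  also have "\<dots> = 1" using w'(3) \<nu>(2) unfolding power2_norm_eq_inner norm_eq_1 by (simp add: power2_eq_square)
  finally show "norm (w' + s' *\<^sub>R \<nu>) = 1" by (simp add: norm_eq_1)
qed

lemma mixed_sqs: "w \<bullet> w + s * s = 1" "w' \<bullet> w' + s' * s' = 1" "\<nu> \<bullet> \<nu> = 1" "\<nu> \<bullet> w = 0" "\<nu> \<bullet> w' = 0"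
  using w w' \<nu> unfolding power2_norm_eq_inner norm_eq_1 by (simp_all add: power2_eq_square)

lemma mixed_bounds: "-1 \<le> w \<bullet> w' - s * s'" "w \<bullet> w' - s * s' \<le> 1"
proof -
  have "0 \<le> (w - w') \<bullet> (w - w') + (s + s') * (s + s')" "0 \<le> (w + w') \<bullet> (w + w') + (s - s') * (s - s')"
    by (intro add_nonneg_nonneg inner_ge_zero zero_le_square)+
  then show "-1 \<le> w \<bullet> w' - s * s'" "w \<bullet> w' - s * s' \<le> 1"
    using mixed_sqs by (simp_all add: inner_simps inner_commute algebra_simps)
qed

text \<open>The broken line from \<open>E (t w) (t s)\<close> to the flat crosses \<open>W\<close> where the straight line in the unfolded
  sphere would.\<close>
lemma mixed_angle_le:
  assumes s: "0 < s"
  shows "bd_angle (hemi s w) (flat_point (w' + s' *\<^sub>R \<nu>)) \<le> arccos (w \<bullet> w' - s * s')"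
proof -
  define u where "u = w' + s' *\<^sub>R \<nu>"
  have fp: "flat_point u = ray_class (\<lambda>t. E (t *\<^sub>R u) 0)"
    using flat_point_eq[OF W_props(1) _ mixed_unit, of 0] by (simp add: u_def)
  have c': "geod_ray (\<lambda>t. E (t *\<^sub>R u) 0)" using flat_ray(1)[OF W_props(1) _ mixed_unit, of 0] by (simp add: u_def)
  \<comment> \<open>The chord between unit vectors whose heights \<open>s\<close> and
    \<open>s'\<close> lie on opposite sides of \<open>W\<close> in the unfolded picture.\<close>
  define \<rho> where "\<rho> = sqrt ((norm (w - w'))\<^sup>2 + (s + s')\<^sup>2)"
  have \<rho>2: "\<rho>\<^sup>2 = (norm (w - w'))\<^sup>2 + (s + s')\<^sup>2" and \<rho>0: "0 \<le> \<rho>" by (simp_all add: \<rho>_def)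
  have "(norm (w - w'))\<^sup>2 + (s + s')\<^sup>2 = (w \<bullet> w + s * s) + (w' \<bullet> w' + s' * s') - 2 * (w \<bullet> w' - s * s')"
    unfolding power2_norm_eq_inner by (simp add: inner_simps inner_commute power2_eq_square algebra_simps)
  then have \<rho>: "\<rho> = sqrt (2 - 2 * (w \<bullet> w' - s * s'))" unfolding \<rho>_def mixed_sqs by simp
  \<comment> \<open>The fraction at which this chord meets height zero; the broken line through that
    point then has the length of the chord.\<close>
  define l where "l = s / (s + s')"
  have l: "0 \<le> l" "0 \<le> 1 - l" "l * (s + s') = s" "(1 - l) * (s + s') = s'"
    using s w'(2) by (auto simp: l_def field_simps)
  show ?thesis
    unfolding u_def[symmetric] fp hemi_def
  proof (rule bd_angle_le[OF hemi_ray[OF w] c'])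
    show "0 \<le> arccos (w \<bullet> w' - s * s')" "arccos (w \<bullet> w' - s * s') \<le> pi"
      using mixed_bounds by (auto intro: arccos_lbound arccos_ubound)
    fix t :: real assume t: "0 \<le> t"
    define q where "q = t *\<^sub>R ((1 - l) *\<^sub>R w + l *\<^sub>R w')"
    have q: "q \<in> W" using w w' W_props(2) by (simp add: q_def subspace_add subspace_scale)
    have "(dist (E (t *\<^sub>R w) (t * s)) (E q 0))\<^sup>2 = (norm (t *\<^sub>R w - q))\<^sup>2 + (t * s - 0)\<^sup>2"
      using q w t W_props(2) by (intro hemi_dist0) (auto simp: subspace_scale)
    also have "t *\<^sub>R w - q = (t * l) *\<^sub>R (w - w')" by (simp add: q_def algebra_simps)
    also have "(norm ((t * l) *\<^sub>R (w - w')))\<^sup>2 + (t * s - 0)\<^sup>2 = (t * l)\<^sup>2 * (norm (w - w'))\<^sup>2 + (t * (l * (s + s')))\<^sup>2"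
      unfolding l(3) by (simp add: power_mult_distrib)
    also have "\<dots> = (t * l * \<rho>)\<^sup>2" unfolding power_mult_distrib \<rho>2 by (simp add: algebra_simps)
    finally have d1: "dist (E (t *\<^sub>R w) (t * s)) (E q 0) = t * l * \<rho>"
      by (rule power2_eq_imp_eq) (intro zero_le_dist mult_nonneg_nonneg t l \<rho>0)+
    have "(dist (E q 0) (E (t *\<^sub>R u) 0))\<^sup>2 = (norm (q - t *\<^sub>R u))\<^sup>2"
      using rf_base_dist[OF W_props(1) W_in_S[OF q], of "t *\<^sub>R u"] mixed_unit(1) by (simp add: u_def)
    also have "q - t *\<^sub>R u = (t * (1 - l)) *\<^sub>R (w - w') - (t * s') *\<^sub>R \<nu>" by (simp add: q_def u_def algebra_simps)
    also have "(norm \<dots>)\<^sup>2 = (t * (1 - l))\<^sup>2 * (norm (w - w'))\<^sup>2 + (t * s')\<^sup>2 * (\<nu> \<bullet> \<nu>)"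
      unfolding power2_norm_eq_inner using mixed_sqs(4,5) by (simp add: inner_simps inner_commute power2_eq_square)
    also have "\<dots> = (t * (1 - l))\<^sup>2 * (norm (w - w'))\<^sup>2 + (t * ((1 - l) * (s + s')))\<^sup>2" unfolding l(4) mixed_sqs(3) by simp
    also have "\<dots> = (t * (1 - l) * \<rho>)\<^sup>2" unfolding power_mult_distrib \<rho>2 by (simp add: algebra_simps)
    finally have d2: "dist (E q 0) (E (t *\<^sub>R u) 0) = t * (1 - l) * \<rho>"
      by (rule power2_eq_imp_eq) (intro zero_le_dist mult_nonneg_nonneg t l \<rho>0)+
    have "dist (E (t *\<^sub>R w) (t * s)) (E (t *\<^sub>R u) 0) \<le> t * l * \<rho> + t * (1 - l) * \<rho>"
      using dist_triangle[of "E (t *\<^sub>R w) (t * s)" "E (t *\<^sub>R u) 0" "E q 0"] d1 d2 by simp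
    also have "\<dots> = t * \<rho>" by (simp add: algebra_simps)
    finally show "dist (E (t *\<^sub>R w) (t * s)) (E (t *\<^sub>R u) 0) \<le> 2 * t * sin (arccos (w \<bullet> w' - s * s') / 2) + 0"
      unfolding half_angle_chord[OF mixed_bounds t] \<rho> by simp
  qed
qed

text \<open>Far out along \<open>\<nu>\<close> the ray of \<open>hemi s w\<close> runs nearly in the flat, in the direction \<open>w - s \<nu>\<close>.\<close>
lemma mixed_slope:
  assumes s: "0 < s" and d: "0 < d"
  shows "\<exists>z\<in>S. \<forall>h>0. h * (s * s' - w \<bullet> w' - d)
    \<le> bus (\<lambda>v t. E (v + t *\<^sub>R w) (t * s)) (z + h *\<^sub>R (w' + s' *\<^sub>R \<nu>)) - bus (\<lambda>v t. E (v + t *\<^sub>R w) (t * s)) z"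
proof -
  define E' where "E' = (\<lambda>v t. E (v + t *\<^sub>R w) (t * s))"
  have E': "ray_field y E'" unfolding E'_def by (rule hemi_field[OF w])
  define u where "u = w' + s' *\<^sub>R \<nu>"
  \<comment> \<open>Opposite to the flat direction that the rays nearly follow far out, so the
    Busemann function climbs at nearly unit rate along \<open>a\<close>; its rate along
    \<open>u\<close> is then nearly \<open>a \<bullet> u\<close>.\<close>
  define a where "a = - w + s *\<^sub>R \<nu>"
  define \<kappa> where "\<kappa> = s * s' - w \<bullet> w'"
  have u: "u \<in> S" "norm u = 1" using mixed_unit by (auto simp: u_def)
  have aS: "a \<in> S" using W_in_S[OF w(1)] \<nu>(1) by (simp add: a_def)
  have aa: "a \<bullet> a = 1"
  proof -
    have "a \<bullet> a = w \<bullet> w + s * s * (\<nu> \<bullet> \<nu>)" unfolding a_def using mixed_sqs(4) by (simp add: inner_simps inner_commute)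
    then show ?thesis using mixed_sqs(1,3) by simp
  qed
  have au: "a \<bullet> u = \<kappa>"
  proof -
    have "a \<bullet> u = s * s' * (\<nu> \<bullet> \<nu>) - w \<bullet> w'" unfolding a_def u_def using mixed_sqs(4,5) by (simp add: inner_simps inner_commute)
    then show ?thesis using mixed_sqs(3) by (simp add: \<kappa>_def)
  qed
  have \<kappa>: "-1 \<le> \<kappa>" "\<kappa> \<le> 1" using mixed_bounds by (auto simp: \<kappa>_def)
  \<comment> \<open>So large that \<open>(H - 1) * d = 1\<close>, which absorbs the squared length
    of \<open>u\<close> in the norm estimate.\<close>
  define H where "H = 1 + 1 / d"
  have H: "1 < H" using d by (simp add: H_def)
  have e: "0 < d / 2" and Hs: "0 \<le> H * s" using d H s by simp_all
  obtain s0 where s0: "0 < s0" "\<And>\<sigma> \<nu> w. s0 \<le> \<sigma> \<Longrightarrow> \<nu> \<in> S \<Longrightarrow> norm \<nu> = 1 \<Longrightarrow> (\<And>w. w \<in> W \<Longrightarrow> \<nu> \<bullet> w = 0) \<Longrightarrow> w \<in> W \<Longrightarrow>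
     dist (E (\<sigma> *\<^sub>R \<nu> + w) (H * s)) (E (\<sigma> *\<^sub>R \<nu> + w - (H * s) *\<^sub>R (0 + rad 0 *\<^sub>R \<nu>)) 0) \<le> d / 2"
    using rigid_far[OF R Hs e] by blast
  define z where "z = s0 *\<^sub>R \<nu>"
  have z: "z \<in> S" using \<nu>(1) by (simp add: z_def)
  have close: "dist (E' (z + H *\<^sub>R a) H) (E' z 0) \<le> d / 2"
  proof -
    have "dist (E ((s0 + H * s) *\<^sub>R \<nu> + 0) (H * s)) (E ((s0 + H * s) *\<^sub>R \<nu> + 0 - (H * s) *\<^sub>R (0 + rad 0 *\<^sub>R \<nu>)) 0) \<le> d / 2"
      using H s subspace_0[OF W_props(2)] by (intro s0(2) \<nu>) auto
    moreover have "z + H *\<^sub>R a + H *\<^sub>R w = (s0 + H * s) *\<^sub>R \<nu> + 0" by (simp add: z_def a_def algebra_simps)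
    moreover have "(s0 + H * s) *\<^sub>R \<nu> + 0 - (H * s) *\<^sub>R (0 + rad 0 *\<^sub>R \<nu>) = z" by (simp add: z_def rad_def[OF R] algebra_simps)
    ultimately show ?thesis unfolding E'_def by simp
  qed
  have "bus E' z \<le> busemann (E' 0) (E' (z + H *\<^sub>R a) H) + dist (E' z 0) (E' (z + H *\<^sub>R a) H)"
    unfolding bus_def by (rule busemann_lipschitz[OF rf_ray[OF E']]) simp
  also have "busemann (E' 0) (E' (z + H *\<^sub>R a) H) = bus E' (z + H *\<^sub>R a) - H"
    using z aS H by (intro busemann_field_ray[OF E']) auto
  finally have far: "bus E' z + H - d / 2 \<le> bus E' (z + H *\<^sub>R a)" using close by (simp add: dist_commute)
  have "bus E' (z + H *\<^sub>R a) \<le> bus E' (z + u) + norm ((z + H *\<^sub>R a) - (z + u))"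
    using z aS u by (intro bus_lipschitz[OF E']) auto
  also have "norm ((z + H *\<^sub>R a) - (z + u)) \<le> H - \<kappa> + d / 2"
  proof (rule power2_le_imp_le)
    have "(norm ((z + H *\<^sub>R a) - (z + u)))\<^sup>2 = H\<^sup>2 * (a \<bullet> a) - 2 * H * (a \<bullet> u) + u \<bullet> u"
      unfolding power2_norm_eq_inner by (simp add: inner_simps inner_commute power2_eq_square algebra_simps)
    also have "\<dots> = H\<^sup>2 - 2 * H * \<kappa> + 1" using aa au u(2) by (simp add: norm_eq_1)
    also have "\<dots> \<le> (H - \<kappa>)\<^sup>2 + (H - \<kappa>) * d + (d / 2)\<^sup>2"
    proof -
      have "1 = (H - 1) * d" using d by (simp add: H_def)
      also have "\<dots> \<le> (H - \<kappa>) * d" using \<kappa> d by (intro mult_right_mono) auto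
      finally have "1 \<le> (H - \<kappa>) * d + \<kappa>\<^sup>2 + (d / 2)\<^sup>2" by (simp add: add_increasing2)
      then show ?thesis by (simp add: power2_diff)
    qed
    also have "\<dots> = (H - \<kappa> + d / 2)\<^sup>2" by (simp add: power2_eq_square algebra_simps)
    finally show "(norm ((z + H *\<^sub>R a) - (z + u)))\<^sup>2 \<le> (H - \<kappa> + d / 2)\<^sup>2" .
    show "0 \<le> H - \<kappa> + d / 2" using \<kappa> H d by simp
  qed
  finally have sl: "\<kappa> - d \<le> bus E' (z + u) - bus E' z" using far by simp
  have "h * (\<kappa> - d) \<le> bus E' ((z + u) + h *\<^sub>R u) - bus E' (z + u)" if h: "0 < h" for h
    by (rule order_trans[OF mult_left_mono[OF sl less_imp_le[OF h]] bus_slope_mono[OF E' z u(1) h]])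
  moreover have "z + u \<in> S" using z u by simp
  ultimately show ?thesis unfolding E'_def u_def \<kappa>_def by blast
qed

lemma mixed_angle_ge:
  assumes s: "0 < s"
  shows "arccos (w \<bullet> w' - s * s') \<le> bd_angle (hemi s w) (flat_point (w' + s' *\<^sub>R \<nu>))"
proof (rule ccontr)
  define a where "a = w \<bullet> w' - s * s'"
  define \<beta> where "\<beta> = bd_angle (hemi s w) (flat_point (w' + s' *\<^sub>R \<nu>))"
  assume "\<not> ?thesis"
  then have \<beta>: "\<beta> < arccos a" by (simp add: a_def \<beta>_def)
  have a: "-1 \<le> a" "a \<le> 1" using mixed_bounds by (auto simp: a_def)
  define E' where "E' = (\<lambda>v t. E (v + t *\<^sub>R w) (t * s))"
  have E': "ray_field y E'" unfolding E'_def by (rule hemi_field[OF w])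
  have hemi: "hemi s w = ray_class (E' 0)" by (simp add: hemi_def E'_def)
  have lip: "h * (- 1) \<le> bus E' (z + h *\<^sub>R (w' + s' *\<^sub>R \<nu>)) - bus E' z" if "z \<in> S" "0 < h" for z h
    using bus_lipschitz[OF E', of z "z + h *\<^sub>R (w' + s' *\<^sub>R \<nu>)"] that mixed_unit subspace_scale[OF subS mixed_unit(1), of h] by simp
  \<comment> \<open>Slopes within \<open>d\<close> of the expected one exist for every positive
    \<open>d\<close>; clamping at \<open>-1\<close> and \<open>1\<close> keeps the argument in the
    domain of \<open>arccos\<close>.\<close>
  have key: "arccos (min 1 (a + d)) \<le> \<beta>" if d: "0 < d" for d
  proof -
    obtain z where z: "z \<in> S" "\<And>h. 0 < h \<Longrightarrow> h * (s * s' - w \<bullet> w' - d) \<le> bus E' (z + h *\<^sub>R (w' + s' *\<^sub>R \<nu>)) - bus E' z"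
      using mixed_slope[OF s d] unfolding E'_def by blast
    have "arccos (- max (-1) (- a - d)) \<le> bd_angle (ray_class (E' 0)) (flat_point (w' + s' *\<^sub>R \<nu>))"
    proof (rule slope_imp_angle_ge[OF E' z(1) mixed_unit])
      show "h * max (-1) (- a - d) \<le> bus E' (z + h *\<^sub>R (w' + s' *\<^sub>R \<nu>)) - bus E' z" if h: "0 < h" for h
        using lip[OF z(1) h] z(2)[OF h] by (cases "- a - d \<le> -1") (auto simp: max_def a_def)
    qed (use a d in auto)
    moreover have "- max (-1) (- a - d) = min 1 (a + d)" by (simp add: max_def min_def)
    ultimately show ?thesis by (simp only: \<beta>_def hemi)
  qed
  have "0 \<le> arccos (min 1 (a + 1))" using a by (intro arccos_lbound) auto
  then have \<beta>0: "0 \<le> \<beta>" using key[of 1] by simp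
  have "cos (arccos a) < cos \<beta>" using \<beta> \<beta>0 a by (intro cos_monotone_0_pi arccos_ubound)
  then have gap: "a < cos \<beta>" using a by simp
  define d where "d = (cos \<beta> - a) / 2"
  have d: "0 < d" "a + d < cos \<beta>" using gap by (auto simp: d_def field_simps)
  have le1: "a + d \<le> 1" using d cos_le_one[of \<beta>] by linarith
  have "arccos (a + d) \<le> \<beta>" using key[OF d(1)] le1 by (simp add: min_def)
  moreover have "\<beta> \<le> pi" using \<beta> arccos_ubound[OF a] by simp
  moreover have "0 \<le> arccos (a + d)" using a d le1 by (intro arccos_lbound) auto
  ultimately have "cos \<beta> \<le> cos (arccos (a + d))" by (intro cos_monotone_0_pi_le)
  moreover have "cos (arccos (a + d)) = a + d" using a d le1 by (intro cos_arccos) auto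
  ultimately show False using d by simp
qed

lemma mixed_angle: "bd_angle (hemi s w) (flat_point (w' + s' *\<^sub>R \<nu>)) = arccos (w \<bullet> w' - s * s')"
proof (cases "s = 0")
  case True
  then have nw: "norm w = 1" using w(3) by (simp add: abs_square_eq_1)
  have "w \<bullet> (w' + s' *\<^sub>R \<nu>) = w \<bullet> w'" using mixed_sqs(4) by (simp add: inner_simps inner_commute)
  then show ?thesis using flat_point_angle[OF W_in_S[OF w(1)] nw mixed_unit] hemi_0[OF w(1) nw] True by simp
next
  case False
  then show ?thesis using w(2) mixed_angle_le mixed_angle_ge by (intro antisym) auto
qed

end

definition singular_cap :: "(real \<Rightarrow> 'a) set set" where
  "singular_cap = {hemi s w | s w. w \<in> W \<and> 0 \<le> s \<and> (norm w)\<^sup>2 + s\<^sup>2 = 1}"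

definition flat_cap :: "'v \<Rightarrow> (real \<Rightarrow> 'a) set set" where
  "flat_cap \<nu> = {flat_point (w + s *\<^sub>R \<nu>) | s w. w \<in> W \<and> 0 \<le> s \<and> (norm w)\<^sup>2 + s\<^sup>2 = 1}"

text \<open>One chart on the sphere of dimension \<open>dim W\<close> serves both caps: coordinate
  \<open>0\<close> is the height, nonnegative heights lead into the hemisphere over \<open>W\<close>
  and negative ones into the flat. Angles agree with spherical distances in all sign cases, across
  the equator by \<open>mixed_angle\<close>.\<close>

lemma cap_charts:
  assumes \<nu>: "\<nu> \<in> S" "norm \<nu> = 1" "\<And>w. w \<in> W \<Longrightarrow> \<nu> \<bullet> w = 0"
  obtains \<Psi> where "\<And>A. A \<subseteq> std_sphere (dim W) \<Longrightarrow> tits_isometry (dim W) A \<Psi> (\<Psi> ` A)"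
    "\<Psi> ` std_hemisphere (dim W) = singular_cap" "\<Psi> ` std_sphere (dim W) = singular_cap \<union> flat_cap \<nu>"
    "\<Psi> ` std_equator (dim W) = {flat_point w | w. w \<in> W \<and> norm w = 1}"
proof -
  obtain vec where vec: "\<And>x. vec x \<in> W" "\<And>x y. vec x \<bullet> vec y = (\<Sum>i<dim W. x i * y i)"
    "\<And>w. w \<in> W \<Longrightarrow> \<exists>x. (\<forall>i\<ge>dim W. x i = 0) \<and> vec x = w"
    using onb_coordinates[OF W_props(4)] by blast
  define k where "k = dim W"
  define p where "p = (\<lambda>x :: nat \<Rightarrow> real. vec (\<lambda>i. x (Suc i)))"
  define \<Psi> where "\<Psi> = (\<lambda>x :: nat \<Rightarrow> real. if 0 \<le> x 0 then hemi (x 0) (p x) else flat_point (p x + (- x 0) *\<^sub>R \<nu>))"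
  have p: "p x \<in> W" for x using vec(1) by (simp add: p_def)
  have sum: "(\<Sum>i\<le>k. x i * y i) = x 0 * y 0 + p x \<bullet> p y" for x y :: "nat \<Rightarrow> real"
    unfolding p_def vec(2) k_def by (rule sum.atMost_shift)
  have unit: "(norm (p x))\<^sup>2 + (x 0)\<^sup>2 = 1" if "x \<in> std_sphere k" for x
    using that sum[of x x] unfolding power2_norm_eq_inner by (simp add: std_sphere_def power2_eq_square)
  have unit': "(norm (p x))\<^sup>2 + (- x 0)\<^sup>2 = 1" if "x \<in> std_sphere k" for x using unit[OF that] by simp
  have ang: "bd_angle (\<Psi> x) (\<Psi> y) = sph_dist k x y" if x: "x \<in> std_sphere k" and y: "y \<in> std_sphere k" for x y
  proof -
    have mixed: "bd_angle (\<Psi> a) (\<Psi> b) = sph_dist k a b"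
      if a: "a \<in> std_sphere k" "0 \<le> a 0" and b: "b \<in> std_sphere k" "\<not> 0 \<le> b 0" for a b
    proof -
      have "bd_angle (hemi (a 0) (p a)) (flat_point (p b + (- b 0) *\<^sub>R \<nu>)) = arccos (p a \<bullet> p b - a 0 * (- b 0))"
        using a b by (intro mixed_angle p unit unit' \<nu>) auto
      then show ?thesis using a b by (simp add: \<Psi>_def sph_dist_def sum add.commute)
    qed
    consider "0 \<le> x 0" "0 \<le> y 0" | "0 \<le> x 0" "\<not> 0 \<le> y 0" | "\<not> 0 \<le> x 0" "0 \<le> y 0" | "\<not> 0 \<le> x 0" "\<not> 0 \<le> y 0" by blast
    then show ?thesis
    proof cases
      case 1
      then show ?thesis using hemi_angle[OF p 1(1) unit[OF x] p 1(2) unit[OF y]] by (simp add: \<Psi>_def sph_dist_def sum add.commute)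
    next
      case 2
      then show ?thesis using mixed x y by blast
    next
      case 3
      then have "bd_angle (\<Psi> y) (\<Psi> x) = sph_dist k y x" using mixed x y by blast
      then show ?thesis by (subst bd_angle_commute) (simp add: sph_dist_def mult.commute)
    next
      case 4
      have m: "p z + (- z 0) *\<^sub>R \<nu> \<in> S" "norm (p z + (- z 0) *\<^sub>R \<nu>) = 1" if "z \<in> std_sphere k" "\<not> 0 \<le> z 0" for z
        using mixed_unit[OF p _ unit'[OF that(1)] p _ unit'[OF that(1)] \<nu>] that(2) by auto
      have "(p x + (- x 0) *\<^sub>R \<nu>) \<bullet> (p y + (- y 0) *\<^sub>R \<nu>) = p x \<bullet> p y + x 0 * y 0 * (\<nu> \<bullet> \<nu>)"
        using \<nu>(3)[OF p] by (simp add: inner_simps inner_commute)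
      also have "\<dots> = (\<Sum>i\<le>k. x i * y i)" using \<nu>(2) by (simp add: norm_eq_1 sum)
      finally show ?thesis using flat_point_angle[OF m[OF x 4(1)] m[OF y 4(2)]] 4 by (simp add: \<Psi>_def sph_dist_def)
    qed
  qed
  have bdry: "\<Psi> x \<in> ideal_boundary TYPE('a)" if x: "x \<in> std_sphere k" for x
  proof (cases "0 \<le> x 0")
    case True
    then show ?thesis using hemi_boundary[OF p True unit[OF x]] by (simp add: \<Psi>_def)
  next
    case False
    then have "0 \<le> - x 0" by simp
    from mixed_unit[OF p this unit'[OF x] p this unit'[OF x] \<nu>] show ?thesis
      using flat_point_boundary False by (simp add: \<Psi>_def)
  qed
  have iso: "tits_isometry k A \<Psi> (\<Psi> ` A)" if "A \<subseteq> std_sphere k" for A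
    using W_props(5) by (intro tits_isometry_from_angles bdry ang that) (auto simp: k_def)
  have coord: "\<exists>x. x \<in> std_sphere k \<and> x 0 = s \<and> p x = w" if w: "w \<in> W" "(norm w)\<^sup>2 + s\<^sup>2 = 1" for w s
  proof -
    obtain x' where x': "\<forall>i\<ge>dim W. x' i = 0" "vec x' = w" using vec(3)[OF w(1)] by blast
    define x where "x = (\<lambda>i. case i of 0 \<Rightarrow> s | Suc j \<Rightarrow> x' j)"
    have px: "p x = w" using x'(2) by (simp add: p_def x_def)
    have "(\<Sum>i\<le>k. (x i)\<^sup>2) = 1"
      using sum[of x x] w(2) px unfolding power2_norm_eq_inner by (simp add: x_def power2_eq_square)
    moreover have "x i = 0" if "i > k" for i using that x'(1) by (cases i) (auto simp: x_def k_def)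
    ultimately have "x \<in> std_sphere k" by (simp add: std_sphere_def)
    then show ?thesis using px by (intro exI[of _ x]) (simp add: x_def)
  qed
  have hemisphere: "\<Psi> ` std_hemisphere k = singular_cap"
  proof (intro equalityI subsetI)
    fix \<xi> assume "\<xi> \<in> \<Psi> ` std_hemisphere k"
    then obtain x where x: "x \<in> std_sphere k" "0 \<le> x 0" "\<xi> = \<Psi> x" by (auto simp: std_hemisphere_def)
    then have "\<xi> = hemi (x 0) (p x)" by (simp add: \<Psi>_def)
    then show "\<xi> \<in> singular_cap" unfolding singular_cap_def using p unit[OF x(1)] x(2) by blast
  next
    fix \<xi> assume "\<xi> \<in> singular_cap"
    then obtain s w where sw: "\<xi> = hemi s w" "w \<in> W" "0 \<le> s" "(norm w)\<^sup>2 + s\<^sup>2 = 1" by (auto simp: singular_cap_def)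
    obtain x where "x \<in> std_sphere k" "x 0 = s" "p x = w" using coord[OF sw(2,4)] by blast
    then show "\<xi> \<in> \<Psi> ` std_hemisphere k" using sw(1,3) by (intro image_eqI[of _ _ x]) (auto simp: \<Psi>_def std_hemisphere_def)
  qed
  have equator: "\<Psi> ` std_equator k = {flat_point w | w. w \<in> W \<and> norm w = 1}"
  proof (intro equalityI subsetI)
    fix \<xi> assume "\<xi> \<in> \<Psi> ` std_equator k"
    then obtain x where x: "x \<in> std_sphere k" "x 0 = 0" "\<xi> = \<Psi> x" by (auto simp: std_equator_def)
    then have n: "norm (p x) = 1" using unit[OF x(1)] by (simp add: abs_square_eq_1)
    then have "\<xi> = flat_point (p x)" using x hemi_0[OF p n] by (simp add: \<Psi>_def)
    then show "\<xi> \<in> {flat_point w | w. w \<in> W \<and> norm w = 1}" using p n by blast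
  next
    fix \<xi> assume "\<xi> \<in> {flat_point w | w. w \<in> W \<and> norm w = 1}"
    then obtain w where w: "\<xi> = flat_point w" "w \<in> W" "norm w = 1" by blast
    obtain x where "x \<in> std_sphere k" "x 0 = 0" "p x = w" using coord[OF w(2), of 0] w(3) by auto
    then show "\<xi> \<in> \<Psi> ` std_equator k" using w hemi_0[OF w(2,3)] by (intro image_eqI[of _ _ x]) (auto simp: \<Psi>_def std_equator_def)
  qed
  have "\<Psi> ` std_sphere k = singular_cap \<union> flat_cap \<nu>"
  proof (intro equalityI subsetI)
    fix \<xi> assume "\<xi> \<in> \<Psi> ` std_sphere k"
    then obtain x where x: "x \<in> std_sphere k" "\<xi> = \<Psi> x" by blast
    show "\<xi> \<in> singular_cap \<union> flat_cap \<nu>"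
    proof (cases "0 \<le> x 0")
      case True
      then show ?thesis using x hemisphere by (auto simp: std_hemisphere_def)
    next
      case False
      then have "\<xi> = flat_point (p x + (- x 0) *\<^sub>R \<nu>)" "0 \<le> - x 0" using x(2) by (auto simp: \<Psi>_def)
      then have "\<xi> \<in> flat_cap \<nu>" unfolding flat_cap_def using p unit'[OF x(1)] by blast
      then show ?thesis by blast
    qed
  next
    fix \<xi> assume "\<xi> \<in> singular_cap \<union> flat_cap \<nu>"
    then show "\<xi> \<in> \<Psi> ` std_sphere k"
    proof
      assume "\<xi> \<in> singular_cap"
      then show ?thesis unfolding hemisphere[symmetric] std_hemisphere_def by blast
    next
      assume "\<xi> \<in> flat_cap \<nu>"
      then obtain s w where sw: "\<xi> = flat_point (w + s *\<^sub>R \<nu>)" "w \<in> W" "0 \<le> s" "(norm w)\<^sup>2 + s\<^sup>2 = 1" by (auto simp: flat_cap_def)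
      show ?thesis
      proof (cases "s = 0")
        case True
        then have "\<xi> \<in> {flat_point w | w. w \<in> W \<and> norm w = 1}" using sw by (auto simp: abs_square_eq_1)
        then show ?thesis unfolding equator[symmetric] std_equator_def by blast
      next
        case False
        obtain x where "x \<in> std_sphere k" "x 0 = - s" "p x = w" using coord[OF sw(2), of "- s"] sw(4) by auto
        then show ?thesis using sw(1,3) False by (intro image_eqI[of _ _ x]) (auto simp: \<Psi>_def)
      qed
    qed
  qed
  with iso hemisphere equator show thesis unfolding k_def by (intro that[of \<Psi>]) auto
qed

lemma singular_cap_inter: "singular_cap \<inter> bd_of (\<iota> ` S) = {flat_point w | w. w \<in> W \<and> norm w = 1}"
proof (intro equalityI subsetI)
  fix \<xi> assume "\<xi> \<in> singular_cap \<inter> bd_of (\<iota> ` S)"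
  then obtain s w u where sw: "\<xi> = hemi s w" "w \<in> W" "0 \<le> s" "(norm w)\<^sup>2 + s\<^sup>2 = 1"
    and u: "\<xi> = flat_point u" "u \<in> S" "norm u = 1" by (auto simp: singular_cap_def bd_of_flat)
  have "s = 0"
  proof (rule ccontr)
    assume "s \<noteq> 0"
    obtain \<nu>0 where \<nu>0: "\<nu>0 \<in> S" "norm \<nu>0 = 1" "\<And>w. w \<in> W \<Longrightarrow> \<nu>0 \<bullet> w = 0" using normal_exists by blast
    define w' d where "w' = orth_proj W u" and "d = norm (u - w')"
    have w': "w' \<in> W" using orth_proj_in[OF W_props(4)] by (simp add: w'_def)
    have orth: "(u - w') \<bullet> z = 0" if "z \<in> W" for z using orth_proj_orth[OF W_props(4) that] by (simp add: w'_def)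
    define \<nu> where "\<nu> = (if d = 0 then \<nu>0 else (u - w') /\<^sub>R d)"
    have \<nu>: "\<nu> \<in> S" "norm \<nu> = 1" "\<And>z. z \<in> W \<Longrightarrow> \<nu> \<bullet> z = 0"
      using \<nu>0 u(2) W_in_S[OF w'] orth by (auto simp: \<nu>_def d_def)
    have ueq: "u = w' + d *\<^sub>R \<nu>" by (simp add: \<nu>_def) (simp add: d_def)
    have "(norm w')\<^sup>2 + d\<^sup>2 = (norm u)\<^sup>2"
      using orth[OF w'] norm_add_Pythagorean[of "u - w'" w'] by (simp add: orthogonal_def d_def)
    then have w'd: "(norm w')\<^sup>2 + d\<^sup>2 = 1" using u(3) by simp
    have d0: "0 \<le> d" by (simp add: d_def)
    \<comment> \<open>A common point has angle zero to itself, which forces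
      \<open>w \<bullet> w' - s * d = 1\<close>; with both vectors of norm at most one and
      nonnegative heights this leaves only \<open>s = 0\<close>.\<close>
    have "arccos (w \<bullet> w' - s * d) = bd_angle (flat_point u) (flat_point u)"
      using mixed_angle[OF sw(2-4) w' d0 w'd \<nu>] sw(1) u(1) ueq by simp
    also have "\<dots> = arccos 1" using flat_point_angle[OF u(2,3,2,3)] u(3) by (simp add: norm_eq_1)
    finally have "w \<bullet> w' - s * d = 1"
      using arccos_eq_iff[of "w \<bullet> w' - s * d" 1] mixed_bounds[OF sw(2-4) w' d0 w'd \<nu>] by (simp add: abs_le_iff)
    then have "1 \<le> w \<bullet> w'" using sw(3) d0 mult_nonneg_nonneg[of s d] by linarith
    also have "\<dots> \<le> norm w * norm w'" by (rule norm_cauchy_schwarz)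
    also have "\<dots> \<le> norm w * 1"
    proof (rule mult_left_mono)
      have "(norm w')\<^sup>2 \<le> 1\<^sup>2" using w'd zero_le_power2[of d] unfolding one_power2 by linarith
      then show "norm w' \<le> 1" by (rule power2_le_imp_le) simp
    qed simp
    finally have "1\<^sup>2 \<le> (norm w)\<^sup>2" by (intro power_mono) auto
    then have "s\<^sup>2 \<le> 0" using sw(4) unfolding one_power2 by linarith
    then show False using \<open>s \<noteq> 0\<close> by simp
  qed
  then have n: "norm w = 1" using sw(4) by (simp add: abs_square_eq_1)
  then have "\<xi> = flat_point w" using hemi_0[OF sw(2) n] sw(1) \<open>s = 0\<close> by simp
  then show "\<xi> \<in> {flat_point w | w. w \<in> W \<and> norm w = 1}" using n sw(2) by blast
next
  fix \<xi> assume "\<xi> \<in> {flat_point w | w. w \<in> W \<and> norm w = 1}"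
  then obtain w where w: "\<xi> = flat_point w" "w \<in> W" "norm w = 1" by blast
  have "\<xi> = hemi 0 w" using hemi_0[OF w(2,3)] w(1) by simp
  then have "\<xi> \<in> singular_cap" unfolding singular_cap_def using w by (intro CollectI exI[of _ 0] exI[of _ w]) auto
  then show "\<xi> \<in> singular_cap \<inter> bd_of (\<iota> ` S)" unfolding bd_of_flat using w W_in_S by blast
qed

text \<open>The Tits metric on flat directions is the spherical one, so a hemisphere of flat
  directions is determined by the direction \<nu> of its pole, which is orthogonal to the equator
  and hence to \<open>W\<close>.\<close>

lemma hemisphere_in_flat:
  assumes T: "round_hemisphere T {flat_point w | w. w \<in> W \<and> norm w = 1}" "T \<subseteq> bd_of (\<iota> ` S)"
  obtains \<nu> where "\<nu> \<in> S" "norm \<nu> = 1" "\<And>w. w \<in> W \<Longrightarrow> \<nu> \<bullet> w = 0" "T = flat_cap \<nu>"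
proof -
  have n: "2 \<le> dim S" using W_props(5) dim_W_less by simp
  obtain k f where f: "tits_isometry k (std_hemisphere k) f T" "f ` std_equator k = {flat_point w | w. w \<in> W \<and> norm w = 1}"
    using T(1) by (auto simp: round_hemisphere_def)
  have img: "f ` std_hemisphere k = T" using f(1) by (simp add: tits_isometry_def bij_betw_def)
  define inn where "inn = (\<lambda>x y :: nat \<Rightarrow> real. \<Sum>i\<le>k. x i * y i)"
  have sph: "std_hemisphere k \<subseteq> std_sphere k" "std_equator k \<subseteq> std_hemisphere k"
    by (auto simp: std_hemisphere_def std_equator_def)
  have inner: "u \<bullet> v = inn x z"
    if x: "x \<in> std_hemisphere k" "f x = flat_point u" "u \<in> S" "norm u = 1"
      and z: "z \<in> std_hemisphere k" "f z = flat_point v" "v \<in> S" "norm v = 1" for x z u v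
  proof -
    have "ereal (arccos (u \<bullet> v)) = tits_dist (f x) (f z)" using flat_point_tits[OF n x(3,4) z(3,4)] x(2) z(2) by simp
    also have "\<dots> = ereal (arccos (inn x z))" using f(1) x(1) z(1) by (simp add: tits_isometry_def sph_dist_def inn_def)
    finally have "arccos (u \<bullet> v) = arccos (inn x z)" by simp
    moreover have "\<bar>u \<bullet> v\<bar> \<le> 1" using unit_inner_bounds[OF x(4) z(4)] by (simp add: abs_le_iff)
    moreover have "\<bar>inn x z\<bar> \<le> 1" unfolding inn_def using sum_prod_bound[of x k z] x(1) z(1) sph by blast
    ultimately show ?thesis using arccos_eq_iff by blast
  qed
  have flat: "\<exists>u. u \<in> S \<and> norm u = 1 \<and> f x = flat_point u" if "x \<in> std_hemisphere k" for x
  proof -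
    have "f x \<in> bd_of (\<iota> ` S)" using T(2) img that by blast
    then show ?thesis unfolding bd_of_flat by blast
  qed
  define e where "e = (\<lambda>i::nat. if i = 0 then 1 else 0::real)"
  have inn_e: "inn x e = x 0" for x unfolding inn_def e_def by (simp add: if_distrib sum.delta cong: if_cong)
  have e: "e \<in> std_hemisphere k" using inn_e[of e] by (simp add: std_hemisphere_def std_sphere_def inn_def e_def power2_eq_square)
  obtain \<nu> where \<nu>: "\<nu> \<in> S" "norm \<nu> = 1" "f e = flat_point \<nu>" using flat[OF e] by blast
  have eq_w: "\<exists>w. w \<in> W \<and> norm w = 1 \<and> f q = flat_point w" if "q \<in> std_equator k" for q using f(2) that by blast
  have w_eq: "\<exists>q. q \<in> std_equator k \<and> f q = flat_point w" if w: "w \<in> W" "norm w = 1" for w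
  proof -
    have "flat_point w \<in> f ` std_equator k" unfolding f(2) using w by blast
    then show ?thesis by auto
  qed
  have perp1: "\<nu> \<bullet> w = 0" if w: "w \<in> W" "norm w = 1" for w
  proof -
    obtain q where q: "q \<in> std_equator k" "f q = flat_point w" using w_eq[OF w] by blast
    have "w \<bullet> \<nu> = inn q e" using q sph W_in_S w \<nu> e by (intro inner) auto
    then show ?thesis using q(1) by (simp add: inn_e std_equator_def inner_commute)
  qed
  have perp: "\<nu> \<bullet> w = 0" if w: "w \<in> W" for w
  proof (cases "w = 0")
    case False
    then have "\<nu> \<bullet> (w /\<^sub>R norm w) = 0" using w W_props(2) by (intro perp1) (auto simp: subspace_scale)
    then show ?thesis using False by simp
  qed simp
  obtain w0 where w0: "w0 \<in> W" "w0 \<noteq> 0" using W0 subspace_0[OF W_props(2)] by blast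
  \<comment> \<open>At the pole no projection to the equator is distinguished, and any equator point
    will do; one exists because \<open>W\<close> is nonzero.\<close>
  have "\<exists>q0. q0 \<in> std_equator k"
    using w_eq[of "w0 /\<^sub>R norm w0"] w0 W_props(2) by (auto simp: subspace_scale)
  then obtain q0 where q0: "q0 \<in> std_equator k" by blast
  have "T = flat_cap \<nu>"
  proof (intro equalityI subsetI)
    fix \<xi> assume "\<xi> \<in> T"
    then obtain x where x: "x \<in> std_hemisphere k" "\<xi> = f x" using img by blast
    obtain u where u: "u \<in> S" "norm u = 1" "f x = flat_point u" using flat[OF x(1)] by blast
    define s where "s = x 0"
    have s: "0 \<le> s" using x(1) by (simp add: s_def std_hemisphere_def)
    define r where "r = sqrt (1 - s\<^sup>2)"
    have xx: "(\<Sum>i\<le>k. (x i)\<^sup>2) = 1" "\<And>i. i > k \<Longrightarrow> x i = 0" using x(1) by (auto simp: std_hemisphere_def std_sphere_def)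
    have split: "(\<Sum>i\<le>k. g i) = g 0 + (\<Sum>i\<in>{1..k}. g i)" for g :: "nat \<Rightarrow> real"
      by (simp add: atMost_atLeast0 sum.atLeast_Suc_atMost)
    have rest: "(\<Sum>i\<in>{1..k}. (x i)\<^sup>2) = 1 - s\<^sup>2" using xx(1) split[of "\<lambda>i. (x i)\<^sup>2"] by (simp add: s_def)
    have "0 \<le> (\<Sum>i\<in>{1..k}. (x i)\<^sup>2)" by (intro sum_nonneg) simp
    then have r: "0 \<le> r" "r\<^sup>2 = 1 - s\<^sup>2" unfolding r_def rest by simp_all
    have "\<exists>q. q \<in> std_equator k \<and> inn x q = r"
    proof (cases "r = 0")
      case True
      then have "(\<Sum>i\<in>{1..k}. (x i)\<^sup>2) = 0" unfolding rest r(2)[symmetric] by simp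
      then have "\<forall>i\<in>{1..k}. (x i)\<^sup>2 = 0" by (subst (asm) sum_nonneg_eq_0_iff) auto
      then have "inn x q0 = 0" using q0 unfolding inn_def split by (auto simp: std_equator_def)
      then show ?thesis using q0 True by blast
    next
      case False
      \<comment> \<open>The nearest equator point: the height is dropped and the rest normalised.
        The inner products with \<nu> and with the image of \<open>q\<close> then determine the
        direction completely.\<close>
      define q where "q = (\<lambda>i. if i = 0 then 0 else x i / r)"
      have "(\<Sum>i\<in>{1..k}. (q i)\<^sup>2) = (\<Sum>i\<in>{1..k}. (x i)\<^sup>2) / r\<^sup>2"
        unfolding sum_divide_distrib by (intro sum.cong) (auto simp: q_def power_divide)
      then have "(\<Sum>i\<in>{1..k}. (q i)\<^sup>2) = 1" unfolding rest r(2)[symmetric] using False by simp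
      moreover have "q 0 = 0" by (simp add: q_def)
      ultimately have "(\<Sum>i\<le>k. (q i)\<^sup>2) = 1" unfolding split by simp
      then have "q \<in> std_equator k" using xx(2) by (auto simp: std_equator_def std_sphere_def q_def)
      moreover have "(\<Sum>i\<in>{1..k}. x i * q i) = (\<Sum>i\<in>{1..k}. (x i)\<^sup>2) / r"
        unfolding sum_divide_distrib by (intro sum.cong) (auto simp: q_def power2_eq_square)
      then have "inn x q = r" unfolding inn_def split rest r(2)[symmetric] using False by (simp add: q_def power2_eq_square)
      ultimately show ?thesis by blast
    qed
    then obtain q where q: "q \<in> std_equator k" "inn x q = r" by blast
    obtain w where w: "w \<in> W" "norm w = 1" "f q = flat_point w" using eq_w[OF q(1)] by blast
    have "u \<bullet> \<nu> = s" using inner[OF x(1) u(3,1,2) e \<nu>(3,1,2)] by (simp add: inn_e s_def)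
    moreover have "u \<bullet> w = r" using inner[OF x(1) u(3,1,2) _ w(3) W_in_S[OF w(1)] w(2)] q sph by auto
    ultimately have "u = r *\<^sub>R w + s *\<^sub>R \<nu>"
      using u w \<nu> perp r by (intro unit_combination) auto
    then have "\<xi> = flat_point (r *\<^sub>R w + s *\<^sub>R \<nu>)" using u(3) x(2) by simp
    moreover have "r *\<^sub>R w \<in> W" using w(1) W_props(2) by (simp add: subspace_scale)
    moreover have "(norm (r *\<^sub>R w))\<^sup>2 + s\<^sup>2 = 1" using w(2) r by simp
    ultimately show "\<xi> \<in> flat_cap \<nu>" unfolding flat_cap_def using s by blast
  next
    fix \<xi> assume "\<xi> \<in> flat_cap \<nu>"
    then obtain s v where v: "\<xi> = flat_point (v + s *\<^sub>R \<nu>)" "v \<in> W" "0 \<le> s" "(norm v)\<^sup>2 + s\<^sup>2 = 1"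
      by (auto simp: flat_cap_def)
    define r where "r = norm v"
    define w where "w = (if r = 0 then w0 /\<^sub>R norm w0 else v /\<^sub>R r)"
    have w: "w \<in> W" "norm w = 1" "v = r *\<^sub>R w"
      using w0 v(2) W_props(2) by (auto simp: w_def r_def subspace_scale)
    obtain q where q: "q \<in> std_equator k" "f q = flat_point w" using w_eq[OF w(1,2)] by blast
    have qq: "(\<Sum>i\<le>k. q i * q i) = 1" "q 0 = 0" "\<And>i. i > k \<Longrightarrow> q i = 0"
      using q(1) by (auto simp: std_equator_def std_sphere_def power2_eq_square)
    define x where "x = (\<lambda>i. s * e i + r * q i)"
    have ix: "inn x z = s * inn e z + r * inn q z" for z
      unfolding inn_def sum_distrib_left sum.distrib[symmetric] x_def by (intro sum.cong) (auto simp: algebra_simps)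
    have comm: "inn a b = inn b a" for a b by (simp add: inn_def mult.commute)
    have ii: "inn e e = 1" "inn q q = 1" "inn q e = 0" "inn e q = 0"
      using inn_e[of e] inn_e[of q] comm[of e q] qq by (auto simp: inn_def e_def)
    have xe: "inn x e = s" "inn x q = r" using ix ii by simp_all
    have "inn x x = s * inn x e + r * inn x q" using ix[of x] comm by simp
    then have "inn x x = 1" using xe v(4) by (simp add: r_def power2_eq_square)
    moreover have "x i = 0" if "i > k" for i using that qq(3) by (simp add: x_def e_def)
    moreover have "x 0 = s" using qq(2) by (simp add: x_def e_def)
    ultimately have x: "x \<in> std_hemisphere k"
      using v(3) by (simp add: std_hemisphere_def std_sphere_def inn_def power2_eq_square)
    obtain u where u: "u \<in> S" "norm u = 1" "f x = flat_point u" using flat[OF x] by blast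
    have c1: "u \<bullet> \<nu> = s" using inner[OF x u(3,1,2) e \<nu>(3,1,2)] xe by simp
    have c2: "u \<bullet> w = r" using inner[OF x u(3,1,2) _ q(2) W_in_S[OF w(1)] w(2)] q(1) sph xe by auto
    have "s\<^sup>2 + r\<^sup>2 = 1" using v(4) by (simp add: r_def)
    then have "u = r *\<^sub>R w + s *\<^sub>R \<nu>" by (rule unit_combination[OF u(2) w(2) \<nu>(2) perp[OF w(1)] c1 c2])
    then have "\<xi> = f x" using u(3) v(1) w(3) by simp
    then show "\<xi> \<in> T" using img x by blast
  qed
  then show thesis using that \<nu> perp by blast
qed

lemma rigid_singular_sphere:
  "singular_sphere (bd_of (\<iota> ` S)) {flat_point w | w. w \<in> W \<and> norm w = 1}"
  "round_sphere_dim {flat_point w | w. w \<in> W \<and> norm w = 1} (dim W - 1)"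
  "round_sphere_dim (bd_of (\<iota> ` S)) (dim S - 1)" "dim W - 1 < dim S - 1"
proof -
  have n: "2 \<le> dim S" using W_props(5) dim_W_less by simp
  show \<sigma>: "round_sphere_dim {flat_point w | w. w \<in> W \<and> norm w = 1} (dim W - 1)"
    by (rule flat_sphere_dim[OF n W_props(2,3) W0])
  have "S \<noteq> {0}" using W0 W_props(2,3) subspace_0 by blast
  then show "round_sphere_dim (bd_of (\<iota> ` S)) (dim S - 1)"
    unfolding bd_of_flat by (rule flat_sphere_dim[OF n subS order_refl])
  show "dim W - 1 < dim S - 1" using W_props(5) dim_W_less by simp
  obtain \<nu>0 where \<nu>0: "\<nu>0 \<in> S" "norm \<nu>0 = 1" "\<And>w. w \<in> W \<Longrightarrow> \<nu>0 \<bullet> w = 0" using normal_exists by blast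
  have cap_bd: "singular_cap \<subseteq> ideal_boundary TYPE('a)" by (auto simp: singular_cap_def hemi_boundary)
  have "round_hemisphere singular_cap {flat_point w | w. w \<in> W \<and> norm w = 1}"
  proof (rule cap_charts[OF \<nu>0])
    fix \<Psi> assume iso: "\<And>A. A \<subseteq> std_sphere (dim W) \<Longrightarrow> tits_isometry (dim W) A \<Psi> (\<Psi> ` A)"
      and h: "\<Psi> ` std_hemisphere (dim W) = singular_cap" "\<Psi> ` std_equator (dim W) = {flat_point w | w. w \<in> W \<and> norm w = 1}"
    have "tits_isometry (dim W) (std_hemisphere (dim W)) \<Psi> (\<Psi> ` std_hemisphere (dim W))"
      by (rule iso) (auto simp: std_hemisphere_def)
    then show ?thesis unfolding round_hemisphere_def using h cap_bd by auto
  qed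
  moreover have "round_sphere (singular_cap \<union> T)"
    if T: "round_hemisphere T {flat_point w | w. w \<in> W \<and> norm w = 1}" "T \<subseteq> bd_of (\<iota> ` S)" for T
  proof (rule hemisphere_in_flat[OF T])
    fix \<nu> assume \<nu>: "\<nu> \<in> S" "norm \<nu> = 1" "\<And>w. w \<in> W \<Longrightarrow> \<nu> \<bullet> w = 0" and Teq: "T = flat_cap \<nu>"
    show ?thesis
    proof (rule cap_charts[OF \<nu>])
      fix \<Psi> assume iso: "\<And>A. A \<subseteq> std_sphere (dim W) \<Longrightarrow> tits_isometry (dim W) A \<Psi> (\<Psi> ` A)"
        and s: "\<Psi> ` std_sphere (dim W) = singular_cap \<union> flat_cap \<nu>"
      have "tits_isometry (dim W) (std_sphere (dim W)) \<Psi> (singular_cap \<union> T)" using iso[OF order_refl] s Teq by simp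
      moreover have "T \<subseteq> ideal_boundary TYPE('a)" using T(1) by (simp add: round_hemisphere_def)
      ultimately show ?thesis unfolding round_sphere_def round_sphere_dim_def using cap_bd by blast
    qed
  qed
  moreover have "round_sphere {flat_point w | w. w \<in> W \<and> norm w = 1}" using \<sigma> by (auto simp: round_sphere_def)
  moreover have "{flat_point w | w. w \<in> W \<and> norm w = 1} \<subseteq> bd_of (\<iota> ` S)" unfolding bd_of_flat using W_in_S by blast
  ultimately show "singular_sphere (bd_of (\<iota> ` S)) {flat_point w | w. w \<in> W \<and> norm w = 1}"
    unfolding singular_sphere_def using singular_cap_inter by blast
qed

end

text \<open>Singularity provides boundary points outside the boundary of the flat at arbitrarily
  small Tits distance. Their fields are not affine and descend steeply along \<open>u\<close>, so
  maximal singular subspaces come arbitrarily close to \<open>u\<close>.\<close>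

lemma singular_direction:
  assumes "\<xi> \<in> singular_points (bd_of (\<iota> ` S))"
  obtains M u where "maximal_singular M" "u \<in> M" "norm u = 1" "\<xi> = flat_point u"
proof -
  have \<xi>: "\<xi> \<in> bd_of (\<iota> ` S)" "\<not> regular_point (bd_of (\<iota> ` S)) \<xi>" using assms by (auto simp: singular_points_def)
  obtain u where u: "u \<in> S" "norm u = 1" "\<xi> = flat_point u" using \<xi>(1) unfolding bd_of_flat by blast
  have "\<exists>M. maximal_singular M \<and> norm (u - orth_proj M u) \<le> e" if e: "0 < e" for e
  proof -
    \<comment> \<open>The cap at one keeps the angle below \<open>pi / 2\<close>.\<close>
    define d where "d = min e 1"
    have d: "0 < d" "d < pi / 2" "d < pi" "d \<le> e" using e pi_gt3 by (auto simp: d_def min_def)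
    have "\<not> {\<eta> \<in> ideal_boundary TYPE('a). tits_dist \<xi> \<eta> < ereal d} \<subseteq> bd_of (\<iota> ` S)"
      using \<xi> d(1) unfolding regular_point_def by blast
    then obtain \<eta> where \<eta>: "\<eta> \<in> ideal_boundary TYPE('a)" "tits_dist \<xi> \<eta> < ereal d" "\<eta> \<notin> bd_of (\<iota> ` S)" by blast
    obtain E where E: "ray_field 0 E" "ray_class (E 0) = \<eta>" by (rule boundary_ray_field[OF \<eta>(1)])
    have nl: "\<not> linear_bus E" using linear_bus_boundary[OF E(1)] E(2) \<eta>(3) by blast
    have "ereal (bd_angle \<xi> \<eta>) < ereal d" using tits_dist_ge[of \<xi> \<eta>] \<eta>(2) by (rule order_le_less_trans)
    then have ang: "bd_angle (flat_point u) (ray_class (E 0)) < d" using E(2) u(3) by simp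
    obtain M where M: "maximal_singular M" "norm (u - orth_proj M u) \<le> sin d"
      using direction_near_singular[OF E(1) nl u(1,2) d(1,2) angle_imp_slope_le[OF E(1) _ u(1,2) d(1,3) ang]] by blast
    have "sin d \<le> e" using sin_x_le_x[of d] d by simp
    then show ?thesis using M by (intro exI[of _ M]) simp
  qed
  then obtain M where "maximal_singular M" "u \<in> M" using direction_in_singular[OF u(1)] by blast
  then show thesis using that u by blast
qed

theorem singular_points_covered:
  "\<exists>\<S>. finite \<S> \<and> singular_points (bd_of (\<iota> ` S)) \<subseteq> \<Union>\<S> \<and>
     (\<forall>\<sigma>\<in>\<S>. singular_sphere (bd_of (\<iota> ` S)) \<sigma> \<and>
        (\<exists>k m. round_sphere_dim \<sigma> k \<and> round_sphere_dim (bd_of (\<iota> ` S)) m \<and> k < m))"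
proof -
  define \<S> where "\<S> = (\<lambda>M. {flat_point w | w. w \<in> M \<and> norm w = 1}) ` {M. maximal_singular M}"
  show ?thesis
  proof (intro exI[of _ \<S>] conjI ballI)
    show "finite \<S>" unfolding \<S>_def using finite_maximal_singular by (rule finite_imageI)
    show "singular_points (bd_of (\<iota> ` S)) \<subseteq> \<Union>\<S>"
    proof
      fix \<xi> assume "\<xi> \<in> singular_points (bd_of (\<iota> ` S))"
      then obtain M u where "maximal_singular M" "u \<in> M" "norm u = 1" "\<xi> = flat_point u" by (rule singular_direction)
      then show "\<xi> \<in> \<Union>\<S>" unfolding \<S>_def by blast
    qed
    fix \<sigma> assume "\<sigma> \<in> \<S>"
    then obtain M where M: "maximal_singular M" "\<sigma> = {flat_point w | w. w \<in> M \<and> norm w = 1}" by (auto simp: \<S>_def)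
    obtain y E c where "M \<noteq> {0}" "rigid y E M c" using M(1) by (auto simp: maximal_singular_def singular_subspace_def)
    then obtain E' where E': "rigid y E' M 0" using rigid_perpendicular by blast
    show "singular_sphere (bd_of (\<iota> ` S)) \<sigma>" unfolding M(2) by (rule rigid_singular_sphere(1)[OF E' \<open>M \<noteq> {0}\<close>])
    show "\<exists>k m. round_sphere_dim \<sigma> k \<and> round_sphere_dim (bd_of (\<iota> ` S)) m \<and> k < m"
      unfolding M(2) using rigid_singular_sphere(2-4)[OF E' \<open>M \<noteq> {0}\<close>] by blast
  qed
qed

end

section \<open>Euclidean coordinates on a periodic flat\<close>

text \<open>The dimension of the flat is known only inside the proof, while the lemmas are stated
  over a fixed inner product type. Finitely supported sequences contain Euclidean spaces of every
  dimension.\<close>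

typedef finseq = "{x :: nat \<Rightarrow> real. finite {i. x i \<noteq> 0}}" morphisms coord finseq
  by (intro exI[of _ "\<lambda>_. 0"]) simp

lemma finite_coord [simp]: "finite {i. coord x i \<noteq> 0}"
  using coord[of x] by simp

lemma coord_finseq: "finite A \<Longrightarrow> (\<And>i. i \<notin> A \<Longrightarrow> x i = 0) \<Longrightarrow> coord (finseq x) = x"
  by (intro finseq_inverse CollectI) (erule rev_finite_subset, blast)

lemma finseq_eqI: "(\<And>i. coord x i = coord y i) \<Longrightarrow> x = y"
  by (simp add: coord_inject[symmetric] ext)

instantiation finseq :: real_vector
begin

definition "0 = finseq (\<lambda>_. 0)"
definition "x + y = finseq (\<lambda>i. coord x i + coord y i)"
definition "x - y = finseq (\<lambda>i. coord x i - coord y i)"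
definition "- x = finseq (\<lambda>i. - coord x i)"
definition "a *\<^sub>R x = finseq (\<lambda>i. a * coord x i)"

lemma coord_ops [simp]:
  "coord 0 i = 0" "coord (x + y) i = coord x i + coord y i" "coord (x - y) i = coord x i - coord y i"
  "coord (- x) i = - coord x i" "coord (a *\<^sub>R x) i = a * coord x i"
proof -
  let ?A = "{i. coord x i \<noteq> 0} \<union> {i. coord y i \<noteq> 0}"
  have A: "finite ?A" by simp
  show "coord 0 i = 0" unfolding zero_finseq_def by (subst coord_finseq[OF A]) auto
  show "coord (x + y) i = coord x i + coord y i" unfolding plus_finseq_def by (subst coord_finseq[OF A]) auto
  show "coord (x - y) i = coord x i - coord y i" unfolding minus_finseq_def by (subst coord_finseq[OF A]) auto
  show "coord (- x) i = - coord x i" unfolding uminus_finseq_def by (subst coord_finseq[OF A]) auto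
  show "coord (a *\<^sub>R x) i = a * coord x i" unfolding scaleR_finseq_def by (subst coord_finseq[OF A]) auto
qed

instance
  by standard (auto intro!: finseq_eqI simp: algebra_simps)

end

definition finseq_inner :: "finseq \<Rightarrow> finseq \<Rightarrow> real" where
  "finseq_inner x y = (\<Sum>i | coord x i \<noteq> 0. coord x i * coord y i)"

lemma finseq_inner_sum: "finite A \<Longrightarrow> (\<And>i. i \<notin> A \<Longrightarrow> coord x i * coord y i = 0) \<Longrightarrow> finseq_inner x y = (\<Sum>i\<in>A. coord x i * coord y i)"
  unfolding finseq_inner_def by (rule sum.mono_neutral_cong) auto

instantiation finseq :: real_inner
begin

definition "inner x y = finseq_inner x y"
definition norm_finseq :: "finseq \<Rightarrow> real" where "norm_finseq x = sqrt (finseq_inner x x)"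
definition sgn_finseq :: "finseq \<Rightarrow> finseq" where "sgn_finseq x = x /\<^sub>R norm x"
definition dist_finseq :: "finseq \<Rightarrow> finseq \<Rightarrow> real" where "dist_finseq x y = norm (x - y)"
definition uniformity_finseq :: "(finseq \<times> finseq) filter" where
  "uniformity_finseq = (INF e\<in>{0<..}. principal {(x, y). dist x y < e})"
definition open_finseq :: "finseq set \<Rightarrow> bool" where
  "open_finseq U \<longleftrightarrow> (\<forall>x\<in>U. \<forall>\<^sub>F (x', y) in uniformity. x' = x \<longrightarrow> y \<in> U)"

instance
proof
  fix x y z :: finseq and a :: real
  show "dist x y = norm (x - y)" by (rule dist_finseq_def)
  show "sgn x = x /\<^sub>R norm x" by (rule sgn_finseq_def)
  show "(uniformity :: (finseq \<times> finseq) filter) = (INF e\<in>{0<..}. principal {(x, y). dist x y < e})"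
    by (rule uniformity_finseq_def)
  show "open U \<longleftrightarrow> (\<forall>x\<in>U. \<forall>\<^sub>F (x', y) in uniformity. x' = x \<longrightarrow> y \<in> U)" for U :: "finseq set"
    by (rule open_finseq_def)
  let ?A = "{i. coord x i \<noteq> 0} \<union> {i. coord y i \<noteq> 0} \<union> {i. coord z i \<noteq> 0}"
  have A: "finite ?A" by simp
  have s: "finseq_inner u v = (\<Sum>i\<in>?A. coord u i * coord v i)" if "\<And>i. i \<notin> ?A \<Longrightarrow> coord u i = 0" for u v
    using that by (intro finseq_inner_sum[OF A]) auto
  have "finseq_inner x y = (\<Sum>i\<in>?A. coord x i * coord y i)" "finseq_inner y x = (\<Sum>i\<in>?A. coord y i * coord x i)" by (auto intro: s)
  then show "x \<bullet> y = y \<bullet> x" by (simp add: inner_finseq_def mult.commute)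
  have "finseq_inner (x + y) z = (\<Sum>i\<in>?A. coord (x + y) i * coord z i)" "finseq_inner x z = (\<Sum>i\<in>?A. coord x i * coord z i)"
    "finseq_inner y z = (\<Sum>i\<in>?A. coord y i * coord z i)" by (rule s; auto)+
  then show "(x + y) \<bullet> z = x \<bullet> z + y \<bullet> z" by (simp add: inner_finseq_def distrib_right sum.distrib)
  have "finseq_inner (a *\<^sub>R x) y = (\<Sum>i\<in>?A. coord (a *\<^sub>R x) i * coord y i)" "finseq_inner x y = (\<Sum>i\<in>?A. coord x i * coord y i)"
    by (rule s; auto)+
  then show "(a *\<^sub>R x) \<bullet> y = a * (x \<bullet> y)" by (simp add: inner_finseq_def sum_distrib_left mult.assoc)
  show "0 \<le> x \<bullet> x" by (simp add: inner_finseq_def finseq_inner_def sum_nonneg)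
  show "x \<bullet> x = 0 \<longleftrightarrow> x = 0"
  proof
    assume "x \<bullet> x = 0"
    then have "\<forall>i\<in>{i. coord x i \<noteq> 0}. coord x i * coord x i = 0"
      unfolding inner_finseq_def finseq_inner_def by (subst (asm) sum_nonneg_eq_0_iff) auto
    then show "x = 0" by (intro finseq_eqI) auto
  qed (simp add: inner_finseq_def finseq_inner_def)
  show "norm x = sqrt (x \<bullet> x)" by (simp add: norm_finseq_def inner_finseq_def)
qed

end

definition coord_space :: "nat \<Rightarrow> finseq set" where
  "coord_space n = {v. \<forall>i\<ge>n. coord v i = 0}"

lemma coord_space_inner: "v \<in> coord_space n \<Longrightarrow> v \<bullet> w = (\<Sum>i<n. coord v i * coord w i)"
  unfolding inner_finseq_def by (rule finseq_inner_sum) (auto simp: coord_space_def)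

lemma subspace_coord_space: "subspace (coord_space n)"
  by (simp add: coord_space_def subspace_def)

lemma coord_image: "coord ` coord_space n = eucl_space n"
proof (intro equalityI subsetI)
  fix x assume "x \<in> eucl_space n"
  then have x: "coord (finseq x) = x" by (intro coord_finseq[of "{..<n}"]) (auto simp: eucl_space_def)
  then have "finseq x \<in> coord_space n" using \<open>x \<in> eucl_space n\<close> by (simp add: coord_space_def eucl_space_def)
  then show "x \<in> coord ` coord_space n" using x by (metis image_eqI)
qed (auto simp: coord_space_def eucl_space_def)

lemma coord_space_norm:
  assumes "v \<in> coord_space n" "w \<in> coord_space n"
  shows "norm (v - w) = eucl_dist n (coord v) (coord w)"
  using coord_space_inner[OF subspace_diff[OF subspace_coord_space assms], of "v - w"]
  by (simp add: norm_eq_sqrt_inner eucl_dist_def power2_eq_square)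

lemma fin_dim_coord_space: "fin_dim (coord_space n)"
proof -
  define b where "b = (\<lambda>j. finseq (\<lambda>i. if i = j then 1 else 0))"
  have cb: "coord (b j) i = (if i = j then 1 else 0)" for i j
    unfolding b_def by (subst coord_finseq[of "{j}"]) auto
  have bS: "b j \<in> coord_space n" if "j < n" for j using that by (simp add: coord_space_def cb)
  have inner: "b j \<bullet> v = coord v j" for j v
  proof -
    have "b j \<bullet> v = (\<Sum>i\<in>{j}. coord (b j) i * coord v i)"
      unfolding inner_finseq_def by (rule finseq_inner_sum) (auto simp: cb)
    then show ?thesis by (simp add: cb)
  qed
  have "span (b ` {..<n}) = coord_space n"
  proof (rule antisym)
    show "span (b ` {..<n}) \<subseteq> coord_space n"
      using bS by (intro span_minimal subspace_coord_space) auto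
    show "coord_space n \<subseteq> span (b ` {..<n})"
    proof
      fix v assume v: "v \<in> coord_space n"
      define r where "r = v - (\<Sum>j<n. coord v j *\<^sub>R b j)"
      have s: "(\<Sum>j<n. coord v j *\<^sub>R b j) \<in> span (b ` {..<n})" by (intro span_sum span_scale span_base) auto
      have "(\<Sum>j<n. coord v j *\<^sub>R b j) \<in> coord_space n"
        using bS by (intro subspace_sum subspace_scale subspace_coord_space) auto
      then have rS: "r \<in> coord_space n" using v by (simp add: r_def subspace_diff[OF subspace_coord_space])
      have "coord r i = 0" if i: "i < n" for i
      proof -
        have "coord r i = coord v i - (\<Sum>j<n. coord v j * (b i \<bullet> b j))"
          unfolding inner[symmetric] r_def by (simp add: inner_diff_right inner_sum_right)
        also have "(\<Sum>j<n. coord v j * (b i \<bullet> b j)) = (\<Sum>j<n. if i = j then coord v j else 0)"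
          by (intro sum.cong) (auto simp: inner cb)
        finally show ?thesis using i by simp
      qed
      then have "r \<bullet> r = 0" unfolding coord_space_inner[OF rS] by simp
      then have "v = (\<Sum>j<n. coord v j *\<^sub>R b j)" by (simp add: r_def)
      then show "v \<in> span (b ` {..<n})" using s by simp
    qed
  qed
  moreover have "pairwise orthogonal (b ` {..<n})"
    by (auto simp: pairwise_def orthogonal_def inner cb)
  moreover have "norm (b j) = 1" for j by (simp add: norm_eq_1 inner cb)
  ultimately have "onb (b ` {..<n}) (coord_space n)" by (auto simp: onb_def)
  then show ?thesis by (auto simp: fin_dim_def)
qed

text \<open>The given group acts on coordinates by the crystallographic group of all \<open>\<iota>\<^sup>-\<^sup>1 \<circ> g \<circ> \<iota>\<close>, extended by \<open>0\<close>.\<close>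
lemma periodic_flat_translations:
  fixes \<iota> :: "'v::real_inner \<Rightarrow> 'a::metric_space"
  assumes fd: "fin_dim S" and iso: "\<And>v w. v \<in> S \<Longrightarrow> w \<in> S \<Longrightarrow> dist (\<iota> v) (\<iota> w) = norm (v - w)"
    and per: "periodic_flat (\<iota> ` S)"
  shows "\<exists>C. \<forall>x\<in>S. \<exists>g l. flat_translation S \<iota> g l \<and> norm (l - x) \<le> C"
proof -
  have subS: "subspace S" by (rule fin_dim_imp_subspace[OF fd])
  then have S0: "0 \<in> S" by (rule subspace_0)
  obtain G where G: "G \<subseteq> {g \<in> isometries TYPE('a). g ` (\<iota> ` S) = \<iota> ` S}"
    "\<And>g h. g \<in> G \<Longrightarrow> h \<in> G \<Longrightarrow> g \<circ> h \<in> G" "\<And>g. g \<in> G \<Longrightarrow> inv g \<in> G" "acts_geometrically G (\<iota> ` S)"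
    using per unfolding periodic_flat_def by blast
  have gF: "g ` (\<iota> ` S) = \<iota> ` S" and gd: "dist (g p) (g q) = dist p q" and gb: "bij g" if "g \<in> G" for g p q
  proof -
    have "g \<in> {g \<in> isometries TYPE('a). g ` (\<iota> ` S) = \<iota> ` S}" by (rule subsetD[OF G(1) that])
    then have "bij g \<and> (\<forall>x y. dist (g x) (g y) = dist x y) \<and> g ` (\<iota> ` S) = \<iota> ` S"
      unfolding isometries_def by blast
    then show "g ` (\<iota> ` S) = \<iota> ` S" "dist (g p) (g q) = dist p q" "bij g" by blast+
  qed
  have inj: "inj_on \<iota> S" using iso by (intro inj_onI) (metis dist_self norm_eq_zero eq_iff_diff_eq_0)
  define \<kappa> where "\<kappa> = inv_into S \<iota>"
  have \<kappa>: "\<kappa> p \<in> S" "\<iota> (\<kappa> p) = p" if "p \<in> \<iota> ` S" for p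
    using that by (auto simp: \<kappa>_def inv_into_into f_inv_into_f)
  have \<kappa>\<iota>: "\<kappa> (\<iota> v) = v" if "v \<in> S" for v using inv_into_f_f[OF inj that] by (simp add: \<kappa>_def)
  define act where "act = (\<lambda>g v. if v \<in> S then \<kappa> (g (\<iota> v)) else 0)"
  have gin: "g (\<iota> v) \<in> \<iota> ` S" if "g \<in> G" "v \<in> S" for g v using gF[OF that(1)] that(2) by blast
  have actS: "act g v \<in> S" and act\<iota>: "\<iota> (act g v) = g (\<iota> v)" if "g \<in> G" "v \<in> S" for g v
    using \<kappa>[OF gin[OF that]] that(2) by (simp_all add: act_def)
  have act_comp: "act (g \<circ> h) v = act g (act h v)" if "g \<in> G" "h \<in> G" "v \<in> S" for g h v
    using that actS[OF that(2,3)] act\<iota>[OF that(2,3)] by (simp add: act_def)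
  have cont: "continuous_on S \<iota>"
    unfolding continuous_on_iff by (metis iso dist_norm)
  have act_cancel: "act g (act (inv g) v) = v" "act (inv g) (act g v) = v" if g: "g \<in> G" and v: "v \<in> S" for g v
  proof -
    have "g \<circ> inv g = id" using bij_is_surj[OF gb[OF g]] surj_iff[of g] by blast
    moreover have "inv g \<circ> g = id" using bij_is_inj[OF gb[OF g]] inj_iff[of g] by blast
    moreover have "act id v = v" using v \<kappa>\<iota> by (simp add: act_def)
    ultimately show "act g (act (inv g) v) = v" "act (inv g) (act g v) = v"
      using act_comp[OF g G(3)[OF g] v] act_comp[OF G(3)[OF g] g v] by simp_all
  qed
  have cryst: "crystallographic S (act ` G)"
  proof
    show "fin_dim S" by (rule fd)
    show "isometry_on S \<gamma>" if "\<gamma> \<in> act ` G" for \<gamma>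
    proof -
      obtain g where g: "g \<in> G" "\<gamma> = act g" using \<open>\<gamma> \<in> act ` G\<close> by blast
      have "norm (act g v - act g w) = norm (v - w)" if "v \<in> S" "w \<in> S" for v w
        using iso[OF actS[OF g(1) that(1)] actS[OF g(1) that(2)]] act\<iota>[OF g(1)] that gd[OF g(1)] iso by simp
      then show ?thesis unfolding isometry_on_def g(2) using actS[OF g(1)] by blast
    qed
    show "\<exists>\<eta>\<in>act ` G. \<forall>v\<in>S. \<eta> v = \<gamma> (\<delta> v)" if "\<gamma> \<in> act ` G" "\<delta> \<in> act ` G" for \<gamma> \<delta>
      using that act_comp G(2) by blast
    show "\<exists>\<eta>\<in>act ` G. \<forall>v\<in>S. \<eta> (\<gamma> v) = v \<and> \<gamma> (\<eta> v) = v" if "\<gamma> \<in> act ` G" for \<gamma>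
      using that act_cancel G(3) by blast
    show "finite {\<gamma> \<in> act ` G. norm (\<gamma> 0) \<le> r}" for r
    proof -
      \<comment> \<open>The absolute value keeps \<open>\<iota> 0\<close> in \<open>K\<close> for
        negative \<open>r\<close>; an element moving \<open>0\<close> by at most \<open>r\<close>
        then sends a point of \<open>K\<close> into \<open>K\<close>.\<close>
      define K where "K = \<iota> ` (S \<inter> cball 0 \<bar>r\<bar>)"
      have "compact K" unfolding K_def
        by (intro compact_continuous_image continuous_on_subset[OF cont] compact_fin_dim_cball[OF fd]) auto
      moreover have "K \<subseteq> \<iota> ` S" by (auto simp: K_def)
      ultimately have "finite {g \<in> G. g ` K \<inter> K \<noteq> {}}" using G(4) unfolding acts_geometrically_def by blast
      moreover have "{\<gamma> \<in> act ` G. norm (\<gamma> 0) \<le> r} \<subseteq> act ` {g \<in> G. g ` K \<inter> K \<noteq> {}}"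
      proof
        fix \<gamma> assume "\<gamma> \<in> {\<gamma> \<in> act ` G. norm (\<gamma> 0) \<le> r}"
        then obtain g where g: "g \<in> G" "\<gamma> = act g" "norm (act g 0) \<le> r" by blast
        have "\<iota> 0 \<in> K" using S0 by (auto simp: K_def)
        moreover have "g (\<iota> 0) \<in> K"
          using act\<iota>[OF g(1) S0] actS[OF g(1) S0] g(3) unfolding K_def by (intro image_eqI[of _ _ "act g 0"]) auto
        ultimately have "g ` K \<inter> K \<noteq> {}" by blast
        then show "\<gamma> \<in> act ` {g \<in> G. g ` K \<inter> K \<noteq> {}}" using g by blast
      qed
      ultimately show ?thesis by (meson finite_imageI finite_subset)
    qed
    obtain K where K: "compact K" "K \<subseteq> \<iota> ` S" "\<iota> ` S = (\<Union>g\<in>G. g ` K)"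
      using G(4) unfolding acts_geometrically_def by blast
    obtain d where d: "\<And>k. k \<in> K \<Longrightarrow> dist (\<iota> 0) k \<le> d"
      using compact_imp_bounded[OF K(1)] unfolding bounded_any_center[where a = "\<iota> 0"] by blast
    show "\<exists>d. \<forall>x\<in>S. \<exists>\<gamma>\<in>act ` G. norm (\<gamma> 0 - x) \<le> d"
    proof (intro exI[of _ d] ballI)
      fix x assume x: "x \<in> S"
      then have "\<iota> x \<in> (\<Union>g\<in>G. g ` K)" using K(3) by blast
      then obtain g k where g: "g \<in> G" "k \<in> K" "\<iota> x = g k" by blast
      have "norm (act g 0 - x) = dist (\<iota> (act g 0)) (\<iota> x)" using iso[OF actS[OF g(1) S0] x] by simp
      also have "\<dots> = dist (\<iota> 0) k" unfolding act\<iota>[OF g(1) S0] g(3) by (rule gd[OF g(1)])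
      finally have "norm (act g 0 - x) \<le> d" using d[OF g(2)] by simp
      moreover have "act g \<in> act ` G" using g(1) by (rule imageI)
      ultimately show "\<exists>\<gamma>\<in>act ` G. norm (\<gamma> 0 - x) \<le> d" by blast
    qed
  qed
  obtain C where C: "\<forall>x\<in>S. \<exists>\<gamma>\<in>act ` G. (\<forall>v\<in>S. \<gamma> v = v + \<gamma> 0) \<and> norm (\<gamma> 0 - x) \<le> C"
    using crystallographic.translations_cocompact[OF cryst] by (rule exE)
  have "\<exists>g l. flat_translation S \<iota> g l \<and> norm (l - x) \<le> C" if x: "x \<in> S" for x
  proof -
    obtain g where g: "g \<in> G" "\<forall>v\<in>S. act g v = v + act g 0" "norm (act g 0 - x) \<le> C"
      using bspec[OF C x] by blast
    have eq: "g (\<iota> v) = \<iota> (v + act g 0)" if "v \<in> S" for v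
      unfolding bspec[OF g(2) that, symmetric] by (rule act\<iota>[OF g(1) that, symmetric])
    have "flat_translation S \<iota> g (act g 0)"
      unfolding flat_translation_def by (simp add: eq actS[OF g(1) S0] gd[OF g(1)])
    then show ?thesis using g(3) by blast
  qed
  then show ?thesis by blast
qed

theorem theoremB:
  fixes F :: "'a::metric_space set"
  assumes "locally compact (UNIV::'a set)"
    and "CAT0 TYPE('a)"
    and "periodic_flat F"
    and "morse_flat F"
  shows "\<exists>\<S>. finite \<S> \<and>
           singular_points (bd_of F) \<subseteq> \<Union>\<S> \<and>
           (\<forall>\<sigma>\<in>\<S>. singular_sphere (bd_of F) \<sigma> \<and>
              (\<exists>k m. round_sphere_dim \<sigma> k \<and> round_sphere_dim (bd_of F) m \<and> k < m))"
proof -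
  obtain n f where f: "isom_embedding n (eucl_space n) f" "F = f ` eucl_space n"
    using assms(4) by (auto simp: morse_flat_def is_flat_def)
  define S where "S = coord_space n"
  define \<iota> where "\<iota> = (\<lambda>v. f (coord v))"
  have F: "F = \<iota> ` S" unfolding f(2) \<iota>_def S_def coord_image[symmetric] by (simp add: image_image)
  have iso: "dist (\<iota> v) (\<iota> w) = norm (v - w)" if "v \<in> S" "w \<in> S" for v w
  proof -
    have "coord v \<in> eucl_space n" "coord w \<in> eucl_space n" using that coord_image by (auto simp: S_def)
    then show ?thesis using f(1) coord_space_norm[of v n w] that by (simp add: isom_embedding_def \<iota>_def S_def)
  qed
  have fd: "fin_dim S" unfolding S_def by (rule fin_dim_coord_space)
  have per: "periodic_flat (\<iota> ` S)" using assms(3) F by simp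
  obtain C where C: "\<forall>x\<in>S. \<exists>g l. flat_translation S \<iota> g l \<and> norm (l - x) \<le> C"
    using periodic_flat_translations[OF fd iso per] by (rule exE)
  interpret morse_flat_space "TYPE('a)" S \<iota> C
  proof
    show "CAT0 TYPE('a)" by (rule assms(2))
    show "locally compact (UNIV::'a set)" by (rule assms(1))
    show "\<not> (\<exists>H. flat_half_space H (\<iota> ` S))" using assms(4) F by (simp add: morse_flat_def)
    show "fin_dim S" by (rule fd)
    show "dist (\<iota> v) (\<iota> w) = norm (v - w)" if "v \<in> S" "w \<in> S" for v w by (rule iso[OF that])
    show "\<exists>g l. flat_translation S \<iota> g l \<and> norm (l - x) \<le> C" if "x \<in> S" for x using C that by (rule bspec)
  qed
  show ?thesis unfolding F by (rule singular_points_covered)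
qed

end
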